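(* Let $\rho\in(0,1]$, let $G$ be an $n_y\times n_w$ real rational proper transfer matrix with $G_\rho\in\mathbb{RH}_\infty$, let $\Pi\in\mathbb{RL}_\infty^{(n_y+n_w)\times(n_y+n_w)}$, and let $\Pi_\rho$ be a strict PN multiplier. Then there exists a $\rho$-factorization $(\Psi,M)$ of $\Pi$ such that every bounded causal operator $\Delta:\ell_{2e}^{n_y}\to\ell_{2e}^{n_w}$ that satisfies the $\rho$-IQC defined by $\Pi$ also satisfies the $\rho$-hard IQC defined by $(\Psi,M)$. Further, if there exists $\varepsilon>0$ such that $$\begin{bmatrix}G(\rho z) \\ I\end{bmatrix}^*\Pi(\rho z)\begin{bmatrix}G(\rho z) \\ I\end{bmatrix}\preceq-\varepsilon I\qquad\text{for all }z\in\mathbb T,$$ then there exists $P\succ0$ such that $$\begin{bmatrix}I&0 \\ \mathcal A&\mathcal B \\ \mathcal C&\mathcal D\end{bmatrix}^\top\begin{bmatrix}-\rho^2P&0&0 \\ 0&P&0 \\ 0&0&M\end{bmatrix}\begin{bmatrix}I&0 \\ \mathcal A&\mathcal B \\ \mathcal C&\mathcal D\end{bmatrix}\prec0,$$ where $\mathcal A,\mathcal B,\mathcal C,\mathcal D$ are the matrices built from $G$ and $\Psi$ given in the context.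
   Context: **Notation.** $\mathbb T=\{z\in\mathbb C:|z|=1\}$. $\mathbb{RL}_\infty$: real rational proper transfer matrices (without poles on $\mathbb T$); $\mathbb{RH}_\infty$: its subset of functions with all poles in the open unit disk. For a rational matrix function $\Pi$, $\Pi_\rho(z)=\Pi(\rho z)$ and $\Pi^\sim(z)=\Pi^\top(z^{-1})$. $\ell_{2e}^n$: all sequences $(q_k)_{k\in\mathbb N}$ in $\mathbb R^n$. $\ell_{2,\rho}^n=\{q\in\ell_{2e}^n:\sum_{k\ge0}\rho^{-2k}\|q_k\|^2<\infty\}$. The $z$-transform is $\hat q(z)=\sum_{k\ge0}q_kz^{-k}$. **Strict PN multiplier.** $\Pi=\Pi^\sim\in\mathbb{RL}_\infty^{(n_y+n_w)\times(n_y+n_w)}$ is a strict PN (Positive-Negative) multiplier if, for all $z\in\mathbb T$, its first diagonal block (size $n_y\times n_y$) is positive definite and its second diagonal block (size $n_w\times n_w$) is negative definite. **$\rho$-IQC.** For $\Pi$ with $\Pi(\rho z)$ Hermitian on $\mathbb T$, a bounded operator $\Delta:\ell_{2e}^{n_y}\to\ell_{2e}^{n_w}$ satisfies the $\rho$-IQC defined by $\Pi$ if for all $y\in\ell_{2,\rho}^{n_y}$ and $w=\Delta(y)$ (which lies in $\ell_{2,\rho}^{n_w}$, so that the integral is meaningful) $$\int_{\mathbb T}\begin{bmatrix}\hat y(\rho z) \\ \hat w(\rho z)\end{bmatrix}^*\Pi(\rho z)\begin{bmatrix}\hat y(\rho z) \\ \hat w(\rho z)\end{bmatrix}\,dz\ge0,$$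 the integral being with respect to arc length on $\mathbb T$. **$\rho$-hard IQC.** For $M=M^\top\in\mathbb R^{n_p\times n_p}$ and $\Psi\in\mathbb{RH}_\infty^{n_p\times(n_y+n_w)}$, a bounded operator $\Delta$ satisfies the $\rho$-hard IQC defined by $(\Psi,M)$ if for all $y\in\ell_{2e}^{n_y}$ and all $T\ge1$: $\sum_{t=0}^{T-1}\rho^{-2t}p_t^\top Mp_t\ge0$, where $p=\Psi\begin{bmatrix}y \\ \Delta(y)\end{bmatrix}$ (zero initial filter state). **$\rho$-factorization.** $(\Psi,M)$ with real matrix $M$ is a $\rho$-factorization of $\Pi$ if $\Pi_\rho=(\Psi_\rho)^\sim M\Psi_\rho$ and $\Psi_\rho\in\mathbb{RH}_\infty$. **Augmented matrices.** Let $G(z)=D_G^w+C_G(zI-A_G)^{-1}B_G^w$ and $\Psi(z)=[D_\Psi^y\ D_\Psi^w]+C_\Psi(zI-A_\Psi)^{-1}[B_\Psi^y\ B_\Psi^w]$ be state-space realizations in which all eigenvalues of $A_G$ and of $A_\Psi$ have modulus less than $\rho$ (consistent with $G_\rho,\Psi_\rho\in\mathbb{RH}_\infty$). Then $$\mathcal A=\begin{bmatrix}A_G&0 \\ B_\Psi^yC_G&A_\Psi\end{bmatrix},\ \mathcal B=\begin{bmatrix}B_G^w \\ B_\Psi^yD_G^w+B_\Psi^w\end{bmatrix},\ \mathcal C=\begin{bmatrix}D_\Psi^yC_G&C_\Psi\end{bmatrix},\ \mathcal D=D_\Psi^yD_G^w+D_\Psi^w.$$ *)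

theory Defs
  imports
    "HOL-Analysis.Analysis"
    "HOL-Computational_Algebra.Computational_Algebra"
    "HOL-Computational_Algebra.Field_as_Ring"
    "Jordan_Normal_Form.Gauss_Jordan_Elimination"
    "Jordan_Normal_Form.Spectral_Radius"
begin

unbundle no vec_syntax
unbundle no inner_syntax

hide_const (open) Finite_Cartesian_Product.vec Finite_Cartesian_Product.mat
  Finite_Cartesian_Product.transpose Finite_Cartesian_Product.row Finite_Cartesian_Product.rows
  Finite_Cartesian_Product.column Finite_Cartesian_Product.columns

section \<open>Real rational functions and transfer matrices\<close>

text \<open>A transfer matrix is a matrix over the field of fractions of \<^typ>\<open>real poly\<close>, so that equality
  of transfer matrices is equality of rational functions and is not affected by values at poles.
  Numerator and denominator are those of the reduced fraction, so the poles are exactly the zeros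
  of the denominator.\<close>

type_synonym ratfun = "real poly fract"

definition rf_num :: "ratfun \<Rightarrow> real poly" where
  "rf_num r = fst (quot_of_fract r)"

definition rf_den :: "ratfun \<Rightarrow> real poly" where
  "rf_den r = snd (quot_of_fract r)"

definition rf_eval :: "ratfun \<Rightarrow> complex \<Rightarrow> complex" where
  "rf_eval r z = poly (map_poly of_real (rf_num r)) z / poly (map_poly of_real (rf_den r)) z"

definition rf_pole :: "ratfun \<Rightarrow> complex \<Rightarrow> bool" where
  "rf_pole r z \<longleftrightarrow> poly (map_poly of_real (rf_den r)) z = 0"

definition rf_proper :: "ratfun \<Rightarrow> bool" where
  "rf_proper r \<longleftrightarrow> degree (rf_num r) \<le> degree (rf_den r)"

definition rf_const :: "real \<Rightarrow> ratfun" where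
  "rf_const c = to_fract [:c:]"

definition rf_z :: ratfun where
  "rf_z = to_fract [:0, 1:]"

definition rf_compose :: "ratfun \<Rightarrow> ratfun \<Rightarrow> ratfun" where
  "rf_compose r s = poly (map_poly rf_const (rf_num r)) s / poly (map_poly rf_const (rf_den r)) s"

definition eval_mat :: "ratfun mat \<Rightarrow> complex \<Rightarrow> complex mat" where
  "eval_mat R z = map_mat (\<lambda>r. rf_eval r z) R"

definition const_mat :: "real mat \<Rightarrow> ratfun mat" where
  "const_mat A = map_mat rf_const A"

definition scale_mat :: "real \<Rightarrow> ratfun mat \<Rightarrow> ratfun mat" where
  "scale_mat \<rho> R = map_mat (\<lambda>r. rf_compose r (rf_const \<rho> * rf_z)) R"

definition para_mat :: "ratfun mat \<Rightarrow> ratfun mat" where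
  "para_mat R = transpose_mat (map_mat (\<lambda>r. rf_compose r (inverse rf_z)) R)"

definition proper_transfer :: "nat \<Rightarrow> nat \<Rightarrow> ratfun mat set" where
  "proper_transfer m n = {R \<in> carrier_mat m n. \<forall>i<m. \<forall>j<n. rf_proper (R $$ (i, j))}"

definition RL_inf :: "nat \<Rightarrow> nat \<Rightarrow> ratfun mat set" where
  "RL_inf m n = {R \<in> proper_transfer m n.
     \<forall>i<m. \<forall>j<n. \<forall>z. cmod z = 1 \<longrightarrow> \<not> rf_pole (R $$ (i, j)) z}"

definition RH_inf :: "nat \<Rightarrow> nat \<Rightarrow> ratfun mat set" where
  "RH_inf m n = {R \<in> proper_transfer m n.
     \<forall>i<m. \<forall>j<n. \<forall>z. rf_pole (R $$ (i, j)) z \<longrightarrow> cmod z < 1}"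

section \<open>Definite matrices\<close>

text \<open>Used with both real and complex entries. In the latter case the order is
  the componentwise one of \<^theory>\<open>HOL-Library.Complex_Order\<close>: \<open>0 < x\<close> means that \<open>x\<close> is real and positive.\<close>

definition quad_form :: "'a :: conjugatable_ordered_field mat \<Rightarrow> 'a vec \<Rightarrow> 'a" where
  "quad_form A v = conjugate v \<bullet> (A *\<^sub>v v)"

definition pos_def :: "nat \<Rightarrow> 'a :: conjugatable_ordered_field mat \<Rightarrow> bool" where
  "pos_def n A \<longleftrightarrow> A \<in> carrier_mat n n \<and> mat_adjoint A = A \<and>
     (\<forall>v\<in>carrier_vec n. v \<noteq> 0\<^sub>v n \<longrightarrow> 0 < quad_form A v)"

definition pos_semidef :: "nat \<Rightarrow> 'a :: conjugatable_ordered_field mat \<Rightarrow> bool" where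
  "pos_semidef n A \<longleftrightarrow> A \<in> carrier_mat n n \<and> mat_adjoint A = A \<and>
     (\<forall>v\<in>carrier_vec n. 0 \<le> quad_form A v)"

definition neg_def :: "nat \<Rightarrow> 'a :: conjugatable_ordered_field mat \<Rightarrow> bool" where
  "neg_def n A \<longleftrightarrow> pos_def n (- A)"

definition loewner_le :: "nat \<Rightarrow> 'a :: conjugatable_ordered_field mat \<Rightarrow> 'a mat \<Rightarrow> bool" where
  "loewner_le n A B \<longleftrightarrow> A \<in> carrier_mat n n \<and> B \<in> carrier_mat n n \<and> pos_semidef n (B - A)"

definition strict_PN :: "nat \<Rightarrow> nat \<Rightarrow> ratfun mat \<Rightarrow> bool" where
  "strict_PN n\<^sub>y n\<^sub>w R \<longleftrightarrow> R \<in> RL_inf (n\<^sub>y + n\<^sub>w) (n\<^sub>y + n\<^sub>w) \<and> R = para_mat R \<and>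
     (\<forall>z. cmod z = 1 \<longrightarrow>
        (case split_block (eval_mat R z) n\<^sub>y n\<^sub>y of (R11, R12, R21, R22) \<Rightarrow>
           pos_def n\<^sub>y R11 \<and> neg_def n\<^sub>w R22))"

section \<open>Signals and operators\<close>

type_synonym signal = "nat \<Rightarrow> real vec"

definition l2e :: "nat \<Rightarrow> signal set" where
  "l2e n = {q. \<forall>k. q k \<in> carrier_vec n}"

definition l2rho :: "real \<Rightarrow> nat \<Rightarrow> signal set" where
  "l2rho \<rho> n = {q \<in> l2e n. summable (\<lambda>k. (q k \<bullet> q k) / \<rho> ^ (2 * k))}"

definition l2rho_norm :: "real \<Rightarrow> signal \<Rightarrow> real" where
  "l2rho_norm \<rho> q = sqrt (\<Sum>k. (q k \<bullet> q k) / \<rho> ^ (2 * k))"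

definition causal_op :: "nat \<Rightarrow> (signal \<Rightarrow> signal) \<Rightarrow> bool" where
  "causal_op n \<Delta> \<longleftrightarrow> (\<forall>y\<in>l2e n. \<forall>y'\<in>l2e n. \<forall>T.
     (\<forall>t\<le>T. y t = y' t) \<longrightarrow> (\<forall>t\<le>T. \<Delta> y t = \<Delta> y' t))"

text \<open>Finite gain in the \<open>\<rho>\<close>-weighted norm; the operator need not be linear.\<close>

definition bounded_op :: "real \<Rightarrow> nat \<Rightarrow> nat \<Rightarrow> (signal \<Rightarrow> signal) \<Rightarrow> bool" where
  "bounded_op \<rho> n\<^sub>y n\<^sub>w \<Delta> \<longleftrightarrow> (\<exists>c. \<forall>y\<in>l2rho \<rho> n\<^sub>y.
     \<Delta> y \<in> l2rho \<rho> n\<^sub>w \<and> l2rho_norm \<rho> (\<Delta> y) \<le> c * l2rho_norm \<rho> y)"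

section \<open>The z-transform on the circle of radius \<open>\<rho>\<close>\<close>

definition zt_partial :: "real \<Rightarrow> (nat \<Rightarrow> real) \<Rightarrow> nat \<Rightarrow> complex \<Rightarrow> complex" where
  "zt_partial \<rho> q N z = (\<Sum>k<N. of_real (q k) / (of_real \<rho> * z) ^ k)"

text \<open>For a \<open>\<rho>\<close>-weighted square-summable \<open>q\<close>, the series of the z-transform at \<open>\<rho> z\<close>, \<open>cmod z = 1\<close>,
  converges in the mean-square sense on the unit circle and need not converge at a given point.
  Its sum is thus an \<open>L\<^sup>2\<close> function, determined almost everywhere.\<close>

definition is_zt :: "real \<Rightarrow> (nat \<Rightarrow> real) \<Rightarrow> (complex \<Rightarrow> complex) \<Rightarrow> bool" where
  "is_zt \<rho> q f \<longleftrightarrow> f \<in> borel_measurable borel \<and>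
     (\<lambda>N. \<integral>\<^sup>+\<theta>\<in>{0..2*pi}. ennreal ((cmod (f (cis \<theta>) - zt_partial \<rho> q N (cis \<theta>)))\<^sup>2) \<partial>lborel)
       \<longlonglongrightarrow> 0"

text \<open>Existence of the mean-square limit (Riesz--Fischer), so that the choice in \<open>zt\<close> below is meaningful.\<close>

lemma zt_partial_cis:
  assumes "\<rho> > 0" "N \<le> M"
  shows "zt_partial \<rho> q M (cis \<theta>) - zt_partial \<rho> q N (cis \<theta>)
    = (\<Sum>k\<in>{N..<M}. of_real (q k / \<rho> ^ k) * cis (- (real k * \<theta>)))"
proof -
  have "zt_partial \<rho> q M z - zt_partial \<rho> q N z = (\<Sum>k\<in>{N..<M}. of_real (q k) / (of_real \<rho> * z) ^ k)" for z
    unfolding zt_partial_def lessThan_atLeast0 using sum_diff_nat_ivl[of 0 N M] assms by simp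
  also have "\<dots> (cis \<theta>) = (\<Sum>k\<in>{N..<M}. of_real (q k / \<rho> ^ k) * cis (- (real k * \<theta>)))"
    by (intro sum.cong refl)
      (simp add: power_mult_distrib Complex.DeMoivre divide_inverse cis_inverse[symmetric] del: cis_inverse)
  finally show ?thesis .
qed

lemma integral_cos_multiple:
  "has_bochner_integral lborel (\<lambda>\<theta>. cos ((real j - real k) * \<theta>) * indicator {0..2*pi} \<theta>)
     (if j = k then 2 * pi else 0)"
proof (cases "j = k")
  case True
  have "has_bochner_integral lborel (\<lambda>x. 1 * indicator {0..2*pi} x) (2*pi - 0)"
    by (rule has_bochner_integral_FTC_Icc_real[where F="\<lambda>x. x"]) (auto intro!: derivative_eq_intros)
  then show ?thesis using True by simp
next
  case False
  define c where "c = real j - real k"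
  have c: "c \<noteq> 0" using False by (simp add: c_def)
  have "has_bochner_integral lborel (\<lambda>x. cos (c * x) * indicator {0..2*pi} x)
      (sin (c * (2*pi)) / c - sin (c * 0) / c)"
    by (rule has_bochner_integral_FTC_Icc_real[where F="\<lambda>x. sin (c * x) / c"])
       (auto intro!: derivative_eq_intros simp: c)
  moreover have "sin (c * (2*pi)) = 0"
    unfolding sin_zero_iff_int2 c_def
    by (rule exI[of _ "2 * (int j - int k)"]) (simp add: algebra_simps)
  ultimately show ?thesis using False by (simp add: c_def)
qed

lemma nn_integral_zt_partial_diff:
  assumes "\<rho> > 0" "N \<le> M"
  shows "(\<integral>\<^sup>+\<theta>\<in>{0..2*pi}. ennreal ((cmod (zt_partial \<rho> q M (cis \<theta>) - zt_partial \<rho> q N (cis \<theta>)))\<^sup>2) \<partial>lborel)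
    = ennreal (2 * pi * (\<Sum>k\<in>{N..<M}. (q k)\<^sup>2 / \<rho> ^ (2 * k)))"
proof -
  define a where "a k = q k / \<rho> ^ k" for k
  define S where "S \<theta> = (cmod (zt_partial \<rho> q M (cis \<theta>) - zt_partial \<rho> q N (cis \<theta>)))\<^sup>2" for \<theta>
  have S: "S \<theta> = (\<Sum>j\<in>{N..<M}. \<Sum>k\<in>{N..<M}. a j * a k * cos ((real j - real k) * \<theta>))" for \<theta>
  proof -
    let ?D = "\<Sum>k\<in>{N..<M}. of_real (a k) * cis (- (real k * \<theta>))"
    have c2: "cos ((real j - real k) * \<theta>) =
        cos (real j * \<theta>) * cos (real k * \<theta>) + sin (real j * \<theta>) * sin (real k * \<theta>)" for j k
      by (simp add: left_diff_distrib cos_diff)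
    have "S \<theta> = (Re ?D)\<^sup>2 + (Im ?D)\<^sup>2"
      unfolding S_def zt_partial_cis[OF assms] a_def by (simp only: cmod_power2)
    also have "\<dots> = (\<Sum>k\<in>{N..<M}. a k * cos (real k * \<theta>))\<^sup>2 + (\<Sum>k\<in>{N..<M}. a k * sin (real k * \<theta>))\<^sup>2"
      by (simp add: sum_negf)
    also have "\<dots> = (\<Sum>j\<in>{N..<M}. \<Sum>k\<in>{N..<M}. a j * a k * cos ((real j - real k) * \<theta>))"
      unfolding power2_eq_square sum_product sum.distrib[symmetric]
      by (intro sum.cong refl) (subst c2, simp only: distrib_left mult_ac)
    finally show ?thesis .
  qed
  have "has_bochner_integral lborel
     (\<lambda>\<theta>. \<Sum>j\<in>{N..<M}. \<Sum>k\<in>{N..<M}. a j * a k * (cos ((real j - real k) * \<theta>) * indicator {0..2*pi} \<theta>))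
     (\<Sum>j\<in>{N..<M}. \<Sum>k\<in>{N..<M}. a j * a k * (if j = k then 2 * pi else 0))"
    by (intro has_bochner_integral_sum has_bochner_integral_mult_right integral_cos_multiple)
  also have "(\<Sum>j\<in>{N..<M}. \<Sum>k\<in>{N..<M}. a j * a k * (if j = k then 2 * pi else 0))
      = 2 * pi * (\<Sum>k\<in>{N..<M}. (q k)\<^sup>2 / \<rho> ^ (2 * k))"
    by (simp add: a_def sum_distrib_left if_distrib sum.delta power2_eq_square power_mult
        power_mult_distrib mult_ac cong: if_cong)
  also have "(\<lambda>\<theta>. \<Sum>j\<in>{N..<M}. \<Sum>k\<in>{N..<M}. a j * a k * (cos ((real j - real k) * \<theta>) * indicator {0..2*pi} \<theta>))
      = (\<lambda>\<theta>. indicator {0..2*pi} \<theta> * S \<theta>)"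
    by (auto simp: S fun_eq_iff indicator_def)
  finally have hb: "has_bochner_integral lborel (\<lambda>\<theta>. indicator {0..2*pi} \<theta> * S \<theta>)
      (2 * pi * (\<Sum>k\<in>{N..<M}. (q k)\<^sup>2 / \<rho> ^ (2 * k)))" .
  have "(\<integral>\<^sup>+\<theta>\<in>{0..2*pi}. ennreal (S \<theta>) \<partial>lborel) = (\<integral>\<^sup>+\<theta>. ennreal (indicator {0..2*pi} \<theta> * S \<theta>) \<partial>lborel)"
    by (intro nn_integral_cong) (auto simp: indicator_def)
  also have "\<dots> = ennreal (2 * pi * (\<Sum>k\<in>{N..<M}. (q k)\<^sup>2 / \<rho> ^ (2 * k)))"
    using hb
    by (subst nn_integral_eq_integral) (auto simp: has_bochner_integral_iff S_def)
  finally show ?thesis unfolding S_def .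
qed

theorem is_zt_exists:
  assumes \<rho>: "\<rho> > 0" and q: "summable (\<lambda>k. (q k)\<^sup>2 / \<rho> ^ (2 * k))"
  shows "\<exists>f. is_zt \<rho> q f"
proof -
  define b where "b k = (q k)\<^sup>2 / \<rho> ^ (2 * k)" for k
  have b0: "b k \<ge> 0" for k using \<rho> by (simp add: b_def)
  have sb: "summable b" using q unfolding b_def .
  have "\<exists>N. \<forall>m\<ge>N. \<forall>n. norm (sum b {m..<n}) < (1/4) ^ j" for j :: nat
    using sb[unfolded summable_Cauchy] by (meson zero_less_divide_1_iff zero_less_numeral zero_less_power)
  then obtain N0 where N0: "\<And>j m n. m \<ge> N0 j \<Longrightarrow> norm (sum b {m..<n}) < (1/4) ^ j" by metis
  define n where "n j = j + (\<Sum>i\<le>j. N0 i)" for j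
  have n_ge: "n j \<ge> N0 j" "n j \<ge> j" for j
    by (auto simp: n_def intro!: trans_le_add2 member_le_sum)
  have n_mono: "n j \<le> n (Suc j)" for j by (simp add: n_def)
  define S where "S N \<theta> = zt_partial \<rho> q N (cis \<theta>)" for N \<theta>
  define I where "I = (indicator {0..2*pi} :: real \<Rightarrow> ennreal)"
  have meas_zp: "zt_partial \<rho> q N \<in> borel_measurable borel" for N
    unfolding zt_partial_def by measurable
  have meas_cis: "cis \<in> borel_measurable borel"
    by (intro borel_measurable_continuous_onI continuous_intros)
  have meas_S[measurable]: "S N \<in> borel_measurable borel" for N
    unfolding S_def using measurable_compose[OF meas_cis meas_zp] by simp
  have meas_I[measurable]: "I \<in> borel_measurable borel" unfolding I_def by simp
  have diff: "(\<integral>\<^sup>+\<theta>. ennreal ((cmod (S M \<theta> - S N \<theta>))\<^sup>2) * I \<theta> \<partial>lborel) = ennreal (2 * pi * sum b {N..<M})"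
    if "N \<le> M" for N M
    unfolding S_def I_def b_def by (rule nn_integral_zt_partial_diff[OF \<rho> that])
  define F where "F \<theta> = (\<Sum>j. ennreal (2 ^ j) * (ennreal ((cmod (S (n (Suc j)) \<theta> - S (n j) \<theta>))\<^sup>2) * I \<theta>))" for \<theta>
  have "(\<integral>\<^sup>+\<theta>. F \<theta> \<partial>lborel) = (\<Sum>j. ennreal (2 ^ j) * ennreal (2 * pi * sum b {n j..<n (Suc j)}))"
    unfolding F_def
    by (subst nn_integral_suminf, measurable, subst nn_integral_cmult, measurable, subst diff[OF n_mono], simp)
  also have "\<dots> \<le> (\<Sum>j. ennreal (2 * pi * (1/2) ^ j))"
  proof (intro suminf_le summableI)
    fix j
    have "sum b {n j..<n (Suc j)} \<le> (1/4) ^ j"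
      using N0[OF n_ge(1), of j "n (Suc j)"] by auto
    then have "2 ^ j * (2 * pi * sum b {n j..<n (Suc j)}) \<le> 2 ^ j * (2 * pi * (1/4) ^ j)"
      by (intro mult_left_mono) auto
    also have "\<dots> = 2 * pi * (1/2) ^ j"
      by (simp add: power_divide power_mult_distrib[symmetric] field_simps)
    finally show "ennreal (2 ^ j) * ennreal (2 * pi * sum b {n j..<n (Suc j)}) \<le> ennreal (2 * pi * (1/2) ^ j)"
      by (subst ennreal_mult[symmetric]) (auto intro!: ennreal_leI mult_nonneg_nonneg sum_nonneg b0)
  qed
  also have "\<dots> = ennreal (\<Sum>j. 2 * pi * (1/2) ^ j)"
    by (intro suminf_ennreal2 summable_mult summable_geometric) auto
  finally have "(\<integral>\<^sup>+\<theta>. F \<theta> \<partial>lborel) \<noteq> \<infinity>" by (auto simp: top_unique)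
  then have AE_F: "AE \<theta> in lborel. F \<theta> \<noteq> \<infinity>"
    unfolding F_def by (intro nn_integral_PInf_AE) measurable
  have conv: "convergent (\<lambda>j. S (n j) \<theta>)" if F: "F \<theta> \<noteq> \<infinity>" and \<theta>: "\<theta> \<in> {0..2*pi}" for \<theta>
  proof -
    define d where "d j = S (n (Suc j)) \<theta> - S (n j) \<theta>" for j
    have "(\<Sum>j. ennreal (2 ^ j * (cmod (d j))\<^sup>2)) \<noteq> \<infinity>"
      using F \<theta> by (simp add: F_def I_def d_def ennreal_mult)
    then have "summable (\<lambda>j. 2 ^ j * (cmod (d j))\<^sup>2)"
      by (intro summable_suminf_not_top) (auto simp: infinity_ennreal_def)
    then have "Bseq (\<lambda>j. 2 ^ j * (cmod (d j))\<^sup>2)"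
      using summable_LIMSEQ_zero convergentI convergent_imp_Bseq by blast
    then obtain K where K: "K > 0" "\<And>j. norm (2 ^ j * (cmod (d j))\<^sup>2) \<le> K"
      unfolding Bseq_def by auto
    have "norm (d j) \<le> sqrt K * (1 / sqrt 2) ^ j" for j
    proof -
      have "(cmod (d j))\<^sup>2 \<le> K / 2 ^ j" using K(2)[of j] by (simp add: field_simps)
      then have "cmod (d j) \<le> sqrt (K / 2 ^ j)" by (rule real_le_rsqrt)
      also have "\<dots> = sqrt K * (1 / sqrt 2) ^ j"
        by (simp add: real_sqrt_divide real_sqrt_power power_divide)
      finally show ?thesis by simp
    qed
    moreover have "summable (\<lambda>j. sqrt K * (1 / sqrt 2) ^ j)"
      by (intro summable_mult summable_geometric) auto
    ultimately have "summable d" by (rule summable_comparison_test'[rotated])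
    then have "(\<lambda>m. S (n 0) \<theta> + (\<Sum>j<m. d j)) \<longlonglongrightarrow> S (n 0) \<theta> + suminf d"
      by (intro tendsto_intros summable_LIMSEQ)
    moreover have "S (n 0) \<theta> + (\<Sum>j<m. d j) = S (n m) \<theta>" for m
      unfolding d_def by (subst sum_lessThan_telescope) simp
    ultimately show ?thesis by (auto simp: convergent_def)
  qed
  define f where "f z = lim (\<lambda>j. zt_partial \<rho> q (n j) z)" for z
  have meas_f: "f \<in> borel_measurable borel"
    unfolding f_def by (intro borel_measurable_lim_metric meas_zp)
  have bound: "(\<integral>\<^sup>+\<theta>\<in>{0..2*pi}. ennreal ((cmod (f (cis \<theta>) - zt_partial \<rho> q N (cis \<theta>)))\<^sup>2) \<partial>lborel)
      \<le> ennreal (2 * pi * (suminf b - sum b {..<N}))" (is "?L N \<le> ennreal (?R N)") for N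
  proof -
    have "?L N = (\<integral>\<^sup>+\<theta>. liminf (\<lambda>j. ennreal ((cmod (S (n j) \<theta> - S N \<theta>))\<^sup>2) * I \<theta>) \<partial>lborel)"
    proof (intro nn_integral_cong_AE, use AE_F in eventually_elim)
      case (elim \<theta>)
      show ?case
      proof (cases "\<theta> \<in> {0..2*pi}")
        case True
        have "(\<lambda>j. S (n j) \<theta>) \<longlonglongrightarrow> f (cis \<theta>)"
          using conv[OF elim True] unfolding S_def f_def by (simp add: convergent_LIMSEQ_iff)
        then have "(\<lambda>j. ennreal ((cmod (S (n j) \<theta> - S N \<theta>))\<^sup>2)) \<longlonglongrightarrow> ennreal ((cmod (f (cis \<theta>) - S N \<theta>))\<^sup>2)"
          by (intro tendsto_intros)
        from lim_imp_Liminf[OF _ this] show ?thesis using True by (simp add: I_def S_def)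
      next
        case False
        then show ?thesis by (simp add: I_def Liminf_const)
      qed
    qed
    also have "\<dots> \<le> liminf (\<lambda>j. \<integral>\<^sup>+\<theta>. ennreal ((cmod (S (n j) \<theta> - S N \<theta>))\<^sup>2) * I \<theta> \<partial>lborel)"
      by (intro nn_integral_liminf) measurable
    also have "\<dots> \<le> liminf (\<lambda>j. ennreal (?R N))"
    proof (intro Liminf_mono eventually_mono[OF eventually_ge_at_top[of N]])
      fix j assume "N \<le> j"
      then have le: "N \<le> n j" using n_ge(2)[of j] by linarith
      have "sum b {N..<n j} = sum b {..<n j} - sum b {..<N}"
        using le sum_diff_nat_ivl[of 0 N "n j" b] by (simp add: lessThan_atLeast0)
      also have "\<dots> \<le> suminf b - sum b {..<N}"
        using sum_le_suminf[OF sb, of "{..<n j}"] b0 by auto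
      finally show "(\<integral>\<^sup>+\<theta>. ennreal ((cmod (S (n j) \<theta> - S N \<theta>))\<^sup>2) * I \<theta> \<partial>lborel) \<le> ennreal (?R N)"
        unfolding diff[OF le] by (intro ennreal_leI mult_left_mono) auto
    qed
    finally show ?thesis by (simp add: Liminf_const)
  qed
  have "(\<lambda>N. ennreal (?R N)) \<longlonglongrightarrow> ennreal (2 * pi * (suminf b - suminf b))"
    by (intro tendsto_intros summable_LIMSEQ sb)
  then have "(\<lambda>N. ennreal (?R N)) \<longlonglongrightarrow> 0" by simp
  then have "?L \<longlonglongrightarrow> 0"
    by (rule tendsto_sandwich[OF _ _ tendsto_const, rotated 2]) (auto intro!: always_eventually bound)
  then show ?thesis unfolding is_zt_def using meas_f by blast
qed

definition zt :: "real \<Rightarrow> (nat \<Rightarrow> real) \<Rightarrow> complex \<Rightarrow> complex" where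
  "zt \<rho> q = (SOME f. is_zt \<rho> q f)"

definition zt_vec :: "real \<Rightarrow> nat \<Rightarrow> signal \<Rightarrow> complex \<Rightarrow> complex vec" where
  "zt_vec \<rho> n q z = vec n (\<lambda>i. zt \<rho> (\<lambda>k. q k $ i) z)"

section \<open>Integral quadratic constraints\<close>

definition rho_IQC ::
  "real \<Rightarrow> nat \<Rightarrow> nat \<Rightarrow> ratfun mat \<Rightarrow> (signal \<Rightarrow> signal) \<Rightarrow> bool" where
  "rho_IQC \<rho> n\<^sub>y n\<^sub>w \<Pi>m \<Delta> \<longleftrightarrow> (\<forall>y\<in>l2rho \<rho> n\<^sub>y.
     0 \<le> (LINT \<theta>:{0..2*pi}|lborel.
            quad_form (eval_mat \<Pi>m (of_real \<rho> * cis \<theta>))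
              (zt_vec \<rho> n\<^sub>y y (cis \<theta>) @\<^sub>v zt_vec \<rho> n\<^sub>w (\<Delta> y) (cis \<theta>))))"

text \<open>The impulse response of a proper \<open>r\<close>: the coefficients \<open>h k\<close> of the expansion
  \<open>r(z) = (\<Sum>k. h k * z ^ (-k))\<close> at infinity, i.e. the Taylor coefficients at \<open>0\<close> of \<open>r(1/z)\<close>.\<close>

definition rf_impulse :: "ratfun \<Rightarrow> nat \<Rightarrow> real" where
  "rf_impulse r k = (let s = rf_compose r (inverse rf_z) in
     fps_nth (fps_of_poly (rf_num s) / fps_of_poly (rf_den s)) k)"

text \<open>Filtering with zero initial state is convolution with the impulse response.\<close>

definition filter_response :: "ratfun mat \<Rightarrow> signal \<Rightarrow> signal" where
  "filter_response R u t = vec (dim_row R)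
     (\<lambda>i. \<Sum>k\<le>t. (map_mat (\<lambda>r. rf_impulse r k) R *\<^sub>v u (t - k)) $ i)"

definition rho_hard_IQC ::
  "real \<Rightarrow> nat \<Rightarrow> ratfun mat \<Rightarrow> real mat \<Rightarrow> (signal \<Rightarrow> signal) \<Rightarrow> bool" where
  "rho_hard_IQC \<rho> n\<^sub>y \<Psi> M \<Delta> \<longleftrightarrow> (\<forall>y\<in>l2e n\<^sub>y. \<forall>T\<ge>1.
     let p = filter_response \<Psi> (\<lambda>t. y t @\<^sub>v \<Delta> y t)
     in 0 \<le> (\<Sum>t<T. (p t \<bullet> (M *\<^sub>v p t)) / \<rho> ^ (2 * t)))"

definition rho_factorization ::
  "real \<Rightarrow> nat \<Rightarrow> nat \<Rightarrow> ratfun mat \<Rightarrow> real mat \<Rightarrow> ratfun mat \<Rightarrow> bool" where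
  "rho_factorization \<rho> n\<^sub>p n \<Psi> M \<Pi>m \<longleftrightarrow> M \<in> carrier_mat n\<^sub>p n\<^sub>p \<and>
     scale_mat \<rho> \<Psi> \<in> RH_inf n\<^sub>p n \<and>
     scale_mat \<rho> \<Pi>m = para_mat (scale_mat \<rho> \<Psi>) * const_mat M * scale_mat \<rho> \<Psi>"

section \<open>State-space realizations and the augmented system\<close>

definition append_cols :: "'a :: zero mat \<Rightarrow> 'a mat \<Rightarrow> 'a mat" (infixr \<open>@\<^sub>c\<close> 65) where
  "A @\<^sub>c B = four_block_mat A B (0\<^sub>m 0 (dim_col A)) (0\<^sub>m 0 (dim_col B))"

definition transfer_mat :: "real mat \<Rightarrow> real mat \<Rightarrow> real mat \<Rightarrow> real mat \<Rightarrow> ratfun mat" where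
  "transfer_mat A B C D = const_mat D +
     const_mat C * the (mat_inverse (rf_z \<cdot>\<^sub>m 1\<^sub>m (dim_row A) - const_mat A)) * const_mat B"

definition realization ::
  "nat \<Rightarrow> nat \<Rightarrow> nat \<Rightarrow> real mat \<Rightarrow> real mat \<Rightarrow> real mat \<Rightarrow> real mat \<Rightarrow> ratfun mat \<Rightarrow> bool" where
  "realization m n k A B C D R \<longleftrightarrow>
     A \<in> carrier_mat k k \<and> B \<in> carrier_mat k n \<and> C \<in> carrier_mat m k \<and> D \<in> carrier_mat m n \<and>
     R = transfer_mat A B C D"

definition spectrum_within :: "real \<Rightarrow> real mat \<Rightarrow> bool" where
  "spectrum_within \<rho> A \<longleftrightarrow> (\<forall>l\<in>spectrum (map_mat complex_of_real A). cmod l < \<rho>)"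

definition aug_A :: "real mat \<Rightarrow> real mat \<Rightarrow> real mat \<Rightarrow> real mat \<Rightarrow> real mat" where
  "aug_A A\<^sub>G C\<^sub>G A\<^sub>\<Psi> B\<^sub>\<Psi>\<^sub>y =
     four_block_mat A\<^sub>G (0\<^sub>m (dim_row A\<^sub>G) (dim_col A\<^sub>\<Psi>)) (B\<^sub>\<Psi>\<^sub>y * C\<^sub>G) A\<^sub>\<Psi>"

definition aug_B :: "real mat \<Rightarrow> real mat \<Rightarrow> real mat \<Rightarrow> real mat \<Rightarrow> real mat" where
  "aug_B B\<^sub>G D\<^sub>G B\<^sub>\<Psi>\<^sub>y B\<^sub>\<Psi>\<^sub>w = B\<^sub>G @\<^sub>r (B\<^sub>\<Psi>\<^sub>y * D\<^sub>G + B\<^sub>\<Psi>\<^sub>w)"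

definition aug_C :: "real mat \<Rightarrow> real mat \<Rightarrow> real mat \<Rightarrow> real mat" where
  "aug_C C\<^sub>G C\<^sub>\<Psi> D\<^sub>\<Psi>\<^sub>y = (D\<^sub>\<Psi>\<^sub>y * C\<^sub>G) @\<^sub>c C\<^sub>\<Psi>"

definition aug_D :: "real mat \<Rightarrow> real mat \<Rightarrow> real mat \<Rightarrow> real mat" where
  "aug_D D\<^sub>G D\<^sub>\<Psi>\<^sub>y D\<^sub>\<Psi>\<^sub>w = D\<^sub>\<Psi>\<^sub>y * D\<^sub>G + D\<^sub>\<Psi>\<^sub>w"

definition lmi_mat ::
  "real \<Rightarrow> real mat \<Rightarrow> real mat \<Rightarrow> real mat \<Rightarrow> real mat \<Rightarrow> real mat \<Rightarrow> real mat \<Rightarrow> real mat" where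
  "lmi_mat \<rho> A B C D P M =
     (let n = dim_row A;
          L = (1\<^sub>m n @\<^sub>c 0\<^sub>m n (dim_col B)) @\<^sub>r (A @\<^sub>c B) @\<^sub>r (C @\<^sub>c D)
      in transpose_mat L * diag_block_mat [(- (\<rho>\<^sup>2)) \<cdot>\<^sub>m P, P, M] * L)"

end

(* After a sign change in its second block row, the multiplier has Toeplitz matrices that are coercive uniformly
   in their size: the diagonal blocks become positive definite and the off-diagonal ones contribute a skew form.
   Clearing denominators makes the matrices banded, and solving the corresponding infinite system with
   square-summable sequences yields a factorization with constant middle matrix M whose factor Psi is stable
   together with its inverse.

   Hard IQC: let u = (y, Delta y), and let v be the input for which Psi v is Psi u truncated at time T.
   It exists and agrees with u before T, since the inverse of Psi is stable and causal. Put y' for the first component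
   of v and u' = (y', Delta y'). Then u' - v vanishes before T and has first component 0, so Psi u' is the sum of Psi v and
   Psi (u' - v), which have disjoint supports. The energy of Psi u' is nonnegative by the IQC and
   that of Psi (u' - v) is nonpositive by negativity of the second block; hence that of Psi v is nonnegative.

   LMI: the frequency domain inequality bounds the optimal value of the infinite-horizon cost of the augmented
   system. As a function of the initial state this value satisfies the parallelogram law, so it is a quadratic form P,
   and its dynamic programming inequality is the LMI. P is positive because some input makes
   the multiplier part of the cost nonnegative: see nonneg_cost_input. *)

theory Submission
  imports Defs "HOL-Complex_Analysis.Complex_Analysis"
begin

unbundle no vec_syntax
unbundle no inner_syntax

hide_const (open) Finite_Cartesian_Product.vec Finite_Cartesian_Product.mat
  Finite_Cartesian_Product.transpose Finite_Cartesian_Product.row Finite_Cartesian_Product.rows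
  Finite_Cartesian_Product.column Finite_Cartesian_Product.columns

section \<open>Causal filters as real power series: gains, evaluation and stable inverses\<close>

section \<open>Power series with summable and square-summable coefficients\<close>

text \<open>Dividing the signal at time t by \<open>\<rho> ^ t\<close> moves everything to the unit
  circle. Signals and stable filters are then power series in x = 1/z, and stability means no zeros
  in the closed unit disc, which is why the factor is built from polynomials in x. The multiplier is
  indefinite, so the signature of M is not prescribed; M has to come out of the computation. The
  columns X of the solved Toeplitz system make S^T X a polynomial matrix of degree m. Correlating
  two columns in two ways, by the symmetry of S, shows that its reversal F satisfies F X = X(0), a
  constant matrix. Hence M is the inverse of X(0), and F is invertible wherever X converges, that is
  in the open disc; the circle itself is left to the PN property. The common denominator q may have
  zeros on both sides of the circle; the same theorem in size 1 replaces it by a zero-free d.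
  Strictness of the LMI comes from adding a small multiple of the squared trajectory to the cost;
  this term also makes P definite. The value function belongs to the system scaled by 1/\<rho>, so
  its matrix is divided by \<open>\<rho>\<^sup>2\<close>.\<close>

definition cpoly :: "real poly \<Rightarrow> complex \<Rightarrow> complex" where
  "cpoly p x = poly (map_poly of_real p) x"

lemma cpoly_hom: "comm_ring_hom (\<lambda>p. cpoly p x)"
proof -
  interpret of_real_poly: map_poly_inj_idom_hom "of_real :: real \<Rightarrow> complex" ..
  show ?thesis by unfold_locales (simp_all add: cpoly_def hom_distribs)
qed

lemma cpoly_simps [simp]:
  "cpoly (p + q) x = cpoly p x + cpoly q x" "cpoly (p * q) x = cpoly p x * cpoly q x"
  "cpoly 0 x = 0" "cpoly 1 x = 1" "cpoly [:c:] x = of_real c" "cpoly (- p) x = - cpoly p x"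
  "cpoly (p - q) x = cpoly p x - cpoly q x" "cpoly (pCons c p) x = of_real c + x * cpoly p x"
proof -
  interpret comm_ring_hom "\<lambda>p. cpoly p x" by (rule cpoly_hom)
  show "cpoly (p + q) x = cpoly p x + cpoly q x" "cpoly (p * q) x = cpoly p x * cpoly q x"
  "cpoly 0 x = 0" "cpoly 1 x = 1" "cpoly (- p) x = - cpoly p x"
  "cpoly (p - q) x = cpoly p x - cpoly q x" by (simp_all add: hom_distribs)
qed (simp_all add: cpoly_def of_real_hom.map_poly_pCons_hom)

lemma cpoly_smult [simp]: "cpoly (Polynomial.smult c p) x = of_real c * cpoly p x"
  using cpoly_simps(2)[of "[:c:]" p x] by (simp del: cpoly_simps(2))

lemma cpoly_sum [simp]: "cpoly (sum f A) x = (\<Sum>i\<in>A. cpoly (f i) x)"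
  by (induction A rule: infinite_finite_induct) simp_all

lemma cpoly_prod: "cpoly (prod f A) x = (\<Prod>i\<in>A. cpoly (f i) x)"
  by (induction A rule: infinite_finite_induct) simp_all

lemma cpoly_cnj: "cpoly p (cnj x) = cnj (cpoly p x)"
  by (induction p) simp_all

lemma cpoly_altdef: "cpoly p x = (\<Sum>k\<le>degree p. of_real (coeff p k) * x ^ k)"
  unfolding cpoly_def by (simp add: poly_altdef degree_map_poly coeff_map_poly)

lemma cpoly_sum_upto: "degree p \<le> N \<Longrightarrow> cpoly p x = (\<Sum>k\<le>N. of_real (coeff p k) * x ^ k)"
  unfolding cpoly_altdef by (rule sum.mono_neutral_left) (auto simp: coeff_eq_0)

lemma cpoly_zeros_finite: "p \<noteq> 0 \<Longrightarrow> finite {x. cpoly p x = 0}"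
  unfolding cpoly_def by (rule poly_roots_finite) (simp add: map_poly_eq_0_iff)

lemma cpoly_eqI:
  assumes "infinite {x. cpoly p x = cpoly q x}" shows "p = q"
proof (rule ccontr)
  assume "p \<noteq> q"
  then have "finite {x. cpoly (p - q) x = 0}" by (intro cpoly_zeros_finite) simp
  with assms show False by simp
qed

definition l2f :: "real fps \<Rightarrow> bool" where "l2f A \<longleftrightarrow> summable (\<lambda>k. (fps_nth A k)\<^sup>2)"
definition l1f :: "real fps \<Rightarrow> bool" where "l1f A \<longleftrightarrow> summable (\<lambda>k. \<bar>fps_nth A k\<bar>)"

lemma l2f_0 [simp]: "l2f 0" by (simp add: l2f_def)

lemma l2f_add: assumes "l2f A" "l2f B" shows "l2f (A + B)"
proof -
  have "summable (\<lambda>k. 2 * (fps_nth A k)\<^sup>2 + 2 * (fps_nth B k)\<^sup>2)"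
    using assms unfolding l2f_def by (intro summable_add summable_mult)
  moreover have "norm ((a + b)\<^sup>2) \<le> 2 * a\<^sup>2 + 2 * b\<^sup>2" for a b :: real
    using sum_squares_bound[of a b] sum_squares_bound[of a "-b"] by (simp add: power2_sum abs_le_iff)
  ultimately show ?thesis unfolding l2f_def fps_add_nth by (rule summable_comparison_test'[where N=0])
qed

lemma l2f_cmult: "l2f A \<Longrightarrow> l2f (fps_const c * A)"
  unfolding l2f_def by (simp add: power_mult_distrib summable_mult)

lemma l2f_uminus: "l2f A \<Longrightarrow> l2f (- A)"
  unfolding l2f_def by simp

lemma l2f_diff: "l2f A \<Longrightarrow> l2f B \<Longrightarrow> l2f (A - B)"
  using l2f_add[of A "- B"] l2f_uminus[of B] by simp

lemma l2f_sum: "(\<And>i. i \<in> I \<Longrightarrow> l2f (A i)) \<Longrightarrow> l2f (sum A I)"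
  by (induction I rule: infinite_finite_induct) (auto intro: l2f_add)

lemma l1f_mult: assumes "l1f A" "l1f B" shows "l1f (A * B)"
proof -
  have "summable (\<lambda>k. \<Sum>i\<le>k. \<bar>fps_nth A i\<bar> * \<bar>fps_nth B (k - i)\<bar>)"
    using assms unfolding l1f_def by (intro summable_Cauchy_product) auto
  moreover have "norm \<bar>fps_nth (A * B) k\<bar> \<le> (\<Sum>i\<le>k. \<bar>fps_nth A i\<bar> * \<bar>fps_nth B (k - i)\<bar>)" for k
    unfolding fps_mult_nth atLeast0AtMost by (simp add: abs_mult[symmetric])
  ultimately show ?thesis unfolding l1f_def by (rule summable_comparison_test'[where N=0])
qed

lemma l1f_poly: "l1f (fps_of_poly p)"
  unfolding l1f_def by (rule summable_finite[of "{..degree p}"]) (auto simp: coeff_eq_0)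

text \<open>Young's inequality for l1 and l2. Causality makes the first N terms of the product
  depend only on the first N terms of \<open>A\<close>, so the bound holds for partial sums and
  every \<open>A\<close>.\<close>

lemma convolution_bound:
  assumes "l1f H"
  shows "(\<Sum>t<N. (fps_nth (H * A) t)\<^sup>2) \<le> (\<Sum>k. \<bar>fps_nth H k\<bar>)\<^sup>2 * (\<Sum>t<N. (fps_nth A t)\<^sup>2)"
proof -
  let ?h = "\<lambda>k. \<bar>fps_nth H k\<bar>" and ?B = "\<Sum>k. \<bar>fps_nth H k\<bar>"
  have sH: "summable ?h" using assms by (simp add: l1f_def)
  have B: "sum ?h {..<t} \<le> ?B" for t by (rule sum_le_suminf[OF sH]) auto
  have B0: "0 \<le> ?B" using suminf_nonneg[OF sH] by simp
  have 1: "(fps_nth (H * A) t)\<^sup>2 \<le> ?B * (\<Sum>k\<le>t. ?h k * (fps_nth A (t - k))\<^sup>2)" for t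
  proof -
    have "\<bar>fps_nth (H * A) t\<bar> \<le> (\<Sum>k\<le>t. ?h k * \<bar>fps_nth A (t - k)\<bar>)"
      unfolding fps_mult_nth atLeast0AtMost by (simp add: abs_mult[symmetric])
    \<comment> \<open>Splitting each weight into two square roots lets Cauchy-Schwarz put one factor
      of the l1 norm outside and keep the weights inside.\<close>
    also have "\<dots> = (\<Sum>k\<le>t. sqrt (?h k) * (sqrt (?h k) * \<bar>fps_nth A (t - k)\<bar>))"
      by (intro sum.cong) (auto simp: mult.assoc[symmetric])
    finally have "(fps_nth (H * A) t)\<^sup>2 \<le> (\<Sum>k\<le>t. sqrt (?h k) * (sqrt (?h k) * \<bar>fps_nth A (t - k)\<bar>))\<^sup>2"
      by (rule power2_le_iff_abs_le[THEN iffD2, rotated]) (auto intro!: sum_nonneg)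
    also have "\<dots> \<le> (\<Sum>k\<le>t. (sqrt (?h k))\<^sup>2) * (\<Sum>k\<le>t. (sqrt (?h k) * \<bar>fps_nth A (t - k)\<bar>)\<^sup>2)"
      by (rule Cauchy_Schwarz_ineq_sum)
    also have "\<dots> = (\<Sum>k\<le>t. ?h k) * (\<Sum>k\<le>t. ?h k * (fps_nth A (t - k))\<^sup>2)"
      by (simp add: power_mult_distrib)
    also have "\<dots> \<le> ?B * (\<Sum>k\<le>t. ?h k * (fps_nth A (t - k))\<^sup>2)"
      using B[of "Suc t"] by (intro mult_right_mono sum_nonneg) (auto simp: lessThan_Suc_atMost)
    finally show ?thesis .
  qed
  have "(\<Sum>t<N. (fps_nth (H * A) t)\<^sup>2) \<le> (\<Sum>t<N. ?B * (\<Sum>k\<le>t. ?h k * (fps_nth A (t - k))\<^sup>2))"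
    by (intro sum_mono 1)
  also have "\<dots> = ?B * (\<Sum>(k,s)\<in>{(k,s). k + s < N}. ?h k * (fps_nth A s)\<^sup>2)"
    by (simp add: sum_distrib_left[symmetric] sum.triangle_reindex)
  also have "(\<Sum>(k,s)\<in>{(k,s). k + s < N}. ?h k * (fps_nth A s)\<^sup>2) \<le> (\<Sum>(k,s)\<in>{..<N}\<times>{..<N}. ?h k * (fps_nth A s)\<^sup>2)"
    by (intro sum_mono2) auto
  also have "\<dots> = sum ?h {..<N} * (\<Sum>s<N. (fps_nth A s)\<^sup>2)"
    by (simp add: sum_product sum.cartesian_product)
  also have "?B * \<dots> \<le> ?B * (?B * (\<Sum>s<N. (fps_nth A s)\<^sup>2))"
    using B0 B by (intro mult_left_mono mult_right_mono sum_nonneg) auto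
  finally show ?thesis using B0 by (simp only: power2_eq_square mult.assoc mult_left_mono)
qed

lemma l2f_l1f_mult: assumes "l1f H" "l2f A" shows "l2f (H * A)"
  unfolding l2f_def
proof (rule bounded_imp_summable)
  fix N
  have "(\<Sum>t\<le>N. (fps_nth (H * A) t)\<^sup>2) \<le> (\<Sum>k. \<bar>fps_nth H k\<bar>)\<^sup>2 * (\<Sum>t<Suc N. (fps_nth A t)\<^sup>2)"
    using convolution_bound[OF assms(1), of A "Suc N"] by (simp only: lessThan_Suc_atMost)
  also have "\<dots> \<le> (\<Sum>k. \<bar>fps_nth H k\<bar>)\<^sup>2 * (\<Sum>t. (fps_nth A t)\<^sup>2)"
    using assms(2) by (intro mult_left_mono sum_le_suminf) (auto simp: l2f_def)
  finally show "(\<Sum>t\<le>N. (fps_nth (H * A) t)\<^sup>2) \<le> (\<Sum>k. \<bar>fps_nth H k\<bar>)\<^sup>2 * (\<Sum>t. (fps_nth A t)\<^sup>2)" .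
qed auto

text \<open>The zeros of \<open>e\<close> are finitely many and lie outside the closed disc, so the
  inverse converges in a disc of radius greater than 1; hence it converges absolutely at 1.\<close>

lemma l1f_inverse_poly:
  assumes nz: "\<And>x. cmod x \<le> 1 \<Longrightarrow> cpoly e x \<noteq> 0"
  shows "l1f (inverse (fps_of_poly e))"
proof -
  define E where "E = map_poly complex_of_real e"
  have e0: "coeff e 0 \<noteq> 0" using nz[of 0] by (simp add: cpoly_def poly_0_coeff_0 coeff_map_poly)
  then have "E \<noteq> 0" by (auto simp: E_def map_poly_eq_0_iff)
  then have fin: "finite {x. poly E x = 0}" by (rule poly_roots_finite)
  \<comment> \<open>The 2 keeps the minimum over a nonempty set when \<open>e\<close> has no zeros;
    any number above 1 would do.\<close>
  define r where "r = Min (insert 2 (cmod ` {x. poly E x = 0}))"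
  have r1: "r > 1" unfolding r_def using fin nz
    by (subst Min_gr_iff) (auto simp: cpoly_def E_def not_le[symmetric])
  have nzr: "poly E x \<noteq> 0" if "cmod x < r" for x
  proof
    assume "poly E x = 0"
    then have "r \<le> cmod x" unfolding r_def using fin by (intro Min_le) auto
    with that show False by simp
  qed
  let ?I = "inverse (fps_of_poly E)"
  have "fps_conv_radius ?I \<ge> min (ereal r) (fps_conv_radius (fps_of_poly E))"
    by (rule fps_conv_radius_inverse) (use nzr in \<open>auto simp: eball_def\<close> )
  then have "fps_conv_radius ?I \<ge> ereal r" by simp
  moreover have "1 < ereal r" using r1 by simp
  ultimately have "1 < fps_conv_radius ?I" by (rule less_le_trans[rotated])
  then have "summable (\<lambda>n. norm (fps_nth ?I n * 1 ^ n))"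
    unfolding fps_conv_radius_def by (intro abs_summable_in_conv_radius) (simp add: one_ereal_def)
  moreover have "fps_nth ?I n = of_real (fps_nth (inverse (fps_of_poly e)) n)" for n
  proof -
    let ?J = "Abs_fps (\<lambda>n. complex_of_real (fps_nth (inverse (fps_of_poly e)) n))"
    have "fps_of_poly e * inverse (fps_of_poly e) = 1"
      using e0 by (intro inverse_mult_eq_1') simp
    then have eq: "fps_nth (fps_of_poly e * inverse (fps_of_poly e)) n = fps_nth 1 n" for n by simp
    have "fps_of_poly E * ?J = 1"
    proof (rule fps_ext)
      fix n
      have "fps_nth (fps_of_poly E * ?J) n = of_real (fps_nth (fps_of_poly e * inverse (fps_of_poly e)) n)"
        by (simp add: fps_mult_nth E_def coeff_map_poly)
      then show "fps_nth (fps_of_poly E * ?J) n = fps_nth 1 n" unfolding eq by simp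
    qed
    moreover have "coeff E 0 \<noteq> 0" using e0 by (simp add: E_def coeff_map_poly)
    ultimately have "?J = ?I" by (intro fps_inverse_unique[symmetric])
    then show ?thesis by (metis fps_nth_Abs_fps)
  qed
  ultimately show ?thesis by (simp add: l1f_def)
qed

definition pmat :: "nat \<Rightarrow> (nat \<Rightarrow> nat \<Rightarrow> real poly) \<Rightarrow> complex \<Rightarrow> complex mat" where
  "pmat n E x = mat n n (\<lambda>(i,j). cpoly (E i j) x)"

lemma det_pmat: "det (pmat n E x) = cpoly (det (mat n n (\<lambda>(i,j). E i j))) x"
proof -
  interpret comm_ring_hom "\<lambda>p. cpoly p x" by (rule cpoly_hom)
  have "pmat n E x = map_mat (\<lambda>p. cpoly p x) (mat n n (\<lambda>(i,j). E i j))"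
    unfolding pmat_def by (intro eq_matI) auto
  then show ?thesis by (simp add: hom_det)
qed

lemma mat_mult_index:
  assumes "A \<in> carrier_mat n m" "B \<in> carrier_mat m k" "i < n" "j < k"
  shows "(A * B) $$ (i, j) = (\<Sum>l<m. A $$ (i, l) * B $$ (l, j))"
  using assms by (auto simp: scalar_prod_def atLeast0LessThan intro!: sum.cong)

text \<open>Cramer's rule: the adjugate has polynomial entries and the inverse of the determinant
  has summable coefficients. Both one-sided identities are kept, since one constructs an input with
  a given output and the other recovers the input from its output.\<close>

lemma stable_inverse:
  assumes nz: "\<And>x. cmod x \<le> 1 \<Longrightarrow> det (pmat n E x) \<noteq> 0"
  obtains h where "\<And>i j. l1f (h i j)"
    "\<And>i j. i < n \<Longrightarrow> j < n \<Longrightarrow> (\<Sum>k<n. h i k * fps_of_poly (E k j)) = (if i = j then 1 else 0)"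
    "\<And>i j. i < n \<Longrightarrow> j < n \<Longrightarrow> (\<Sum>k<n. fps_of_poly (E i k) * h k j) = (if i = j then 1 else 0)"
proof -
  define A where "A = mat n n (\<lambda>(i,j). E i j)"
  have A: "A \<in> carrier_mat n n" by (simp add: A_def)
  define e where "e = det A"
  have nze: "cpoly e x \<noteq> 0" if "cmod x \<le> 1" for x using nz[OF that] by (simp add: e_def A_def det_pmat)
  let ?I = "inverse (fps_of_poly e)"
  have e0: "fps_nth (fps_of_poly e) 0 \<noteq> 0" using nze[of 0] by (simp add: cpoly_def poly_0_coeff_0 coeff_map_poly)
  have eI: "fps_of_poly e * ?I = 1" using e0 by (rule inverse_mult_eq_1')
  note adj = adj_mat[OF A]
  define h where "h i j = fps_of_poly (adj_mat A $$ (i,j)) * ?I" for i j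
  show thesis
  proof
    show "l1f (h i j)" for i j unfolding h_def by (intro l1f_mult l1f_poly l1f_inverse_poly nze)
    fix i j assume ij: "i < n" "j < n"
    have "(\<Sum>k<n. h i k * fps_of_poly (E k j)) = fps_of_poly ((adj_mat A * A) $$ (i,j)) * ?I"
      unfolding mat_mult_index[OF adj(1) A ij] h_def using ij
      by (simp add: A_def fps_of_poly_sum fps_of_poly_mult sum_distrib_right, simp only: mult_ac)
    also have "\<dots> = (if i = j then 1 else 0)" unfolding adj(3) using ij eI by (simp add: e_def)
    finally show "(\<Sum>k<n. h i k * fps_of_poly (E k j)) = (if i = j then 1 else 0)" .
    have "(\<Sum>k<n. fps_of_poly (E i k) * h k j) = fps_of_poly ((A * adj_mat A) $$ (i,j)) * ?I"
      unfolding mat_mult_index[OF A adj(1) ij] h_def using ij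
      by (simp add: A_def fps_of_poly_sum fps_of_poly_mult sum_distrib_right, simp only: mult_ac)
    also have "\<dots> = (if i = j then 1 else 0)" unfolding adj(2) using ij eI by (simp add: e_def)
    finally show "(\<Sum>k<n. fps_of_poly (E i k) * h k j) = (if i = j then 1 else 0)" .
  qed
qed

section \<open>Fourier analysis of one-sided square-summable sequences on the circle\<close>

section \<open>Mean-square z-transforms and Parseval's identity\<close>

text \<open>The squared L2 norm on the circle, taken in the extended nonnegative reals so that
  integrability need not be known beforehand.\<close>

abbreviation circ :: "(complex \<Rightarrow> complex) \<Rightarrow> ennreal" where
  "circ f \<equiv> (\<integral>\<^sup>+\<theta>\<in>{0..2*pi}. ennreal ((cmod (f (cis \<theta>)))\<^sup>2) \<partial>lborel)"

text \<open>The transform with weight 1; \<open>is_zt_scale\<close> absorbs the weight \<rho> into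
  the coefficients.\<close>

definition zts :: "real fps \<Rightarrow> (complex \<Rightarrow> complex) \<Rightarrow> bool" where
  "zts A f \<longleftrightarrow> is_zt 1 (fps_nth A) f"

lemma cis_borel [measurable]: "cis \<in> borel_measurable borel"
  by (intro borel_measurable_continuous_onI continuous_intros)

lemma circ_borel: "f \<in> borel_measurable borel \<Longrightarrow> (\<lambda>\<theta>. f (cis \<theta>)) \<in> borel_measurable borel"
  by (rule measurable_compose[OF cis_borel])

lemma zt_partial_borel [measurable]: "zt_partial \<rho> q N \<in> borel_measurable borel"
  unfolding zt_partial_def by measurable

lemma is_zt_scale:
  "is_zt \<rho> q f \<longleftrightarrow> zts (Abs_fps (\<lambda>k. q k / \<rho> ^ k)) f"
proof -
  have "zt_partial \<rho> q = zt_partial 1 (\<lambda>k. q k / \<rho> ^ k)"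
    by (intro ext) (simp add: zt_partial_def power_mult_distrib)
  moreover have "fps_nth (Abs_fps (\<lambda>k. q k / \<rho> ^ k)) = (\<lambda>k. q k / \<rho> ^ k)" by (rule ext) simp
  ultimately show ?thesis unfolding zts_def is_zt_def by simp
qed

text \<open>The cross term of the square is split with weight \<delta>. A constant near 1 in front
  of \<open>f\<close> lets \<open>circ_parseval\<close> pass to the limit without loss, which the
  constant 2 would not.\<close>

lemma circ_add_le_weighted:
  assumes [measurable]: "f \<in> borel_measurable borel" "g \<in> borel_measurable borel" and d: "\<delta> > 0"
  shows "circ (\<lambda>z. f z + g z) \<le> ennreal (1 + \<delta>) * circ f + ennreal (1 + 1 / \<delta>) * circ g"
proof -
  have [measurable]: "(\<lambda>\<theta>. f (cis \<theta>)) \<in> borel_measurable borel" "(\<lambda>\<theta>. g (cis \<theta>)) \<in> borel_measurable borel"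
    by (intro circ_borel assms)+
  have *: "(cmod (x + y))\<^sup>2 \<le> (1 + \<delta>) * (cmod x)\<^sup>2 + (1 + 1 / \<delta>) * (cmod y)\<^sup>2" for x y
  proof -
    have "(cmod (x + y))\<^sup>2 \<le> (cmod x + cmod y)\<^sup>2" by (intro power_mono norm_triangle_ineq) auto
    also have "\<dots> \<le> (1 + \<delta>) * (cmod x)\<^sup>2 + (1 + 1 / \<delta>) * (cmod y)\<^sup>2"
    proof -
      have "0 \<le> (\<delta> * cmod x - cmod y)\<^sup>2 / \<delta>" using d by simp
      also have "\<dots> = \<delta> * (cmod x)\<^sup>2 + (1 / \<delta>) * (cmod y)\<^sup>2 - 2 * cmod x * cmod y"
      proof -
        have "(\<delta> * x - y)\<^sup>2 / \<delta> = \<delta> * x\<^sup>2 + (1 / \<delta>) * y\<^sup>2 - 2 * x * y" for x y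
          using d by (simp add: power2_diff power_mult_distrib diff_divide_distrib add_divide_distrib) (simp add: power2_eq_square)
        then show ?thesis .
      qed
      finally show ?thesis by (simp add: power2_sum algebra_simps)
    qed
    finally show ?thesis .
  qed
  have "circ (\<lambda>z. f z + g z) \<le> (\<integral>\<^sup>+\<theta>. ennreal (1 + \<delta>) * (ennreal ((cmod (f (cis \<theta>)))\<^sup>2) * indicator {0..2*pi} \<theta>)
      + ennreal (1 + 1 / \<delta>) * (ennreal ((cmod (g (cis \<theta>)))\<^sup>2) * indicator {0..2*pi} \<theta>) \<partial>lborel)"
  proof (rule nn_integral_mono)
    fix \<theta> :: real
    have "ennreal ((cmod (f (cis \<theta>) + g (cis \<theta>)))\<^sup>2) \<le> ennreal (1 + \<delta>) * ennreal ((cmod (f (cis \<theta>)))\<^sup>2)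
        + ennreal (1 + 1 / \<delta>) * ennreal ((cmod (g (cis \<theta>)))\<^sup>2)"
    proof -
      have p: "1 + \<delta> \<ge> 0" "1 + 1 / \<delta> \<ge> 0" using d by auto
      have "ennreal ((1 + \<delta>) * a\<^sup>2 + (1 + 1 / \<delta>) * b\<^sup>2) = ennreal (1 + \<delta>) * ennreal (a\<^sup>2) + ennreal (1 + 1 / \<delta>) * ennreal (b\<^sup>2)" for a b
        using p by (subst ennreal_plus, simp, simp) (simp only: ennreal_mult zero_le_power2)
      then show ?thesis using ennreal_leI[OF *[of "f (cis \<theta>)" "g (cis \<theta>)"]] by simp
    qed
    then show "ennreal ((cmod (f (cis \<theta>) + g (cis \<theta>)))\<^sup>2) * indicator {0..2*pi} \<theta>
       \<le> ennreal (1 + \<delta>) * (ennreal ((cmod (f (cis \<theta>)))\<^sup>2) * indicator {0..2*pi} \<theta>)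
      + ennreal (1 + 1 / \<delta>) * (ennreal ((cmod (g (cis \<theta>)))\<^sup>2) * indicator {0..2*pi} \<theta>)"
      by (auto simp: indicator_def)
  qed
  also have "\<dots> = ennreal (1 + \<delta>) * circ f + ennreal (1 + 1 / \<delta>) * circ g"
    by (subst nn_integral_add; simp add: nn_integral_cmult)
  finally show ?thesis .
qed

lemma circ_add_le:
  assumes "f \<in> borel_measurable borel" "g \<in> borel_measurable borel"
  shows "circ (\<lambda>z. f z + g z) \<le> 2 * circ f + 2 * circ g"
  using circ_add_le_weighted[OF assms, of 1] by simp

lemma circ_cong: "(\<And>z. cmod z = 1 \<Longrightarrow> cmod (f z) = cmod (g z)) \<Longrightarrow> circ f = circ g"
  by (intro nn_integral_cong) simp

lemma circ_cmult:
  assumes [measurable]: "f \<in> borel_measurable borel"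
  shows "circ (\<lambda>z. c * f z) = ennreal ((cmod c)\<^sup>2) * circ f"
proof -
  have [measurable]: "(\<lambda>\<theta>. f (cis \<theta>)) \<in> borel_measurable borel" by (intro circ_borel assms)
  show ?thesis
    by (subst nn_integral_cmult[symmetric])
      (auto intro!: nn_integral_cong simp: norm_mult power_mult_distrib ennreal_mult mult_ac)
qed

lemma zt_partial_add: "zt_partial 1 (fps_nth (A + B)) N z = zt_partial 1 (fps_nth A) N z + zt_partial 1 (fps_nth B) N z"
  by (simp add: zt_partial_def add_divide_distrib sum.distrib)

lemma zts_add: assumes "zts A f" "zts B g" shows "zts (A + B) (\<lambda>z. f z + g z)"
  unfolding zts_def is_zt_def
proof
  have [measurable]: "f \<in> borel_measurable borel" "g \<in> borel_measurable borel"
    using assms by (auto simp: zts_def is_zt_def)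
  show "(\<lambda>z. f z + g z) \<in> borel_measurable borel" by measurable
  let ?a = "\<lambda>N. circ (\<lambda>z. f z - zt_partial 1 (fps_nth A) N z)"
  let ?b = "\<lambda>N. circ (\<lambda>z. g z - zt_partial 1 (fps_nth B) N z)"
  have "(\<lambda>N. 2 * ?a N + 2 * ?b N) \<longlonglongrightarrow> 2 * 0 + 2 * 0"
    using assms unfolding zts_def is_zt_def by (intro tendsto_add ennreal_tendsto_cmult) auto
  then have l: "(\<lambda>N. 2 * ?a N + 2 * ?b N) \<longlonglongrightarrow> 0" by simp
  have le: "circ (\<lambda>z. f z + g z - zt_partial 1 (fps_nth (A + B)) N z) \<le> 2 * ?a N + 2 * ?b N" for N
    using circ_add_le[of "\<lambda>z. f z - zt_partial 1 (fps_nth A) N z" "\<lambda>z. g z - zt_partial 1 (fps_nth B) N z"]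
    by (simp add: zt_partial_add algebra_simps)
  show "(\<lambda>N. circ (\<lambda>z. f z + g z - zt_partial 1 (fps_nth (A + B)) N z)) \<longlonglongrightarrow> 0"
    by (rule tendsto_sandwich[OF _ _ tendsto_const l]) (auto simp: le)
qed

lemma zts_cmult: assumes "zts A f" shows "zts (fps_const c * A) (\<lambda>z. of_real c * f z)"
  unfolding zts_def is_zt_def
proof
  have [measurable]: "f \<in> borel_measurable borel" using assms by (auto simp: zts_def is_zt_def)
  show "(\<lambda>z. of_real c * f z) \<in> borel_measurable borel" by measurable
  have eq: "circ (\<lambda>z. of_real c * f z - zt_partial 1 (fps_nth (fps_const c * A)) N z)
     = ennreal ((cmod (of_real c))\<^sup>2) * circ (\<lambda>z. f z - zt_partial 1 (fps_nth A) N z)" for N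
  proof -
    have "of_real c * f z - zt_partial 1 (fps_nth (fps_const c * A)) N z
        = of_real c * (f z - zt_partial 1 (fps_nth A) N z)" for z
      by (simp add: zt_partial_def sum_distrib_left right_diff_distrib)
    then show ?thesis using circ_cmult[of "\<lambda>z. f z - zt_partial 1 (fps_nth A) N z" "of_real c"] by simp
  qed
  have "(\<lambda>N. ennreal ((cmod (of_real c))\<^sup>2) * circ (\<lambda>z. f z - zt_partial 1 (fps_nth A) N z)) \<longlonglongrightarrow> ennreal ((cmod (of_real c))\<^sup>2) * 0"
    using assms unfolding zts_def is_zt_def by (intro ennreal_tendsto_cmult) auto
  then show "(\<lambda>N. circ (\<lambda>z. of_real c * f z - zt_partial 1 (fps_nth (fps_const c * A)) N z)) \<longlonglongrightarrow> 0"
    unfolding eq by simp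
qed

lemma zts_0 [simp]: "zts 0 (\<lambda>z. 0)"
  by (simp add: zts_def is_zt_def zt_partial_def)

lemma zts_sum: "(\<And>i. i \<in> I \<Longrightarrow> zts (A i) (f i)) \<Longrightarrow> zts (sum A I) (\<lambda>z. \<Sum>i\<in>I. f i z)"
proof (induction I rule: infinite_finite_induct)
  case (insert x F)
  then show ?case using zts_add[of "A x" "f x" "sum A F" "\<lambda>z. \<Sum>i\<in>F. f i z"] by simp
qed simp_all

lemma zts_diff: assumes "zts A f" "zts B g" shows "zts (A - B) (\<lambda>z. f z - g z)"
proof -
  have e: "fps_const (-1) * B = - B" by (metis fps_const_1_eq_1 fps_const_neg mult_minus1)
  show ?thesis using zts_add[OF assms(1) zts_cmult[OF assms(2), of "-1"]] unfolding e by simp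
qed

lemma zt_partial_delay: "zt_partial 1 (fps_nth (fps_X * A)) (Suc N) z = zt_partial 1 (fps_nth A) N z / z"
  unfolding zt_partial_def sum.lessThan_Suc_shift by (simp add: sum_divide_distrib mult.commute)

text \<open>Division by z does not change moduli on the circle, so the delayed partial sums have the
  old errors with the index moved by one.\<close>

lemma zts_delay: assumes "zts A f" shows "zts (fps_X * A) (\<lambda>z. f z / z)"
  unfolding zts_def is_zt_def
proof
  have [measurable]: "f \<in> borel_measurable borel" using assms by (auto simp: zts_def is_zt_def)
  show "(\<lambda>z. f z / z) \<in> borel_measurable borel" by measurable
  have "circ (\<lambda>z. f z / z - zt_partial 1 (fps_nth (fps_X * A)) (Suc N) z)
     = circ (\<lambda>z. f z - zt_partial 1 (fps_nth A) N z)" for N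
    unfolding zt_partial_delay diff_divide_distrib[symmetric] by (intro circ_cong) (simp add: norm_divide)
  then have "(\<lambda>N. circ (\<lambda>z. f z / z - zt_partial 1 (fps_nth (fps_X * A)) (Suc N) z)) \<longlonglongrightarrow> 0"
    using assms by (simp add: zts_def is_zt_def)
  then show "(\<lambda>N. circ (\<lambda>z. f z / z - zt_partial 1 (fps_nth (fps_X * A)) N z)) \<longlonglongrightarrow> 0"
    by (rule LIMSEQ_imp_Suc)
qed

lemma zts_poly_mult: assumes "zts A f" shows "zts (fps_of_poly p * A) (\<lambda>z. cpoly p (1 / z) * f z)"
proof (induction p)
  case (pCons c p)
  have "fps_of_poly (pCons c p) * A = fps_const c * A + fps_X * (fps_of_poly p * A)"
    by (simp add: fps_of_poly_pCons algebra_simps)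
  then show ?case using zts_add[OF zts_cmult[OF assms, of c] zts_delay[OF pCons.IH]]
    by (simp add: algebra_simps)
qed simp

text \<open>The difference of the two functions is a transform of the zero series. Its partial sums
  vanish, so its approximation error is its own norm.\<close>

lemma zts_unique:
  assumes "zts A f" "zts A g"
  shows "AE \<theta> in lborel. \<theta> \<in> {0..2*pi} \<longrightarrow> f (cis \<theta>) = g (cis \<theta>)"
proof -
  have [measurable]: "f \<in> borel_measurable borel" "g \<in> borel_measurable borel"
    using assms by (auto simp: zts_def is_zt_def)
  have [measurable]: "(\<lambda>\<theta>. f (cis \<theta>)) \<in> borel_measurable borel" "(\<lambda>\<theta>. g (cis \<theta>)) \<in> borel_measurable borel"
    by (intro circ_borel; measurable)+
  have "zts (A - A) (\<lambda>z. f z - g z)" using assms by (rule zts_diff)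
  then have "(\<lambda>N::nat. circ (\<lambda>z. f z - g z)) \<longlonglongrightarrow> 0" by (simp add: zts_def is_zt_def zt_partial_def)
  then have "circ (\<lambda>z. f z - g z) = 0" by (simp add: LIMSEQ_const_iff)
  then have "AE \<theta> in lborel. ennreal ((cmod (f (cis \<theta>) - g (cis \<theta>)))\<^sup>2) * indicator {0..2*pi} \<theta> = 0"
    by (subst (asm) nn_integral_0_iff_AE) auto
  then show ?thesis by eventually_elim (auto simp: indicator_def split: if_splits)
qed

lemma zts_exists: "l2f A \<Longrightarrow> \<exists>f. zts A f"
  unfolding zts_def by (rule is_zt_exists) (simp_all add: l2f_def)

text \<open>The identity is known for partial sums. Comparing \<open>f\<close> with them in both
  directions costs a factor 1 + \<delta> and an error tending to 0; then \<delta> tends to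
  0.\<close>

lemma circ_parseval:
  assumes "zts A f" "l2f A"
  shows "circ f = ennreal (2 * pi * (\<Sum>k. (fps_nth A k)\<^sup>2))"
proof -
  define S where "S N = zt_partial 1 (fps_nth A) N" for N
  have [measurable]: "f \<in> borel_measurable borel" "S N \<in> borel_measurable borel" for N
    using assms by (auto simp: zts_def is_zt_def S_def)
  define E where "E = 2 * pi * (\<Sum>k. (fps_nth A k)\<^sup>2)"
  have E0: "E \<ge> 0" unfolding E_def using assms(2) by (intro mult_nonneg_nonneg suminf_nonneg) (auto simp: l2f_def)
  have cS: "circ (S N) = ennreal (2 * pi * (\<Sum>k<N. (fps_nth A k)\<^sup>2))" for N
    using nn_integral_zt_partial_diff[of 1 0 N "fps_nth A"]
    by (simp add: S_def zt_partial_def atLeast0LessThan)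
  have "(\<lambda>N. ennreal (2 * pi * (\<Sum>k<N. (fps_nth A k)\<^sup>2))) \<longlonglongrightarrow> ennreal E"
    unfolding E_def using assms(2) by (intro tendsto_intros summable_LIMSEQ) (simp add: l2f_def)
  then have limS: "(\<lambda>N. circ (S N)) \<longlonglongrightarrow> ennreal E" by (simp only: cS)
  have lim0: "(\<lambda>N. circ (\<lambda>z. f z - S N z)) \<longlonglongrightarrow> 0" using assms by (simp add: zts_def is_zt_def S_def)
  have sym: "circ (\<lambda>z. S N z - f z) = circ (\<lambda>z. f z - S N z)" for N
    by (intro circ_cong) (simp add: norm_minus_commute)
  have up: "circ f \<le> ennreal (1 + \<delta>) * ennreal E" if "\<delta> > 0" for \<delta>
  proof (rule LIMSEQ_le[OF tendsto_const, of "\<lambda>N. ennreal (1 + \<delta>) * circ (S N) + ennreal (1 + 1/\<delta>) * circ (\<lambda>z. f z - S N z)"])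
    show "\<exists>N. \<forall>n\<ge>N. circ f \<le> ennreal (1 + \<delta>) * circ (S n) + ennreal (1 + 1/\<delta>) * circ (\<lambda>z. f z - S n z)"
    proof (intro exI[of _ 0] allI impI)
      fix n show "circ f \<le> ennreal (1 + \<delta>) * circ (S n) + ennreal (1 + 1/\<delta>) * circ (\<lambda>z. f z - S n z)"
        using circ_add_le_weighted[of "S n" "\<lambda>z. f z - S n z", OF _ _ that] by simp
    qed
    have "(\<lambda>N. ennreal (1 + \<delta>) * circ (S N) + ennreal (1 + 1/\<delta>) * circ (\<lambda>z. f z - S N z))
        \<longlonglongrightarrow> ennreal (1 + \<delta>) * ennreal E + ennreal (1 + 1/\<delta>) * 0"
      by (intro tendsto_add ennreal_tendsto_cmult limS lim0) auto
    then show "(\<lambda>N. ennreal (1 + \<delta>) * circ (S N) + ennreal (1 + 1/\<delta>) * circ (\<lambda>z. f z - S N z))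
        \<longlonglongrightarrow> ennreal (1 + \<delta>) * ennreal E" by simp
  qed
  have lo: "ennreal E \<le> ennreal (1 + \<delta>) * circ f" if "\<delta> > 0" for \<delta>
  proof (rule LIMSEQ_le[OF limS, of "\<lambda>N. ennreal (1 + \<delta>) * circ f + ennreal (1 + 1/\<delta>) * circ (\<lambda>z. f z - S N z)"])
    show "\<exists>N. \<forall>n\<ge>N. circ (S n) \<le> ennreal (1 + \<delta>) * circ f + ennreal (1 + 1/\<delta>) * circ (\<lambda>z. f z - S n z)"
    proof (intro exI[of _ 0] allI impI)
      fix n show "circ (S n) \<le> ennreal (1 + \<delta>) * circ f + ennreal (1 + 1/\<delta>) * circ (\<lambda>z. f z - S n z)"
        using circ_add_le_weighted[of f "\<lambda>z. S n z - f z", OF _ _ that] unfolding sym by simp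
    qed
    have "(\<lambda>N. ennreal (1 + \<delta>) * circ f + ennreal (1 + 1/\<delta>) * circ (\<lambda>z. f z - S N z))
        \<longlonglongrightarrow> ennreal (1 + \<delta>) * circ f + ennreal (1 + 1/\<delta>) * 0"
      by (intro tendsto_add ennreal_tendsto_cmult lim0 tendsto_const) auto
    then show "(\<lambda>N. ennreal (1 + \<delta>) * circ f + ennreal (1 + 1/\<delta>) * circ (\<lambda>z. f z - S N z))
        \<longlonglongrightarrow> ennreal (1 + \<delta>) * circ f" by simp
  qed
  \<comment> \<open>The upper bound at \<delta> = 1 already excludes an infinite norm, so what
    remains is about real numbers.\<close>
  obtain c where c: "circ f = ennreal c" "c \<ge> 0"
    using up[of 1] E0 by (cases "circ f") (auto simp: ennreal_mult[symmetric] top_unique ennreal_mult_eq_top_iff)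
  have "c \<le> (1 + \<delta>) * E" "E \<le> (1 + \<delta>) * c" if "\<delta> > 0" for \<delta>
    using up[OF that] lo[OF that] c E0 that
    by (simp_all add: ennreal_mult[symmetric] ennreal_le_iff del: ennreal_plus)
  note cE = this
  have lim: "((\<lambda>\<delta>. (1 + \<delta>) * x) \<longlongrightarrow> (1 + 0) * x) (at_right 0)" for x :: real
    by (intro tendsto_intros)
  have "c \<le> (1 + 0) * E"
    by (rule tendsto_lowerbound[OF lim]) (auto simp: eventually_at_right_less cE intro!: eventually_at_rightI[of 0 1])
  moreover have "E \<le> (1 + 0) * c"
    by (rule tendsto_lowerbound[OF lim]) (auto simp: eventually_at_right_less cE intro!: eventually_at_rightI[of 0 1])
  ultimately show ?thesis using c by (simp add: E_def)
qed

lemma parseval_sq: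
  assumes "zts A f" "l2f A"
  shows "has_bochner_integral lborel (\<lambda>\<theta>. indicator {0..2*pi} \<theta> * (cmod (f (cis \<theta>)))\<^sup>2) (2 * pi * (\<Sum>k. (fps_nth A k)\<^sup>2))"
proof (rule has_bochner_integral_nn_integral)
  have [measurable]: "f \<in> borel_measurable borel" using assms by (auto simp: zts_def is_zt_def)
  have [measurable]: "(\<lambda>\<theta>. f (cis \<theta>)) \<in> borel_measurable borel" by (intro circ_borel) measurable
  show "(\<lambda>\<theta>. indicator {0..2*pi} \<theta> * (cmod (f (cis \<theta>)))\<^sup>2) \<in> borel_measurable lborel" by measurable
  show "0 \<le> 2 * pi * (\<Sum>k. (fps_nth A k)\<^sup>2)"
    using assms(2) by (intro mult_nonneg_nonneg suminf_nonneg) (auto simp: l2f_def)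
  have "(\<integral>\<^sup>+\<theta>. ennreal (indicator {0..2*pi} \<theta> * (cmod (f (cis \<theta>)))\<^sup>2) \<partial>lborel) = circ f"
    by (intro nn_integral_cong) (auto simp: indicator_def)
  then show "(\<integral>\<^sup>+\<theta>. ennreal (indicator {0..2*pi} \<theta> * (cmod (f (cis \<theta>)))\<^sup>2) \<partial>lborel) = ennreal (2 * pi * (\<Sum>k. (fps_nth A k)\<^sup>2))"
    using circ_parseval[OF assms] by simp
qed auto

lemma l2f_summable_mult: assumes "l2f A" "l2f B" shows "summable (\<lambda>k. fps_nth A k * fps_nth B k)"
proof -
  have "summable (\<lambda>k. ((fps_nth (A + B) k)\<^sup>2 - (fps_nth (A - B) k)\<^sup>2) / 4)"
    using l2f_add[OF assms] l2f_diff[OF assms] unfolding l2f_def by (intro summable_divide summable_diff)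
  moreover have "((fps_nth (A + B) k)\<^sup>2 - (fps_nth (A - B) k)\<^sup>2) / 4 = fps_nth A k * fps_nth B k" for k
    by (simp add: power2_eq_square field_simps)
  ultimately show ?thesis by (simp only:)
qed

text \<open>Polarization of \<open>parseval_sq\<close>, which yields the real part of the inner
  product.\<close>

lemma parseval:
  assumes "zts A f" "l2f A" "zts B g" "l2f B"
  shows "has_bochner_integral lborel (\<lambda>\<theta>. indicator {0..2*pi} \<theta> * Re (cnj (f (cis \<theta>)) * g (cis \<theta>)))
    (2 * pi * (\<Sum>k. fps_nth A k * fps_nth B k))"
proof -
  have s: "summable (\<lambda>k. (fps_nth (A + B) k)\<^sup>2)" "summable (\<lambda>k. (fps_nth (A - B) k)\<^sup>2)"
    using l2f_add[OF assms(2,4)] l2f_diff[OF assms(2,4)] unfolding l2f_def by auto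
  have "has_bochner_integral lborel (\<lambda>\<theta>. (indicator {0..2*pi} \<theta> * (cmod (f (cis \<theta>) + g (cis \<theta>)))\<^sup>2 - indicator {0..2*pi} \<theta> * (cmod (f (cis \<theta>) - g (cis \<theta>)))\<^sup>2) / 4)
    ((2 * pi * (\<Sum>k. (fps_nth (A + B) k)\<^sup>2) - 2 * pi * (\<Sum>k. (fps_nth (A - B) k)\<^sup>2)) / 4)"
    by (intro has_bochner_integral_divide has_bochner_integral_diff parseval_sq zts_add zts_diff l2f_add l2f_diff assms)
  also have "(2 * pi * (\<Sum>k. (fps_nth (A + B) k)\<^sup>2) - 2 * pi * (\<Sum>k. (fps_nth (A - B) k)\<^sup>2)) / 4
    = 2 * pi * ((\<Sum>k. (fps_nth (A + B) k)\<^sup>2 - (fps_nth (A - B) k)\<^sup>2) / 4)"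
    using suminf_diff[OF s] by (simp add: right_diff_distrib[symmetric])
  also have "(\<Sum>k. (fps_nth (A + B) k)\<^sup>2 - (fps_nth (A - B) k)\<^sup>2) / 4 = (\<Sum>k. fps_nth A k * fps_nth B k)"
    unfolding suminf_divide[OF summable_diff[OF s], symmetric]
    by (intro suminf_cong) (simp add: power2_eq_square field_simps)
  also have "(\<lambda>\<theta>. (indicator {0..2*pi} \<theta> * (cmod (f (cis \<theta>) + g (cis \<theta>)))\<^sup>2 - indicator {0..2*pi} \<theta> * (cmod (f (cis \<theta>) - g (cis \<theta>)))\<^sup>2) / 4)
    = (\<lambda>\<theta>. indicator {0..2*pi} \<theta> * Re (cnj (f (cis \<theta>)) * g (cis \<theta>)))"
    by (auto simp: fun_eq_iff indicator_def cmod_power2) (simp add: power2_eq_square field_simps)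
  finally show ?thesis .
qed

text \<open>This carries identities from the circle back to sequences; through it the
  frequency-domain description of a filter determines its output in time.\<close>

lemma zts_zero_imp:
  assumes "zts A f" "l2f A" "AE \<theta> in lborel. \<theta> \<in> {0..2*pi} \<longrightarrow> f (cis \<theta>) = 0"
  shows "A = 0"
proof -
  have [measurable]: "f \<in> borel_measurable borel" using assms by (auto simp: zts_def is_zt_def)
  have [measurable]: "(\<lambda>\<theta>. f (cis \<theta>)) \<in> borel_measurable borel" by (intro circ_borel) measurable
  have "circ f = 0" by (subst nn_integral_0_iff_AE) (use assms(3) in \<open>auto elim!: eventually_mono simp: indicator_def\<close>)
  then have "2 * pi * (\<Sum>k. (fps_nth A k)\<^sup>2) \<le> 0"
    unfolding circ_parseval[OF assms(1,2)] by (simp add: ennreal_eq_0_iff)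
  then have "(\<Sum>k. (fps_nth A k)\<^sup>2) \<le> 0" using pi_gt_zero by (simp add: mult_le_0_iff not_le)
  moreover have "(fps_nth A k)\<^sup>2 \<le> (\<Sum>k. (fps_nth A k)\<^sup>2)" for k
    using sum_le_suminf[of "\<lambda>k. (fps_nth A k)\<^sup>2" "{k}"] assms(2) by (simp add: l2f_def)
  ultimately have "(fps_nth A k)\<^sup>2 \<le> 0" for k by (meson order_trans)
  then show ?thesis by (intro fps_ext) simp
qed

section \<open>One-sided Toeplitz systems solved in l2 by truncation\<close>

section \<open>Coercivity of Toeplitz matrices with a PN symbol\<close>

text \<open>Galerkin's method: coercivity makes every truncated system solvable and, tested with the
  solution itself, bounds the solutions in l2 by 1/c whatever the size. A componentwise limit solves
  the infinite system, because the band leaves finitely many unknowns in each equation.\<close>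

lemma banded_coercive_solution:
  fixes t :: "nat \<Rightarrow> nat \<Rightarrow> real" and s :: "nat \<Rightarrow> real"
  assumes c: "c > 0" and s: "\<And>i. \<bar>s i\<bar> \<le> 1"
    and coercive: "\<And>N a. c * (\<Sum>i<N. (a i)\<^sup>2) \<le> (\<Sum>i<N. \<Sum>j<N. s i * a i * t i j * a j)"
    and band: "\<And>i j. i + b < j \<Longrightarrow> t i j = 0"
  obtains a where "summable (\<lambda>i. (a i)\<^sup>2)"
    "\<And>i. (\<Sum>j\<le>i + b. t i j * a j) = (if i = i0 then 1 else 0)"
proof -
  define A where "A N = mat N N (\<lambda>(i,j). t i j)" for N
  have A: "A N \<in> carrier_mat N N" for N by (simp add: A_def)
  have det: "det (A N) \<noteq> 0" for N
  proof
    assume "det (A N) = 0"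
    then obtain v where v: "v \<in> carrier_vec N" "v \<noteq> 0\<^sub>v N" "A N *\<^sub>v v = 0\<^sub>v N"
      using det_0_iff_vec_prod_zero_field[OF A] by auto
    have "(\<Sum>j<N. t i j * v $ j) = 0" if "i < N" for i
    proof -
      have "(A N *\<^sub>v v) $ i = (\<Sum>j<N. t i j * v $ j)"
        using that v(1) by (auto simp: A_def scalar_prod_def atLeast0LessThan intro!: sum.cong)
      then show ?thesis using v(3) that by simp
    qed
    then have "(\<Sum>i<N. \<Sum>j<N. s i * v $ i * t i j * v $ j) = 0"
      by (simp add: mult.assoc sum_distrib_left[symmetric] del: mult_eq_0_iff)
    then have "(\<Sum>i<N. (v $ i)\<^sup>2) \<le> 0"
      using coercive[where N=N and a="\<lambda>i. v $ i"] c by (simp add: mult_le_0_iff)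
    then have "(\<Sum>i<N. (v $ i)\<^sup>2) = 0" by (intro antisym sum_nonneg) auto
    then have "v $ i = 0" if "i < N" for i
      using that by (subst (asm) sum_nonneg_eq_0_iff) auto
    with v show False by (auto intro: eq_vecI)
  qed
  \<comment> \<open>Column \<open>i0\<close> of the inverse by Cramer's rule, extended by 0;
    truncations too small to contain the right-hand side get the value 0.\<close>
  define a where "a N j = (if j < N \<and> i0 < N then adj_mat (A N) $$ (j, i0) / det (A N) else 0)" for N j
  have sol: "(\<Sum>j<N. t i j * a N j) = (if i = i0 then 1 else 0)" if "i < N" "i0 < N" for N i
  proof -
    have "(\<Sum>j<N. t i j * a N j) = (\<Sum>j<N. A N $$ (i,j) * adj_mat (A N) $$ (j, i0)) / det (A N)"
      unfolding sum_divide_distrib using that by (intro sum.cong) (auto simp: a_def A_def)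
    also have "(\<Sum>j<N. A N $$ (i,j) * adj_mat (A N) $$ (j, i0)) = (A N * adj_mat (A N)) $$ (i, i0)"
      using that by (subst mat_mult_index[OF A adj_mat(1)[OF A]]) auto
    also have "\<dots> = (if i = i0 then det (A N) else 0)" unfolding adj_mat(2)[OF A] using that by simp
    finally show ?thesis using det[of N] by simp
  qed
  have bound: "(\<Sum>i<N. (a N i)\<^sup>2) \<le> 1 / c\<^sup>2" for N
  proof (cases "i0 < N")
    case True
    let ?S = "\<Sum>i<N. (a N i)\<^sup>2"
    have S0: "?S \<ge> 0" by (intro sum_nonneg) auto
    have "(\<Sum>i<N. \<Sum>j<N. s i * a N i * t i j * a N j) = (\<Sum>i<N. s i * a N i * (\<Sum>j<N. t i j * a N j))"
      by (simp add: sum_distrib_left mult.assoc)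
    also have "\<dots> = (\<Sum>i<N. if i = i0 then s i * a N i else 0)"
      using True by (intro sum.cong) (auto simp: sol)
    also have "\<dots> = s i0 * a N i0" using True by simp
    finally have "c * ?S \<le> s i0 * a N i0" using coercive[where N=N and a="a N"] by linarith
    also have "\<dots> \<le> \<bar>s i0 * a N i0\<bar>" by (rule abs_ge_self)
    also have "\<dots> \<le> \<bar>a N i0\<bar>" using s[of i0] unfolding abs_mult by (intro mult_left_le_one_le) auto
    \<comment> \<open>Coercivity bounds c times the squared norm S by the modulus of one component,
      whose square is at most S; hence c^2 S^2 \<le> S.\<close>
    finally have "(c * ?S)\<^sup>2 \<le> \<bar>a N i0\<bar>\<^sup>2" using S0 c by (intro power_mono) auto
    also have "\<dots> \<le> ?S" using True by (auto intro!: member_le_sum[where f="\<lambda>i. (a N i)\<^sup>2"])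
    finally have "c\<^sup>2 * ?S * ?S \<le> 1 * ?S" by (simp add: power2_eq_square mult_ac)
    then have "c\<^sup>2 * ?S \<le> 1 \<or> ?S = 0" using S0 unfolding mult_le_cancel_right by linarith
    then show ?thesis
    proof
      assume "c\<^sup>2 * ?S \<le> 1"
      then show ?thesis using c by (simp only: pos_le_divide_eq zero_less_power mult.commute)
    qed simp
  qed (simp add: a_def)
  \<comment> \<open>A bound on each component suffices for a diagonal subsequence along which all
    components converge.\<close>
  have "\<bar>a N j\<bar> \<le> 1 / c" for N j
  proof (cases "j < N")
    case True
    then have "(a N j)\<^sup>2 \<le> (\<Sum>i<N. (a N i)\<^sup>2)" by (auto intro!: member_le_sum[where f="\<lambda>i. (a N i)\<^sup>2"])
    also have "\<dots> \<le> (1 / c)\<^sup>2" using bound[of N] by (simp add: power_divide)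
    finally show ?thesis using c abs_le_square_iff[of "a N j" "1 / c"] by simp
  qed (use c in \<open>simp add: a_def\<close>)
  then obtain k where k: "strict_mono k" "\<And>j. \<exists>l. (\<lambda>n. a (k n) j) \<longlonglongrightarrow> l"
    by (rule_tac function_convergent_subsequence[of UNIV a "1 / c"]) auto
  then obtain l where l: "\<And>j. (\<lambda>n. a (k n) j) \<longlonglongrightarrow> l j" by metis
  have kge: "k n \<ge> n" for n using k(1) by (rule seq_suble)
  show thesis
  proof
    show "summable (\<lambda>i. (l i)\<^sup>2)"
    proof (rule bounded_imp_summable)
      fix K
      have "(\<lambda>n. \<Sum>i\<le>K. (a (k n) i)\<^sup>2) \<longlonglongrightarrow> (\<Sum>i\<le>K. (l i)\<^sup>2)" by (intro tendsto_intros l)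
      then show "(\<Sum>i\<le>K. (l i)\<^sup>2) \<le> 1 / c\<^sup>2"
      proof (rule LIMSEQ_le_const2, intro exI[of _ "Suc K"] allI impI)
        fix n assume "Suc K \<le> n"
        then have "(\<Sum>i\<le>K. (a (k n) i)\<^sup>2) \<le> (\<Sum>i<k n. (a (k n) i)\<^sup>2)"
          using kge[of n] by (intro sum_mono2) auto
        then show "(\<Sum>i\<le>K. (a (k n) i)\<^sup>2) \<le> 1 / c\<^sup>2" using bound[of "k n"] by linarith
      qed
    qed auto
    fix i
    have "(\<lambda>n. \<Sum>j\<le>i + b. t i j * a (k n) j) \<longlonglongrightarrow> (\<Sum>j\<le>i + b. t i j * l j)" by (intro tendsto_intros l)
    moreover have "(\<lambda>n. \<Sum>j\<le>i + b. t i j * a (k n) j) \<longlonglongrightarrow> (if i = i0 then 1 else 0)"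
    proof (rule tendsto_eventually)
      show "eventually (\<lambda>n. (\<Sum>j\<le>i + b. t i j * a (k n) j) = (if i = i0 then 1 else 0)) sequentially"
      unfolding eventually_sequentially
    proof (intro exI[of _ "Suc (i + b + i0)"] allI impI)
      fix n assume "Suc (i + b + i0) \<le> n"
      then have n: "i + b < k n" "i < k n" "i0 < k n" using kge[of n] by auto
      \<comment> \<open>Once the truncation contains the whole band of row i, its equation is the
        full one.\<close>
      have "(\<Sum>j\<le>i + b. t i j * a (k n) j) = (\<Sum>j<k n. t i j * a (k n) j)"
        using n band by (intro sum.mono_neutral_left) auto
      then show "(\<Sum>j\<le>i + b. t i j * a (k n) j) = (if i = i0 then 1 else 0)" using sol n by simp
    qed
    qed
    ultimately show "(\<Sum>j\<le>i + b. t i j * l j) = (if i = i0 then 1 else 0)"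
      by (rule LIMSEQ_unique)
  qed
qed

lemma sum_flatten: "(\<Sum>p<N * n. g p) = (\<Sum>t<N. \<Sum>i<n. g (t * n + i :: nat))"
proof -
  have "sum g {t * n..<t * n + n} = (\<Sum>i<n. g (t * n + i))" for t
    using sum.shift_bounds_nat_ivl[of g 0 "t * n" n] by (simp add: atLeast0LessThan add.commute)
  then show ?thesis unfolding sum.nat_group[symmetric] by simp
qed

lemma sum_triple_product:
  fixes A B C :: "_ \<Rightarrow> 'a :: comm_ring"
  shows "x * sum A X * sum B Y * sum C Z = (\<Sum>t\<in>X. \<Sum>\<kappa>\<in>Y. \<Sum>\<tau>\<in>Z. x * A t * B \<kappa> * C \<tau>)"
proof -
  have "x * sum A X * sum B Y * sum C Z = x * (sum A X * (sum B Y * sum C Z))"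
    by (simp only: mult.assoc)
  also have "\<dots> = (\<Sum>t\<in>X. \<Sum>\<kappa>\<in>Y. \<Sum>\<tau>\<in>Z. x * (A t * (B \<kappa> * C \<tau>)))"
    unfolding sum_product by (simp only: sum_distrib_left sum_distrib_right)
  finally show ?thesis by (simp only: mult.assoc)
qed

text \<open>Entry (t, \<tau>) of the Toeplitz matrix of the Laurent polynomial p(z)/z^m, namely its
  coefficient of order \<tau> - t. The case distinction protects the subtraction of natural
  numbers.\<close>

definition toep :: "nat \<Rightarrow> real poly \<Rightarrow> nat \<Rightarrow> nat \<Rightarrow> real" where
  "toep m p t \<tau> = (if t \<le> m + \<tau> then coeff p (m + \<tau> - t) else 0)"

text \<open>The symbol is the matrix of Laurent polynomials S(z)/z^m. \<open>sym\<close> expresses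
  in real coefficients that it is Hermitian on the circle, and \<open>s\<close> holds the row signs
  that make it coercive.\<close>

locale pn_symbol =
  fixes n m :: nat and S :: "nat \<Rightarrow> nat \<Rightarrow> real poly" and s :: "nat \<Rightarrow> real" and c :: real
  assumes c: "c > 0" and s: "\<And>i. \<bar>s i\<bar> \<le> 1"
    and deg: "\<And>i j. i < n \<Longrightarrow> j < n \<Longrightarrow> degree (S i j) \<le> 2 * m"
    and sym: "\<And>i j k. i < n \<Longrightarrow> j < n \<Longrightarrow> k \<le> 2 * m \<Longrightarrow> coeff (S i j) k = coeff (S j i) (2 * m - k)"
    and pos: "\<And>z v. cmod z = 1 \<Longrightarrow> c * (\<Sum>i<n. (cmod (v i))\<^sup>2)
       \<le> Re (\<Sum>i<n. \<Sum>j<n. of_real (s i) * cnj (v i) * (cpoly (S i j) z / z ^ m) * v j)"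
begin

text \<open>The Toeplitz form is the mean over the circle of the signed symbol at the trigonometric
  polynomial with coefficients \<open>u\<close>, so the pointwise bound integrates to one with the
  same constant for every N.\<close>

lemma toeplitz_coercive:
  fixes u :: "nat \<Rightarrow> nat \<Rightarrow> real"
  shows "c * (\<Sum>t<N. \<Sum>i<n. (u t i)\<^sup>2)
    \<le> (\<Sum>t<N. \<Sum>i<n. \<Sum>\<tau><N. \<Sum>j<n. s i * u t i * toep m (S i j) t \<tau> * u \<tau> j)"
proof -
  define uh where "uh \<theta> i = (\<Sum>t<N. of_real (u t i) * cis (- (real t * \<theta>)))" for \<theta> i
  define I where "I = (indicator {0..2*pi} :: real \<Rightarrow> real)"
  \<comment> \<open>Both sides of the pointwise bound expand into cosines of integer frequency,
    whose integrals select equal indices.\<close>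
  have L: "has_bochner_integral lborel (\<lambda>\<theta>. c * (\<Sum>i<n. \<Sum>t<N. \<Sum>\<tau><N. u t i * u \<tau> i * (cos ((real t - real \<tau>) * \<theta>) * I \<theta>)))
     (c * (\<Sum>i<n. \<Sum>t<N. \<Sum>\<tau><N. u t i * u \<tau> i * (if t = \<tau> then 2 * pi else 0)))"
    unfolding I_def
    by (intro has_bochner_integral_mult_right has_bochner_integral_sum integral_cos_multiple)
  have R: "has_bochner_integral lborel
      (\<lambda>\<theta>. \<Sum>i<n. \<Sum>j<n. \<Sum>t<N. \<Sum>\<kappa>\<le>2*m. \<Sum>\<tau><N. s i * u t i * coeff (S i j) \<kappa> * u \<tau> j * (cos ((real (t + \<kappa>) - real (m + \<tau>)) * \<theta>) * I \<theta>))
      (\<Sum>i<n. \<Sum>j<n. \<Sum>t<N. \<Sum>\<kappa>\<le>2*m. \<Sum>\<tau><N. s i * u t i * coeff (S i j) \<kappa> * u \<tau> j * (if t + \<kappa> = m + \<tau> then 2 * pi else 0))"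
    unfolding I_def
    by (intro has_bochner_integral_mult_right has_bochner_integral_sum integral_cos_multiple)
  have le: "c * (\<Sum>i<n. \<Sum>t<N. \<Sum>\<tau><N. u t i * u \<tau> i * (cos ((real t - real \<tau>) * \<theta>) * I \<theta>))
     \<le> (\<Sum>i<n. \<Sum>j<n. \<Sum>t<N. \<Sum>\<kappa>\<le>2*m. \<Sum>\<tau><N. s i * u t i * coeff (S i j) \<kappa> * u \<tau> j * (cos ((real (t + \<kappa>) - real (m + \<tau>)) * \<theta>) * I \<theta>))" for \<theta>
  proof -
    have l: "(cmod (uh \<theta> i))\<^sup>2 = (\<Sum>t<N. \<Sum>\<tau><N. u t i * u \<tau> i * cos ((real t - real \<tau>) * \<theta>))" for i
    proof -
      have "of_real ((cmod (uh \<theta> i))\<^sup>2) = cnj (uh \<theta> i) * uh \<theta> i" by (metis complex_norm_square mult.commute)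
      also have "\<dots> = (\<Sum>t<N. \<Sum>\<tau><N. of_real (u t i * u \<tau> i) * cis ((real t - real \<tau>) * \<theta>))"
        unfolding uh_def cnj_sum sum_product
      proof (intro sum.cong refl)
        fix t \<tau>
        have "cis (real t * \<theta>) * cis (- (real \<tau> * \<theta>)) = cis ((real t - real \<tau>) * \<theta>)"
          unfolding cis_mult by (simp add: left_diff_distrib)
        then show "cnj (of_real (u t i) * cis (- (real t * \<theta>))) * (of_real (u \<tau> i) * cis (- (real \<tau> * \<theta>)))
          = of_real (u t i * u \<tau> i) * cis ((real t - real \<tau>) * \<theta>)"
          by (simp only: complex_cnj_mult complex_cnj_complex_of_real cis_cnj minus_minus of_real_mult mult_ac)
      qed
      finally have "Re (of_real ((cmod (uh \<theta> i))\<^sup>2)) = Re (\<Sum>t<N. \<Sum>\<tau><N. of_real (u t i * u \<tau> i) * cis ((real t - real \<tau>) * \<theta>))" by simp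
      then show ?thesis by simp
    qed
    have r: "of_real (s i) * cnj (uh \<theta> i) * (cpoly (S i j) (cis \<theta>) / cis \<theta> ^ m) * uh \<theta> j
       = (\<Sum>t<N. \<Sum>\<kappa>\<le>2*m. \<Sum>\<tau><N. of_real (s i * u t i * coeff (S i j) \<kappa> * u \<tau> j) * cis ((real (t + \<kappa>) - real (m + \<tau>)) * \<theta>))"
      if "i < n" "j < n" for i j
    proof -
      have a: "cpoly (S i j) (cis \<theta>) / cis \<theta> ^ m = (\<Sum>\<kappa>\<le>2*m. of_real (coeff (S i j) \<kappa>) * cis (real \<kappa> * \<theta>) / cis (real m * \<theta>))"
        unfolding cpoly_sum_upto[OF deg[OF that]] by (simp only: sum_divide_distrib Complex.DeMoivre)
      have b: "s i * (of_real (u t i) * cis (real t * \<theta>)) * (of_real (coeff (S i j) \<kappa>) * cis (real \<kappa> * \<theta>) / cis (real m * \<theta>)) * (of_real (u \<tau> j) * cis (- (real \<tau> * \<theta>)))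
         = of_real (s i * u t i * coeff (S i j) \<kappa> * u \<tau> j) * cis ((real (t + \<kappa>) - real (m + \<tau>)) * \<theta>)" for t \<kappa> \<tau>
      proof -
        have "s i * (of_real (u t i) * cis (real t * \<theta>)) * (of_real (coeff (S i j) \<kappa>) * cis (real \<kappa> * \<theta>) / cis (real m * \<theta>)) * (of_real (u \<tau> j) * cis (- (real \<tau> * \<theta>)))
          = of_real (s i) * of_real (u t i) * of_real (coeff (S i j) \<kappa>) * of_real (u \<tau> j) * (cis (real t * \<theta>) * (cis (real \<kappa> * \<theta>) / cis (real m * \<theta>)) * cis (- (real \<tau> * \<theta>)))"
          by (simp only: times_divide_eq_right times_divide_eq_left mult_ac)
        also have "cis (real t * \<theta>) * (cis (real \<kappa> * \<theta>) / cis (real m * \<theta>)) * cis (- (real \<tau> * \<theta>)) = cis ((real (t + \<kappa>) - real (m + \<tau>)) * \<theta>)"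
          by (simp only: cis_mult cis_divide) (simp add: algebra_simps)
        finally show ?thesis by (simp only: of_real_mult)
      qed
      have d: "cnj (uh \<theta> i) = (\<Sum>t<N. of_real (u t i) * cis (real t * \<theta>))"
        unfolding uh_def by (simp add: cis_cnj)
      show ?thesis unfolding a d uh_def[of \<theta> j] sum_triple_product b by (rule refl)
    qed
    have "c * (\<Sum>i<n. (cmod (uh \<theta> i))\<^sup>2)
       \<le> Re (\<Sum>i<n. \<Sum>j<n. of_real (s i) * cnj (uh \<theta> i) * (cpoly (S i j) (cis \<theta>) / cis \<theta> ^ m) * uh \<theta> j)"
      by (rule pos) simp
    also have "\<dots> = Re (\<Sum>i<n. \<Sum>j<n. \<Sum>t<N. \<Sum>\<kappa>\<le>2*m. \<Sum>\<tau><N. of_real (s i * u t i * coeff (S i j) \<kappa> * u \<tau> j) * cis ((real (t + \<kappa>) - real (m + \<tau>)) * \<theta>))"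
      by (intro arg_cong[of _ _ Re] sum.cong refl r) auto
    also have "\<dots> = (\<Sum>i<n. \<Sum>j<n. \<Sum>t<N. \<Sum>\<kappa>\<le>2*m. \<Sum>\<tau><N. s i * u t i * coeff (S i j) \<kappa> * u \<tau> j * cos ((real (t + \<kappa>) - real (m + \<tau>)) * \<theta>))"
      by simp
    finally show ?thesis unfolding l by (simp add: I_def indicator_def)
  qed
  have "c * (\<Sum>i<n. \<Sum>t<N. \<Sum>\<tau><N. u t i * u \<tau> i * (if t = \<tau> then 2 * pi else 0))
    \<le> (\<Sum>i<n. \<Sum>j<n. \<Sum>t<N. \<Sum>\<kappa>\<le>2*m. \<Sum>\<tau><N. s i * u t i * coeff (S i j) \<kappa> * u \<tau> j * (if t + \<kappa> = m + \<tau> then 2 * pi else 0))"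
    unfolding has_bochner_integral_integral_eq[OF L, symmetric] has_bochner_integral_integral_eq[OF R, symmetric]
    by (rule integral_mono[OF integrable.intros[OF L] integrable.intros[OF R] le])
  also have "(\<Sum>i<n. \<Sum>t<N. \<Sum>\<tau><N. u t i * u \<tau> i * (if t = \<tau> then 2 * pi else 0)) = 2 * pi * (\<Sum>t<N. \<Sum>i<n. (u t i)\<^sup>2)"
    by (subst sum.swap) (simp add: if_distrib sum.delta sum_distrib_left power2_eq_square mult_ac cong: if_cong)
  also have "(\<Sum>i<n. \<Sum>j<n. \<Sum>t<N. \<Sum>\<kappa>\<le>2*m. \<Sum>\<tau><N. s i * u t i * coeff (S i j) \<kappa> * u \<tau> j * (if t + \<kappa> = m + \<tau> then 2 * pi else 0))
    = (\<Sum>i<n. \<Sum>j<n. \<Sum>t<N. \<Sum>\<tau><N. 2 * pi * (s i * u t i * toep m (S i j) t \<tau> * u \<tau> j))"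
  proof (rule sum.cong[OF refl], rule sum.cong[OF refl], rule sum.cong[OF refl])
    fix i j t assume ij: "i \<in> {..<n}" "j \<in> {..<n}"
    have "(\<Sum>\<kappa>\<le>2*m. s i * u t i * coeff (S i j) \<kappa> * u \<tau> j * (if t + \<kappa> = m + \<tau> then 2 * pi else 0))
        = 2 * pi * (s i * u t i * toep m (S i j) t \<tau> * u \<tau> j)" for \<tau>
    proof (cases "t \<le> m + \<tau>")
      case True
      have "(\<Sum>\<kappa>\<le>2*m. s i * u t i * coeff (S i j) \<kappa> * u \<tau> j * (if t + \<kappa> = m + \<tau> then 2 * pi else 0))
        = (\<Sum>\<kappa>\<le>2*m. if \<kappa> = m + \<tau> - t then s i * u t i * coeff (S i j) (m + \<tau> - t) * u \<tau> j * (2 * pi) else 0)"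
        using True by (intro sum.cong refl) auto
      also have "\<dots> = s i * u t i * coeff (S i j) (m + \<tau> - t) * u \<tau> j * (2 * pi)"
        using deg[of i j] ij by (auto simp: coeff_eq_0)
      finally show ?thesis using True by (simp add: toep_def)
    next
      case False
      then have "t + \<kappa> \<noteq> m + \<tau>" for \<kappa> by linarith
      with False show ?thesis by (simp add: toep_def)
    qed
    then show "(\<Sum>\<kappa>\<le>2*m. \<Sum>\<tau><N. s i * u t i * coeff (S i j) \<kappa> * u \<tau> j * (if t + \<kappa> = m + \<tau> then 2 * pi else 0))
       = (\<Sum>\<tau><N. 2 * pi * (s i * u t i * toep m (S i j) t \<tau> * u \<tau> j))"
      by (subst sum.swap) simp
  qed
  also have "\<dots> = 2 * pi * (\<Sum>t<N. \<Sum>i<n. \<Sum>\<tau><N. \<Sum>j<n. s i * u t i * toep m (S i j) t \<tau> * u \<tau> j)"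
  proof -
    have 1: "(\<Sum>j<n. \<Sum>t<N. \<Sum>\<tau><N. g j t \<tau>) = (\<Sum>t<N. \<Sum>\<tau><N. \<Sum>j<n. g j t \<tau>)" for g :: "nat \<Rightarrow> nat \<Rightarrow> nat \<Rightarrow> real"
      by (subst sum.swap, rule sum.cong[OF refl], rule sum.swap)
    have 2: "(\<Sum>i<n. \<Sum>j<n. \<Sum>t<N. \<Sum>\<tau><N. g i j t \<tau>) = (\<Sum>t<N. \<Sum>i<n. \<Sum>\<tau><N. \<Sum>j<n. g i j t \<tau>)" for g :: "nat \<Rightarrow> nat \<Rightarrow> nat \<Rightarrow> nat \<Rightarrow> real"
    proof -
      have "(\<Sum>i<n. \<Sum>j<n. \<Sum>t<N. \<Sum>\<tau><N. g i j t \<tau>) = (\<Sum>i<n. \<Sum>t<N. \<Sum>\<tau><N. \<Sum>j<n. g i j t \<tau>)"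
        by (rule sum.cong[OF refl], rule 1)
      then show ?thesis by (simp only: sum.swap[of _ "{..<N}" "{..<n}"])
    qed
    show ?thesis unfolding 2 by (simp add: sum_distrib_left)
  qed
  finally show ?thesis using pi_gt_zero by (simp add: mult.left_commute[of c])
qed

end

context pn_symbol
begin

text \<open>Time and channel are merged into the single index \<open>t * n + i\<close>, so that the
  scalar statement about banded matrices applies. The right-hand side is a unit impulse in channel
  \<open>i0\<close> at time 0.\<close>

lemma toeplitz_solution:
  assumes n: "n > 0" and i0: "i0 < n"
  obtains X :: "nat \<Rightarrow> real fps" where "\<And>j. j < n \<Longrightarrow> l2f (X j)"
    "\<And>i t. i < n \<Longrightarrow> (\<Sum>\<tau>\<le>t + m. \<Sum>j<n. toep m (S i j) t \<tau> * fps_nth (X j) \<tau>) = (if t = 0 \<and> i = i0 then 1 else 0)"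
proof -
  define T where "T p q = toep m (S (p mod n) (q mod n)) (p div n) (q div n)" for p q
  have dm: "(t * n + i) div n = t" "(t * n + i) mod n = i" if "i < n" for t i using that by auto
  have z: "toep m (S i j) t \<tau> = 0" if "i < n" "j < n" "t + m < \<tau>" for i j t \<tau>
    using deg[OF that(1,2)] that(3) by (auto simp: toep_def intro: coeff_eq_0)
  have coercive: "c * (\<Sum>p<N. (a p)\<^sup>2) \<le> (\<Sum>p<N. \<Sum>q<N. s (p mod n) * a p * T p q * a q)" for N and a :: "nat \<Rightarrow> real"
  proof -
    \<comment> \<open>A truncation need not end at the boundary of a block; padding with zeros to
      full blocks changes neither side of the inequality.\<close>
    define a' where "a' p = (if p < N then a p else 0)" for p
    have NN: "N \<le> N * n" using n by simp
    have "(\<Sum>p<N. (a p)\<^sup>2) = (\<Sum>p<N * n. (a' p)\<^sup>2)"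
      using NN by (intro sum.mono_neutral_cong_left) (auto simp: a'_def)
    also have "\<dots> = (\<Sum>t<N. \<Sum>i<n. (a' (t * n + i))\<^sup>2)" by (rule sum_flatten)
    finally have e: "(\<Sum>p<N. (a p)\<^sup>2) = (\<Sum>t<N. \<Sum>i<n. (a' (t * n + i))\<^sup>2)" .
    have "c * (\<Sum>p<N. (a p)\<^sup>2) \<le> (\<Sum>t<N. \<Sum>i<n. \<Sum>\<tau><N. \<Sum>j<n. s i * a' (t * n + i) * toep m (S i j) t \<tau> * a' (\<tau> * n + j))"
      unfolding e by (rule toeplitz_coercive)
    also have "\<dots> = (\<Sum>t<N. \<Sum>i<n. \<Sum>\<tau><N. \<Sum>j<n. s ((t * n + i) mod n) * a' (t * n + i) * T (t * n + i) (\<tau> * n + j) * a' (\<tau> * n + j))"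
      by (intro sum.cong refl) (simp add: T_def dm)
    also have "\<dots> = (\<Sum>p<N * n. \<Sum>q<N * n. s (p mod n) * a' p * T p q * a' q)"
      by (simp only: sum_flatten)
    also have "\<dots> = (\<Sum>p<N. \<Sum>q<N. s (p mod n) * a p * T p q * a q)"
      using NN by (intro sum.mono_neutral_cong_right) (auto simp: a'_def intro!: sum.mono_neutral_cong_right)
    finally show ?thesis .
  qed
  \<comment> \<open>The symbol couples m blocks ahead; one more block accounts for the positions
    inside the blocks.\<close>
  have band: "T p q = 0" if "p + (m + 1) * n < q" for p q
  proof -
    have "(p + (m + 1) * n) div n \<le> q div n" using that by (intro div_le_mono) simp
    moreover have "(p + (m + 1) * n) div n = (m + 1) + p div n" using n by (intro div_mult_self1) simp
    ultimately have "p div n + (m + 1) \<le> q div n" by simp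
    then show ?thesis unfolding T_def using n by (intro z) auto
  qed
  obtain a where a: "summable (\<lambda>p. (a p)\<^sup>2)"
    "\<And>p. (\<Sum>q\<le>p + (m + 1) * n. T p q * a q) = (if p = i0 then 1 else 0)"
    using banded_coercive_solution[of c "\<lambda>p. s (p mod n)" T "(m + 1) * n" i0] c s coercive band by blast
  define X where "X j = Abs_fps (\<lambda>t. a (t * n + j))" for j
  show thesis
  proof
    fix j assume j: "j < n"
    have inj: "inj (\<lambda>t. t * n + j)" using n by (auto simp: inj_def)
    have "summable ((\<lambda>p. (a p)\<^sup>2) \<circ> (\<lambda>t. t * n + j))"
    proof (rule bounded_imp_summable)
      fix K
      have "(\<Sum>t\<le>K. ((\<lambda>p. (a p)\<^sup>2) \<circ> (\<lambda>t. t * n + j)) t) = (\<Sum>p\<in>(\<lambda>t. t * n + j) ` {..K}. (a p)\<^sup>2)"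
        using inj by (subst sum.reindex) (auto intro: inj_on_subset)
      also have "\<dots> \<le> (\<Sum>p. (a p)\<^sup>2)" by (intro sum_le_suminf a) auto
      finally show "(\<Sum>t\<le>K. ((\<lambda>p. (a p)\<^sup>2) \<circ> (\<lambda>t. t * n + j)) t) \<le> (\<Sum>p. (a p)\<^sup>2)" .
    qed auto
    then show "l2f (X j)" by (simp add: l2f_def X_def o_def)
  next
    fix i t assume i: "i < n"
    have "(\<Sum>\<tau>\<le>t + m. \<Sum>j<n. toep m (S i j) t \<tau> * fps_nth (X j) \<tau>)
       = (\<Sum>\<tau><t + m + 1. \<Sum>j<n. T (t * n + i) (\<tau> * n + j) * a (\<tau> * n + j))"
      using i by (intro sum.cong) (auto simp: T_def dm X_def)
    also have "\<dots> = (\<Sum>q<(t + m + 1) * n. T (t * n + i) q * a q)" by (simp only: sum_flatten)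
    also have "\<dots> = (\<Sum>q\<le>t * n + i + (m + 1) * n. T (t * n + i) q * a q)"
    proof (rule sum.mono_neutral_left)
      \<comment> \<open>The surplus indices belong to times beyond t + m, where the symbol has no
        coefficient.\<close>
      show "\<forall>q\<in>{..t * n + i + (m + 1) * n} - {..<(t + m + 1) * n}. T (t * n + i) q * a q = 0"
      proof
        fix q assume "q \<in> {..t * n + i + (m + 1) * n} - {..<(t + m + 1) * n}"
        then have "t + m + 1 \<le> q div n" using n by (simp add: less_eq_div_iff_mult_less_eq)
        then show "T (t * n + i) q * a q = 0" unfolding T_def dm[OF i] using n i by (simp add: z)
      qed
    qed (auto simp: algebra_simps)
    also have "\<dots> = (if t * n + i = i0 then 1 else 0)" by (rule a)
    also have "\<dots> = (if t = 0 \<and> i = i0 then 1 else 0)"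
    proof -
      have "t * n + i = i0 \<longleftrightarrow> t = 0 \<and> i = i0" using i i0 by (cases t) auto
      then show ?thesis by simp
    qed
    finally show "(\<Sum>\<tau>\<le>t + m. \<Sum>j<n. toep m (S i j) t \<tau> * fps_nth (X j) \<tau>) = (if t = 0 \<and> i = i0 then 1 else 0)" .
  qed
qed

text \<open>The equations of the infinite system are the coefficients of order at least m of S^T X.
  Hence S^T X is a polynomial matrix of degree at most m whose coefficient of order m is the
  identity.\<close>

lemma toeplitz_fps:
  assumes n: "n > 0"
  obtains X :: "nat \<Rightarrow> nat \<Rightarrow> real fps" where "\<And>j k. j < n \<Longrightarrow> k < n \<Longrightarrow> l2f (X j k)"
    "\<And>i k r. i < n \<Longrightarrow> k < n \<Longrightarrow> r \<ge> m \<Longrightarrow>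
       fps_nth (\<Sum>j<n. fps_of_poly (S j i) * X j k) r = (if r = m \<and> i = k then 1 else 0)"
proof -
  define P where "P k X \<longleftrightarrow> (\<forall>j<n. l2f (X j)) \<and>
    (\<forall>i t. i < n \<longrightarrow> (\<Sum>\<tau>\<le>t + m. \<Sum>j<n. toep m (S i j) t \<tau> * fps_nth (X j) \<tau>) = (if t = 0 \<and> i = k then 1 else 0))" for k X
  have "\<exists>X. P k X" if "k < n" for k
    by (rule toeplitz_solution[OF n that], unfold P_def, blast)
  then have PX: "P k (SOME X. P k X)" if "k < n" for k using that by (intro someI_ex[of "P k"])
  define X where "X k = (SOME X. P k X)" for k
  have "P k (X k)" if "k < n" for k unfolding X_def using that by (rule PX)
  then have X: "\<And>k j. k < n \<Longrightarrow> j < n \<Longrightarrow> l2f (X k j)"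
    "\<And>k i t. k < n \<Longrightarrow> i < n \<Longrightarrow> (\<Sum>\<tau>\<le>t + m. \<Sum>j<n. toep m (S i j) t \<tau> * fps_nth (X k j) \<tau>) = (if t = 0 \<and> i = k then 1 else 0)"
    unfolding P_def by blast+
  show thesis
  proof (rule that[of "\<lambda>j k. X k j"])
    fix i k r assume ik: "i < n" "k < n" and r: "r \<ge> m"
    obtain t where t: "r = t + m" using r by (metis le_add_diff_inverse2)
    have "fps_nth (\<Sum>j<n. fps_of_poly (S j i) * X k j) r = (\<Sum>j<n. \<Sum>\<tau>\<le>t + m. coeff (S j i) (t + m - \<tau>) * fps_nth (X k j) \<tau>)"
      unfolding fps_sum_nth t by (intro sum.cong refl, subst mult.commute) (simp add: fps_mult_nth atLeast0AtMost mult.commute)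
    also have "\<dots> = (\<Sum>j<n. \<Sum>\<tau>\<le>t + m. toep m (S i j) t \<tau> * fps_nth (X k j) \<tau>)"
    proof (intro sum.cong refl arg_cong2[of _ _ _ _ times])
      fix j \<tau> assume j: "j \<in> {..<n}" and \<tau>: "\<tau> \<in> {..t + m}"
      show "coeff (S j i) (t + m - \<tau>) = toep m (S i j) t \<tau>"
      proof (cases "t \<le> m + \<tau>")
        case True
        \<comment> \<open>The system was solved for S while the product contains its transpose; the
          coefficient symmetry reconciles them.\<close>
        then have "coeff (S j i) (t + m - \<tau>) = coeff (S i j) (2 * m - (t + m - \<tau>))"
          using ik j \<tau> by (intro sym) auto
        also have "2 * m - (t + m - \<tau>) = m + \<tau> - t" using True \<tau> by auto
        finally show ?thesis using True by (simp add: toep_def)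
      next
        case False
        then show ?thesis using deg[of j i] ik j by (auto simp: toep_def intro!: coeff_eq_0)
      qed
    qed
    also have "\<dots> = (\<Sum>\<tau>\<le>t + m. \<Sum>j<n. toep m (S i j) t \<tau> * fps_nth (X k j) \<tau>)" by (rule sum.swap)
    also have "\<dots> = (if r = m \<and> i = k then 1 else 0)" using X(2)[of k i t] ik t by simp
    finally show "fps_nth (\<Sum>j<n. fps_of_poly (S j i) * X k j) r = (if r = m \<and> i = k then 1 else 0)" .
  qed (use X in auto)
qed

end

section \<open>Factorization from correlations of the Toeplitz solutions\<close>

section \<open>J-spectral factorization\<close>

text \<open>Extension by zero to all integer times, so that correlation sums can be shifted
  freely.\<close>

definition xt :: "real fps \<Rightarrow> int \<Rightarrow> real" where
  "xt A t = (if t \<ge> 0 then fps_nth A (nat t) else 0)"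

lemma xt_poly_mult:
  assumes "degree p \<le> d"
  shows "xt (fps_of_poly p * A) t = (\<Sum>\<kappa>\<le>d. coeff p \<kappa> * xt A (t - int \<kappa>))"
proof (cases "t \<ge> 0")
  case True
  define k where "k = nat t"
  have t: "t = int k" using True by (simp add: k_def)
  have "xt (fps_of_poly p * A) t = (\<Sum>\<kappa>\<le>k. coeff p \<kappa> * fps_nth A (k - \<kappa>))"
    by (simp add: t xt_def fps_mult_nth atLeast0AtMost)
  also have "\<dots> = (\<Sum>\<kappa>\<le>k. coeff p \<kappa> * xt A (t - int \<kappa>))"
    by (intro sum.cong refl) (simp add: t xt_def nat_diff_distrib)
  also have "\<dots> = (\<Sum>\<kappa>\<le>max k d. coeff p \<kappa> * xt A (t - int \<kappa>))"
    by (intro sum.mono_neutral_left) (auto simp: t xt_def)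
  also have "\<dots> = (\<Sum>\<kappa>\<le>d. coeff p \<kappa> * xt A (t - int \<kappa>))"
    using assms by (intro sum.mono_neutral_right) (auto simp: coeff_eq_0)
  finally show ?thesis .
qed (simp add: xt_def)

lemma xt_sum: "xt (\<Sum>i\<in>I. A i) t = (\<Sum>i\<in>I. xt (A i) t)"
  by (simp add: xt_def fps_sum_nth)

lemma xt_l2:
  assumes "l2f A" shows "(\<lambda>t. (xt A (t + d))\<^sup>2) summable_on UNIV"
proof -
  have "(\<lambda>k. (fps_nth A k)\<^sup>2) summable_on UNIV"
    using assms by (intro norm_summable_imp_summable_on) (simp add: l2f_def)
  then have "((\<lambda>t. (xt A t)\<^sup>2) \<circ> int) summable_on UNIV" by (simp add: o_def xt_def)
  then have "(\<lambda>t. (xt A t)\<^sup>2) summable_on range int"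
    by (subst summable_on_reindex) auto
  then have "(\<lambda>t. (xt A t)\<^sup>2) summable_on UNIV"
  proof (rule summable_on_cong_neutral[THEN iffD1, rotated -1])
    fix t assume "t \<in> UNIV - range int"
    then have "t < 0" by (metis DiffD2 nonneg_int_cases not_le rangeI)
    then show "(xt A t)\<^sup>2 = 0" by (simp add: xt_def)
  qed auto
  then show ?thesis
    by (subst summable_on_reindex_bij_betw[where g="\<lambda>t. t + d" and A=UNIV and B=UNIV and f="\<lambda>t. (xt A t)\<^sup>2"])
      (auto intro!: bij_betwI[where g="\<lambda>t. t - d"])
qed

lemma xt_mult_summable:
  assumes "l2f A" "l2f B" shows "(\<lambda>t. xt A (t + a) * xt B (t + b)) summable_on UNIV"
proof -
  have "(\<lambda>t. (xt A (t + a))\<^sup>2 + (xt B (t + b))\<^sup>2) summable_on UNIV"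
    by (intro summable_on_add xt_l2 assms)
  then have s: "(\<lambda>t. norm ((xt A (t + a))\<^sup>2 + (xt B (t + b))\<^sup>2)) summable_on UNIV"
    by (rule summable_on_iff_abs_summable_on_real[THEN iffD1])
  have le: "norm (xt A (t + a) * xt B (t + b)) \<le> norm ((xt A (t + a))\<^sup>2 + (xt B (t + b))\<^sup>2)" for t
  proof -
    have "2 * (\<bar>xt A (t + a)\<bar> * \<bar>xt B (t + b)\<bar>) \<le> (xt A (t + a))\<^sup>2 + (xt B (t + b))\<^sup>2"
      using sum_squares_bound[of "\<bar>xt A (t + a)\<bar>" "\<bar>xt B (t + b)\<bar>"] by simp
    moreover have "0 \<le> \<bar>xt A (t + a)\<bar> * \<bar>xt B (t + b)\<bar>" by simp
    ultimately show ?thesis unfolding real_norm_def abs_mult by linarith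
  qed
  have "(\<lambda>t. norm (xt A (t + a) * xt B (t + b))) summable_on UNIV"
    by (rule Infinite_Sum.abs_summable_on_comparison_test[OF s le])
  then show ?thesis by (rule abs_summable_summable)
qed

lemma xt_mult_shift:
  "(\<Sum>\<^sub>\<infinity>t. xt A (t + a) * xt B (t + b)) = (\<Sum>\<^sub>\<infinity>t. xt A t * xt B (t + (b - a)))"
proof -
  have "bij_betw (\<lambda>t::int. t + a) UNIV UNIV" by (auto intro!: bij_betwI[where g="\<lambda>t. t - a"])
  from infsum_reindex_bij_betw[OF this, of "\<lambda>t. xt A t * xt B (t + (b - a))"] show ?thesis
    by (simp add: algebra_simps)
qed

lemma infsum_finite_sum:
  fixes f :: "'b \<Rightarrow> 'a \<Rightarrow> real"
  assumes "\<And>i. i \<in> I \<Longrightarrow> f i summable_on A"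
  shows "(\<lambda>t. \<Sum>i\<in>I. f i t) summable_on A \<and> (\<Sum>\<^sub>\<infinity>t\<in>A. \<Sum>i\<in>I. f i t) = (\<Sum>i\<in>I. \<Sum>\<^sub>\<infinity>t\<in>A. f i t)"
  using assms by (induction I rule: infinite_finite_induct) (auto simp: infsum_add summable_on_add)

lemma infsum_triple_sum:
  fixes f :: "'b \<Rightarrow> 'c \<Rightarrow> 'd \<Rightarrow> 'a \<Rightarrow> real"
  assumes "\<And>i j k. i \<in> I \<Longrightarrow> j \<in> J \<Longrightarrow> k \<in> K \<Longrightarrow> f i j k summable_on A"
  shows "(\<Sum>\<^sub>\<infinity>t\<in>A. \<Sum>i\<in>I. \<Sum>j\<in>J. \<Sum>k\<in>K. f i j k t) = (\<Sum>i\<in>I. \<Sum>j\<in>J. \<Sum>k\<in>K. \<Sum>\<^sub>\<infinity>t\<in>A. f i j k t)"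
proof -
  have 1: "(\<lambda>t. \<Sum>k\<in>K. f i j k t) summable_on A" "(\<Sum>\<^sub>\<infinity>t\<in>A. \<Sum>k\<in>K. f i j k t) = (\<Sum>k\<in>K. \<Sum>\<^sub>\<infinity>t\<in>A. f i j k t)"
    if "i \<in> I" "j \<in> J" for i j
    using infsum_finite_sum[of K "f i j" A] assms that by auto
  have 2: "(\<lambda>t. \<Sum>j\<in>J. \<Sum>k\<in>K. f i j k t) summable_on A"
    "(\<Sum>\<^sub>\<infinity>t\<in>A. \<Sum>j\<in>J. \<Sum>k\<in>K. f i j k t) = (\<Sum>j\<in>J. \<Sum>\<^sub>\<infinity>t\<in>A. \<Sum>k\<in>K. f i j k t)" if "i \<in> I" for i
    using infsum_finite_sum[of J "\<lambda>j t. \<Sum>k\<in>K. f i j k t" A] 1 that by auto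
  have "(\<Sum>\<^sub>\<infinity>t\<in>A. \<Sum>i\<in>I. \<Sum>j\<in>J. \<Sum>k\<in>K. f i j k t) = (\<Sum>i\<in>I. \<Sum>\<^sub>\<infinity>t\<in>A. \<Sum>j\<in>J. \<Sum>k\<in>K. f i j k t)"
    using infsum_finite_sum[of I "\<lambda>i t. \<Sum>j\<in>J. \<Sum>k\<in>K. f i j k t" A] 2 by auto
  also have "\<dots> = (\<Sum>i\<in>I. \<Sum>j\<in>J. \<Sum>k\<in>K. \<Sum>\<^sub>\<infinity>t\<in>A. f i j k t)"
    by (intro sum.cong refl) (simp add: 1 2)
  finally show ?thesis .
qed

context pn_symbol
begin

text \<open>The left-hand side correlates column \<open>i0\<close> of S^T X with column
  \<open>i1\<close> of X. The symmetry of S lets S move to the other column; there S^T X, advanced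
  by m + \<sigma>, meets the one-sided X in its coefficient of order m, the identity, or not at all.
  So nothing remains unless \<sigma> = 0.\<close>

lemma correlation_symmetry:
  assumes X: "\<And>j k. j < n \<Longrightarrow> k < n \<Longrightarrow> l2f (X j k)"
    and Y: "\<And>i k r. i < n \<Longrightarrow> k < n \<Longrightarrow> r \<ge> m \<Longrightarrow>
       fps_nth (\<Sum>j<n. fps_of_poly (S j i) * X j k) r = (if r = m \<and> i = k then 1 else 0)"
    and i01: "i0 < n" "i1 < n"
  shows "(\<Sum>i<n. \<Sum>r\<le>m. fps_nth (\<Sum>j<n. fps_of_poly (S j i) * X j i0) (m - r) * xt (X i i1) (int \<sigma> - int r))
     = (if \<sigma> = 0 then fps_nth (X i1 i0) 0 else 0)"
proof -
  define Yf where "Yf i k = (\<Sum>j<n. fps_of_poly (S j i) * X j k)" for i k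
  define D where "D A B d = (\<Sum>\<^sub>\<infinity>t. xt A t * xt B (t + d))" for A B d
  have Yx: "xt (Yf i k) t = (\<Sum>j<n. \<Sum>\<kappa>\<le>2*m. coeff (S j i) \<kappa> * xt (X j k) (t - int \<kappa>))" if "i < n" for i k t
    unfolding Yf_def xt_sum using that deg by (intro sum.cong refl xt_poly_mult) auto
  have Y0: "xt (Yf i k) t = (if t = int m \<and> i = k then 1 else 0)" if "i < n" "k < n" "t \<ge> int m" for i k t
  proof -
    have "t \<ge> 0" using that(3) by linarith
    then obtain k' where "t = int k'" using nonneg_int_cases by blast
    then show ?thesis using Y[OF that(1,2), of k'] that(3) by (auto simp: xt_def Yf_def)
  qed
  have s1: "(\<lambda>t. coeff (S j i) \<kappa> * (xt (X j i0) (t + (int m - int \<kappa>)) * xt (X i i1) (t + int \<sigma>))) summable_on UNIV"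
    if "i < n" "j < n" for i j \<kappa>
    using that i01 by (intro summable_on_cmult_right xt_mult_summable X)
  have "(\<Sum>\<^sub>\<infinity>t. \<Sum>i<n. xt (Yf i i0) (t + int m) * xt (X i i1) (t + int \<sigma>))
     = (\<Sum>\<^sub>\<infinity>t. \<Sum>i<n. \<Sum>j<n. \<Sum>\<kappa>\<le>2*m. coeff (S j i) \<kappa> * (xt (X j i0) (t + (int m - int \<kappa>)) * xt (X i i1) (t + int \<sigma>)))"
  proof (intro infsum_cong sum.cong refl)
    fix t i assume "i \<in> {..<n}"
    then show "xt (Yf i i0) (t + int m) * xt (X i i1) (t + int \<sigma>)
      = (\<Sum>j<n. \<Sum>\<kappa>\<le>2*m. coeff (S j i) \<kappa> * (xt (X j i0) (t + (int m - int \<kappa>)) * xt (X i i1) (t + int \<sigma>)))"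
      by (subst Yx) (simp_all only: lessThan_iff sum_distrib_right mult.assoc add_diff_eq)
  qed
  also have "\<dots> = (\<Sum>i<n. \<Sum>j<n. \<Sum>\<kappa>\<le>2*m. \<Sum>\<^sub>\<infinity>t. coeff (S j i) \<kappa> * (xt (X j i0) (t + (int m - int \<kappa>)) * xt (X i i1) (t + int \<sigma>)))"
    using s1 by (intro infsum_triple_sum) auto
  also have "\<dots> = (\<Sum>i<n. \<Sum>j<n. \<Sum>\<kappa>\<le>2*m. coeff (S j i) \<kappa> * D (X j i0) (X i i1) (int \<sigma> + int \<kappa> - int m))"
    by (simp only: infsum_cmult_right' xt_mult_shift D_def diff_diff_eq2)
  finally have L: "(\<Sum>\<^sub>\<infinity>t. \<Sum>i<n. xt (Yf i i0) (t + int m) * xt (X i i1) (t + int \<sigma>))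
    = (\<Sum>i<n. \<Sum>j<n. \<Sum>\<kappa>\<le>2*m. coeff (S j i) \<kappa> * D (X j i0) (X i i1) (int \<sigma> + int \<kappa> - int m))" .
  have s2: "(\<lambda>t. coeff (S j i) \<kappa> * (xt (X i i0) (t + 0) * xt (X j i1) (t + (int \<sigma> + int m - int \<kappa>)))) summable_on UNIV"
    if "i < n" "j < n" for i j \<kappa>
    using that i01 by (intro summable_on_cmult_right xt_mult_summable X)
  have "(\<Sum>\<^sub>\<infinity>t. \<Sum>i<n. xt (X i i0) t * xt (Yf i i1) (t + int \<sigma> + int m))
     = (\<Sum>\<^sub>\<infinity>t. \<Sum>i<n. \<Sum>j<n. \<Sum>\<kappa>\<le>2*m. coeff (S j i) \<kappa> * (xt (X i i0) t * xt (X j i1) (t + (int \<sigma> + int m - int \<kappa>))))"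
  proof (intro infsum_cong sum.cong refl)
    fix t i assume "i \<in> {..<n}"
    then show "xt (X i i0) t * xt (Yf i i1) (t + int \<sigma> + int m)
      = (\<Sum>j<n. \<Sum>\<kappa>\<le>2*m. coeff (S j i) \<kappa> * (xt (X i i0) t * xt (X j i1) (t + (int \<sigma> + int m - int \<kappa>))))"
      by (subst Yx) (simp_all only: lessThan_iff sum_distrib_left mult.left_commute[of "xt _ _" "coeff _ _"] add_diff_eq add.assoc)
  qed
  also have "\<dots> = (\<Sum>i<n. \<Sum>j<n. \<Sum>\<kappa>\<le>2*m. \<Sum>\<^sub>\<infinity>t. coeff (S j i) \<kappa> * (xt (X i i0) t * xt (X j i1) (t + (int \<sigma> + int m - int \<kappa>))))"
    using s2[unfolded add_0_right] by (intro infsum_triple_sum) auto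
  also have "\<dots> = (\<Sum>i<n. \<Sum>j<n. \<Sum>\<kappa>\<le>2*m. coeff (S j i) \<kappa> * D (X i i0) (X j i1) (int \<sigma> + int m - int \<kappa>))"
    by (simp add: infsum_cmult_right' D_def)
  also have "\<dots> = (\<Sum>i<n. \<Sum>j<n. \<Sum>\<kappa>\<le>2*m. coeff (S i j) \<kappa> * D (X j i0) (X i i1) (int \<sigma> + int m - int \<kappa>))"
    by (rule sum.swap)
  also have "\<dots> = (\<Sum>i<n. \<Sum>j<n. \<Sum>\<kappa>\<le>2*m. coeff (S j i) \<kappa> * D (X j i0) (X i i1) (int \<sigma> + int \<kappa> - int m))"
  proof (rule sum.cong[OF refl], rule sum.cong[OF refl])
    fix i j assume ij: "i \<in> {..<n}" "j \<in> {..<n}"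
    show "(\<Sum>\<kappa>\<le>2*m. coeff (S i j) \<kappa> * D (X j i0) (X i i1) (int \<sigma> + int m - int \<kappa>))
      = (\<Sum>\<kappa>\<le>2*m. coeff (S j i) \<kappa> * D (X j i0) (X i i1) (int \<sigma> + int \<kappa> - int m))"
      \<comment> \<open>Reversing the order of the coefficients is where the symmetry of S
        enters.\<close>
      using ij by (subst sum.nat_diff_reindex[of _ "Suc (2*m)", unfolded lessThan_Suc_atMost, symmetric])
        (auto intro!: sum.cong arg_cong2[of _ _ _ _ times] simp: sym[of i j] of_nat_diff algebra_simps)
  qed
  finally have R: "(\<Sum>\<^sub>\<infinity>t. \<Sum>i<n. xt (X i i0) t * xt (Yf i i1) (t + int \<sigma> + int m))
    = (\<Sum>i<n. \<Sum>j<n. \<Sum>\<kappa>\<le>2*m. coeff (S j i) \<kappa> * D (X j i0) (X i i1) (int \<sigma> + int \<kappa> - int m))" .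
  have "(\<Sum>i<n. \<Sum>r\<le>m. fps_nth (Yf i i0) (m - r) * xt (X i i1) (int \<sigma> - int r))
     = (\<Sum>r\<le>m. \<Sum>i<n. fps_nth (Yf i i0) (m - r) * xt (X i i1) (int \<sigma> - int r))" by (rule sum.swap)
  also have "\<dots> = (\<Sum>t\<in>(\<lambda>r. - int r) ` {..m}. \<Sum>i<n. xt (Yf i i0) (t + int m) * xt (X i i1) (t + int \<sigma>))"
    by (subst sum.reindex) (auto simp: inj_on_def xt_def nat_diff_distrib intro!: sum.cong)
  also have "\<dots> = (\<Sum>\<^sub>\<infinity>t\<in>(\<lambda>r. - int r) ` {..m}. \<Sum>i<n. xt (Yf i i0) (t + int m) * xt (X i i1) (t + int \<sigma>))"
    by (subst infsum_finite) auto
  \<comment> \<open>Only the shifts from -m to 0 contribute, since S^T X vanishes outside the orders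
    0 to m.\<close>
  also have "\<dots> = (\<Sum>\<^sub>\<infinity>t. \<Sum>i<n. xt (Yf i i0) (t + int m) * xt (X i i1) (t + int \<sigma>))"
  proof (rule infsum_cong_neutral)
    fix t assume "t \<in> UNIV - (\<lambda>r. - int r) ` {..m}"
    then have *: "t \<notin> (\<lambda>r. - int r) ` {..m}" by simp
    have "t > 0 \<or> t < - int m"
    proof (rule ccontr)
      assume "\<not> (t > 0 \<or> t < - int m)"
      then have "t = - int (nat (- t))" "nat (- t) \<le> m" by auto
      with * show False by blast
    qed
    then show "(\<Sum>i<n. xt (Yf i i0) (t + int m) * xt (X i i1) (t + int \<sigma>)) = 0"
    proof
      assume "t > 0"
      then show ?thesis using i01 by (intro sum.neutral ballI) (simp add: Y0)
    qed (simp add: xt_def)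
  qed auto
  also have "\<dots> = (\<Sum>\<^sub>\<infinity>t. \<Sum>i<n. xt (X i i0) t * xt (Yf i i1) (t + int \<sigma> + int m))" unfolding L R ..
  also have "\<dots> = (\<Sum>\<^sub>\<infinity>t\<in>{0}. \<Sum>i<n. xt (X i i0) t * xt (Yf i i1) (t + int \<sigma> + int m))"
  proof (rule infsum_cong_neutral)
    fix t :: int assume t: "t \<in> UNIV - {0}"
    show "(\<Sum>i<n. xt (X i i0) t * xt (Yf i i1) (t + int \<sigma> + int m)) = 0"
    proof (cases "t < 0")
      case False
      then show ?thesis using t i01 by (intro sum.neutral ballI) (simp add: Y0)
    qed (simp add: xt_def)
  qed auto
  also have "\<dots> = (\<Sum>i<n. xt (X i i0) 0 * xt (Yf i i1) (int \<sigma> + int m))" by simp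
  also have "\<dots> = (\<Sum>i<n. if i = i1 then (if \<sigma> = 0 then xt (X i i0) 0 else 0) else 0)"
    using i01 by (intro sum.cong refl) (simp add: Y0)
  also have "\<dots> = (if \<sigma> = 0 then fps_nth (X i1 i0) 0 else 0)" using i01 by (simp add: xt_def)
  finally show ?thesis unfolding Yf_def .
qed

end

section \<open>Matrices over power series, complex evaluation and reflection\<close>

text \<open>The adjugate and cancellation of the determinant replace division, so that the statement
  covers matrices of power series.\<close>

lemma mat_left_right_inverse_idom:
  fixes A B :: "'a :: idom mat"
  assumes A: "A \<in> carrier_mat n n" and B: "B \<in> carrier_mat n n" and AB: "A * B = 1\<^sub>m n"
  shows "B * A = 1\<^sub>m n"
proof -
  note adj = adj_mat[OF A]
  have "det A * det B = 1" using det_mult[OF A B] AB by simp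
  then have d: "det A \<noteq> 0" by auto
  have "adj_mat A = adj_mat A * (A * B)" using AB adj(1) by simp
  also have "\<dots> = (det A \<cdot>\<^sub>m 1\<^sub>m n) * B" using A B adj by (simp add: assoc_mult_mat[symmetric])
  also have "\<dots> = det A \<cdot>\<^sub>m B" using B by (simp add: mult_smult_assoc_mat[of _ n n _ n])
  finally have "det A \<cdot>\<^sub>m 1\<^sub>m n = (det A \<cdot>\<^sub>m B) * A" using adj(3) by simp
  then have e: "det A \<cdot>\<^sub>m 1\<^sub>m n = det A \<cdot>\<^sub>m (B * A)" using A B by (simp add: mult_smult_assoc_mat[of _ n n _ n])
  show ?thesis
  proof (rule eq_matI)
    fix i j assume ij: "i < dim_row (1\<^sub>m n :: 'a mat)" "j < dim_col (1\<^sub>m n :: 'a mat)"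
    have "det A * (1\<^sub>m n :: 'a mat) $$ (i,j) = det A * (B * A) $$ (i,j)"
      using arg_cong[OF e, of "\<lambda>M. M $$ (i,j)"] ij A B by simp
    then show "(B * A) $$ (i,j) = (1\<^sub>m n :: 'a mat) $$ (i,j)" using d by simp
  qed (use A B in auto)
qed

lemma det_nonzero_inverse:
  fixes A :: "'a :: field mat"
  assumes A: "A \<in> carrier_mat n n" and d: "det A \<noteq> 0"
  obtains B where "B \<in> carrier_mat n n" "A * B = 1\<^sub>m n" "B * A = 1\<^sub>m n"
proof
  note adj = adj_mat[OF A]
  let ?B = "inverse (det A) \<cdot>\<^sub>m adj_mat A"
  show B: "?B \<in> carrier_mat n n" using adj by simp
  show *: "A * ?B = 1\<^sub>m n" using A adj d by (intro eq_matI) (auto simp: mult_smult_distrib[OF A adj(1)])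
  show "?B * A = 1\<^sub>m n" by (rule mat_left_right_inverse_idom[OF A B *])
qed

definition cf :: "real fps \<Rightarrow> complex fps" where
  "cf A = Abs_fps (\<lambda>n. of_real (fps_nth A n))"

lemma cf_simps [simp]:
  "cf (A * B) = cf A * cf B" "cf (A + B) = cf A + cf B" "cf 0 = 0" "cf 1 = 1"
  "cf (fps_const c) = fps_const (of_real c)" "cf (fps_of_poly p) = fps_of_poly (map_poly of_real p)"
  by (intro fps_ext; simp add: cf_def fps_mult_nth coeff_map_poly)+

lemma cf_sum: "cf (\<Sum>i\<in>I. A i) = (\<Sum>i\<in>I. cf (A i))"
  by (induction I rule: infinite_finite_induct) auto

text \<open>Square-summable coefficients are bounded, and a geometric series dominates.\<close>

lemma cf_conv_radius:
  assumes "l2f A" "cmod x < 1" shows "ereal (cmod x) < fps_conv_radius (cf A)"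
proof -
  obtain r where r: "cmod x < r" "r < 1" using assms(2) dense by blast
  have r0: "0 \<le> r" using r(1) norm_ge_zero[of x] by linarith
  have "(\<lambda>k. (fps_nth A k)\<^sup>2) \<longlonglongrightarrow> 0" using assms(1) unfolding l2f_def by (rule summable_LIMSEQ_zero)
  then have "Bseq (\<lambda>k. (fps_nth A k)\<^sup>2)" by (intro convergent_imp_Bseq convergentI)
  then obtain K where K: "K > 0" "\<And>k. norm ((fps_nth A k)\<^sup>2) \<le> K" by (auto elim: BseqE)
  have b: "\<bar>fps_nth A k\<bar> \<le> sqrt K" for k using K(2)[of k] by (intro real_le_rsqrt) simp
  have "summable (\<lambda>k. sqrt K * r ^ k)" using r r0 by (intro summable_mult summable_geometric) auto
  moreover have "norm (fps_nth (cf A) k * of_real r ^ k) \<le> sqrt K * r ^ k" for k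
    using b[of k] r0 by (simp add: cf_def norm_mult norm_power mult_right_mono)
  ultimately have "summable (\<lambda>k. fps_nth (cf A) k * of_real r ^ k)"
    by (rule summable_comparison_test'[where N=0])
  then have "norm (of_real r :: complex) \<le> fps_conv_radius (cf A)"
    unfolding fps_conv_radius_def by (rule conv_radius_geI)
  then have "ereal r \<le> fps_conv_radius (cf A)" using r0 by simp
  then show ?thesis using r(1) by (meson ereal_less_ereal_Ex less_le_trans less_ereal.simps(1))
qed

lemma fps_nth_0_hom: "comm_ring_hom (\<lambda>f :: 'a :: comm_ring_1 fps. fps_nth f 0)"
  by unfold_locales simp_all

lemma degree_sum_monom_le: "degree (\<Sum>r\<le>m. monom (f r) r) \<le> (m :: nat)"
  by (intro degree_sum_le) (auto intro: order_trans[OF degree_monom_le])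

lemma coeff_sum_monom: "coeff (\<Sum>r\<le>m. monom (f r) r) k = (if k \<le> (m :: nat) then f k else 0)"
  by (simp add: coeff_sum coeff_monom)

lemma cpoly_reflect:
  assumes "degree p \<le> N" "\<And>k. k \<le> N \<Longrightarrow> coeff p k = coeff q (N - k)" "degree q \<le> N" "x \<noteq> 0"
  shows "cpoly p x = x ^ N * cpoly q (1 / x)"
proof -
  have "x ^ N * cpoly q (1 / x) = (\<Sum>k\<le>N. of_real (coeff q k) * (x ^ N * (1 / x) ^ k))"
    unfolding cpoly_sum_upto[OF assms(3)] by (simp add: sum_distrib_left mult_ac)
  also have "\<dots> = (\<Sum>k\<le>N. of_real (coeff q k) * x ^ (N - k))"
    using assms(4) by (intro sum.cong refl) (simp add: power_diff power_divide)
  also have "\<dots> = (\<Sum>k\<le>N. of_real (coeff q (N - k)) * x ^ (N - (N - k)))"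
    by (rule sum.nat_diff_reindex[of _ "Suc N", unfolded lessThan_Suc_atMost, simplified, symmetric])
  also have "\<dots> = cpoly p x" unfolding cpoly_sum_upto[OF assms(1)]
    by (intro sum.cong refl) (simp add: assms(2))
  finally show ?thesis by simp
qed

context pn_symbol
begin

lemma sym_eval: "i < n \<Longrightarrow> j < n \<Longrightarrow> x \<noteq> 0 \<Longrightarrow> cpoly (S i j) x = x ^ (2 * m) * cpoly (S j i) (1 / x)"
  by (intro cpoly_reflect deg sym)

text \<open>With Y = S^T X and F its reversal, F X is a constant matrix X0. So X has the inverse M
  F, where M is the inverse of X0, and S^T = Y M F; expressing Y by its reversal turns this into the
  factorization.\<close>

theorem J_factorization:
  obtains F :: "nat \<Rightarrow> nat \<Rightarrow> real poly" and M :: "nat \<Rightarrow> nat \<Rightarrow> real"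
  where "\<And>i j. i < n \<Longrightarrow> j < n \<Longrightarrow> M i j = M j i"
    "\<And>x. cmod x \<le> 1 \<Longrightarrow> det (pmat n F x) \<noteq> 0"
    "\<And>i j x. i < n \<Longrightarrow> j < n \<Longrightarrow> x \<noteq> 0 \<Longrightarrow>
       cpoly (S i j) x / x ^ m = (\<Sum>k<n. \<Sum>l<n. cpoly (F k i) x * of_real (M k l) * cpoly (F l j) (1 / x))"
proof (cases "n = 0")
  case True
  then show thesis by (intro that[of "\<lambda>_ _. 0" "\<lambda>_ _. 0"]) (auto simp: pmat_def)
next
  case False
  then have n: "n > 0" by simp
  \<comment> \<open>Saved here because the name \<open>c\<close> is reused for the carrier facts
    below.\<close>
  note cpos = c
  obtain X where X: "\<And>j k. j < n \<Longrightarrow> k < n \<Longrightarrow> l2f (X j k)"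
    and Y: "\<And>i k r. i < n \<Longrightarrow> k < n \<Longrightarrow> r \<ge> m \<Longrightarrow>
       fps_nth (\<Sum>j<n. fps_of_poly (S j i) * X j k) r = (if r = m \<and> i = k then 1 else 0)"
    using toeplitz_fps[OF n] by blast
  define Yf where "Yf i k = (\<Sum>j<n. fps_of_poly (S j i) * X j k)" for i k
  define Yp where "Yp i k = (\<Sum>r\<le>m. monom (fps_nth (Yf i k) r) r)" for i k
  \<comment> \<open>The reversal of \<open>Yp\<close>. Its constant coefficient is the coefficient
    of order m of Y, the identity.\<close>
  define F where "F k i = (\<Sum>r\<le>m. monom (fps_nth (Yf i k) (m - r)) r)" for k i
  have Yp: "fps_of_poly (Yp i k) = Yf i k" if "i < n" "k < n" for i k
    using Y[OF that] by (intro fps_ext) (auto simp: Yp_def coeff_sum_monom Yf_def)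
  have Yx: "cpoly (Yp i k) x = x ^ m * cpoly (F k i) (1 / x)" if "x \<noteq> 0" for i k x
    using that by (intro cpoly_reflect) (auto simp: Yp_def F_def degree_sum_monom_le coeff_sum_monom)
  have FX: "(\<Sum>i<n. fps_of_poly (F k i) * X i l) = fps_const (fps_nth (X l k) 0)" if "k < n" "l < n" for k l
  proof (rule fps_ext)
    fix \<sigma>
    have "fps_nth (\<Sum>i<n. fps_of_poly (F k i) * X i l) \<sigma> = (\<Sum>i<n. xt (fps_of_poly (F k i) * X i l) (int \<sigma>))"
      by (simp add: fps_sum_nth xt_def)
    also have "\<dots> = (\<Sum>i<n. \<Sum>r\<le>m. fps_nth (Yf i k) (m - r) * xt (X i l) (int \<sigma> - int r))"
    proof (intro sum.cong refl)
      fix i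
      have "xt (fps_of_poly (F k i) * X i l) (int \<sigma>) = (\<Sum>r\<le>m. coeff (F k i) r * xt (X i l) (int \<sigma> - int r))"
        by (rule xt_poly_mult) (simp add: F_def degree_sum_monom_le)
      then show "xt (fps_of_poly (F k i) * X i l) (int \<sigma>) = (\<Sum>r\<le>m. fps_nth (Yf i k) (m - r) * xt (X i l) (int \<sigma> - int r))"
        by (simp add: F_def coeff_sum_monom)
    qed
    also have "\<dots> = (if \<sigma> = 0 then fps_nth (X l k) 0 else 0)"
      unfolding Yf_def by (rule correlation_symmetry[OF X Y that])
    finally show "fps_nth (\<Sum>i<n. fps_of_poly (F k i) * X i l) \<sigma> = fps_nth (fps_const (fps_nth (X l k) 0)) \<sigma>" by simp
  qed
  have F0: "coeff (F k i) 0 = (if k = i then 1 else 0)" if "k < n" "i < n" for k i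
    using Y[OF that(2,1), of m] by (simp add: F_def coeff_sum_monom Yf_def)
  \<comment> \<open>As F(0) is the identity, the constant term of F X is that of X; the correlation
    identity gives its transpose, so X(0) is symmetric.\<close>
  have sym0: "fps_nth (X l k) 0 = fps_nth (X k l) 0" if "k < n" "l < n" for k l
  proof -
    have "fps_nth (X l k) 0 = fps_nth (\<Sum>i<n. fps_of_poly (F k i) * X i l) 0" unfolding FX[OF that] by simp
    also have "\<dots> = (\<Sum>i<n. if k = i then fps_nth (X i l) 0 else 0)"
      unfolding fps_sum_nth using that by (intro sum.cong refl) (simp add: F0)
    finally show ?thesis using that by simp
  qed
  define Fm where "Fm = mat n n (\<lambda>(i,j). fps_of_poly (F i j))"
  define Xm where "Xm = mat n n (\<lambda>(i,j). X i j)"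
  define Sm where "Sm = mat n n (\<lambda>(i,j). fps_of_poly (S j i))"
  define Ym where "Ym = mat n n (\<lambda>(i,j). Yf i j)"
  define X0 where "X0 = mat n n (\<lambda>(k,l). fps_nth (X l k) 0)"
  have c: "Fm \<in> carrier_mat n n" "Xm \<in> carrier_mat n n" "Sm \<in> carrier_mat n n" "Ym \<in> carrier_mat n n" "X0 \<in> carrier_mat n n"
    by (auto simp: Fm_def Xm_def Sm_def Ym_def X0_def)
  have FXm: "Fm * Xm = map_mat fps_const X0"
  proof (rule eq_matI)
    fix i j assume "i < dim_row (map_mat fps_const X0)" "j < dim_col (map_mat fps_const X0)"
    then have ij: "i < n" "j < n" using c by auto
    show "(Fm * Xm) $$ (i, j) = map_mat fps_const X0 $$ (i, j)"
      using FX[OF ij] ij by (subst mat_mult_index[OF c(1,2) ij]) (simp add: Fm_def Xm_def X0_def)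
  qed (use c in auto)
  have SXm: "Sm * Xm = Ym"
  proof (rule eq_matI)
    fix i j assume "i < dim_row Ym" "j < dim_col Ym"
    then have ij: "i < n" "j < n" using c by auto
    show "(Sm * Xm) $$ (i, j) = Ym $$ (i, j)"
      using ij by (subst mat_mult_index[OF c(3,2) ij]) (simp add: Sm_def Xm_def Ym_def Yf_def)
  qed (use c in auto)
  interpret nth0: comm_ring_hom "\<lambda>f :: real fps. fps_nth f 0" by (rule fps_nth_0_hom)
  have "map_mat (\<lambda>f. fps_nth f 0) Fm = 1\<^sub>m n" by (intro eq_matI) (auto simp: Fm_def F0)
  then have "fps_nth (det Fm) 0 = 1" using nth0.hom_det[of Fm] by simp
  then have dF: "det Fm \<noteq> 0" by auto
  interpret const: comm_ring_hom "fps_const :: real \<Rightarrow> real fps"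
    by unfold_locales simp_all
  \<comment> \<open>A kernel vector of X0 is annihilated by F X, hence by X because det F is a
    nonzero power series, and hence by Y = S^T X. But the coefficient of order m of Y is the
    identity.\<close>
  have dX0: "det X0 \<noteq> 0"
  proof
    assume "det X0 = 0"
    then obtain v where v: "v \<in> carrier_vec n" "v \<noteq> 0\<^sub>v n" "X0 *\<^sub>v v = 0\<^sub>v n"
      using det_0_iff_vec_prod_zero_field[OF c(5)] by auto
    define w where "w = map_vec fps_const v"
    have w: "w \<in> carrier_vec n" using v by (simp add: w_def)
    have "Fm *\<^sub>v (Xm *\<^sub>v w) = map_mat fps_const X0 *\<^sub>v w"
      using FXm c w by (simp add: assoc_mult_mat_vec[symmetric])
    also have "\<dots> = map_vec fps_const (X0 *\<^sub>v v)"
      unfolding w_def using c v by (intro const.mult_mat_vec_hom[symmetric]) auto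
    also have "\<dots> = 0\<^sub>v n" unfolding v(3) by (intro eq_vecI) auto
    finally have "Fm *\<^sub>v (Xm *\<^sub>v w) = 0\<^sub>v n" .
    moreover have "Xm *\<^sub>v w \<in> carrier_vec n" using c w by simp
    ultimately have "Xm *\<^sub>v w = 0\<^sub>v n" using dF det_0_iff_vec_prod_zero[OF c(1)] by blast
    then have "Sm *\<^sub>v (Xm *\<^sub>v w) = 0\<^sub>v n" using c by (intro eq_vecI) auto
    then have Y0: "Ym *\<^sub>v w = 0\<^sub>v n" using SXm c w by (simp add: assoc_mult_mat_vec[symmetric])
    have "v $ i = 0" if i: "i < n" for i
    proof -
      have "0 = fps_nth ((Ym *\<^sub>v w) $ i) m" unfolding Y0 using i by simp
      also have "(Ym *\<^sub>v w) $ i = (\<Sum>j<n. Yf i j * fps_const (v $ j))"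
        using i v c by (auto simp: scalar_prod_def atLeast0LessThan Ym_def w_def intro!: sum.cong)
      also have "fps_nth \<dots> m = (\<Sum>j<n. if i = j then v $ j else 0)"
        unfolding fps_sum_nth using i Y by (intro sum.cong refl) (simp add: Yf_def)
      finally show ?thesis using i by simp
    qed
    with v show False by (auto intro: eq_vecI)
  qed
  obtain M where M: "M \<in> carrier_mat n n" "X0 * M = 1\<^sub>m n" "M * X0 = 1\<^sub>m n"
    using det_nonzero_inverse[OF c(5) dX0] by blast
  have X0t: "transpose_mat X0 = X0" using sym0 by (intro eq_matI) (auto simp: X0_def)
  have Mt: "transpose_mat M = M"
  proof -
    have "transpose_mat M * X0 = 1\<^sub>m n"
      using transpose_mult[OF c(5) M(1)] M(2) X0t by simp
    then have "transpose_mat M * (X0 * M) = M"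
      using M(1) c(5) by (simp add: assoc_mult_mat[symmetric])
    then show ?thesis using M by simp
  qed
  define H where "H = map_mat fps_const M * Fm"
  have H: "H \<in> carrier_mat n n" using M c by (simp add: H_def)
  have "H * Xm = map_mat fps_const M * (Fm * Xm)" unfolding H_def using M c by simp
  also have "\<dots> = map_mat fps_const (M * X0)" unfolding FXm using M c by (subst const.mat_hom_mult) auto
  also have "\<dots> = 1\<^sub>m n" unfolding M(3) by (intro eq_matI) auto
  \<comment> \<open>The computation gives H X = 1; the reverse product is what cancels X on the
    right of S^T X = Y.\<close>
  finally have "Xm * H = 1\<^sub>m n" by (rule mat_left_right_inverse_idom[OF H c(2)])
  then have "Sm = Sm * (Xm * H)" using c by simp
  also have "\<dots> = Ym * H" using c H SXm by (simp add: assoc_mult_mat[symmetric])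
  finally have SH: "Sm = Ym * H" .
  have Spoly: "S j i = (\<Sum>k<n. \<Sum>l<n. Yp i k * [:M $$ (k,l):] * F l j)" if ij: "i < n" "j < n" for i j
  proof -
    have "fps_of_poly (S j i) = Sm $$ (i,j)" using ij by (simp add: Sm_def)
    also have "\<dots> = (\<Sum>k<n. Yf i k * (\<Sum>l<n. fps_const (M $$ (k,l)) * fps_of_poly (F l j)))"
    proof -
      have "H $$ (k,j) = (\<Sum>l<n. fps_const (M $$ (k,l)) * fps_of_poly (F l j))" if "k < n" for k
        unfolding H_def using that ij M(1) by (subst mat_mult_index[OF _ c(1) that ij(2)]) (auto simp: Fm_def)
      then show ?thesis unfolding SH using ij by (subst mat_mult_index[OF c(4) H ij]) (simp add: Ym_def)
    qed
    also have "\<dots> = fps_of_poly (\<Sum>k<n. \<Sum>l<n. Yp i k * [:M $$ (k,l):] * F l j)"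
      using ij by (simp add: fps_of_poly_sum fps_of_poly_mult Yp sum_distrib_left mult.assoc fps_of_poly_const del: mult_pCons_left mult_pCons_right)
    finally show ?thesis by (simp add: fps_of_poly_eq_iff)
  qed
  have Seval: "cpoly (S j i) x = x ^ m * (\<Sum>k<n. \<Sum>l<n. cpoly (F k i) (1 / x) * of_real (M $$ (k,l)) * cpoly (F l j) x)"
    if "i < n" "j < n" "x \<noteq> 0" for i j x
    unfolding Spoly[OF that(1,2)] by (simp add: Yx[OF that(3)] sum_distrib_left mult_ac del: mult_pCons_left mult_pCons_right)
  \<comment> \<open>Inside the disc X converges and F(x) X(x) = X0 is invertible. On the circle X
    need not converge; there the factorization would make a kernel vector of F one of the symbol,
    which positivity excludes.\<close>
  have nonsing: "det (pmat n F x) \<noteq> 0" if x: "cmod x \<le> 1" for x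
  proof (cases "cmod x < 1")
    case True
    define Xe where "Xe = mat n n (\<lambda>(i,j). eval_fps (cf (X i j)) x)"
    have Xe: "Xe \<in> carrier_mat n n" and Fx: "pmat n F x \<in> carrier_mat n n" by (auto simp: Xe_def pmat_def)
    have "pmat n F x * Xe = map_mat of_real X0"
    proof (rule eq_matI)
      fix i j assume "i < dim_row (map_mat complex_of_real X0)" "j < dim_col (map_mat complex_of_real X0)"
      then have ij: "i < n" "j < n" using c by auto
      have r: "ereal (cmod x) < fps_conv_radius (cf (X k j))" if "k < n" for k
        using ij that True by (intro cf_conv_radius X)
      have e: "eval_fps (\<Sum>k\<in>I. fps_of_poly (map_poly of_real (F i k)) * cf (X k j)) x = (\<Sum>k\<in>I. cpoly (F i k) x * eval_fps (cf (X k j)) x)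
         \<and> ereal (cmod x) < fps_conv_radius (\<Sum>k\<in>I. fps_of_poly (map_poly of_real (F i k)) * cf (X k j))"
        if "I \<subseteq> {..<n}" for I
      proof -
        have "finite I" using that finite_subset by blast
        then show ?thesis using that
        proof (induction I rule: finite_induct)
          case (insert k I)
          let ?t = "fps_of_poly (map_poly of_real (F i k)) * cf (X k j)"
          have k: "ereal (cmod x) < fps_conv_radius (cf (X k j))" using insert by (intro r) auto
          have 1: "ereal (cmod x) < fps_conv_radius ?t"
            by (rule less_le_trans[OF _ fps_conv_radius_mult]) (use k in simp)
          have 2: "eval_fps ?t x = cpoly (F i k) x * eval_fps (cf (X k j)) x"
            using k by (subst eval_fps_mult) (simp_all add: cpoly_def)
          show ?case using insert 1 2
            by (auto simp: eval_fps_add intro: less_le_trans[OF _ fps_conv_radius_add])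
        qed simp
      qed
      have "(pmat n F x * Xe) $$ (i, j) = (\<Sum>k<n. cpoly (F i k) x * eval_fps (cf (X k j)) x)"
        using ij by (subst mat_mult_index[OF Fx Xe ij]) (simp add: pmat_def Xe_def)
      also have "\<dots> = eval_fps (cf (\<Sum>k<n. fps_of_poly (F i k) * X k j)) x" using e[of "{..<n}"] by (simp add: cf_sum)
      also have "\<dots> = of_real (fps_nth (X j i) 0)" unfolding FX[OF ij] by simp
      finally show "(pmat n F x * Xe) $$ (i, j) = map_mat of_real X0 $$ (i, j)" using ij by (simp add: X0_def)
    qed (auto simp: pmat_def Xe_def X0_def)
    then have "det (pmat n F x) * det Xe = of_real (det X0)"
      using det_mult[OF Fx Xe] by (simp add: of_real_hom.hom_det)
    then show ?thesis using dX0 by auto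
  next
    case False
    then have x1: "cmod x = 1" using x by simp
    then have x0: "x \<noteq> 0" by auto
    show ?thesis
    proof
      assume "det (pmat n F x) = 0"
      moreover have Fx: "pmat n F x \<in> carrier_mat n n" by (simp add: pmat_def)
      ultimately obtain v where v: "v \<in> carrier_vec n" "v \<noteq> 0\<^sub>v n" "pmat n F x *\<^sub>v v = 0\<^sub>v n"
        using det_0_iff_vec_prod_zero_field[OF Fx] by auto
      have Fv: "(\<Sum>j<n. cpoly (F l j) x * v $ j) = 0" if "l < n" for l
        using arg_cong[OF v(3), of "\<lambda>u :: complex vec. u $ l"] that v(1)
        by (auto simp: pmat_def scalar_prod_def atLeast0LessThan)
      have Sv: "(\<Sum>j<n. cpoly (S i j) (1 / x) * v $ j) = 0" if i: "i < n" for i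
      proof -
        have "x ^ (2 * m) * (\<Sum>j<n. cpoly (S i j) (1 / x) * v $ j) = (\<Sum>j<n. cpoly (S j i) x * v $ j)"
          using i x0 by (simp add: sum_distrib_left sym_eval[of _ i] mult.assoc)
        also have "\<dots> = (\<Sum>j<n. \<Sum>k<n. \<Sum>l<n. x ^ m * cpoly (F k i) (1 / x) * of_real (M $$ (k,l)) * (cpoly (F l j) x * v $ j))"
          using i x0 by (intro sum.cong refl) (simp add: Seval sum_distrib_left sum_distrib_right mult_ac)
        also have "\<dots> = (\<Sum>k<n. \<Sum>l<n. \<Sum>j<n. x ^ m * cpoly (F k i) (1 / x) * of_real (M $$ (k,l)) * (cpoly (F l j) x * v $ j))"
          by (subst sum.swap, rule sum.cong[OF refl], rule sum.swap)
        also have "\<dots> = 0" by (simp add: sum_distrib_left[symmetric] Fv)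
        finally show ?thesis using x0 by simp
      qed
      have "c * (\<Sum>i<n. (cmod (v $ i))\<^sup>2) \<le> Re (\<Sum>i<n. \<Sum>j<n. of_real (s i) * cnj (v $ i) * (cpoly (S i j) (1 / x) / (1 / x) ^ m) * v $ j)"
        by (rule pos) (use x1 in \<open>simp add: norm_divide\<close>)
      also have "(\<Sum>i<n. \<Sum>j<n. of_real (s i) * cnj (v $ i) * (cpoly (S i j) (1 / x) / (1 / x) ^ m) * v $ j)
         = (\<Sum>i<n. (of_real (s i) * cnj (v $ i) / (1 / x) ^ m) * (\<Sum>j<n. cpoly (S i j) (1 / x) * v $ j))"
        by (simp add: sum_distrib_left mult_ac)
      also have "\<dots> = 0" by (intro sum.neutral ballI) (use Sv in simp)
      finally have "(\<Sum>i<n. (cmod (v $ i))\<^sup>2) \<le> 0" using cpos by (simp add: mult_le_0_iff)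
      then have "(\<Sum>i<n. (cmod (v $ i))\<^sup>2) = 0" by (intro antisym sum_nonneg) auto
      then have "v $ i = 0" if "i < n" for i using that by (subst (asm) sum_nonneg_eq_0_iff) auto
      with v show False by (auto intro: eq_vecI)
    qed
  qed
  show thesis
  proof (rule that[of "\<lambda>k l. M $$ (k,l)" F])
    show "M $$ (i,j) = M $$ (j,i)" if "i < n" "j < n" for i j
      using arg_cong[OF Mt, of "\<lambda>A. A $$ (i,j)"] that M(1) by simp
    fix i j and x :: complex assume ij: "i < n" "j < n" and x: "x \<noteq> 0"
    have "cpoly (S i j) x = x ^ (2 * m) * cpoly (S j i) (1 / x)" using ij x by (rule sym_eval)
    also have "\<dots> = x ^ (2 * m) * (1 / x) ^ m * (\<Sum>k<n. \<Sum>l<n. cpoly (F k i) x * of_real (M $$ (k,l)) * cpoly (F l j) (1 / x))"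
      using x by (subst Seval[OF ij]) auto
    also have "x ^ (2 * m) * (1 / x) ^ m = x ^ m" using x by (simp add: power_divide mult_2 power_add)
    finally show "cpoly (S i j) x / x ^ m = (\<Sum>k<n. \<Sum>l<n. cpoly (F k i) x * of_real (M $$ (k,l)) * cpoly (F l j) (1 / x))"
      using x by simp
  qed (rule nonsing)
qed

end

section \<open>Rational functions through fractions that need not be reduced\<close>

section \<open>Evaluation of rational functions\<close>

lemma rf_den_nonzero [simp]: "rf_den r \<noteq> 0"
  by (simp add: rf_den_def)

lemma rf_eq: "r = to_fract (rf_num r) / to_fract (rf_den r)"
  unfolding rf_num_def rf_den_def by (metis Fract_conv_to_fract Fract_quot_of_fract)

lemma rf_cross:
  assumes "r = to_fract p / to_fract q" "q \<noteq> 0" shows "rf_num r * q = rf_den r * p"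
proof -
  have "to_fract (rf_num r) / to_fract (rf_den r) = to_fract p / to_fract q"
    using rf_eq[of r] assms(1) by simp
  then have "to_fract (rf_num r * q) = to_fract (rf_den r * p)"
    using assms(2) by (simp add: field_simps)
  then show ?thesis by (simp only: to_fract_eq_iff)
qed

lemma rf_den_dvd:
  assumes "r = to_fract p / to_fract q" "q \<noteq> 0" shows "rf_den r dvd q"
proof -
  have "rf_den r dvd rf_num r * q" unfolding rf_cross[OF assms] by simp
  moreover have "coprime (rf_num r) (rf_den r)"
    unfolding rf_num_def rf_den_def by (rule coprime_quot_of_fract)
  ultimately show ?thesis by (simp add: coprime_commute coprime_dvd_mult_right_iff)
qed

lemma rf_pole_cpoly: "rf_pole r z \<longleftrightarrow> cpoly (rf_den r) z = 0"
  by (simp add: rf_pole_def cpoly_def)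

lemma rf_eval_cpoly: "rf_eval r z = cpoly (rf_num r) z / cpoly (rf_den r) z"
  by (simp add: rf_eval_def cpoly_def)

text \<open>Values may be computed from any fraction whose denominator does not vanish at z, because
  the reduced denominator divides it.\<close>

lemma rf_fraction:
  assumes r: "r = to_fract p / to_fract q" and q: "cpoly q z \<noteq> 0"
  shows "\<not> rf_pole r z" "rf_eval r z = cpoly p z / cpoly q z"
proof -
  have q0: "q \<noteq> 0" using q by auto
  obtain k where "q = rf_den r * k" using rf_den_dvd[OF r q0] by (elim dvdE)
  then have "cpoly q z = cpoly (rf_den r) z * cpoly k z" by simp
  with q have d: "cpoly (rf_den r) z \<noteq> 0" by auto
  then show "\<not> rf_pole r z" by (simp add: rf_pole_cpoly)
  have "cpoly (rf_num r * q) z = cpoly (rf_den r * p) z" unfolding rf_cross[OF r q0] ..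
  then show "rf_eval r z = cpoly p z / cpoly q z" using d q by (simp add: rf_eval_cpoly field_simps)
qed

lemma rf_add:
  assumes "\<not> rf_pole a z" "\<not> rf_pole b z"
  shows "\<not> rf_pole (a + b) z" "rf_eval (a + b) z = rf_eval a z + rf_eval b z"
proof -
  have e: "a + b = to_fract (rf_num a * rf_den b + rf_num b * rf_den a) / to_fract (rf_den a * rf_den b)"
    by (subst rf_eq[of a], subst rf_eq[of b]) (simp add: field_simps)
  have q: "cpoly (rf_den a * rf_den b) z \<noteq> 0" using assms by (simp add: rf_pole_cpoly)
  show "\<not> rf_pole (a + b) z" by (rule rf_fraction[OF e q])
  show "rf_eval (a + b) z = rf_eval a z + rf_eval b z"
    using rf_fraction(2)[OF e q] q by (simp add: rf_eval_cpoly add_frac_eq)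
qed

lemma rf_mult:
  assumes "\<not> rf_pole a z" "\<not> rf_pole b z"
  shows "\<not> rf_pole (a * b) z" "rf_eval (a * b) z = rf_eval a z * rf_eval b z"
proof -
  have e: "a * b = to_fract (rf_num a * rf_num b) / to_fract (rf_den a * rf_den b)"
    by (subst rf_eq[of a], subst rf_eq[of b]) simp
  have q: "cpoly (rf_den a * rf_den b) z \<noteq> 0" using assms by (simp add: rf_pole_cpoly)
  show "\<not> rf_pole (a * b) z" by (rule rf_fraction[OF e q])
  show "rf_eval (a * b) z = rf_eval a z * rf_eval b z"
    using rf_fraction(2)[OF e q] by (simp add: rf_eval_cpoly)
qed

lemma rf_const [simp]: "\<not> rf_pole (rf_const c) z" "rf_eval (rf_const c) z = of_real c"
  using rf_fraction[of "rf_const c" "[:c:]" 1 z] by (simp_all add: rf_const_def)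

lemma rf_sum:
  assumes "\<And>i. i \<in> I \<Longrightarrow> \<not> rf_pole (f i) z"
  shows "\<not> rf_pole (sum f I) z \<and> rf_eval (sum f I) z = (\<Sum>i\<in>I. rf_eval (f i) z)"
  using assms
proof (induction I rule: infinite_finite_induct)
  case (insert x F)
  then show ?case using rf_add[of "f x" z "sum f F"] by simp
qed (use rf_const[of 0 z] in \<open>simp_all add: rf_const_def\<close>)

text \<open>The identity theorem for rational functions; it reduces equality of transfer matrices to
  values on the unit circle.\<close>

lemma rf_eqI:
  assumes "infinite {z. \<not> rf_pole a z \<and> \<not> rf_pole b z \<and> rf_eval a z = rf_eval b z}"
  shows "a = b"
proof -
  have "{z. \<not> rf_pole a z \<and> \<not> rf_pole b z \<and> rf_eval a z = rf_eval b z}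
    \<subseteq> {z. cpoly (rf_num a * rf_den b) z = cpoly (rf_num b * rf_den a) z}"
    by (auto simp: rf_pole_cpoly rf_eval_cpoly field_simps)
  then have "infinite {z. cpoly (rf_num a * rf_den b) z = cpoly (rf_num b * rf_den a) z}"
    using assms infinite_super by blast
  then have "rf_num a * rf_den b = rf_num b * rf_den a" by (rule cpoly_eqI)
  then have "to_fract (rf_num a) * to_fract (rf_den b) = to_fract (rf_num b) * to_fract (rf_den a)"
    by (simp only: to_fract_mult[symmetric])
  then show ?thesis by (subst rf_eq[of a], subst rf_eq[of b]) (simp add: field_simps)
qed

lemma infinite_unit_circle: "infinite {z :: complex. cmod z = 1}"
proof -
  have "sphere (0::complex) 1 = {z. cmod z = 1}" by (auto simp: sphere_def)
  moreover have "infinite (sphere (0::complex) 1)"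
  proof
    assume "finite (sphere (0::complex) 1)"
    moreover have "inj_on cis {0..1}"
      by (rule inj_onI) (use cos_inj_pi pi_gt3 in \<open>auto simp: complex_eq_iff\<close>)
    moreover have "cis ` {0..1} \<subseteq> sphere (0::complex) 1" by auto
    ultimately have "finite {0..1::real}" by (meson finite_imageD finite_subset)
    then show False using infinite_Icc[of "0::real" 1] by simp
  qed
  ultimately show ?thesis by simp
qed

lemma to_fract_pcompose:
  "poly (map_poly rf_const p) (to_fract u) = to_fract (pcompose p u)"
proof (induction p)
  case (pCons a p)
  have "map_poly rf_const (pCons a p) = pCons (rf_const a) (map_poly rf_const p)"
    by (rule poly_eqI) (simp add: coeff_map_poly coeff_pCons rf_const_def split: nat.split)
  then show ?case using pCons.IH by (simp add: pcompose_pCons rf_const_def[symmetric])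
qed simp

definition scl :: "real \<Rightarrow> real poly \<Rightarrow> real poly" where "scl \<rho> p = pcompose p [:0, \<rho>:]"

lemma cpoly_scl: "cpoly (scl \<rho> p) z = cpoly p (of_real \<rho> * z)"
  by (induction p) (simp_all add: scl_def pcompose_pCons mult_ac)

lemma scl_eq_0_iff [simp]: "\<rho> \<noteq> 0 \<Longrightarrow> scl \<rho> p = 0 \<longleftrightarrow> p = 0"
  unfolding scl_def by (subst pcompose_eq_0_iff) auto

lemma scl_simps: "scl \<rho> (p * q) = scl \<rho> p * scl \<rho> q"
  by (simp add: scl_def pcompose_mult)

lemma scl_scl: "\<rho> \<noteq> 0 \<Longrightarrow> scl (1 / \<rho>) (scl \<rho> p) = p"
  unfolding scl_def pcompose_assoc[symmetric] by (simp add: pcompose_pCons)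

lemma degree_scl: "\<rho> \<noteq> 0 \<Longrightarrow> degree (scl \<rho> p) = degree p"
  by (simp add: scl_def degree_pcompose)

lemma coeff_scl: "coeff (scl \<rho> p) k = coeff p k * \<rho> ^ k"
proof (induction p arbitrary: k)
  case (pCons a p)
  then show ?case by (cases k) (auto simp: scl_def pcompose_pCons coeff_pCons)
qed (simp add: scl_def)

lemma rf_compose_scale:
  assumes r: "r = to_fract p / to_fract q" "q \<noteq> 0" and \<rho>: "\<rho> \<noteq> 0"
  shows "rf_compose r (rf_const \<rho> * rf_z) = to_fract (scl \<rho> p) / to_fract (scl \<rho> q)"
proof -
  have u: "rf_const \<rho> * rf_z = to_fract [:0, \<rho>:]"
    by (simp add: rf_const_def rf_z_def to_fract_mult[symmetric] del: to_fract_mult)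
  have e: "rf_compose r (rf_const \<rho> * rf_z) = to_fract (scl \<rho> (rf_num r)) / to_fract (scl \<rho> (rf_den r))"
    unfolding rf_compose_def u to_fract_pcompose scl_def ..
  have "scl \<rho> (rf_num r) * scl \<rho> q = scl \<rho> (rf_den r) * scl \<rho> p"
    using rf_cross[OF r] by (simp add: scl_simps[symmetric])
  then have "to_fract (scl \<rho> (rf_num r)) * to_fract (scl \<rho> q) = to_fract (scl \<rho> (rf_den r)) * to_fract (scl \<rho> p)"
    by (simp only: to_fract_mult[symmetric])
  then show ?thesis unfolding e using \<rho> r(2) by (simp add: field_simps)
qed

lemma rf_scale_eval:
  assumes "\<not> rf_pole r (of_real \<rho> * z)" "\<rho> \<noteq> 0"
  shows "\<not> rf_pole (rf_compose r (rf_const \<rho> * rf_z)) z"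
    "rf_eval (rf_compose r (rf_const \<rho> * rf_z)) z = rf_eval r (of_real \<rho> * z)"
proof -
  note e = rf_compose_scale[OF rf_eq rf_den_nonzero assms(2), of r]
  have q: "cpoly (scl \<rho> (rf_den r)) z \<noteq> 0" using assms(1) by (simp add: cpoly_scl rf_pole_cpoly)
  show "\<not> rf_pole (rf_compose r (rf_const \<rho> * rf_z)) z" by (rule rf_fraction[OF e q])
  show "rf_eval (rf_compose r (rf_const \<rho> * rf_z)) z = rf_eval r (of_real \<rho> * z)"
    unfolding rf_fraction(2)[OF e q] by (simp add: cpoly_scl rf_eval_cpoly)
qed

text \<open>Scaling by 1/\<rho> undoes scaling by \<rho>, so \<open>rf_scale_eval\<close> can be
  read backwards. This excludes poles of the unscaled multiplier on the circle of radius
  \<rho>.\<close>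

lemma rf_scale_pole:
  assumes "\<not> rf_pole (rf_compose r (rf_const \<rho> * rf_z)) z" "\<rho> \<noteq> 0"
  shows "\<not> rf_pole r (of_real \<rho> * z)"
proof -
  let ?s = "rf_compose r (rf_const \<rho> * rf_z)"
  have "rf_compose ?s (rf_const (1 / \<rho>) * rf_z)
     = to_fract (scl (1 / \<rho>) (scl \<rho> (rf_num r))) / to_fract (scl (1 / \<rho>) (scl \<rho> (rf_den r)))"
    by (rule rf_compose_scale[OF rf_compose_scale[OF rf_eq rf_den_nonzero assms(2)]]) (use assms(2) in auto)
  also have "\<dots> = r" using assms(2) rf_eq[of r] by (simp add: scl_scl)
  finally have "rf_compose ?s (rf_const (1 / \<rho>) * rf_z) = r" .
  then show ?thesis using rf_scale_eval(1)[of ?s "1 / \<rho>" "of_real \<rho> * z"] assms by simp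
qed

section \<open>Reversal of polynomials and the substitution of 1/z\<close>

text \<open>The reversal z^K p(1/z). K is a parameter rather than the degree, so that numerator and
  denominator are reversed with the same power.\<close>

definition rv :: "nat \<Rightarrow> real poly \<Rightarrow> real poly" where
  "rv K p = (\<Sum>r\<le>K. monom (coeff p (K - r)) r)"

lemma coeff_rv: "coeff (rv K p) k = (if k \<le> K then coeff p (K - k) else 0)"
  by (simp add: rv_def coeff_sum_monom)

lemma degree_rv: "degree (rv K p) \<le> K"
  by (simp add: rv_def degree_sum_monom_le)

lemma cpoly_rv: "degree p \<le> K \<Longrightarrow> z \<noteq> 0 \<Longrightarrow> cpoly (rv K p) z = z ^ K * cpoly p (1 / z)"
  by (intro cpoly_reflect degree_rv) (auto simp: coeff_rv)

lemma rv_eq_0_iff: "degree p \<le> K \<Longrightarrow> rv K p = 0 \<longleftrightarrow> p = 0"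
proof
  assume d: "degree p \<le> K" and r: "rv K p = 0"
  have "coeff p k = coeff (rv K p) (K - k)" if "k \<le> K" for k using that by (simp add: coeff_rv)
  then have "coeff p k = 0" for k using r d by (cases "k \<le> K") (auto simp: coeff_eq_0)
  then show "p = 0" by (simp add: poly_eqI)
qed (simp add: rv_def)

lemma to_fract_rv:
  assumes "degree p \<le> K"
  shows "poly (map_poly rf_const p) (inverse rf_z) * rf_z ^ K = to_fract (rv K p)"
proof -
  have z: "rf_z \<noteq> 0" by (simp add: rf_z_def)
  have m: "map_poly rf_const p = (\<Sum>k\<le>K. monom (rf_const (coeff p k)) k)"
    by (rule poly_eqI) (use assms in \<open>auto simp: coeff_sum coeff_monom coeff_map_poly rf_const_def coeff_eq_0\<close>)
  have zk: "rf_z ^ k = to_fract (monom 1 k)" for k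
    by (induction k) (simp_all add: rf_z_def monom_Suc to_fract_mult[symmetric] monom_0 pCons_one del: to_fract_mult)
  have "poly (map_poly rf_const p) (inverse rf_z) * rf_z ^ K = (\<Sum>k\<le>K. rf_const (coeff p k) * (inverse rf_z ^ k * rf_z ^ K))"
    unfolding m by (simp add: poly_sum poly_monom sum_distrib_right mult.assoc)
  also have "\<dots> = (\<Sum>k\<le>K. rf_const (coeff p k) * rf_z ^ (K - k))"
    using z by (intro sum.cong refl) (simp add: power_diff power_inverse field_simps)
  also have "\<dots> = to_fract (\<Sum>k\<le>K. monom (coeff p k) (K - k))"
    by (simp add: zk rf_const_def to_fract_mult[symmetric] smult_monom del: to_fract_mult)
  also have "(\<Sum>k\<le>K. monom (coeff p k) (K - k)) = (\<Sum>k\<le>K. monom (coeff p (K - k)) (K - (K - k)))"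
    by (rule sum.nat_diff_reindex[of _ "Suc K", unfolded lessThan_Suc_atMost, simplified, symmetric])
  also have "\<dots> = rv K p" unfolding rv_def by (intro sum.cong) auto
  finally show ?thesis .
qed

text \<open>A common power of z turns the substitution of 1/z into reversal, first for the reduced
  fraction; the cross-multiplied identity, checked at nonzero points, extends this to any
  fraction.\<close>

lemma rf_compose_inverse:
  assumes r: "r = to_fract p / to_fract q" "q \<noteq> 0" and d: "degree p \<le> K" "degree q \<le> K"
  shows "rf_compose r (inverse rf_z) = to_fract (rv K p) / to_fract (rv K q)"
proof -
  define N where "N = max (degree (rf_num r)) (degree (rf_den r))"
  have z: "rf_z \<noteq> 0" by (simp add: rf_z_def)
  have "rf_compose r (inverse rf_z) = (poly (map_poly rf_const (rf_num r)) (inverse rf_z) * rf_z ^ N) / (poly (map_poly rf_const (rf_den r)) (inverse rf_z) * rf_z ^ N)"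
    unfolding rf_compose_def using z by simp
  also have "\<dots> = to_fract (rv N (rf_num r)) / to_fract (rv N (rf_den r))"
    by (simp add: to_fract_rv N_def)
  also have "\<dots> = to_fract (rv K p) / to_fract (rv K q)"
  proof -
    have "rv N (rf_num r) * rv K q = rv N (rf_den r) * rv K p"
    proof (rule cpoly_eqI, rule infinite_super)
      show "infinite (- {0::complex})" by (simp add: infinite_UNIV_char_0)
      show "- {0} \<subseteq> {x. cpoly (rv N (rf_num r) * rv K q) x = cpoly (rv N (rf_den r) * rv K p) x}"
      proof
        fix x :: complex assume "x \<in> - {0}"
        then have x: "x \<noteq> 0" by simp
        have "cpoly (rf_num r * q) (1 / x) = cpoly (rf_den r * p) (1 / x)" using rf_cross[OF r] by simp
        then show "x \<in> {x. cpoly (rv N (rf_num r) * rv K q) x = cpoly (rv N (rf_den r) * rv K p) x}"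
          using x d by (simp add: cpoly_rv N_def)
      qed
    qed
    then have "to_fract (rv N (rf_num r)) * to_fract (rv K q) = to_fract (rv N (rf_den r)) * to_fract (rv K p)"
      by (simp only: to_fract_mult[symmetric])
    then show ?thesis using r(2) d by (simp add: field_simps rv_eq_0_iff N_def)
  qed
  finally show ?thesis .
qed

lemma rf_inverse_eval:
  assumes "\<not> rf_pole r (1 / z)" "z \<noteq> 0"
  shows "\<not> rf_pole (rf_compose r (inverse rf_z)) z"
    "rf_eval (rf_compose r (inverse rf_z)) z = rf_eval r (1 / z)"
proof -
  define N where "N = max (degree (rf_num r)) (degree (rf_den r))"
  have d: "degree (rf_num r) \<le> N" "degree (rf_den r) \<le> N" by (auto simp: N_def)
  note e = rf_compose_inverse[OF rf_eq rf_den_nonzero d]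
  have q: "cpoly (rv N (rf_den r)) z \<noteq> 0" using assms d by (simp add: cpoly_rv rf_pole_cpoly)
  show "\<not> rf_pole (rf_compose r (inverse rf_z)) z" by (rule rf_fraction[OF e q])
  show "rf_eval (rf_compose r (inverse rf_z)) z = rf_eval r (1 / z)"
    unfolding rf_fraction(2)[OF e q] using assms(2) d by (simp add: cpoly_rv rf_eval_cpoly)
qed

lemma rf_proper_fraction:
  assumes r: "r = to_fract p / to_fract q" "q \<noteq> 0" and d: "degree p \<le> degree q"
  shows "rf_proper r"
proof (cases "p = 0")
  case True
  then have "rf_num r = 0" using rf_cross[OF r] r(2) by simp
  then show ?thesis by (simp add: rf_proper_def)
next
  case False
  have c: "rf_num r * q = rf_den r * p" by (rule rf_cross[OF r])
  have "rf_num r \<noteq> 0" using c False r(2) by auto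
  then have "degree (rf_num r) + degree q = degree (rf_den r) + degree p"
    using arg_cong[OF c, of degree] False r(2) by (simp add: degree_mult_eq)
  then show ?thesis using d by (simp add: rf_proper_def)
qed

section \<open>From a strict PN multiplier to a symbol with a uniform bound\<close>

section \<open>Spectral factors of a strict PN multiplier\<close>

text \<open>Positivity is given pointwise, whereas the Toeplitz bound needs one constant.
  Compactness supplies it: normalized violators of the bounds 1/(k+1) have a limit point, which
  contradicts positivity.\<close>

lemma uniform_positivity:
  fixes P :: "nat \<Rightarrow> nat \<Rightarrow> complex \<Rightarrow> complex"
  assumes cont: "\<And>i j. i < n \<Longrightarrow> j < n \<Longrightarrow> continuous_on {z. cmod z = 1} (P i j)"
    and pos: "\<And>z v. cmod z = 1 \<Longrightarrow> \<exists>i<n. v i \<noteq> 0 \<Longrightarrow> 0 < Re (\<Sum>i<n. \<Sum>j<n. cnj (v i) * P i j z * v j)"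
  obtains c where "c > 0"
    "\<And>z v. cmod z = 1 \<Longrightarrow> c * (\<Sum>i<n. (cmod (v i))\<^sup>2) \<le> Re (\<Sum>i<n. \<Sum>j<n. cnj (v i) * P i j z * v j)"
proof -
  define f where "f z v = Re (\<Sum>i<n. \<Sum>j<n. cnj (v i) * P i j z * v j)" for z v
  have "\<exists>c>0. \<forall>z v. cmod z = 1 \<longrightarrow> c * (\<Sum>i<n. (cmod (v i))\<^sup>2) \<le> f z v"
  proof (rule ccontr)
    assume "\<not> ?thesis"
    then have "\<forall>c>0. \<exists>z v. cmod z = 1 \<and> f z v < c * (\<Sum>i<n. (cmod (v i))\<^sup>2)"
      by (auto simp: not_le)
    then have "\<exists>z v. cmod z = 1 \<and> f z v < 1 / real (Suc k) * (\<Sum>i<n. (cmod (v i))\<^sup>2)" for k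
      by (metis of_nat_0_less_iff zero_less_Suc zero_less_divide_1_iff)
    then obtain z v where z: "\<And>k. cmod (z k) = 1"
      and v: "\<And>k. f (z k) (v k) < 1 / real (Suc k) * (\<Sum>i<n. (cmod (v k i))\<^sup>2)" by metis
    define N where "N k = (\<Sum>i<n. (cmod (v k i))\<^sup>2)" for k
    have N0: "N k > 0" for k
    proof (rule ccontr)
      assume "\<not> N k > 0"
      moreover have "N k \<ge> 0" unfolding N_def by (intro sum_nonneg) auto
      ultimately have 0: "N k = 0" by simp
      then have "v k i = 0" if "i < n" for i
        unfolding N_def using that by (subst (asm) sum_nonneg_eq_0_iff) auto
      then have "f (z k) (v k) = 0" unfolding f_def by simp
      with v[of k] 0 show False unfolding N_def by simp
    qed
    define w where "w k i = (if i < n then v k i / of_real (sqrt (N k)) else 0)" for k i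
    have w1: "(\<Sum>i<n. (cmod (w k i))\<^sup>2) = 1" for k
    proof -
      have "(\<Sum>i<n. (cmod (w k i))\<^sup>2) = (\<Sum>i<n. (cmod (v k i))\<^sup>2 / N k)"
        using N0[of k] by (intro sum.cong refl) (simp add: w_def norm_divide power_divide)
      also have "\<dots> = N k / N k" by (simp only: sum_divide_distrib[symmetric] N_def[symmetric])
      finally show ?thesis using N0[of k] by simp
    qed
    have fw: "f (z k) (w k) \<le> 1 / real (Suc k)" for k
    proof -
      have "cnj (w k i) * P i j (z k) * w k j = of_real (1 / N k) * (cnj (v k i) * P i j (z k) * v k j)"
        if "i < n" "j < n" for i j
      proof -
        have "complex_of_real (N k) = of_real (sqrt (N k)) * of_real (sqrt (N k))"
          using N0[of k] by (simp add: of_real_mult[symmetric] del: of_real_mult)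
        then show ?thesis using that by (simp add: w_def)
      qed
      then have "(\<Sum>i<n. \<Sum>j<n. cnj (w k i) * P i j (z k) * w k j) = of_real (1 / N k) * (\<Sum>i<n. \<Sum>j<n. cnj (v k i) * P i j (z k) * v k j)"
        by (simp add: sum_distrib_left)
      then have "f (z k) (w k) = 1 / N k * f (z k) (v k)" unfolding f_def by (simp only: Re_complex_of_real times_complex.sel Im_complex_of_real)
      also have "\<dots> \<le> 1 / N k * (1 / real (Suc k) * N k)"
        using v[of k] N0[of k] unfolding N_def by (intro mult_left_mono) auto
      finally show ?thesis using N0[of k] by simp
    qed
    \<comment> \<open>The point and the components of the vector are packed into one sequence, so
      that a single diagonal argument makes them all converge.\<close>
    define g where "g k i = (case i of 0 \<Rightarrow> z k | Suc j \<Rightarrow> w k j)" for k i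
    have wle: "cmod (w k i) \<le> 1" for k i
    proof (cases "i < n")
      case True
      then have "(cmod (w k i))\<^sup>2 \<le> (\<Sum>i<n. (cmod (w k i))\<^sup>2)" by (auto intro!: member_le_sum[where f="\<lambda>i. (cmod (w k i))\<^sup>2"])
      then show ?thesis unfolding w1 by (simp add: power_le_one_iff abs_square_le_1)
    qed (simp add: w_def)
    then have "norm (g k i) \<le> 1" for k i using z by (auto simp: g_def split: nat.split)
    then obtain \<sigma> where \<sigma>: "strict_mono \<sigma>" "\<And>i. \<exists>l. (\<lambda>k. g (\<sigma> k) i) \<longlonglongrightarrow> l"
      by (rule_tac function_convergent_subsequence[of UNIV g 1]) auto
    obtain l where l: "\<And>i. (\<lambda>k. g (\<sigma> k) i) \<longlonglongrightarrow> l i" using \<sigma>(2) by metis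
    have lz: "(\<lambda>k. z (\<sigma> k)) \<longlonglongrightarrow> l 0" using l[of 0] by (simp add: g_def)
    have lw: "(\<lambda>k. w (\<sigma> k) i) \<longlonglongrightarrow> l (Suc i)" for i using l[of "Suc i"] by (simp add: g_def)
    have l0: "cmod (l 0) = 1"
      using tendsto_norm[OF lz] z by (simp add: LIMSEQ_const_iff)
    have lP: "(\<lambda>k. P i j (z (\<sigma> k))) \<longlonglongrightarrow> P i j (l 0)" if "i < n" "j < n" for i j
      by (rule continuous_on_tendsto_compose[OF cont[OF that] lz]) (auto simp: l0 z)
    have "(\<lambda>k. \<Sum>i<n. (cmod (w (\<sigma> k) i))\<^sup>2) \<longlonglongrightarrow> (\<Sum>i<n. (cmod (l (Suc i)))\<^sup>2)"
      by (intro tendsto_intros lw)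
    then have l1: "(\<Sum>i<n. (cmod (l (Suc i)))\<^sup>2) = 1" unfolding w1 by (simp add: LIMSEQ_const_iff)
    then have "\<exists>i<n. l (Suc i) \<noteq> 0" by (metis (no_types, lifting) lessThan_iff norm_zero power_zero_numeral sum.neutral zero_neq_one)
    then have "0 < f (l 0) (\<lambda>i. l (Suc i))" unfolding f_def using l0 by (intro pos) auto
    moreover have "(\<lambda>k. f (z (\<sigma> k)) (w (\<sigma> k))) \<longlonglongrightarrow> f (l 0) (\<lambda>i. l (Suc i))"
      unfolding f_def by (intro tendsto_intros lw lP) auto
    moreover have "(\<lambda>k. 1 / real (Suc (\<sigma> k))) \<longlonglongrightarrow> 0"
      using LIMSEQ_subseq_LIMSEQ[OF LIMSEQ_Suc[OF lim_1_over_n] \<sigma>(1)] by (simp add: o_def)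
    ultimately show False using fw LIMSEQ_le[of "\<lambda>k. f (z (\<sigma> k)) (w (\<sigma> k))" _ "\<lambda>k. 1 / real (Suc (\<sigma> k))" 0] by fastforce
  qed
  then show thesis using that unfolding f_def by blast
qed

lemma unit_cnj: "cmod z = 1 \<Longrightarrow> cnj z = 1 / z"
proof -
  assume z: "cmod z = 1"
  then have "z * cnj z = 1" using complex_norm_square[of z] by simp
  moreover have "z \<noteq> 0" using z by auto
  ultimately show "cnj z = 1 / z" by (simp add: field_simps)
qed

lemma cpoly_continuous: "continuous_on A (cpoly p)"
  unfolding cpoly_def by (intro continuous_intros)

text \<open>For real coefficients, Hermitian symmetry on the circle is a reflection of the
  coefficients; the degree bound is a by-product of it.\<close>

lemma pn_symbol_exists:
  assumes s: "\<And>i. \<bar>s i\<bar> \<le> (1::real)"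
    and herm: "\<And>z i j. cmod z = 1 \<Longrightarrow> i < n \<Longrightarrow> j < n \<Longrightarrow> cpoly (S i j) z / z ^ m = cnj (cpoly (S j i) z / z ^ m)"
    and pos: "\<And>z v. cmod z = 1 \<Longrightarrow> \<exists>i<n. v i \<noteq> 0 \<Longrightarrow>
       0 < Re (\<Sum>i<n. \<Sum>j<n. of_real (s i) * cnj (v i) * (cpoly (S i j) z / z ^ m) * v j)"
  obtains c where "pn_symbol n m S s c"
proof -
  have co: "coeff (S i j) k = (if k \<le> 2 * m then coeff (S j i) (2 * m - k) else 0)" if ij: "i < n" "j < n" for i j k
  proof -
    \<comment> \<open>No degree bound is known yet. N leaves room for both entries, and
      multiplication by powers of z makes the relation an identity of polynomials.\<close>
    define N where "N = max (2 * m) (degree (S j i))"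
    have "monom 1 N * S i j = monom 1 (2 * m) * rv N (S j i)"
    proof (rule cpoly_eqI, rule infinite_super)
      show "{z. cmod z = 1} \<subseteq> {x. cpoly (monom 1 N * S i j) x = cpoly (monom 1 (2 * m) * rv N (S j i)) x}"
      proof
        fix z :: complex assume "z \<in> {z. cmod z = 1}"
        then have z: "cmod z = 1" "z \<noteq> 0" "cnj z = 1 / z"
          by (auto intro: unit_cnj)
        have m: "cpoly (monom 1 r) z = z ^ r" for r by (simp add: cpoly_def map_poly_monom poly_monom)
        have "cpoly (S i j) z / z ^ m = z ^ m * cpoly (S j i) (1 / z)"
          using herm[OF z(1) ij] z by (simp add: cpoly_cnj[symmetric] power_divide)
        then have "cpoly (S i j) z = z ^ (2 * m) * cpoly (S j i) (1 / z)"
          using z(2) by (simp add: field_simps mult_2_right power_add)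
        then show "z \<in> {x. cpoly (monom 1 N * S i j) x = cpoly (monom 1 (2 * m) * rv N (S j i)) x}"
          using z(2) by (simp add: m cpoly_rv N_def)
      qed
    qed (rule infinite_unit_circle)
    then have "coeff (monom 1 N * S i j) (N + k) = coeff (monom 1 (2 * m) * rv N (S j i)) (N + k)" by simp
    then have "coeff (S i j) k = coeff (rv N (S j i)) (N + k - 2 * m)"
      by (simp add: coeff_monom_mult N_def)
    also have "\<dots> = (if k \<le> 2 * m then coeff (S j i) (2 * m - k) else 0)"
      unfolding coeff_rv by (auto simp: N_def intro!: arg_cong[of _ _ "coeff (S j i)"])
    finally show ?thesis .
  qed
  have "continuous_on {z. cmod z = 1} (\<lambda>z. of_real (s i) * (cpoly (S i j) z / z ^ m))" for i j
    by (intro continuous_intros cpoly_continuous) auto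
  moreover have eq: "(\<Sum>i<n. \<Sum>j<n. of_real (s i) * cnj (v i) * (cpoly (S i j) z / z ^ m) * v j)
      = (\<Sum>i<n. \<Sum>j<n. cnj (v i) * (of_real (s i) * (cpoly (S i j) z / z ^ m)) * v j)" for z v
    by (intro sum.cong refl) (simp only: mult_ac)
  ultimately obtain c where c: "c > 0" "\<And>z v. cmod z = 1 \<Longrightarrow> c * (\<Sum>i<n. (cmod (v i))\<^sup>2) \<le> Re (\<Sum>i<n. \<Sum>j<n. cnj (v i) * (of_real (s i) * (cpoly (S i j) z / z ^ m)) * v j)"
    using uniform_positivity[of n "\<lambda>i j z. of_real (s i) * (cpoly (S i j) z / z ^ m)"] pos[unfolded eq] by blast
  show thesis
  proof (rule that[of c], unfold_locales)
    show "degree (S i j) \<le> 2 * m" if "i < n" "j < n" for i j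
      by (rule degree_le) (use co[OF that] in auto)
    show "coeff (S i j) k = coeff (S j i) (2 * m - k)" if "i < n" "j < n" "k \<le> 2 * m" for i j k
      using co[OF that(1,2), of k] that(3) by simp
    fix z :: complex and v :: "nat \<Rightarrow> complex" assume z: "cmod z = 1"
    show "c * (\<Sum>i<n. (cmod (v i))\<^sup>2) \<le> Re (\<Sum>i<n. \<Sum>j<n. of_real (s i) * cnj (v i) * (cpoly (S i j) z / z ^ m) * v j)"
      unfolding eq by (rule c(2)[OF z])
  qed (use c s in auto)
qed

lemma quad_form_sum:
  assumes "A \<in> carrier_mat n n" "v \<in> carrier_vec n"
  shows "quad_form A v = (\<Sum>i<n. \<Sum>j<n. conjugate (v $ i) * A $$ (i,j) * v $ j)"
  using assms unfolding quad_form_def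
  by (auto simp: scalar_prod_def atLeast0LessThan sum_distrib_left mult.assoc intro!: sum.cong)

lemma sum_lessThan_add:
  fixes f :: "nat \<Rightarrow> 'a :: comm_monoid_add"
  shows "(\<Sum>i<a + b. f i) = (\<Sum>i<a. f i) + (\<Sum>i<b. f (i + a))"
  by (induction b) (simp_all add: add_ac)

lemma RL_inf_D: "R \<in> RL_inf a b \<Longrightarrow> i < a \<Longrightarrow> j < b \<Longrightarrow> cmod z = 1 \<Longrightarrow> \<not> rf_pole (R $$ (i,j)) z"
  by (auto simp: RL_inf_def)

lemma RL_inf_carrier: "R \<in> RL_inf a b \<Longrightarrow> R \<in> carrier_mat a b"
  by (auto simp: RL_inf_def proper_transfer_def)

locale strict_PN_at =
  fixes a b :: nat and R :: "ratfun mat"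
  assumes PN: "strict_PN a b R"
begin

abbreviation r :: "nat \<Rightarrow> nat \<Rightarrow> complex \<Rightarrow> complex" where "r i j z \<equiv> rf_eval (R $$ (i,j)) z"

lemma carrier: "R \<in> carrier_mat (a + b) (a + b)"
  using PN by (auto simp: strict_PN_def RL_inf_carrier)

lemma no_pole: "i < a + b \<Longrightarrow> j < a + b \<Longrightarrow> cmod z = 1 \<Longrightarrow> \<not> rf_pole (R $$ (i,j)) z"
  using PN by (auto simp: strict_PN_def dest: RL_inf_D)

text \<open>On the circle 1/z is the conjugate of z, so for real coefficients the para-Hermitian
  property becomes conjugate symmetry.\<close>

lemma hermitian:
  assumes "i < a + b" "j < a + b" "cmod z = 1" shows "r i j z = cnj (r j i z)"
proof -
  have z: "z \<noteq> 0" "1 / z = cnj z" "cmod (1 / z) = 1" using assms(3) unit_cnj[of z] by (auto simp: norm_divide)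
  have "R = para_mat R" using PN by (simp add: strict_PN_def)
  then have "R $$ (i,j) = para_mat R $$ (i,j)" by simp
  also have "\<dots> = rf_compose (R $$ (j,i)) (inverse rf_z)" using assms carrier by (simp add: para_mat_def)
  finally have "r i j z = r j i (1 / z)"
    using rf_inverse_eval(2)[of "R $$ (j,i)" z] no_pole[of j i "1 / z"] assms z by simp
  then show ?thesis unfolding z(2) by (simp add: rf_eval_cpoly cpoly_cnj)
qed

lemma blocks:
  assumes "cmod z = 1"
  shows "pos_def a (mat a a (\<lambda>(i,j). r i j z))" "neg_def b (mat b b (\<lambda>(i,j). r (i + a) (j + a) z))"
proof -
  have c: "eval_mat R z \<in> carrier_mat (a + b) (a + b)" using carrier by (simp add: eval_mat_def)
  obtain R11 R12 R21 R22 where s: "split_block (eval_mat R z) a a = (R11, R12, R21, R22)"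
    by (metis prod_cases4)
  have "R11 = mat a a (\<lambda>(i,j). r i j z)" "R22 = mat b b (\<lambda>(i,j). r (i + a) (j + a) z)"
    using s c carrier by (auto simp: split_block_def Let_def eval_mat_def intro!: eq_matI)
  moreover have "pos_def a R11 \<and> neg_def b R22" using PN assms s by (force simp: strict_PN_def)
  ultimately show "pos_def a (mat a a (\<lambda>(i,j). r i j z))" "neg_def b (mat b b (\<lambda>(i,j). r (i + a) (j + a) z))"
    by auto
qed

lemma block1_pos:
  assumes "cmod z = 1" "\<exists>i<a. v i \<noteq> 0"
  shows "0 < Re (\<Sum>i<a. \<Sum>j<a. cnj (v i) * r i j z * v j)"
proof -
  let ?v = "vec a v" and ?A = "mat a a (\<lambda>(i,j). r i j z)"
  have "?v \<noteq> 0\<^sub>v a" using assms(2) by (auto simp: vec_eq_iff)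
  then have "0 < quad_form ?A ?v" using blocks(1)[OF assms(1)] by (auto simp: pos_def_def)
  also have "quad_form ?A ?v = (\<Sum>i<a. \<Sum>j<a. cnj (v i) * r i j z * v j)"
    by (subst quad_form_sum[of _ a]) (auto intro!: sum.cong)
  finally show ?thesis by (simp add: less_complex_def)
qed

lemma block2_neg:
  assumes "cmod z = 1" "\<exists>i<b. v i \<noteq> 0"
  shows "Re (\<Sum>i<b. \<Sum>j<b. cnj (v i) * r (i + a) (j + a) z * v j) < 0"
proof -
  let ?v = "vec b v" and ?A = "- mat b b (\<lambda>(i,j). r (i + a) (j + a) z)"
  have "?v \<noteq> 0\<^sub>v b" using assms(2) by (auto simp: vec_eq_iff)
  then have "0 < quad_form ?A ?v" using blocks(2)[OF assms(1)] by (auto simp: pos_def_def neg_def_def)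
  also have "quad_form ?A ?v = - (\<Sum>i<b. \<Sum>j<b. cnj (v i) * r (i + a) (j + a) z * v j)"
    by (subst quad_form_sum[of _ b]) (auto intro!: sum.cong simp: sum_negf[symmetric])
  finally show ?thesis by (simp add: less_complex_def)
qed

definition sgn2 :: "nat \<Rightarrow> real" where "sgn2 i = (if i < a then 1 else -1)"

text \<open>The signed form need not be Hermitian, which is why the real part is taken: the two
  off-diagonal sums are conjugate to each other, so their difference is purely imaginary.\<close>

lemma signed_pos:
  assumes z: "cmod z = 1" and v: "\<exists>i<a + b. v i \<noteq> 0"
  shows "0 < Re (\<Sum>i<a + b. \<Sum>j<a + b. of_real (sgn2 i) * cnj (v i) * r i j z * v j)"
proof -
  let ?f = "\<lambda>i j. cnj (v i) * r i j z * v j"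
  let ?A = "Re (\<Sum>i<a. \<Sum>j<a. ?f i j)" and ?B = "Re (\<Sum>i<b. \<Sum>j<b. ?f (i + a) (j + a))"
  have cross: "cnj (\<Sum>i<b. \<Sum>j<a. ?f (i + a) j) = (\<Sum>i<a. \<Sum>j<b. ?f i (j + a))"
  proof -
    have "cnj (\<Sum>i<b. \<Sum>j<a. ?f (i + a) j) = (\<Sum>i<b. \<Sum>j<a. ?f j (i + a))"
      unfolding cnj_sum
    proof (intro sum.cong refl)
      fix i j assume "i \<in> {..<b}" "j \<in> {..<a}"
      then have "r j (i + a) z = cnj (r (i + a) j z)" using z by (intro hermitian) auto
      then show "cnj (?f (i + a) j) = ?f j (i + a)" by (simp only: complex_cnj_mult complex_cnj_cnj mult_ac)
    qed
    also have "\<dots> = (\<Sum>i<a. \<Sum>j<b. ?f i (j + a))" by (rule sum.swap)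
    finally show ?thesis .
  qed
  have "(\<Sum>i<a + b. \<Sum>j<a + b. of_real (sgn2 i) * cnj (v i) * r i j z * v j)
    = (\<Sum>i<a. \<Sum>j<a + b. ?f i j) - (\<Sum>i<b. \<Sum>j<a + b. ?f (i + a) j)"
    by (simp add: sum_lessThan_add[of _ a b] sgn2_def sum_negf sum.distrib)
  also have "\<dots> = (\<Sum>i<a. \<Sum>j<a. ?f i j) + (\<Sum>i<a. \<Sum>j<b. ?f i (j + a)) - ((\<Sum>i<b. \<Sum>j<a. ?f (i + a) j) + (\<Sum>i<b. \<Sum>j<b. ?f (i + a) (j + a)))"
    by (simp add: sum_lessThan_add[of _ a b] sum.distrib)
  finally have e0: "(\<Sum>i<a + b. \<Sum>j<a + b. of_real (sgn2 i) * cnj (v i) * r i j z * v j)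
    = (\<Sum>i<a. \<Sum>j<a. ?f i j) + (\<Sum>i<a. \<Sum>j<b. ?f i (j + a)) - ((\<Sum>i<b. \<Sum>j<a. ?f (i + a) j) + (\<Sum>i<b. \<Sum>j<b. ?f (i + a) (j + a)))" .
  have "Re (\<Sum>i<a. \<Sum>j<b. ?f i (j + a)) = Re (\<Sum>i<b. \<Sum>j<a. ?f (i + a) j)"
    unfolding cross[symmetric] by (simp only: cnj.sel)
  then have e: "Re (\<Sum>i<a + b. \<Sum>j<a + b. of_real (sgn2 i) * cnj (v i) * r i j z * v j) = ?A - ?B"
    unfolding e0 by (simp only: plus_complex.sel minus_complex.sel)
  have A: "?A \<ge> 0"
    using block1_pos[OF z, of v] by (cases "\<exists>i<a. v i \<noteq> 0") auto
  have B: "?B \<le> 0"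
    using block2_neg[OF z, of "\<lambda>i. v (i + a)"] by (cases "\<exists>i<b. v (i + a) \<noteq> 0") auto
  obtain i where i: "i < a + b" "v i \<noteq> 0" using v by auto
  show ?thesis
  proof (cases "i < a")
    case True
    then have "?A > 0" using i by (intro block1_pos[OF z]) auto
    then show ?thesis using B e by linarith
  next
    case False
    then have "i - a < b" "v (i - a + a) \<noteq> 0" using i by auto
    then have "?B < 0" by (intro block2_neg[OF z]) auto
    then show ?thesis using A e by linarith
  qed
qed

text \<open>Multiplying by q and by its conjugate turns the multiplier R into the Laurent polynomial
  matrix |q|^2 R, to which the factorization applies. Since q may have zeros inside the disc, |q|^2
  is factored as well, as a symbol of size 1; its factor d has no zeros in the closed disc and
  serves as denominator.\<close>

theorem spectral_factors:
  obtains F :: "nat \<Rightarrow> nat \<Rightarrow> real poly" and d :: "real poly" and M :: "nat \<Rightarrow> nat \<Rightarrow> real"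
  where "\<And>i j. i < a + b \<Longrightarrow> j < a + b \<Longrightarrow> M i j = M j i"
    "\<And>x. cmod x \<le> 1 \<Longrightarrow> cpoly d x \<noteq> 0"
    "\<And>x. cmod x \<le> 1 \<Longrightarrow> det (pmat (a + b) F x) \<noteq> 0"
    "\<And>i j z. i < a + b \<Longrightarrow> j < a + b \<Longrightarrow> cmod z = 1 \<Longrightarrow>
       r i j z = (\<Sum>k<a + b. \<Sum>l<a + b. cpoly (F k i) z / cpoly d z * of_real (M k l) * (cpoly (F l j) (1 / z) / cpoly d (1 / z)))"
proof -
  let ?n = "a + b"
  define q where "q = (\<Prod>i<?n. \<Prod>j<?n. rf_den (R $$ (i,j)))"
  define m where "m = degree q"
  have dv: "rf_den (R $$ (i,j)) dvd q" if "i < ?n" "j < ?n" for i j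
  proof -
    have "rf_den (R $$ (i,j)) dvd (\<Prod>j<?n. rf_den (R $$ (i,j)))"
      using that by (intro dvd_prodI) auto
    also have "\<dots> dvd q" unfolding q_def using that by (intro dvd_prodI) auto
    finally show ?thesis .
  qed
  define p where "p i j = rf_num (R $$ (i,j)) * (q div rf_den (R $$ (i,j)))" for i j
  have q1: "cpoly q z \<noteq> 0" if "cmod z = 1" for z
    unfolding q_def using no_pole that by (auto simp: cpoly_prod rf_pole_cpoly)
  have q0: "q \<noteq> 0" using q1[of 1] by auto
  have rp: "r i j z * cpoly q z = cpoly (p i j) z" if "i < ?n" "j < ?n" "cmod z = 1" for i j z
  proof -
    have "q = rf_den (R $$ (i,j)) * (q div rf_den (R $$ (i,j)))" using dv[OF that(1,2)] by simp
    then have "cpoly q z = cpoly (rf_den (R $$ (i,j))) z * cpoly (q div rf_den (R $$ (i,j))) z"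
      by (metis cpoly_simps(2))
    then show ?thesis using no_pole[OF that] by (simp add: rf_eval_cpoly p_def rf_pole_cpoly)
  qed
  have qq: "cpoly (rv m q) z / z ^ m * cpoly q z = of_real ((cmod (cpoly q z))\<^sup>2)" if "cmod z = 1" for z
  proof -
    have "z \<noteq> 0" using that by auto
    then have "cpoly (rv m q) z / z ^ m = cpoly q (1 / z)" by (simp add: cpoly_rv m_def)
    also have "\<dots> = cnj (cpoly q z)" using unit_cnj[OF that] by (metis cpoly_cnj)
    finally show ?thesis by (metis complex_norm_square mult.commute)
  qed
  define S where "S i j = p i j * rv m q" for i j
  have Sz: "cpoly (S i j) z / z ^ m = of_real ((cmod (cpoly q z))\<^sup>2) * r i j z" if "i < ?n" "j < ?n" "cmod z = 1" for i j z
    unfolding S_def qq[OF that(3), symmetric] using rp[OF that] by (simp add: mult_ac)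
  obtain c where "pn_symbol ?n m S sgn2 c"
  proof (rule pn_symbol_exists[of sgn2 ?n S m])
    show "\<bar>sgn2 i\<bar> \<le> 1" for i by (simp add: sgn2_def)
    show "cpoly (S i j) z / z ^ m = cnj (cpoly (S j i) z / z ^ m)" if "cmod z = 1" "i < ?n" "j < ?n" for z i j
      using that hermitian[of i j z] by (simp add: Sz)
    fix z :: complex and v :: "nat \<Rightarrow> complex" assume z: "cmod z = 1" and v: "\<exists>i<?n. v i \<noteq> 0"
    have "(\<Sum>i<?n. \<Sum>j<?n. of_real (sgn2 i) * cnj (v i) * (cpoly (S i j) z / z ^ m) * v j)
      = of_real ((cmod (cpoly q z))\<^sup>2) * (\<Sum>i<?n. \<Sum>j<?n. of_real (sgn2 i) * cnj (v i) * r i j z * v j)"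
      unfolding sum_distrib_left using z by (intro sum.cong refl) (simp add: Sz mult_ac)
    then have "Re (\<Sum>i<?n. \<Sum>j<?n. of_real (sgn2 i) * cnj (v i) * (cpoly (S i j) z / z ^ m) * v j)
      = (cmod (cpoly q z))\<^sup>2 * Re (\<Sum>i<?n. \<Sum>j<?n. of_real (sgn2 i) * cnj (v i) * r i j z * v j)"
      by (simp only: Re_complex_of_real times_complex.sel Im_complex_of_real) 
    then show "0 < Re (\<Sum>i<?n. \<Sum>j<?n. of_real (sgn2 i) * cnj (v i) * (cpoly (S i j) z / z ^ m) * v j)"
      using signed_pos[OF z v] q1[OF z] by simp
  qed
  then interpret big: pn_symbol ?n m S sgn2 c .
  obtain F M where FM: "\<And>i j. i < ?n \<Longrightarrow> j < ?n \<Longrightarrow> M i j = M j i"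
    "\<And>x. cmod x \<le> 1 \<Longrightarrow> det (pmat ?n F x) \<noteq> 0"
    "\<And>i j x. i < ?n \<Longrightarrow> j < ?n \<Longrightarrow> x \<noteq> 0 \<Longrightarrow>
       cpoly (S i j) x / x ^ m = (\<Sum>k<?n. \<Sum>l<?n. cpoly (F k i) x * of_real (M k l) * cpoly (F l j) (1 / x))"
    by (rule big.J_factorization, rule that)
  obtain c' where "pn_symbol 1 m (\<lambda>_ _. q * rv m q) (\<lambda>_. 1) c'"
  proof (rule pn_symbol_exists[of "\<lambda>_. 1" 1 "\<lambda>_ _. q * rv m q" m])
    have e: "cpoly (q * rv m q) z / z ^ m = of_real ((cmod (cpoly q z))\<^sup>2)" if "cmod z = 1" for z
      unfolding qq[OF that, symmetric] by simp
    show "cpoly (q * rv m q) z / z ^ m = cnj (cpoly (q * rv m q) z / z ^ m)" if "cmod z = 1" for z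
      unfolding e[OF that] by simp
    fix z :: complex and v :: "nat \<Rightarrow> complex" assume z: "cmod z = 1" and v: "\<exists>i<1. v i \<noteq> 0"
    have "0 < (cmod (cpoly q z))\<^sup>2 * (cmod (v 0))\<^sup>2" using q1[OF z] v by simp
    also have "\<dots> = Re (of_real ((cmod (cpoly q z))\<^sup>2) * (v 0 * cnj (v 0)))"
      unfolding complex_norm_square[symmetric] by simp
    finally show "0 < Re (\<Sum>i<1. \<Sum>j<1. of_real 1 * cnj (v i) * (cpoly (q * rv m q) z / z ^ m) * v j)"
      unfolding e[OF z] by (simp add: mult_ac)
  qed simp
  then interpret sc: pn_symbol 1 m "\<lambda>_ _. q * rv m q" "\<lambda>_. 1" c' .
  obtain D N where DN: "\<And>i j. i < (1::nat) \<Longrightarrow> j < (1::nat) \<Longrightarrow> N i j = N j i"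
    "\<And>x. cmod x \<le> 1 \<Longrightarrow> det (pmat 1 D x) \<noteq> 0"
    "\<And>i j x. i < (1::nat) \<Longrightarrow> j < (1::nat) \<Longrightarrow> x \<noteq> 0 \<Longrightarrow>
       cpoly (q * rv m q) x / x ^ m = (\<Sum>k<1. \<Sum>l<1. cpoly (D k i) x * of_real (N k l) * cpoly (D l j) (1 / x))"
    by (rule sc.J_factorization, rule that)
  define d where "d = D 0 0"
  have d: "cpoly d x \<noteq> 0" if "cmod x \<le> 1" for x
    using DN(2)[OF that] by (simp add: pmat_def det_single d_def)
  have ds: "cpoly (q * rv m q) x / x ^ m = cpoly d x * of_real (N 0 0) * cpoly d (1 / x)" if "x \<noteq> 0" for x
    using DN(3)[of 0 0 x] that by (simp add: d_def)
  have N0: "N 0 0 \<noteq> 0" using ds[of 1] qq[of 1] q1[of 1] by (auto simp: mult.commute)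
  show thesis
  \<comment> \<open>Dividing the two factorizations leaves the scalar middle constant of |q|^2,
    which is absorbed into M.\<close>
  proof (rule that[of "\<lambda>k l. M k l / N 0 0" d F])
    fix i j and z :: complex assume ij: "i < ?n" "j < ?n" and z: "cmod z = 1"
    have z0: "z \<noteq> 0" using z by auto
    have dz: "cpoly d z \<noteq> 0" "cpoly d (1 / z) \<noteq> 0" using z by (auto intro!: d simp: norm_divide)
    have "cpoly (q * rv m q) z / z ^ m = of_real ((cmod (cpoly q z))\<^sup>2)" using qq[OF z] by (simp add: mult.commute)
    then have "of_real ((cmod (cpoly q z))\<^sup>2) = cpoly d z * of_real (N 0 0) * cpoly d (1 / z)"
      using ds[OF z0] by (simp only:)
    moreover have "of_real ((cmod (cpoly q z))\<^sup>2) * r i j z = (\<Sum>k<?n. \<Sum>l<?n. cpoly (F k i) z * of_real (M k l) * cpoly (F l j) (1 / z))"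
      using Sz[OF ij z] FM(3)[OF ij z0] by (simp only:)
    ultimately have "(cpoly d z * of_real (N 0 0) * cpoly d (1 / z)) * r i j z = (\<Sum>k<?n. \<Sum>l<?n. cpoly (F k i) z * of_real (M k l) * cpoly (F l j) (1 / z))"
      by (simp only:)
    then have "r i j z = (\<Sum>k<?n. \<Sum>l<?n. cpoly (F k i) z * of_real (M k l) * cpoly (F l j) (1 / z)) / (cpoly d z * of_real (N 0 0) * cpoly d (1 / z))"
      using dz N0 by (metis (no_types, lifting) mult_eq_0_iff nonzero_mult_div_cancel_left of_real_eq_0_iff)
    also have "\<dots> = (\<Sum>k<?n. \<Sum>l<?n. cpoly (F k i) z / cpoly d z * of_real (M k l / N 0 0) * (cpoly (F l j) (1 / z) / cpoly d (1 / z)))"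
      unfolding sum_divide_distrib by (intro sum.cong refl) (simp only: of_real_divide times_divide_times_eq)
    finally show "r i j z = (\<Sum>k<?n. \<Sum>l<?n. cpoly (F k i) z / cpoly d z * of_real (M k l / N 0 0) * (cpoly (F l j) (1 / z) / cpoly d (1 / z)))" .
  qed (use FM d in auto)
qed

end

section \<open>The factor as a transfer matrix and as a multiplication operator\<close>

section \<open>The factor and its filter\<close>

text \<open>One component of a signal, with the weight \<rho>^(-t) built in.\<close>

definition wsig :: "real \<Rightarrow> signal \<Rightarrow> nat \<Rightarrow> real fps" where
  "wsig \<rho> q i = Abs_fps (\<lambda>t. q t $ i / \<rho> ^ t)"

text \<open>Substitution of \<rho> X for the variable X; it relates the impulse response of the
  filter to that of the scaled one.\<close>

definition fscl :: "real \<Rightarrow> real fps \<Rightarrow> real fps" where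
  "fscl \<rho> A = Abs_fps (\<lambda>k. fps_nth A k * \<rho> ^ k)"

lemma fscl_mult: "fscl \<rho> (A * B) = fscl \<rho> A * fscl \<rho> B"
proof (rule fps_ext)
  fix k
  have "\<rho> ^ i * \<rho> ^ (k - i) = \<rho> ^ k" if "i \<le> k" for i using that by (simp add: power_add[symmetric])
  then show "fps_nth (fscl \<rho> (A * B)) k = fps_nth (fscl \<rho> A * fscl \<rho> B) k"
    unfolding fscl_def fps_mult_nth fps_nth_Abs_fps sum_distrib_right
    by (intro sum.cong refl) (simp add: mult_ac)
qed

lemma fscl_poly: "fscl \<rho> (fps_of_poly p) = fps_of_poly (scl \<rho> p)"
  by (intro fps_ext) (simp add: fscl_def coeff_scl)

lemma fscl_inverse:
  assumes "fps_nth A 0 \<noteq> 0" shows "fscl \<rho> (inverse A) = inverse (fscl \<rho> A)"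
proof (rule fps_inverse_unique[symmetric])
  have "fscl \<rho> A * fscl \<rho> (inverse A) = fscl \<rho> 1"
    unfolding fscl_mult[symmetric] using assms by (simp add: inverse_mult_eq_1')
  also have "fscl \<rho> 1 = 1" by (intro fps_ext) (simp add: fscl_def)
  finally show "fscl \<rho> A * fscl \<rho> (inverse A) = 1" .
qed

text \<open>Here r(z) = p(1/z)/q(1/z), whose expansion at infinity is that of p/q at 0. The
  definition takes the reduced fraction; its denominator divides q and so has a nonzero constant
  term too, which makes both quotients agree.\<close>

lemma rf_impulse_fraction:
  assumes r: "r = to_fract (rv K p) / to_fract (rv K q)" and d: "degree p \<le> K" "degree q \<le> K"
    and q0: "coeff q 0 \<noteq> 0"
  shows "rf_impulse r k = fps_nth (fps_of_poly p * inverse (fps_of_poly q)) k"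
proof -
  have rr: "rv K (rv K p) = p" if "degree p \<le> K" for p
    using that by (intro poly_eqI) (auto simp: coeff_rv coeff_eq_0)
  have qn: "q \<noteq> 0" using q0 by auto
  define s where "s = rf_compose r (inverse rf_z)"
  have s: "s = to_fract p / to_fract q"
    using rf_compose_inverse[OF r, of K] qn d by (simp add: s_def rv_eq_0_iff degree_rv rr)
  have "rf_den s dvd q" by (rule rf_den_dvd[OF s qn])
  then obtain g where g: "q = rf_den s * g" by (elim dvdE)
  have D0: "fps_nth (fps_of_poly (rf_den s)) 0 \<noteq> 0" "fps_nth (fps_of_poly q) 0 \<noteq> 0"
    using q0 arg_cong[OF g, of "\<lambda>x. coeff x 0"] by (auto simp: coeff_mult)
  have c: "fps_of_poly (rf_num s) * fps_of_poly q = fps_of_poly (rf_den s) * fps_of_poly p"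
    using rf_cross[OF s qn] by (simp add: fps_of_poly_mult[symmetric])
  have "fps_of_poly (rf_num s) / fps_of_poly (rf_den s) = fps_of_poly (rf_num s) * inverse (fps_of_poly (rf_den s))"
    using D0 by (simp add: fps_divide_unit)
  also have "\<dots> = (fps_of_poly (rf_num s) * fps_of_poly q) * inverse (fps_of_poly q) * inverse (fps_of_poly (rf_den s))"
    using inverse_mult_eq_1'[OF D0(2)] by (simp add: mult_ac)
  also have "\<dots> = fps_of_poly p * inverse (fps_of_poly q) * (fps_of_poly (rf_den s) * inverse (fps_of_poly (rf_den s)))"
    unfolding c by (simp add: mult_ac)
  finally have "fps_of_poly (rf_num s) / fps_of_poly (rf_den s) = fps_of_poly p * inverse (fps_of_poly q)"
    using inverse_mult_eq_1'[OF D0(1)] by simp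
  then show ?thesis by (simp add: rf_impulse_def Let_def s_def)
qed

text \<open>F and d are polynomials in 1/z acting on weighted signals. Their zero-freeness in the
  closed disc makes both the filter F/d and its inverse stable.\<close>

locale psi =
  fixes \<rho> :: real and n :: nat and F :: "nat \<Rightarrow> nat \<Rightarrow> real poly" and d :: "real poly"
  assumes \<rho>: "0 < \<rho>" "\<rho> \<le> 1"
    and d: "\<And>x. cmod x \<le> 1 \<Longrightarrow> cpoly d x \<noteq> 0"
    and F: "\<And>x. cmod x \<le> 1 \<Longrightarrow> det (pmat n F x) \<noteq> 0"
begin

text \<open>A crude common bound on all degrees.\<close>

definition K :: nat where "K = degree d + (\<Sum>i<n. \<Sum>j<n. degree (F i j))"

text \<open>In formulas, Psi(z) = F(\<rho>/z)/d(\<rho>/z).\<close>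

definition Psi :: "ratfun mat" where
  "Psi = mat n n (\<lambda>(i,j). to_fract (rv K (scl \<rho> (F i j))) / to_fract (rv K (scl \<rho> d)))"

text \<open>The values of Psi at \<rho> z for z on the circle, see
  \<open>eval_circle\<close>.\<close>

definition Pf :: "nat \<Rightarrow> nat \<Rightarrow> complex \<Rightarrow> complex" where
  "Pf i j z = cpoly (F i j) (1 / z) / cpoly d (1 / z)"

lemma degK: "degree (scl \<rho> d) \<le> K" "i < n \<Longrightarrow> j < n \<Longrightarrow> degree (scl \<rho> (F i j)) \<le> K"
proof -
  show "degree (scl \<rho> d) \<le> K" using \<rho> by (simp add: degree_scl K_def)
  assume ij: "i < n" "j < n"
  have "degree (F i j) \<le> (\<Sum>j<n. degree (F i j))" using ij by (intro member_le_sum) auto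
  also have "\<dots> \<le> (\<Sum>i<n. \<Sum>j<n. degree (F i j))" using ij by (intro member_le_sum[where f="\<lambda>i. \<Sum>j<n. degree (F i j)"]) auto
  finally show "degree (scl \<rho> (F i j)) \<le> K" using \<rho> by (simp add: degree_scl K_def)
qed

lemma d0: "coeff d 0 \<noteq> 0" using d[of 0] by (simp add: cpoly_def poly_0_coeff_0 coeff_map_poly)

lemma entry: "i < n \<Longrightarrow> j < n \<Longrightarrow> Psi $$ (i,j) = to_fract (rv K (scl \<rho> (F i j))) / to_fract (rv K (scl \<rho> d))"
  by (simp add: Psi_def)

lemma den0: "rv K (scl \<rho> d) \<noteq> 0"
  using degK(1) \<rho> d0 by (auto simp: rv_eq_0_iff)

text \<open>All poles lie strictly inside the circle of radius \<rho>. This gives stability of the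
  scaled factor and, by \<rho> \<le> 1, of Psi itself.\<close>

lemma eval_gen:
  assumes "i < n" "j < n" "cmod z \<ge> \<rho>"
  shows "\<not> rf_pole (Psi $$ (i,j)) z" "rf_eval (Psi $$ (i,j)) z = cpoly (F i j) (of_real \<rho> / z) / cpoly d (of_real \<rho> / z)"
proof -
  have z: "z \<noteq> 0" using assms(3) \<rho> by auto
  have q: "cpoly (rv K (scl \<rho> d)) z \<noteq> 0"
    using z assms(3) \<rho> degK(1) by (simp add: cpoly_rv cpoly_scl) (auto intro!: d simp: norm_divide)
  show "\<not> rf_pole (Psi $$ (i,j)) z" by (rule rf_fraction[OF entry[OF assms(1,2)] q])
  show "rf_eval (Psi $$ (i,j)) z = cpoly (F i j) (of_real \<rho> / z) / cpoly d (of_real \<rho> / z)"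
    unfolding rf_fraction(2)[OF entry[OF assms(1,2)] q]
    using z degK assms by (simp add: cpoly_rv cpoly_scl)
qed

lemma carrier: "Psi \<in> carrier_mat n n" by (simp add: Psi_def)

lemma RH: "Psi \<in> RH_inf n n"
proof -
  \<comment> \<open>Since d(0) is nonzero, the reversed denominator has degree exactly K; this makes
    the entries proper.\<close>
  have "coeff (rv K (scl \<rho> d)) K \<noteq> 0" using d0 by (simp add: coeff_rv coeff_scl)
  then have "degree (rv K (scl \<rho> d)) = K" using degree_rv[of K] le_degree le_antisym by blast
  then have "rf_proper (Psi $$ (i,j))" if "i < n" "j < n" for i j
    using degree_rv by (intro rf_proper_fraction[OF entry[OF that] den0]) simp
  moreover have "cmod z < 1" if "i < n" "j < n" "rf_pole (Psi $$ (i,j)) z" for i j z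
    using eval_gen(1)[OF that(1,2), of z] that(3) \<rho> by (meson less_le_trans not_le)
  ultimately show ?thesis unfolding RH_inf_def proper_transfer_def using carrier by blast
qed

lemma scaled_entry:
  assumes "i < n" "j < n"
  shows "scale_mat \<rho> Psi $$ (i,j) = rf_compose (Psi $$ (i,j)) (rf_const \<rho> * rf_z)"
  using assms carrier by (simp add: scale_mat_def)

lemma scaled_RH: "scale_mat \<rho> Psi \<in> RH_inf n n"
proof -
  have c: "scale_mat \<rho> Psi \<in> carrier_mat n n" using carrier by (simp add: scale_mat_def)
  have "rf_proper (scale_mat \<rho> Psi $$ (i,j))" if "i < n" "j < n" for i j
  proof -
    let ?r = "Psi $$ (i,j)"
    have p: "rf_proper ?r" using RH that by (auto simp: RH_inf_def proper_transfer_def)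
    show ?thesis unfolding scaled_entry[OF that]
      by (rule rf_proper_fraction[OF rf_compose_scale[OF rf_eq rf_den_nonzero]])
        (use \<rho> p in \<open>auto simp: degree_scl rf_proper_def\<close>)
  qed
  moreover have "cmod z < 1" if "i < n" "j < n" "rf_pole (scale_mat \<rho> Psi $$ (i,j)) z" for i j z
  proof (rule ccontr)
    assume "\<not> cmod z < 1"
    then have "cmod (of_real \<rho> * z) \<ge> \<rho>" using \<rho> by (simp add: norm_mult)
    then have "\<not> rf_pole (Psi $$ (i,j)) (of_real \<rho> * z)" by (rule eval_gen[OF that(1,2)])
    then show False using that \<rho> rf_scale_eval(1)[of "Psi $$ (i,j)" \<rho> z] by (simp add: scaled_entry)
  qed
  ultimately show ?thesis unfolding RH_inf_def proper_transfer_def using c by blast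
qed

lemma eval_circle:
  assumes "i < n" "j < n" "cmod z = 1"
  shows "\<not> rf_pole (Psi $$ (i,j)) (of_real \<rho> * z)" "rf_eval (Psi $$ (i,j)) (of_real \<rho> * z) = Pf i j z"
  using eval_gen[OF assms(1,2), of "of_real \<rho> * z"] assms(3) \<rho> by (auto simp: norm_mult Pf_def)

lemma scaled_eval:
  assumes "i < n" "j < n" "cmod z = 1"
  shows "\<not> rf_pole (scale_mat \<rho> Psi $$ (i,j)) z" "rf_eval (scale_mat \<rho> Psi $$ (i,j)) z = Pf i j z"
  using rf_scale_eval[of "Psi $$ (i,j)" \<rho> z] eval_circle[OF assms] \<rho> assms by (auto simp: scaled_entry)

lemma rho_factorization:
  assumes R: "scale_mat \<rho> \<Pi>m \<in> RL_inf n n"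
    and e: "\<And>i j z. i < n \<Longrightarrow> j < n \<Longrightarrow> cmod z = 1 \<Longrightarrow>
       rf_eval (scale_mat \<rho> \<Pi>m $$ (i,j)) z = (\<Sum>k<n. \<Sum>l<n. Pf k i (1 / z) * of_real (M k l) * Pf l j z)"
  shows "rho_factorization \<rho> n n Psi (mat n n (\<lambda>(i,j). M i j)) \<Pi>m"
proof -
  let ?S = "scale_mat \<rho> Psi" and ?M = "mat n n (\<lambda>(i,j). M i j)"
  have S: "?S \<in> carrier_mat n n" using carrier by (simp add: scale_mat_def)
  have pS: "para_mat ?S \<in> carrier_mat n n" using S by (simp add: para_mat_def)
  have cM: "const_mat ?M \<in> carrier_mat n n" by (simp add: const_mat_def)
  have "scale_mat \<rho> \<Pi>m = para_mat ?S * const_mat ?M * ?S"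
  proof (rule eq_matI)
    fix i j assume "i < dim_row (para_mat ?S * const_mat ?M * ?S)" "j < dim_col (para_mat ?S * const_mat ?M * ?S)"
    then have ij: "i < n" "j < n" using S pS by auto
    define t where "t l k = para_mat ?S $$ (i,k) * const_mat ?M $$ (k,l) * ?S $$ (l,j)" for l k
    have "(para_mat ?S * const_mat ?M * ?S) $$ (i,j) = (\<Sum>l<n. \<Sum>k<n. t l k)"
      using ij by (subst mat_mult_index[OF mult_carrier_mat[OF pS cM] S ij])
        (simp add: mat_mult_index[OF pS cM] sum_distrib_right t_def)
    moreover have "scale_mat \<rho> \<Pi>m $$ (i,j) = (\<Sum>l<n. \<Sum>k<n. t l k)"
    proof (rule rf_eqI, rule infinite_super[OF _ infinite_unit_circle], rule subsetI)
      fix z :: complex assume "z \<in> {z. cmod z = 1}"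
      then have z: "cmod z = 1" "cmod (1 / z) = 1" "z \<noteq> 0" by (auto simp: norm_divide)
      have pe: "\<not> rf_pole (para_mat ?S $$ (i,k)) z" "rf_eval (para_mat ?S $$ (i,k)) z = Pf k i (1 / z)" if "k < n" for k
      proof -
        have "para_mat ?S $$ (i,k) = rf_compose (?S $$ (k,i)) (inverse rf_z)"
          using S ij that by (simp add: para_mat_def)
        then show "\<not> rf_pole (para_mat ?S $$ (i,k)) z" "rf_eval (para_mat ?S $$ (i,k)) z = Pf k i (1 / z)"
          using rf_inverse_eval[of "?S $$ (k,i)" z] scaled_eval[OF that ij(1) z(2)] z by auto
      qed
      have ce: "const_mat ?M $$ (k,l) = rf_const (M k l)" if "k < n" "l < n" for k l
        using that by (simp add: const_mat_def)
      have te: "\<not> rf_pole (t l k) z \<and> rf_eval (t l k) z = Pf k i (1 / z) * of_real (M k l) * Pf l j z" if "k < n" "l < n" for k l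
        unfolding t_def ce[OF that] using pe[OF that(1)] scaled_eval[OF that(2) ij(2) z(1)]
        by (simp add: rf_mult)
      have "\<not> rf_pole (\<Sum>k<n. t l k) z \<and> rf_eval (\<Sum>k<n. t l k) z = (\<Sum>k<n. Pf k i (1 / z) * of_real (M k l) * Pf l j z)" if "l < n" for l
        using rf_sum[of "{..<n}" "t l" z] te that by simp
      then have "\<not> rf_pole (\<Sum>l<n. \<Sum>k<n. t l k) z \<and> rf_eval (\<Sum>l<n. \<Sum>k<n. t l k) z = (\<Sum>l<n. \<Sum>k<n. Pf k i (1 / z) * of_real (M k l) * Pf l j z)"
        using rf_sum[of "{..<n}" "\<lambda>l. \<Sum>k<n. t l k" z] by simp
      moreover have "\<not> rf_pole (scale_mat \<rho> \<Pi>m $$ (i,j)) z" using RL_inf_D[OF R ij z(1)] .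
      ultimately show "z \<in> {z. \<not> rf_pole (scale_mat \<rho> \<Pi>m $$ (i,j)) z \<and> \<not> rf_pole (\<Sum>l<n. \<Sum>k<n. t l k) z
         \<and> rf_eval (scale_mat \<rho> \<Pi>m $$ (i,j)) z = rf_eval (\<Sum>l<n. \<Sum>k<n. t l k) z}"
        using e[OF ij z(1)] sum.swap[of "\<lambda>l k. Pf k i (1 / z) * of_real (M k l) * Pf l j z" "{..<n}" "{..<n}"] by simp
    qed
    ultimately show "scale_mat \<rho> \<Pi>m $$ (i,j) = (para_mat ?S * const_mat ?M * ?S) $$ (i,j)" by simp
  qed (use S pS RL_inf_carrier[OF R] in auto)
  then show ?thesis unfolding rho_factorization_def using scaled_RH by simp
qed

lemma filter_carrier: "filter_response Psi u t \<in> carrier_vec n"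
  using carrier by (simp add: filter_response_def)

text \<open>In weighted coordinates filtering becomes multiplication by F/d, and \<rho>
  disappears.\<close>

lemma filter_fps:
  assumes u: "\<And>t. u t \<in> carrier_vec n" and i: "i < n"
  shows "wsig \<rho> (filter_response Psi u) i = (\<Sum>j<n. fps_of_poly (F i j) * inverse (fps_of_poly d) * wsig \<rho> u j)"
proof (rule fps_ext)
  fix t
  define h where "h j = fps_of_poly (F i j) * inverse (fps_of_poly d)" for j
  have imp: "rf_impulse (Psi $$ (i,j)) k = fps_nth (h j) k * \<rho> ^ k" if "j < n" for j k
  proof -
    have "rf_impulse (Psi $$ (i,j)) k = fps_nth (fps_of_poly (scl \<rho> (F i j)) * inverse (fps_of_poly (scl \<rho> d))) k"
      using entry[OF i that] degK(1) degK(2)[OF i that] d0 by (intro rf_impulse_fraction) (auto simp: coeff_scl)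
    also have "\<dots> = fps_nth (fscl \<rho> (h j)) k"
      using d0 by (simp add: h_def fscl_mult fscl_inverse fscl_poly)
    finally show ?thesis by (simp add: fscl_def)
  qed
  have "filter_response Psi u t $ i = (\<Sum>k\<le>t. \<Sum>j<n. fps_nth (h j) k * \<rho> ^ k * u (t - k) $ j)"
  proof -
    have "filter_response Psi u t $ i = (\<Sum>k\<le>t. (map_mat (\<lambda>r. rf_impulse r k) Psi *\<^sub>v u (t - k)) $ i)"
      using carrier i by (simp add: filter_response_def)
    also have "\<dots> = (\<Sum>k\<le>t. \<Sum>j<n. fps_nth (h j) k * \<rho> ^ k * u (t - k) $ j)"
      using carrier i u by (intro sum.cong refl)
        (auto simp: scalar_prod_def atLeast0LessThan imp carrier_vecD[OF u] intro!: sum.cong)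
    finally show ?thesis .
  qed
  then have "fps_nth (wsig \<rho> (filter_response Psi u) i) t = (\<Sum>k\<le>t. \<Sum>j<n. fps_nth (h j) k * \<rho> ^ k * u (t - k) $ j) / \<rho> ^ t"
    by (simp add: wsig_def)
  also have "\<dots> = (\<Sum>k\<le>t. \<Sum>j<n. fps_nth (h j) k * (u (t - k) $ j / \<rho> ^ (t - k)))"
    unfolding sum_divide_distrib using \<rho> by (intro sum.cong refl) (simp add: power_diff)
  also have "\<dots> = (\<Sum>j<n. \<Sum>k\<le>t. fps_nth (h j) k * (u (t - k) $ j / \<rho> ^ (t - k)))" by (rule sum.swap)
  also have "\<dots> = fps_nth (\<Sum>j<n. h j * wsig \<rho> u j) t"
    by (simp add: fps_sum_nth fps_mult_nth wsig_def atLeast0AtMost)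
  finally show "fps_nth (wsig \<rho> (filter_response Psi u) i) t = fps_nth (\<Sum>j<n. fps_of_poly (F i j) * inverse (fps_of_poly d) * wsig \<rho> u j) t"
    unfolding h_def .
qed

end

section \<open>Energies of filter outputs in time and frequency, and truncation\<close>

section \<open>From the IQC to the hard IQC\<close>

lemma zts_cong_AE:
  assumes "zts A f" and [measurable]: "g \<in> borel_measurable borel"
    and "AE \<theta> in lborel. \<theta> \<in> {0..2*pi} \<longrightarrow> f (cis \<theta>) = g (cis \<theta>)"
  shows "zts A g"
proof -
  have "circ (\<lambda>z. g z - zt_partial 1 (fps_nth A) N z) = circ (\<lambda>z. f z - zt_partial 1 (fps_nth A) N z)" for N
    by (rule nn_integral_cong_AE) (use assms(3) in \<open>auto elim!: eventually_mono simp: indicator_def\<close>)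
  then show ?thesis using assms unfolding zts_def is_zt_def by simp
qed

lemma zts_borel: "zts A f \<Longrightarrow> f \<in> borel_measurable borel"
  by (simp add: zts_def is_zt_def)

lemma cpoly_borel [measurable]: "(\<lambda>z. cpoly p (1 / z)) \<in> borel_measurable borel"
proof -
  have "cpoly p \<in> borel_measurable borel" by (intro borel_measurable_continuous_onI cpoly_continuous)
  moreover have "(\<lambda>z::complex. 1 / z) \<in> borel_measurable borel" by measurable
  ultimately show ?thesis by (rule measurable_compose[rotated])
qed

text \<open>The inverse of d is not a polynomial, so the rule for products is used backwards: the
  transform of P is multiplied by d, identified with g by uniqueness, and divided again on the
  circle, where d has no zeros.\<close>

lemma zts_divide:
  assumes P: "l2f P" and e: "fps_of_poly d * P = Q" and Q: "zts Q g"
    and d: "\<And>x. cmod x \<le> 1 \<Longrightarrow> cpoly d x \<noteq> 0"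
  shows "zts P (\<lambda>z. g z / cpoly d (1 / z))"
proof -
  obtain f where f: "zts P f" using zts_exists[OF P] by blast
  have "zts Q (\<lambda>z. cpoly d (1 / z) * f z)" using zts_poly_mult[OF f, of d] e by simp
  from zts_unique[OF this Q] have "AE \<theta> in lborel. \<theta> \<in> {0..2*pi} \<longrightarrow> f (cis \<theta>) = g (cis \<theta>) / cpoly d (1 / cis \<theta>)"
  proof eventually_elim
    case (elim \<theta>)
    have "cpoly d (1 / cis \<theta>) \<noteq> 0" by (intro d) (simp add: norm_divide)
    with elim show ?case by (auto simp: field_simps)
  qed
  moreover have [measurable]: "g \<in> borel_measurable borel" by (rule zts_borel[OF Q])
  have "(\<lambda>z. g z / cpoly d (1 / z)) \<in> borel_measurable borel" by measurable
  ultimately show ?thesis by (intro zts_cong_AE[OF f])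
qed

lemma zts_mult_integrable:
  assumes "zts A f" "l2f A" "zts B g" "l2f B"
  shows "integrable lborel (\<lambda>\<theta>. indicator {0..2*pi} \<theta> *\<^sub>R (cnj (f (cis \<theta>)) * g (cis \<theta>)))"
proof (rule Bochner_Integration.integrable_bound)
  have [measurable]: "f \<in> borel_measurable borel" "g \<in> borel_measurable borel"
    using assms by (auto intro: zts_borel)
  have [measurable]: "(\<lambda>\<theta>. f (cis \<theta>)) \<in> borel_measurable borel" "(\<lambda>\<theta>. g (cis \<theta>)) \<in> borel_measurable borel"
    by (intro circ_borel; measurable)+
  have [measurable]: "cnj \<in> borel_measurable borel"
    by (intro borel_measurable_continuous_onI continuous_intros)
  show "integrable lborel (\<lambda>\<theta>. indicator {0..2*pi} \<theta> * (cmod (f (cis \<theta>)))\<^sup>2 + indicator {0..2*pi} \<theta> * (cmod (g (cis \<theta>)))\<^sup>2)"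
    using parseval_sq[OF assms(1,2)] parseval_sq[OF assms(3,4)]
    by (intro Bochner_Integration.integrable_add) (auto simp: has_bochner_integral_iff)
  have [measurable]: "(\<lambda>\<theta>. cnj (f (cis \<theta>))) \<in> borel_measurable borel"
    by (rule measurable_compose[of "\<lambda>\<theta>. f (cis \<theta>)" _ borel]) measurable
  show "(\<lambda>\<theta>. indicator {0..2*pi} \<theta> *\<^sub>R (cnj (f (cis \<theta>)) * g (cis \<theta>))) \<in> borel_measurable lborel"
    by measurable
  have "norm (cnj x * y) \<le> (cmod x)\<^sup>2 + (cmod y)\<^sup>2" for x y
  proof -
    have "2 * (cmod x * cmod y) \<le> (cmod x)\<^sup>2 + (cmod y)\<^sup>2" using sum_squares_bound[of "cmod x" "cmod y"] by simp
    moreover have "0 \<le> cmod x * cmod y" by simp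
    ultimately show ?thesis unfolding norm_mult complex_mod_cnj by linarith
  qed
  then show "AE \<theta> in lborel. norm (indicator {0..2*pi} \<theta> *\<^sub>R (cnj (f (cis \<theta>)) * g (cis \<theta>)))
      \<le> norm (indicator {0..2*pi} \<theta> * (cmod (f (cis \<theta>)))\<^sup>2 + indicator {0..2*pi} \<theta> * (cmod (g (cis \<theta>)))\<^sup>2)"
    by (intro AE_I2) (auto simp: indicator_def abs_of_nonneg)
qed

text \<open>The quadratic form of M at time t of the output P; its sum over t is called energy
  below, whatever its sign.\<close>

definition qM :: "nat \<Rightarrow> (nat \<Rightarrow> nat \<Rightarrow> real) \<Rightarrow> (nat \<Rightarrow> real fps) \<Rightarrow> nat \<Rightarrow> real" where
  "qM n M P t = (\<Sum>k<n. \<Sum>l<n. M k l * (fps_nth (P k) t * fps_nth (P l) t))"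

lemma qM_summable:
  assumes "\<And>k. k < n \<Longrightarrow> l2f (P k)" shows "summable (qM n M P)"
  unfolding qM_def using assms by (intro summable_sum summable_mult l2f_summable_mult) auto

lemma qM_parseval:
  assumes P: "\<And>k. k < n \<Longrightarrow> l2f (P k)" "\<And>k. k < n \<Longrightarrow> zts (P k) (p k)"
  shows "integrable lborel (\<lambda>\<theta>. indicator {0..2*pi} \<theta> *\<^sub>R (\<Sum>k<n. \<Sum>l<n. of_real (M k l) * (cnj (p k (cis \<theta>)) * p l (cis \<theta>))))"
    "has_bochner_integral lborel (\<lambda>\<theta>. indicator {0..2*pi} \<theta> * Re (\<Sum>k<n. \<Sum>l<n. of_real (M k l) * (cnj (p k (cis \<theta>)) * p l (cis \<theta>))))
      (2 * pi * (\<Sum>t. qM n M P t))"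
proof -
  have "integrable lborel (\<lambda>\<theta>. \<Sum>k<n. \<Sum>l<n. of_real (M k l) * (indicator {0..2*pi} \<theta> *\<^sub>R (cnj (p k (cis \<theta>)) * p l (cis \<theta>))))"
    using P by (intro Bochner_Integration.integrable_sum integrable_mult_right zts_mult_integrable) auto
  then show "integrable lborel (\<lambda>\<theta>. indicator {0..2*pi} \<theta> *\<^sub>R (\<Sum>k<n. \<Sum>l<n. of_real (M k l) * (cnj (p k (cis \<theta>)) * p l (cis \<theta>))))"
    by (simp add: scaleR_sum_right)
  have "has_bochner_integral lborel (\<lambda>\<theta>. \<Sum>k<n. \<Sum>l<n. M k l * (indicator {0..2*pi} \<theta> * Re (cnj (p k (cis \<theta>)) * p l (cis \<theta>))))
     (\<Sum>k<n. \<Sum>l<n. M k l * (2 * pi * (\<Sum>t. fps_nth (P k) t * fps_nth (P l) t)))"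
    using P by (intro has_bochner_integral_sum has_bochner_integral_mult_right parseval) auto
  also have "(\<lambda>\<theta>. \<Sum>k<n. \<Sum>l<n. M k l * (indicator {0..2*pi} \<theta> * Re (cnj (p k (cis \<theta>)) * p l (cis \<theta>))))
    = (\<lambda>\<theta>. indicator {0..2*pi} \<theta> * Re (\<Sum>k<n. \<Sum>l<n. of_real (M k l) * (cnj (p k (cis \<theta>)) * p l (cis \<theta>))))"
    by (auto simp: fun_eq_iff indicator_def)
  also have "(\<Sum>k<n. \<Sum>l<n. M k l * (2 * pi * (\<Sum>t. fps_nth (P k) t * fps_nth (P l) t))) = 2 * pi * (\<Sum>t. qM n M P t)"
  proof -
    have s: "summable (\<lambda>t. M k l * (fps_nth (P k) t * fps_nth (P l) t))" if "k < n" "l < n" for k l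
      using P that by (intro summable_mult l2f_summable_mult) auto
    have "(\<Sum>t. qM n M P t) = (\<Sum>k<n. \<Sum>t. \<Sum>l<n. M k l * (fps_nth (P k) t * fps_nth (P l) t))"
      unfolding qM_def by (rule suminf_sum) (use s in \<open>auto intro: summable_sum\<close>)
    also have "\<dots> = (\<Sum>k<n. \<Sum>l<n. \<Sum>t. M k l * (fps_nth (P k) t * fps_nth (P l) t))"
      by (intro sum.cong refl suminf_sum) (use s in auto)
    also have "\<dots> = (\<Sum>k<n. \<Sum>l<n. M k l * (\<Sum>t. fps_nth (P k) t * fps_nth (P l) t))"
      using P by (intro sum.cong refl suminf_mult l2f_summable_mult) auto
    finally show ?thesis by (simp add: sum_distrib_left mult_ac)
  qed
  finally show "has_bochner_integral lborel (\<lambda>\<theta>. indicator {0..2*pi} \<theta> * Re (\<Sum>k<n. \<Sum>l<n. of_real (M k l) * (cnj (p k (cis \<theta>)) * p l (cis \<theta>))))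
      (2 * pi * (\<Sum>t. qM n M P t))" .
qed

locale iqc = psi \<rho> "a + b" F d for \<rho> a b F d +
  fixes M :: "nat \<Rightarrow> nat \<Rightarrow> real" and \<Pi>m :: "ratfun mat"
  assumes M: "\<And>i j. i < a + b \<Longrightarrow> j < a + b \<Longrightarrow> M i j = M j i"
    and PN: "strict_PN a b (scale_mat \<rho> \<Pi>m)"
    and fact: "\<And>i j z. i < a + b \<Longrightarrow> j < a + b \<Longrightarrow> cmod z = 1 \<Longrightarrow>
       rf_eval (scale_mat \<rho> \<Pi>m $$ (i,j)) z = (\<Sum>k<a + b. \<Sum>l<a + b. Pf k i (1 / z) * of_real (M k l) * Pf l j z)"
begin

sublocale S: strict_PN_at a b "scale_mat \<rho> \<Pi>m" by unfold_locales (rule PN)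

abbreviation n :: nat where "n \<equiv> a + b"

lemma Pi_carrier: "\<Pi>m \<in> carrier_mat n n"
  using S.carrier by (auto simp: scale_mat_def)

lemma Pi_eval:
  assumes "i < n" "j < n" "cmod z = 1"
  shows "rf_eval (\<Pi>m $$ (i,j)) (of_real \<rho> * z) = S.r i j z"
proof -
  have e: "scale_mat \<rho> \<Pi>m $$ (i,j) = rf_compose (\<Pi>m $$ (i,j)) (rf_const \<rho> * rf_z)"
    using assms Pi_carrier by (simp add: scale_mat_def)
  have "\<not> rf_pole (\<Pi>m $$ (i,j)) (of_real \<rho> * z)"
    using S.no_pole[OF assms] \<rho> unfolding e by (intro rf_scale_pole) auto
  then show ?thesis using \<rho> unfolding e by (simp add: rf_scale_eval)
qed

definition psiF :: "nat \<Rightarrow> nat \<Rightarrow> real fps" where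
  "psiF i j = fps_of_poly (F i j) * inverse (fps_of_poly d)"

text \<open>The filter of \<open>filter_fps\<close>, for arbitrary power series as inputs.\<close>

definition resp :: "(nat \<Rightarrow> real fps) \<Rightarrow> nat \<Rightarrow> real fps" where
  "resp U k = (\<Sum>j<n. psiF k j * U j)"

lemma l1_psiF: "l1f (psiF i j)"
  unfolding psiF_def using d by (intro l1f_mult l1f_poly l1f_inverse_poly)

lemma l2_resp: "(\<And>j. j < n \<Longrightarrow> l2f (U j)) \<Longrightarrow> l2f (resp U k)"
  unfolding resp_def by (intro l2f_sum l2f_l1f_mult l1_psiF) auto

lemma d_inverse: "fps_of_poly d * inverse (fps_of_poly d) = 1"
  using d0 by (intro inverse_mult_eq_1') simp

lemma d_resp: "fps_of_poly d * resp U k = (\<Sum>j<n. fps_of_poly (F k j) * U j)"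
proof -
  have "fps_of_poly d * (psiF k j * U j) = fps_of_poly (F k j) * U j" for j
  proof -
    have "fps_of_poly d * (psiF k j * U j) = (fps_of_poly d * inverse (fps_of_poly d)) * (fps_of_poly (F k j) * U j)"
      by (simp only: psiF_def mult_ac)
    then show ?thesis by (simp only: d_inverse mult_1)
  qed
  then show ?thesis unfolding resp_def sum_distrib_left by (intro sum.cong refl)
qed

lemma zts_resp:
  assumes "\<And>j. j < n \<Longrightarrow> l2f (U j)" "\<And>j. j < n \<Longrightarrow> zts (U j) (f j)"
  shows "zts (resp U k) (\<lambda>z. \<Sum>j<n. Pf k j z * f j z)"
proof -
  have "zts (resp U k) (\<lambda>z. (\<Sum>j<n. cpoly (F k j) (1 / z) * f j z) / cpoly d (1 / z))"
    by (rule zts_divide[OF l2_resp d_resp _ d]) (use assms in \<open>auto intro!: zts_sum zts_poly_mult\<close>)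
  then show ?thesis by (simp add: Pf_def sum_divide_distrib)
qed

lemma Pf_cnj: "cmod z = 1 \<Longrightarrow> Pf k i (1 / z) = cnj (Pf k i z)"
  using unit_cnj[of z] by (simp add: Pf_def cpoly_cnj[symmetric])

lemma form_eq:
  assumes "cmod z = 1"
  shows "(\<Sum>k<n. \<Sum>l<n. of_real (M k l) * (cnj (\<Sum>j<n. Pf k j z * f j) * (\<Sum>j<n. Pf l j z * f j)))
    = (\<Sum>i<n. \<Sum>j<n. cnj (f i) * S.r i j z * f j)"
proof -
  have "(\<Sum>i<n. \<Sum>j<n. cnj (f i) * S.r i j z * f j)
    = (\<Sum>i<n. \<Sum>j<n. \<Sum>k<n. \<Sum>l<n. of_real (M k l) * (cnj (Pf k i z * f i) * (Pf l j z * f j)))"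
    using assms by (intro sum.cong refl) (simp add: fact Pf_cnj sum_distrib_left sum_distrib_right mult_ac)
  also have "\<dots> = (\<Sum>i<n. \<Sum>k<n. \<Sum>l<n. \<Sum>j<n. of_real (M k l) * (cnj (Pf k i z * f i) * (Pf l j z * f j)))"
    by (rule sum.cong[OF refl], subst sum.swap, rule sum.cong[OF refl], rule sum.swap)
  also have "\<dots> = (\<Sum>k<n. \<Sum>l<n. \<Sum>i<n. \<Sum>j<n. of_real (M k l) * (cnj (Pf k i z * f i) * (Pf l j z * f j)))"
    by (subst sum.swap, rule sum.cong[OF refl], rule sum.swap)
  also have "\<dots> = (\<Sum>k<n. \<Sum>l<n. of_real (M k l) * (cnj (\<Sum>j<n. Pf k j z * f j) * (\<Sum>j<n. Pf l j z * f j)))"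
    by (simp only: cnj_sum sum_product) (simp only: sum_distrib_left)
  finally show ?thesis by simp
qed

text \<open>Through the factorization, the energy of the output is an integral of the multiplier.
  The functions \<open>f\<close> have to represent P on the circle and are otherwise
  arbitrary.\<close>

lemma energy:
  assumes P: "\<And>k. k < n \<Longrightarrow> l2f (P k)" "\<And>k. k < n \<Longrightarrow> zts (P k) (\<lambda>z. \<Sum>j<n. Pf k j z * f j z)"
  shows "integrable lborel (\<lambda>\<theta>. indicator {0..2*pi} \<theta> *\<^sub>R (\<Sum>i<n. \<Sum>j<n. cnj (f i (cis \<theta>)) * S.r i j (cis \<theta>) * f j (cis \<theta>)))"
    "has_bochner_integral lborel (\<lambda>\<theta>. indicator {0..2*pi} \<theta> * Re (\<Sum>i<n. \<Sum>j<n. cnj (f i (cis \<theta>)) * S.r i j (cis \<theta>) * f j (cis \<theta>)))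
      (2 * pi * (\<Sum>t. qM n M P t))"
  using qM_parseval[where n=n and P=P and p="\<lambda>k z. \<Sum>j<n. Pf k j z * f j z" and M=M, OF P] by (simp_all only: form_eq[OF norm_cis])

text \<open>Serves the sign condition of the hard IQC, with an empty family W, and the negative
  bound behind the LMI.\<close>

lemma energy_le:
  assumes P: "\<And>k. k < n \<Longrightarrow> l2f (P k)" "\<And>k. k < n \<Longrightarrow> zts (P k) (\<lambda>z. \<Sum>j<n. Pf k j z * f j z)"
    and w: "\<And>i. i < nw \<Longrightarrow> l2f (W i)" "\<And>i. i < nw \<Longrightarrow> zts (W i) (w i)"
    and le: "AE \<theta> in lborel. \<theta> \<in> {0..2*pi} \<longrightarrow>
      Re (\<Sum>i<n. \<Sum>j<n. cnj (f i (cis \<theta>)) * S.r i j (cis \<theta>) * f j (cis \<theta>)) \<le> c * (\<Sum>i<nw. (cmod (w i (cis \<theta>)))\<^sup>2)"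
  shows "(\<Sum>t. qM n M P t) \<le> c * (\<Sum>i<nw. \<Sum>t. (fps_nth (W i) t)\<^sup>2)"
proof -
  note I1 = energy(2)[where P=P and f=f, OF P]
  have I2: "has_bochner_integral lborel (\<lambda>\<theta>. c * (\<Sum>i<nw. indicator {0..2*pi} \<theta> * (cmod (w i (cis \<theta>)))\<^sup>2))
     (c * (\<Sum>i<nw. 2 * pi * (\<Sum>t. (fps_nth (W i) t)\<^sup>2)))"
    using w by (intro has_bochner_integral_mult_right has_bochner_integral_sum parseval_sq) auto
  have AE: "AE \<theta> in lborel. indicator {0..2*pi} \<theta> * Re (\<Sum>i<n. \<Sum>j<n. cnj (f i (cis \<theta>)) * S.r i j (cis \<theta>) * f j (cis \<theta>))
     \<le> c * (\<Sum>i<nw. indicator {0..2*pi} \<theta> * (cmod (w i (cis \<theta>)))\<^sup>2)"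
    using le by eventually_elim (auto simp: indicator_def)
  have "2 * pi * (\<Sum>t. qM n M P t) \<le> c * (\<Sum>i<nw. 2 * pi * (\<Sum>t. (fps_nth (W i) t)\<^sup>2))"
    using integral_mono_AE[OF integrable.intros[OF I1] integrable.intros[OF I2] AE]
    by (simp only: has_bochner_integral_integral_eq[OF I1] has_bochner_integral_integral_eq[OF I2])
  also have "\<dots> = 2 * pi * (c * (\<Sum>i<nw. \<Sum>t. (fps_nth (W i) t)\<^sup>2))"
    by (simp add: sum_distrib_left mult_ac)
  finally show ?thesis using pi_gt_zero by simp
qed

lemma energy_nonpos:
  assumes P: "\<And>k. k < n \<Longrightarrow> l2f (P k)" "\<And>k. k < n \<Longrightarrow> zts (P k) (\<lambda>z. \<Sum>j<n. Pf k j z * f j z)"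
    and "\<And>j. j < a \<Longrightarrow> f j = (\<lambda>_. 0)"
  shows "(\<Sum>t. qM n M P t) \<le> 0"
proof -
  have "Re (\<Sum>i<n. \<Sum>j<n. cnj (f i z) * S.r i j z * f j z) \<le> 0" if z: "cmod z = 1" for z
  proof -
    have "(\<Sum>i<n. \<Sum>j<n. cnj (f i z) * S.r i j z * f j z) = (\<Sum>i<b. \<Sum>j<b. cnj (f (i + a) z) * S.r (i + a) (j + a) z * f (j + a) z)"
      using assms(3) by (simp add: sum_lessThan_add[of _ a b])
    then show ?thesis using S.block2_neg[OF z, of "\<lambda>i. f (i + a) z"]
      by (cases "\<exists>i<b. f (i + a) z \<noteq> 0") auto
  qed
  then show ?thesis using energy_le[where P=P and f=f, OF P, of 0 "\<lambda>_. 0" "\<lambda>_ _. 0" 0] by simp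
qed

lemma energy_nonneg:
  assumes P: "\<And>k. k < n \<Longrightarrow> l2f (P k)" "\<And>k. k < n \<Longrightarrow> zts (P k) (\<lambda>z. \<Sum>j<n. Pf k j z * f j z)"
    and "\<And>j. j \<ge> a \<Longrightarrow> f j = (\<lambda>_. 0)"
  shows "(\<Sum>t. qM n M P t) \<ge> 0"
proof -
  have r: "Re (\<Sum>i<n. \<Sum>j<n. cnj (f i z) * S.r i j z * f j z) \<ge> 0" if z: "cmod z = 1" for z
  proof -
    have "(\<Sum>i<n. \<Sum>j<n. cnj (f i z) * S.r i j z * f j z) = (\<Sum>i<a. \<Sum>j<a. cnj (f i z) * S.r i j z * f j z)"
      using assms(3) by (simp add: sum_lessThan_add[of _ a b])
    then show ?thesis using S.block1_pos[OF z, of "\<lambda>i. f i z"]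
      by (cases "\<exists>i<a. f i z \<noteq> 0") auto
  qed
  have "0 \<le> (LINT \<theta>|lborel. indicator {0..2*pi} \<theta> * Re (\<Sum>i<n. \<Sum>j<n. cnj (f i (cis \<theta>)) * S.r i j (cis \<theta>) * f j (cis \<theta>)))"
    by (intro integral_nonneg_AE AE_I2) (simp add: r indicator_def del: Re_sum)
  then have "0 \<le> 2 * pi * (\<Sum>t. qM n M P t)"
    by (simp only: has_bochner_integral_integral_eq[OF energy(2)[where P=P and f=f, OF P]])
  then show ?thesis using pi_gt_zero by (simp add: zero_le_mult_iff)
qed

end

lemma causal_convolution:
  assumes "\<And>t. t < T \<Longrightarrow> fps_nth A t = fps_nth B t" "t < T"
  shows "fps_nth (H * A) t = fps_nth (H * B) t"
  unfolding fps_mult_nth using assms by (intro sum.cong refl) auto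

lemma l2f_truncate: "l2f (Abs_fps (\<lambda>t. if t < T then f t else 0))"
  unfolding l2f_def by (rule summable_finite[of "{..<T}"]) auto

lemma scalar_prod_self: "(v :: real vec) \<in> carrier_vec n \<Longrightarrow> v \<bullet> v = (\<Sum>i<n. (v $ i)\<^sup>2)"
  by (auto simp: scalar_prod_def atLeast0LessThan power2_eq_square intro!: sum.cong)

lemma l2rho_component:
  assumes "\<rho> > 0" "q \<in> l2rho \<rho> n" "i < n" shows "l2f (wsig \<rho> q i)"
proof -
  have q: "q t \<in> carrier_vec n" for t using assms by (auto simp: l2rho_def l2e_def)
  have s: "summable (\<lambda>k. (q k \<bullet> q k) / \<rho> ^ (2 * k))" using assms by (simp add: l2rho_def)
  have e: "(fps_nth (wsig \<rho> q i) k)\<^sup>2 = (q k $ i)\<^sup>2 / \<rho> ^ (2 * k)" for k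
    by (simp add: wsig_def power_divide power_mult[symmetric] mult.commute)
  have le: "(q k $ i)\<^sup>2 \<le> q k \<bullet> q k" for k
    unfolding scalar_prod_self[OF q] using assms(3) by (intro member_le_sum[where f="\<lambda>i. (q k $ i)\<^sup>2"]) auto
  show ?thesis unfolding l2f_def
    by (rule summable_comparison_test'[OF s, of 0]) (use assms(1) le in \<open>auto simp: e divide_right_mono\<close>)
qed

lemma l2rho_intro:
  assumes "\<rho> > 0" "\<And>t. q t \<in> carrier_vec n" "\<And>i. i < n \<Longrightarrow> l2f (wsig \<rho> q i)" shows "q \<in> l2rho \<rho> n"
proof -
  have "summable (\<lambda>k. \<Sum>i<n. (fps_nth (wsig \<rho> q i) k)\<^sup>2)"
    using assms(3) unfolding l2f_def by (intro summable_sum) auto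
  moreover have "(\<Sum>i<n. (fps_nth (wsig \<rho> q i) k)\<^sup>2) = (q k \<bullet> q k) / \<rho> ^ (2 * k)" for k
    unfolding scalar_prod_self[OF assms(2)] sum_divide_distrib
    by (simp add: wsig_def power_divide power_mult[symmetric] mult.commute)
  ultimately show ?thesis using assms(2) by (simp add: l2rho_def l2e_def)
qed

lemma zts_zt:
  assumes "\<rho> > 0" "l2f (wsig \<rho> q i)" shows "zts (wsig \<rho> q i) (zt \<rho> (\<lambda>k. q k $ i))"
proof -
  obtain f where "zts (wsig \<rho> q i) f" using zts_exists[OF assms(2)] by blast
  then have "is_zt \<rho> (\<lambda>k. q k $ i) f" by (simp add: is_zt_scale wsig_def)
  then have "is_zt \<rho> (\<lambda>k. q k $ i) (zt \<rho> (\<lambda>k. q k $ i))" unfolding zt_def by (rule someI[of "is_zt \<rho> (\<lambda>k. q k $ i)"])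
  then show ?thesis by (simp add: is_zt_scale wsig_def)
qed

context iqc
begin

text \<open>The form in which the IQC is applied: nonnegative total energy of the filter
  output.\<close>

lemma IQC_energy:
  assumes "rho_IQC \<rho> a b \<Pi>m \<Delta>" "y \<in> l2rho \<rho> a" "\<Delta> y \<in> l2rho \<rho> b"
  shows "0 \<le> (\<Sum>t. qM n M (resp (wsig \<rho> (\<lambda>t. y t @\<^sub>v \<Delta> y t))) t)"
proof -
  define U where "U = wsig \<rho> (\<lambda>t. y t @\<^sub>v \<Delta> y t)"
  define f where "f j z = (if j < a then zt \<rho> (\<lambda>k. y k $ j) z else zt \<rho> (\<lambda>k. \<Delta> y k $ (j - a)) z)" for j z
  have yc: "y t \<in> carrier_vec a" "\<Delta> y t \<in> carrier_vec b" for t using assms by (auto simp: l2rho_def l2e_def)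
  have Uy: "U j = wsig \<rho> y j" if "j < a" for j
    using that yc by (intro fps_ext) (simp add: U_def wsig_def carrier_vecD[OF yc(1)] carrier_vecD[OF yc(2)])
  have Uw: "U j = wsig \<rho> (\<Delta> y) (j - a)" if "a \<le> j" "j < n" for j
    using that yc by (intro fps_ext) (simp add: U_def wsig_def carrier_vecD[OF yc(1)] carrier_vecD[OF yc(2)])
  have U: "l2f (U j)" "zts (U j) (f j)" if "j < n" for j
  proof -
    have "l2f (U j) \<and> zts (U j) (f j)"
    proof (cases "j < a")
      case True
      have "l2f (wsig \<rho> y j)" by (rule l2rho_component[OF \<rho>(1) assms(2) True])
      moreover have "f j = zt \<rho> (\<lambda>k. y k $ j)" using True by (auto simp: f_def)
      ultimately show ?thesis using zts_zt[OF \<rho>(1), of y j] Uy[OF True] by simp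
    next
      case False
      then have j: "a \<le> j" "j - a < b" using that by auto
      have "l2f (wsig \<rho> (\<Delta> y) (j - a))" by (rule l2rho_component[OF \<rho>(1) assms(3) j(2)])
      moreover have "f j = zt \<rho> (\<lambda>k. \<Delta> y k $ (j - a))" using False by (auto simp: f_def)
      ultimately show ?thesis using zts_zt[OF \<rho>(1), of "\<Delta> y" "j - a"] Uw[OF j(1) that] by simp
    qed
    then show "l2f (U j)" "zts (U j) (f j)" by auto
  qed
  have P: "\<And>k. k < n \<Longrightarrow> l2f (resp U k)" "\<And>k. k < n \<Longrightarrow> zts (resp U k) (\<lambda>z. \<Sum>j<n. Pf k j z * f j z)"
    using U by (auto intro!: l2_resp zts_resp)
  have q: "quad_form (eval_mat \<Pi>m (of_real \<rho> * cis \<theta>)) (zt_vec \<rho> a y (cis \<theta>) @\<^sub>v zt_vec \<rho> b (\<Delta> y) (cis \<theta>))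
     = (\<Sum>i<n. \<Sum>j<n. cnj (f i (cis \<theta>)) * S.r i j (cis \<theta>) * f j (cis \<theta>))" for \<theta>
  proof -
    have v: "(zt_vec \<rho> a y (cis \<theta>) @\<^sub>v zt_vec \<rho> b (\<Delta> y) (cis \<theta>)) $ i = f i (cis \<theta>)" if "i < n" for i
      using that by (auto simp: zt_vec_def f_def)
    have "zt_vec \<rho> a y (cis \<theta>) @\<^sub>v zt_vec \<rho> b (\<Delta> y) (cis \<theta>) \<in> carrier_vec n"
      by (auto simp: zt_vec_def)
    then show ?thesis using Pi_carrier
      by (subst quad_form_sum[of _ n]) (auto simp: eval_mat_def v Pi_eval intro!: sum.cong)
  qed
  note E = energy[where P="resp U" and f=f, OF P]
  have "0 \<le> (LINT \<theta>:{0..2*pi}|lborel.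
            quad_form (eval_mat \<Pi>m (of_real \<rho> * cis \<theta>)) (zt_vec \<rho> a y (cis \<theta>) @\<^sub>v zt_vec \<rho> b (\<Delta> y) (cis \<theta>)))"
    using assms(1,2) by (simp add: rho_IQC_def)
  then have "0 \<le> (LINT \<theta>|lborel. indicator {0..2*pi} \<theta> *\<^sub>R (\<Sum>i<n. \<Sum>j<n. cnj (f i (cis \<theta>)) * S.r i j (cis \<theta>) * f j (cis \<theta>)))"
    unfolding q set_lebesgue_integral_def .
  \<comment> \<open>The integral is complex-valued; its nonnegativity passes to the real part, which
    Parseval evaluates.\<close>
  then have "0 \<le> Re (LINT \<theta>|lborel. indicator {0..2*pi} \<theta> *\<^sub>R (\<Sum>i<n. \<Sum>j<n. cnj (f i (cis \<theta>)) * S.r i j (cis \<theta>) * f j (cis \<theta>)))"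
    by (simp only: less_eq_complex_def zero_complex.sel)
  also have "\<dots> = (LINT \<theta>|lborel. Re (indicator {0..2*pi} \<theta> *\<^sub>R (\<Sum>i<n. \<Sum>j<n. cnj (f i (cis \<theta>)) * S.r i j (cis \<theta>) * f j (cis \<theta>))))"
    by (rule integral_bounded_linear[OF bounded_linear_Re E(1), symmetric])
  also have "\<dots> = 2 * pi * (\<Sum>t. qM n M (resp U) t)"
    using has_bochner_integral_integral_eq[OF E(2)] by (simp only: scaleR_complex.sel)
  finally show ?thesis unfolding U_def[symmetric] using pi_gt_zero by (simp add: zero_le_mult_iff)
qed

text \<open>The inverse of F/d is d F^(-1), stable and causal by
  \<open>stable_inverse\<close>.\<close>

lemma inverse_filter:
  obtains h where "\<And>i j. l1f (h i j)"
    "\<And>W k. k < n \<Longrightarrow> resp (\<lambda>j. \<Sum>l<n. h j l * W l) k = W k"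
    "\<And>U j. j < n \<Longrightarrow> (\<Sum>l<n. h j l * resp U l) = U j"
proof -
  obtain H where H: "\<And>i j. l1f (H i j)"
    "\<And>i j. i < n \<Longrightarrow> j < n \<Longrightarrow> (\<Sum>k<n. H i k * fps_of_poly (F k j)) = (if i = j then 1 else 0)"
    "\<And>i j. i < n \<Longrightarrow> j < n \<Longrightarrow> (\<Sum>k<n. fps_of_poly (F i k) * H k j) = (if i = j then 1 else 0)"
    by (rule stable_inverse[of n F]) (use F in auto)
  define h where "h i j = fps_of_poly d * H i j" for i j
  have a: "psiF k j * (h j l * X) = fps_of_poly (F k j) * H j l * X" for k j l X
  proof -
    have "psiF k j * (h j l * X) = (fps_of_poly d * inverse (fps_of_poly d)) * (fps_of_poly (F k j) * H j l * X)"
      by (simp only: psiF_def h_def mult_ac)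
    then show ?thesis by (simp only: d_inverse mult_1)
  qed
  have b: "h j k * (psiF k l * X) = H j k * fps_of_poly (F k l) * X" for k j l X
  proof -
    have "h j k * (psiF k l * X) = (fps_of_poly d * inverse (fps_of_poly d)) * (H j k * fps_of_poly (F k l) * X)"
      by (simp only: psiF_def h_def mult_ac)
    then show ?thesis by (simp only: d_inverse mult_1)
  qed
  show thesis
  proof (rule that[of h])
    show "l1f (h i j)" for i j unfolding h_def by (intro l1f_mult l1f_poly H)
    fix W :: "nat \<Rightarrow> real fps" and k assume k: "k < n"
    have "resp (\<lambda>j. \<Sum>l<n. h j l * W l) k = (\<Sum>j<n. \<Sum>l<n. fps_of_poly (F k j) * H j l * W l)"
      by (simp add: resp_def sum_distrib_left a)
    also have "\<dots> = (\<Sum>l<n. (\<Sum>j<n. fps_of_poly (F k j) * H j l) * W l)"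
      by (subst sum.swap) (simp add: sum_distrib_right)
    also have "\<dots> = (\<Sum>l<n. if k = l then W l else 0)" using k by (intro sum.cong refl) (simp add: H)
    finally show "resp (\<lambda>j. \<Sum>l<n. h j l * W l) k = W k" using k by simp
  next
    fix U :: "nat \<Rightarrow> real fps" and j assume j: "j < n"
    have "(\<Sum>l<n. h j l * resp U l) = (\<Sum>k<n. \<Sum>l<n. H j k * fps_of_poly (F k l) * U l)"
      by (simp add: resp_def sum_distrib_left b)
    also have "\<dots> = (\<Sum>l<n. (\<Sum>k<n. H j k * fps_of_poly (F k l)) * U l)"
      by (subst sum.swap) (simp add: sum_distrib_right)
    also have "\<dots> = (\<Sum>l<n. if j = l then U l else 0)" using j by (intro sum.cong refl) (simp add: H)
    finally show "(\<Sum>l<n. h j l * resp U l) = U j" using j by simp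
  qed
qed

lemma qM_wsig:
  assumes p: "p t \<in> carrier_vec n"
  shows "(p t \<bullet> (mat n n (\<lambda>(i,j). M i j) *\<^sub>v p t)) / \<rho> ^ (2 * t) = qM n M (wsig \<rho> p) t"
proof -
  have "p t \<bullet> (mat n n (\<lambda>(i,j). M i j) *\<^sub>v p t) = (\<Sum>k<n. \<Sum>l<n. p t $ k * (M k l * p t $ l))"
    using p by (auto simp: scalar_prod_def atLeast0LessThan sum_distrib_left intro!: sum.cong)
  moreover have "p t $ k * (M k l * p t $ l) / \<rho> ^ (2 * t) = M k l * (fps_nth (wsig \<rho> p k) t * fps_nth (wsig \<rho> p l) t)" for k l
    by (simp add: wsig_def mult_2 power_add)
  ultimately show ?thesis by (simp add: qM_def sum_divide_distrib)
qed

text \<open>Causality enters twice, for the inverse filter and for \<Delta>. Boundedness makes the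
  response of \<Delta> to the modified input square-summable, so that the IQC can be applied to it;
  the original y may grow arbitrarily.\<close>

theorem hard_IQC:
  assumes \<Delta>: "\<Delta> \<in> l2e a \<rightarrow> l2e b" "bounded_op \<rho> a b \<Delta>" "causal_op a \<Delta>" and IQC: "rho_IQC \<rho> a b \<Pi>m \<Delta>"
  shows "rho_hard_IQC \<rho> a Psi (mat n n (\<lambda>(i,j). M i j)) \<Delta>"
  unfolding rho_hard_IQC_def Let_def
proof (intro ballI allI impI)
  fix y T assume y: "y \<in> l2e a" and T: "(1::nat) \<le> T"
  define u where "u t = y t @\<^sub>v \<Delta> y t" for t
  have yc: "y t \<in> carrier_vec a" "\<Delta> y t \<in> carrier_vec b" for t using y \<Delta>(1) by (auto simp: l2e_def)
  have uc: "u t \<in> carrier_vec n" for t using yc by (simp add: u_def)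
  define p where "p = filter_response Psi u"
  define U where "U = wsig \<rho> u"
  have pU: "wsig \<rho> p k = resp U k" if "k < n" for k
    using filter_fps[OF uc that] by (simp add: p_def U_def resp_def psiF_def)
  \<comment> \<open>A finite sequence, so the input V producing it is square-summable even when U is
    not.\<close>
  define W where "W k = Abs_fps (\<lambda>t. if t < T then fps_nth (resp U k) t else 0)" for k
  obtain h where h: "\<And>i j. l1f (h i j)"
    "\<And>W k. k < n \<Longrightarrow> resp (\<lambda>j. \<Sum>l<n. h j l * W l) k = W k"
    "\<And>U j. j < n \<Longrightarrow> (\<Sum>l<n. h j l * resp U l) = U j"
    by (rule inverse_filter, rule that)
  define V where "V j = (\<Sum>l<n. h j l * W l)" for j
  have V2: "l2f (V j)" for j
    unfolding V_def W_def by (intro l2f_sum l2f_l1f_mult h l2f_truncate)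
  have VW: "resp V k = W k" if "k < n" for k using h(2)[OF that, of W] by (simp add: V_def[abs_def])
  have VU: "fps_nth (V j) t = fps_nth (U j) t" if "j < n" "t < T" for j t
  proof -
    have "fps_nth (V j) t = fps_nth (\<Sum>l<n. h j l * resp U l) t"
      unfolding V_def fps_sum_nth
      by (intro sum.cong refl causal_convolution[of T]) (use that in \<open>auto simp: W_def\<close>)
    then show ?thesis using h(3)[OF that(1), of U] by simp
  qed
  define y' where "y' t = vec a (\<lambda>i. fps_nth (V i) t * \<rho> ^ t)" for t
  have y'V: "wsig \<rho> y' i = V i" if "i < a" for i
    using that \<rho> by (intro fps_ext) (simp add: wsig_def y'_def)
  have y'2: "y' \<in> l2rho \<rho> a"
  proof (rule l2rho_intro[OF \<rho>(1)])
    show "y' t \<in> carrier_vec a" for t by (simp add: y'_def)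
    show "l2f (wsig \<rho> y' i)" if "i < a" for i using V2 y'V[OF that] by simp
  qed
  have y'y: "y' t = y t" if "t < T" for t
  proof (rule eq_vecI)
    fix i assume "i < dim_vec (y t)"
    then have i: "i < a" using yc(1)[of t] by simp
    have "fps_nth (U i) t = y t $ i / \<rho> ^ t" using i by (simp add: U_def wsig_def u_def carrier_vecD[OF yc(1)] carrier_vecD[OF yc(2)])
    then show "y' t $ i = y t $ i" using i \<rho> VU[of i t] that by (simp add: y'_def)
  qed (use yc(1)[of t] in \<open>simp add: y'_def\<close>)
  have y'e: "y' \<in> l2e a" by (simp add: l2e_def y'_def)
  have w'2: "\<Delta> y' \<in> l2rho \<rho> b" using \<Delta>(2) y'2 by (auto simp: bounded_op_def)
  have w'c: "\<Delta> y' t \<in> carrier_vec b" for t using w'2 by (auto simp: l2rho_def l2e_def)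
  have w'w: "\<Delta> y' t = \<Delta> y t" if "t < T" for t
  proof -
    \<comment> \<open>\<open>causal_op\<close> includes the final time, hence T - 1, which needs T
      \<ge> 1.\<close>
    have "\<forall>t\<le>T - 1. y' t = y t" using y'y T by auto
    then have "\<forall>t\<le>T - 1. \<Delta> y' t = \<Delta> y t" using \<Delta>(3) y y'e unfolding causal_op_def by blast
    then show ?thesis using that by auto
  qed
  define U' where "U' = wsig \<rho> (\<lambda>t. y' t @\<^sub>v \<Delta> y' t)"
  have U'y: "U' j = V j" if "j < a" for j
  proof -
    have "U' j = wsig \<rho> y' j" using that w'c
      by (intro fps_ext) (simp add: U'_def wsig_def y'_def carrier_vecD[OF w'c])
    then show ?thesis using y'V[OF that] by simp
  qed
  have U'w: "U' j = wsig \<rho> (\<Delta> y') (j - a)" if "a \<le> j" "j < n" for j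
    using that w'c by (intro fps_ext) (simp add: U'_def wsig_def y'_def carrier_vecD[OF w'c])
  have U'2: "l2f (U' j)" if "j < n" for j
    using U'y[of j] U'w[of j] V2 l2rho_component[OF \<rho>(1) w'2, of "j - a"] that by (cases "j < a") auto
  have U'U: "fps_nth (U' j) t = fps_nth (U j) t" if "j < n" "t < T" for j t
    using that y'y w'w by (simp add: U'_def U_def wsig_def u_def)
  define R where "R j = U' j - V j" for j
  have R2: "l2f (R j)" if "j < n" for j unfolding R_def using U'2[OF that] V2 by (rule l2f_diff)
  have R0: "fps_nth (resp R k) t = 0" if "t < T" for k t
  proof -
    have "fps_nth (resp R k) t = fps_nth (resp (\<lambda>_. 0) k) t"
      unfolding resp_def fps_sum_nth
      by (intro sum.cong refl causal_convolution[of T]) (use that VU U'U in \<open>auto simp: R_def\<close>)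
    then show ?thesis by (simp add: resp_def)
  qed
  have U'WR: "resp U' k = W k + resp R k" if "k < n" for k
  proof -
    have "resp U' k = resp V k + resp R k"
      unfolding resp_def R_def by (simp add: sum.distrib[symmetric] distrib_left[symmetric])
    then show ?thesis using VW[OF that] by simp
  qed
  \<comment> \<open>The summands W and \<open>resp R\<close> of \<open>resp U'\<close> live before T
    and from T on, so the form has no cross terms.\<close>
  have split: "qM n M (resp U') t = (if t < T then qM n M (resp U) t else 0) + qM n M (resp R) t" for t
  proof (cases "t < T")
    case True
    then show ?thesis by (simp add: qM_def U'WR W_def R0)
  next
    case False
    then show ?thesis by (simp add: qM_def U'WR W_def)
  qed
  have sU: "summable (\<lambda>t. if t < T then qM n M (resp U) t else 0)"
    by (rule summable_finite[of "{..<T}"]) auto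
  have sR: "summable (qM n M (resp R))" using R2 by (intro qM_summable l2_resp) auto
  have "0 \<le> (\<Sum>t. qM n M (resp U') t)"
    unfolding U'_def by (rule IQC_energy[OF IQC y'2 w'2])
  also have "\<dots> = (\<Sum>t. if t < T then qM n M (resp U) t else 0) + (\<Sum>t. qM n M (resp R) t)"
    unfolding split by (rule suminf_add[OF sU sR, symmetric])
  also have "(\<Sum>t. if t < T then qM n M (resp U) t else 0) = (\<Sum>t<T. qM n M (resp U) t)"
    by (subst suminf_finite[of "{..<T}"]) auto
  also have "(\<Sum>t. qM n M (resp R) t) \<le> 0"
  proof -
    \<comment> \<open>Transforms are determined only almost everywhere; in the first block, where R
      vanishes, the zero function is chosen, so that the second block alone decides the
      sign.\<close>
    have "\<exists>f. zts (R j) f \<and> (j < a \<longrightarrow> f = (\<lambda>_. 0))" if "j < n" for j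
    proof (cases "j < a")
      case True
      then have "R j = 0" by (simp add: R_def U'y)
      then show ?thesis by (metis zts_0)
    qed (use zts_exists[OF R2[OF that]] in auto)
    then obtain f where f: "\<And>j. j < n \<Longrightarrow> zts (R j) (f j)" "\<And>j. j < a \<Longrightarrow> f j = (\<lambda>_. 0)"
      by (metis trans_less_add1)
    show ?thesis
      by (rule energy_nonpos[where f=f]) (use f R2 in \<open>auto intro!: l2_resp zts_resp\<close>)
  qed
  finally have "0 \<le> (\<Sum>t<T. qM n M (resp U) t)" by simp
  also have "\<dots> = (\<Sum>t<T. (p t \<bullet> (mat n n (\<lambda>(i,j). M i j) *\<^sub>v p t)) / \<rho> ^ (2 * t))"
    using filter_carrier pU by (intro sum.cong refl, subst qM_wsig) (auto simp: p_def qM_def)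
  finally show "0 \<le> (\<Sum>t<T. (filter_response Psi (\<lambda>t. y t @\<^sub>v \<Delta> y t) t \<bullet> (mat n n (\<lambda>(i,j). M i j) *\<^sub>v filter_response Psi (\<lambda>t. y t @\<^sub>v \<Delta> y t) t)) / \<rho> ^ (2 * t))"
    unfolding p_def u_def .
qed

end

section \<open>Functions satisfying the parallelogram law are quadratic forms\<close>

section \<open>Quadratic value functions and the KYP lemma\<close>

text \<open>Subtracting the linear function leaves an additive g that vanishes at the integers. So g
  is 1-periodic, the bound on the unit interval is global, and a bounded additive function is
  zero.\<close>

lemma additive_bounded_linear:
  fixes f :: "real \<Rightarrow> real"
  assumes add: "\<And>x y. f (x + y) = f x + f y" and bd: "\<And>x. \<bar>f x\<bar> \<le> c1 * x\<^sup>2 + c2" and c1: "c1 \<ge> 0"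
  shows "f x = x * f 1"
proof -
  define g where "g x = f x - x * f 1" for x
  have g: "g (x + y) = g x + g y" for x y by (simp add: g_def add algebra_simps)
  have g0: "g 0 = 0" using g[of 0 0] by simp
  have gneg: "g (- x) = - g x" for x using g[of x "-x"] g0 by simp
  have gn: "g (of_nat n * x) = of_nat n * g x" for n x
    by (induction n) (simp_all add: g0 g algebra_simps)
  have g1: "g 1 = 0" by (simp add: g_def)
  have gint: "g (of_int k) = 0" for k
  proof (cases k)
    case (nonneg n)
    then show ?thesis using gn[of n 1] g1 by simp
  next
    case (neg n)
    then show ?thesis using gn[of "Suc n" 1] g1 gneg[of "of_nat (Suc n)"] by simp
  qed
  have b: "\<bar>g x\<bar> \<le> c1 + c2 + \<bar>f 1\<bar>" for x
  proof -
    have "g x = g (of_int \<lfloor>x\<rfloor> + frac x)" by (simp add: frac_def)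
    also have "\<dots> = g (frac x)" unfolding g gint by simp
    finally have e: "g x = g (frac x)" .
    have fr: "0 \<le> frac x" "frac x \<le> 1" using frac_lt_1[of x] by auto
    have "\<bar>f (frac x)\<bar> \<le> c1 * (frac x)\<^sup>2 + c2" by (rule bd)
    moreover have "c1 * (frac x)\<^sup>2 \<le> c1 * 1" using fr c1 by (intro mult_left_mono) (auto simp: power_le_one)
    moreover have "\<bar>frac x * f 1\<bar> \<le> \<bar>f 1\<bar>" using fr by (simp add: abs_mult mult_left_le_one_le)
    ultimately show ?thesis unfolding e unfolding g_def by linarith
  qed
  have "g x = 0"
  proof (rule ccontr)
    assume "g x \<noteq> 0"
    then obtain n :: nat where "c1 + c2 + \<bar>f 1\<bar> < of_nat n * \<bar>g x\<bar>"
      using reals_Archimedean3[of "\<bar>g x\<bar>"] by auto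
    then show False using b[of "of_nat n * x"] unfolding gn by (simp add: abs_mult)
  qed
  then show ?thesis by (simp add: g_def)
qed

text \<open>The Jordan-von Neumann argument: the polarization D is additive by the parallelogram law
  and homogeneous by the bound. As the bound sees only the first K coordinates, V depends on no
  others.\<close>

lemma quadratic_of_parallelogram:
  fixes V :: "(nat \<Rightarrow> real) \<Rightarrow> real"
  assumes par: "\<And>x y. V (\<lambda>i. x i + y i) + V (\<lambda>i. x i - y i) = 2 * V x + 2 * V y"
    and bd: "\<And>x. \<bar>V x\<bar> \<le> c * (\<Sum>i<K. (x i)\<^sup>2)" and c: "c \<ge> 0"
  obtains P where "\<And>i j. P i j = P j i" "\<And>x. V x = (\<Sum>i<K. \<Sum>j<K. P i j * x i * x j)"
proof -
  have V0: "V (\<lambda>_. 0) = 0" using bd[of "\<lambda>_. 0"] by simp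
  have ev: "V (\<lambda>i. - y i) = V y" for y using par[of "\<lambda>_. 0" y] V0 by simp
  define D where "D x y = (V (\<lambda>i. x i + y i) - V (\<lambda>i. x i - y i)) / 4" for x y
  have sym: "D x y = D y x" for x y
    using ev[of "\<lambda>i. x i - y i"] by (simp add: D_def add.commute)
  have D0: "D (\<lambda>_. 0) y = 0" for y using ev[of y] by (simp add: D_def)
  have mid: "D (\<lambda>i. x i + z i) y + D (\<lambda>i. x i - z i) y = 2 * D x y" for x y z
    using par[of "\<lambda>i. x i + y i" z] par[of "\<lambda>i. x i - y i" z]
    by (simp add: D_def algebra_simps)
  \<comment> \<open>The midpoint identity is used at half the sum with half the difference, and at
    half the sum with itself.\<close>
  have add: "D (\<lambda>i. u i + v i) y = D u y + D v y" for u v y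
  proof -
    have "D u y + D v y = 2 * D (\<lambda>i. (u i + v i) / 2) y"
      using mid[of "\<lambda>i. (u i + v i) / 2" "\<lambda>i. (u i - v i) / 2" y] by (simp add: field_simps)
    also have "\<dots> = D (\<lambda>i. u i + v i) y"
      using mid[of "\<lambda>i. (u i + v i) / 2" "\<lambda>i. (u i + v i) / 2" y] D0[of y] by (simp add: field_simps)
    finally show ?thesis by simp
  qed
  have nb: "\<bar>D x y\<bar> \<le> c * (\<Sum>i<K. (x i)\<^sup>2) + c * (\<Sum>i<K. (y i)\<^sup>2)" for x y
  proof -
    have "\<bar>V (\<lambda>i. x i + s * y i)\<bar> \<le> 2 * (c * (\<Sum>i<K. (x i)\<^sup>2) + c * (\<Sum>i<K. (y i)\<^sup>2))" if "s = 1 \<or> s = -1" for s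
    proof -
      have "(x i + s * y i)\<^sup>2 \<le> 2 * (x i)\<^sup>2 + 2 * (y i)\<^sup>2" for i
        using that sum_squares_bound[of "x i" "y i"] sum_squares_bound[of "x i" "- y i"]
        by (auto simp: power2_sum power2_diff)
      then have "(\<Sum>i<K. (x i + s * y i)\<^sup>2) \<le> (\<Sum>i<K. 2 * (x i)\<^sup>2 + 2 * (y i)\<^sup>2)" by (intro sum_mono)
      then have "c * (\<Sum>i<K. (x i + s * y i)\<^sup>2) \<le> c * (\<Sum>i<K. 2 * (x i)\<^sup>2 + 2 * (y i)\<^sup>2)"
        using c by (rule mult_left_mono)
      then show ?thesis using bd[of "\<lambda>i. x i + s * y i"]
        by (simp add: sum.distrib sum_distrib_left[symmetric] algebra_simps)
    qed
    from this[of 1] this[of "-1"] show ?thesis by (simp add: D_def)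
  qed
  have hom: "D (\<lambda>i. t * x i) y = t * D x y" for t x y
  proof -
    have "D (\<lambda>i. t * x i) y = t * D (\<lambda>i. 1 * x i) y"
    proof (rule additive_bounded_linear[where f="\<lambda>t. D (\<lambda>i. t * x i) y" and ?c1.0="c * (\<Sum>i<K. (x i)\<^sup>2)" and ?c2.0="c * (\<Sum>i<K. (y i)\<^sup>2)"])
      show "D (\<lambda>i. (s + t) * x i) y = D (\<lambda>i. s * x i) y + D (\<lambda>i. t * x i) y" for s t
        using add[of "\<lambda>i. s * x i" "\<lambda>i. t * x i" y] by (simp add: algebra_simps)
      show "\<bar>D (\<lambda>i. t * x i) y\<bar> \<le> c * (\<Sum>i<K. (x i)\<^sup>2) * t\<^sup>2 + c * (\<Sum>i<K. (y i)\<^sup>2)" for t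
        using nb[of "\<lambda>i. t * x i" y] by (simp add: power_mult_distrib sum_distrib_left[symmetric] mult_ac)
      show "0 \<le> c * (\<Sum>i<K. (x i)\<^sup>2)" using c by (intro mult_nonneg_nonneg sum_nonneg) auto
    qed
    then show ?thesis by simp
  qed
  \<comment> \<open>Scaling such an x multiplies D but leaves the bound unchanged, so D must
    vanish.\<close>
  have rest: "D x y = 0" if "\<And>i. i < K \<Longrightarrow> x i = 0" for x y
  proof (rule ccontr)
    assume "D x y \<noteq> 0"
    then obtain n :: nat where "c * (\<Sum>i<K. (y i)\<^sup>2) < of_nat n * \<bar>D x y\<bar>"
      using reals_Archimedean3[of "\<bar>D x y\<bar>"] by auto
    then show False using nb[of "\<lambda>i. of_nat n * x i" y] that unfolding hom by (simp add: abs_mult)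
  qed
  define e :: "nat \<Rightarrow> nat \<Rightarrow> real" where "e i = (\<lambda>j. if j = i then 1 else 0)" for i
  have expand: "D x y = (\<Sum>i<K. x i * D (e i) y)" for x y
  proof -
    have tr: "D (\<lambda>i. if i < k then x i else 0) y = (\<Sum>i<k. x i * D (e i) y)" for k
    proof (induction k)
      case (Suc k)
      have "(\<lambda>i. if i < Suc k then x i else 0) = (\<lambda>i. (if i < k then x i else 0) + x k * e k i)"
        by (auto simp: e_def fun_eq_iff less_Suc_eq)
      then show ?case using Suc add[of "\<lambda>i. if i < k then x i else 0" "\<lambda>i. x k * e k i" y]
        by (simp add: hom)
    qed (simp add: D0)
    have "x = (\<lambda>i. (if i < K then x i else 0) + (if i < K then 0 else x i))" by auto
    then have "D x y = D (\<lambda>i. if i < K then x i else 0) y + D (\<lambda>i. if i < K then 0 else x i) y"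
      using add[of "\<lambda>i. if i < K then x i else 0" "\<lambda>i. if i < K then 0 else x i" y] by simp
    then show ?thesis using tr[of K] rest[of "\<lambda>i. if i < K then 0 else x i"] by simp
  qed
  show thesis
  proof (rule that[of "\<lambda>i j. D (e i) (e j)"])
    fix x
    have "V x = D x x"
      using par[of x x] V0 by (simp add: D_def)
    also have "\<dots> = (\<Sum>i<K. x i * D x (e i))" by (subst expand) (simp add: sym)
    also have "\<dots> = (\<Sum>i<K. x i * (\<Sum>j<K. x j * D (e j) (e i)))" by (subst expand) simp
    also have "\<dots> = (\<Sum>i<K. \<Sum>j<K. D (e i) (e j) * x i * x j)"
      unfolding sum_distrib_left
    proof (intro sum.cong refl)
      fix i j show "x i * (x j * D (e j) (e i)) = D (e i) (e j) * x i * x j"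
        using sym[of "e i" "e j"] by simp
    qed
    finally show "V x = (\<Sum>i<K. \<Sum>j<K. D (e i) (e j) * x i * x j)" .
  qed (rule sym)
qed

section \<open>Stable linear systems, their trajectories and quadratic costs\<close>

text \<open>The matrix I - x A. Its determinant is the reversed characteristic polynomial, so
  stability is the absence of zeros in the closed disc.\<close>

definition shiftmat :: "(nat \<Rightarrow> nat \<Rightarrow> real) \<Rightarrow> nat \<Rightarrow> nat \<Rightarrow> real poly" where
  "shiftmat A i j = (if i = j then 1 else 0) - monom (A i j) 1"

lemma fps_shiftmat: "fps_of_poly (shiftmat A i j) = (if i = j then 1 else 0) - fps_X * fps_const (A i j)"
  by (intro fps_ext) (auto simp: shiftmat_def coeff_monom fps_X_mult_nth)

definition quad :: "nat \<Rightarrow> (nat \<Rightarrow> nat \<Rightarrow> real) \<Rightarrow> (nat \<Rightarrow> real) \<Rightarrow> real" where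
  "quad r N z = (\<Sum>i<r. \<Sum>j<r. N i j * (z i * z j))"

lemma quad_add:
  "quad r N (\<lambda>i. x i + y i) = quad r N x + (\<Sum>i<r. \<Sum>j<r. N i j * (x i * y j + y i * x j)) + quad r N y"
  by (simp add: quad_def algebra_simps sum.distrib)

text \<open>The sum of the absolute entries replaces the operator norm. Young's inequality with
  weight \<eta> makes the extra term in y small at the expense of the term in x.\<close>

lemma quad_bounds:
  fixes N :: "nat \<Rightarrow> nat \<Rightarrow> real" and r :: nat
  assumes "\<eta> > 0"
  defines "cN \<equiv> (\<Sum>i<r. \<Sum>j<r. \<bar>N i j\<bar>)"
  shows "\<bar>quad r N x\<bar> \<le> cN * (\<Sum>i<r. (x i)\<^sup>2)"
    "quad r N (\<lambda>i. x i + y i) \<le> quad r N y + (cN + cN / \<eta>) * (\<Sum>i<r. (x i)\<^sup>2) + cN * \<eta> * (\<Sum>i<r. (y i)\<^sup>2)"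
proof -
  have e: "\<bar>\<Sum>i<r. \<Sum>j<r. N i j * g i j\<bar> \<le> cN * G" if g: "\<And>i j. i < r \<Longrightarrow> j < r \<Longrightarrow> \<bar>g i j\<bar> \<le> G" for g :: "nat \<Rightarrow> nat \<Rightarrow> real" and G
  proof -
    have "\<bar>\<Sum>i<r. \<Sum>j<r. N i j * g i j\<bar> \<le> (\<Sum>i<r. \<Sum>j<r. \<bar>N i j * g i j\<bar>)"
      by (rule order_trans[OF sum_abs sum_mono[OF sum_abs]])
    also have "\<dots> \<le> (\<Sum>i<r. \<Sum>j<r. \<bar>N i j\<bar> * G)"
      using g by (intro sum_mono) (auto simp: abs_mult intro: mult_left_mono)
    finally show ?thesis by (simp add: cN_def sum_distrib_right)
  qed
  have m: "(x i)\<^sup>2 \<le> (\<Sum>i<r. (x i)\<^sup>2)" if "i < r" for i and x :: "nat \<Rightarrow> real"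
    using that by (auto intro!: member_le_sum[where f="\<lambda>i. (x i)\<^sup>2"])
  have yg: "2 * \<bar>u * v\<bar> \<le> u\<^sup>2 / \<eta> + \<eta> * v\<^sup>2" for u v :: real
  proof -
    have "0 \<le> (\<bar>u\<bar> - \<eta> * \<bar>v\<bar>)\<^sup>2 / \<eta>" using assms by simp
    also have "\<dots> = u\<^sup>2 / \<eta> + \<eta> * v\<^sup>2 - 2 * \<bar>u * v\<bar>"
      using assms(1) by (simp add: power2_diff power_mult_distrib diff_divide_distrib add_divide_distrib abs_mult) (simp add: power2_eq_square)
    finally show ?thesis by simp
  qed
  have q: "\<bar>quad r N x\<bar> \<le> cN * (\<Sum>i<r. (x i)\<^sup>2)" for x
    unfolding quad_def
  proof (rule e)
    fix i j assume ij: "i < r" "j < r"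
    have "2 * \<bar>x i * x j\<bar> \<le> (x i)\<^sup>2 + (x j)\<^sup>2" using sum_squares_bound[of "\<bar>x i\<bar>" "\<bar>x j\<bar>"] by (simp add: abs_mult)
    then show "\<bar>x i * x j\<bar> \<le> (\<Sum>i<r. (x i)\<^sup>2)" using m[of i x] m[of j x] ij by linarith
  qed
  then show "\<bar>quad r N x\<bar> \<le> cN * (\<Sum>i<r. (x i)\<^sup>2)" .
  have "\<bar>\<Sum>i<r. \<Sum>j<r. N i j * (x i * y j + y i * x j)\<bar> \<le> cN * ((\<Sum>i<r. (x i)\<^sup>2) / \<eta> + \<eta> * (\<Sum>i<r. (y i)\<^sup>2))"
  proof (rule e)
    fix i j assume ij: "i < r" "j < r"
    have "\<bar>x i * y j + y i * x j\<bar> \<le> \<bar>x i * y j\<bar> + \<bar>x j * y i\<bar>" using abs_triangle_ineq[of "x i * y j" "y i * x j"] by (simp add: mult.commute)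
    also have "2 * \<dots> \<le> ((x i)\<^sup>2 / \<eta> + \<eta> * (y j)\<^sup>2) + ((x j)\<^sup>2 / \<eta> + \<eta> * (y i)\<^sup>2)" using yg[of "x i" "y j"] yg[of "x j" "y i"] by simp
    also have "\<dots> \<le> 2 * ((\<Sum>i<r. (x i)\<^sup>2) / \<eta> + \<eta> * (\<Sum>i<r. (y i)\<^sup>2))"
    proof -
      have "(x i)\<^sup>2 / \<eta> \<le> (\<Sum>i<r. (x i)\<^sup>2) / \<eta>" "(x j)\<^sup>2 / \<eta> \<le> (\<Sum>i<r. (x i)\<^sup>2) / \<eta>"
        "\<eta> * (y i)\<^sup>2 \<le> \<eta> * (\<Sum>i<r. (y i)\<^sup>2)" "\<eta> * (y j)\<^sup>2 \<le> \<eta> * (\<Sum>i<r. (y i)\<^sup>2)"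
        using m ij assms by (auto intro: divide_right_mono mult_left_mono)
      moreover have "p + q + (p' + q') \<le> 2 * (P + Q)" if "p \<le> P" "p' \<le> P" "q' \<le> Q" "q \<le> Q" for p q p' q' P Q :: real
        unfolding mult_2 by (intro add_mono that)
      ultimately show ?thesis by blast
    qed
    finally show "\<bar>x i * y j + y i * x j\<bar> \<le> (\<Sum>i<r. (x i)\<^sup>2) / \<eta> + \<eta> * (\<Sum>i<r. (y i)\<^sup>2)" by simp
  qed
  then show "quad r N (\<lambda>i. x i + y i) \<le> quad r N y + (cN + cN / \<eta>) * (\<Sum>i<r. (x i)\<^sup>2) + cN * \<eta> * (\<Sum>i<r. (y i)\<^sup>2)"
    unfolding quad_add using q[of x] by (simp add: algebra_simps)
qed

definition sq :: "real fps \<Rightarrow> real" where "sq A = (\<Sum>t. (fps_nth A t)\<^sup>2)"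

lemma sq_nonneg: "l2f A \<Longrightarrow> 0 \<le> sq A"
  unfolding sq_def l2f_def by (intro suminf_nonneg) auto

lemma sq_0 [simp]: "sq 0 = 0" by (simp add: sq_def)

lemma sq_add_le:
  assumes "l2f A" "l2f B" shows "sq (A + B) \<le> 2 * sq A + 2 * sq B"
proof -
  have "(fps_nth (A + B) t)\<^sup>2 \<le> 2 * (fps_nth A t)\<^sup>2 + 2 * (fps_nth B t)\<^sup>2" for t
    using sum_squares_bound[of "fps_nth A t" "fps_nth B t"] by (simp add: power2_sum)
  then have "sq (A + B) \<le> (\<Sum>t. 2 * (fps_nth A t)\<^sup>2 + 2 * (fps_nth B t)\<^sup>2)"
    unfolding sq_def using assms l2f_add[OF assms] unfolding l2f_def
    by (intro suminf_le summable_add summable_mult) auto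
  also have "\<dots> = 2 * sq A + 2 * sq B"
    using assms unfolding sq_def l2f_def by (simp add: suminf_add[symmetric] suminf_mult summable_mult)
  finally show ?thesis .
qed

lemma sq_cmult: "l2f A \<Longrightarrow> sq (fps_const c * A) = c\<^sup>2 * sq A"
  unfolding sq_def l2f_def by (simp add: power_mult_distrib suminf_mult)

lemma l2f_delay: "l2f A \<Longrightarrow> l2f (fps_X * A)"
  unfolding l2f_def by (subst summable_Suc_iff[symmetric]) simp

lemma sq_delay: "l2f A \<Longrightarrow> sq (fps_X * A) = sq A"
proof -
  assume "l2f A"
  then have "summable (\<lambda>t. (fps_nth (fps_X * A) t)\<^sup>2)" using l2f_delay by (simp only: l2f_def)
  from suminf_split_head[OF this] show ?thesis by (simp add: sq_def)
qed

lemma l2f_const [simp]: "l2f (fps_const c)"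
  unfolding l2f_def by (rule summable_finite[of "{0}"]) auto

lemma sq_const: "sq (fps_const c) = c\<^sup>2"
  unfolding sq_def by (subst suminf_finite[of "{0}"]) auto

lemma sq_l1_mult:
  assumes "l1f H" "l2f A" shows "sq (H * A) \<le> (\<Sum>k. \<bar>fps_nth H k\<bar>)\<^sup>2 * sq A"
  unfolding sq_def
proof (rule suminf_le_const)
  show "summable (\<lambda>t. (fps_nth (H * A) t)\<^sup>2)" using l2f_l1f_mult[OF assms] by (simp add: l2f_def)
  fix N
  have "(\<Sum>t<N. (fps_nth (H * A) t)\<^sup>2) \<le> (\<Sum>k. \<bar>fps_nth H k\<bar>)\<^sup>2 * (\<Sum>t<N. (fps_nth A t)\<^sup>2)"
    by (rule convolution_bound[OF assms(1)])
  also have "\<dots> \<le> (\<Sum>k. \<bar>fps_nth H k\<bar>)\<^sup>2 * (\<Sum>t. (fps_nth A t)\<^sup>2)"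
    using assms(2) by (intro mult_left_mono sum_le_suminf) (auto simp: l2f_def)
  finally show "(\<Sum>t<N. (fps_nth (H * A) t)\<^sup>2) \<le> (\<Sum>k. \<bar>fps_nth H k\<bar>)\<^sup>2 * (\<Sum>t. (fps_nth A t)\<^sup>2)" .
qed

locale lti =
  fixes K m :: nat and A B :: "nat \<Rightarrow> nat \<Rightarrow> real"
  assumes stable: "\<And>x. cmod x \<le> 1 \<Longrightarrow> det (pmat K (shiftmat A) x) \<noteq> 0"
begin

text \<open>The inverse of I - x A, fixed by choice so that the state becomes one explicit function
  of initial state and input.\<close>

definition hinv :: "nat \<Rightarrow> nat \<Rightarrow> real fps" where
  "hinv = (SOME h. (\<forall>i j. l1f (h i j)) \<and>
    (\<forall>i<K. \<forall>j<K. (\<Sum>k<K. fps_of_poly (shiftmat A i k) * h k j) = (if i = j then 1 else 0)))"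

lemma hinv: "l1f (hinv i j)"
  "i < K \<Longrightarrow> j < K \<Longrightarrow> (\<Sum>k<K. fps_of_poly (shiftmat A i k) * hinv k j) = (if i = j then 1 else 0)"
proof -
  obtain h where "\<And>i j. l1f (h i j)"
    "\<And>i j. i < K \<Longrightarrow> j < K \<Longrightarrow> (\<Sum>k<K. h i k * fps_of_poly (shiftmat A k j)) = (if i = j then 1 else 0)"
    "\<And>i j. i < K \<Longrightarrow> j < K \<Longrightarrow> (\<Sum>k<K. fps_of_poly (shiftmat A i k) * h k j) = (if i = j then 1 else 0)"
    by (rule stable_inverse[of K "shiftmat A"]) (use stable in auto)
  then have "\<exists>h. (\<forall>i j. l1f (h i j)) \<and>
    (\<forall>i<K. \<forall>j<K. (\<Sum>k<K. fps_of_poly (shiftmat A i k) * h k j) = (if i = j then 1 else 0))" by blast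
  from someI_ex[OF this, folded hinv_def]
  show "l1f (hinv i j)"
    "i < K \<Longrightarrow> j < K \<Longrightarrow> (\<Sum>k<K. fps_of_poly (shiftmat A i k) * hinv k j) = (if i = j then 1 else 0)"
    by auto
qed

definition inp :: "(nat \<Rightarrow> real) \<Rightarrow> (nat \<Rightarrow> real fps) \<Rightarrow> nat \<Rightarrow> real fps" where
  "inp x W j = fps_const (x j) + fps_X * (\<Sum>l<m. fps_const (B j l) * W l)"

text \<open>The solution of (I - x A) times state = initial state plus delayed input;
  \<open>st_0\<close> and \<open>st_Suc\<close> recover the recursion.\<close>

definition st :: "(nat \<Rightarrow> real) \<Rightarrow> (nat \<Rightarrow> real fps) \<Rightarrow> nat \<Rightarrow> real fps" where
  "st x W i = (\<Sum>j<K. hinv i j * inp x W j)"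

definition stp :: "(nat \<Rightarrow> real) \<Rightarrow> (nat \<Rightarrow> real) \<Rightarrow> nat \<Rightarrow> real" where
  "stp x w i = (\<Sum>j<K. A i j * x j) + (\<Sum>l<m. B i l * w l)"

lemma st_eq:
  assumes "i < K"
  shows "st x W i = fps_const (x i) + fps_X * ((\<Sum>j<K. fps_const (A i j) * st x W j) + (\<Sum>l<m. fps_const (B i l) * W l))"
proof -
  have "(\<Sum>k<K. fps_of_poly (shiftmat A i k) * st x W k) = (\<Sum>j<K. (\<Sum>k<K. fps_of_poly (shiftmat A i k) * hinv k j) * inp x W j)"
    unfolding st_def sum_distrib_left sum_distrib_right by (subst sum.swap) (simp add: mult.assoc)
  also have "\<dots> = (\<Sum>j<K. if i = j then inp x W j else 0)"
    using assms by (intro sum.cong refl) (simp add: hinv)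
  also have "\<dots> = inp x W i" using assms by simp
  finally have "(\<Sum>k<K. (if i = k then 1 else 0) * st x W k - fps_X * fps_const (A i k) * st x W k) = inp x W i"
    by (simp add: fps_shiftmat left_diff_distrib)
  moreover have "(\<Sum>k<K. (if i = k then 1 else 0) * st x W k) = st x W i"
    using assms by (simp add: if_distrib[of "\<lambda>x. x * _"] cong: if_cong)
  ultimately have "st x W i - (\<Sum>k<K. fps_X * fps_const (A i k) * st x W k) = inp x W i"
    by (simp add: sum_subtractf)
  then show ?thesis by (simp add: inp_def sum_distrib_left distrib_left mult.assoc algebra_simps)
qed

lemma st_0: "i < K \<Longrightarrow> fps_nth (st x W i) 0 = x i"
  by (subst st_eq) simp_all

lemma st_Suc: "i < K \<Longrightarrow> fps_nth (st x W i) (Suc t) = stp (\<lambda>j. fps_nth (st x W j) t) (\<lambda>l. fps_nth (W l) t) i"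
  by (subst st_eq) (simp_all add: fps_sum_nth stp_def)

definition traj :: "(nat \<Rightarrow> real) \<Rightarrow> (nat \<Rightarrow> real fps) \<Rightarrow> nat \<Rightarrow> real fps" where
  "traj x W i = (if i < K then st x W i else W (i - K))"

definition comb :: "(nat \<Rightarrow> real) \<Rightarrow> (nat \<Rightarrow> real) \<Rightarrow> nat \<Rightarrow> real" where
  "comb x w i = (if i < K then x i else w (i - K))"

lemma traj_lin: "traj (\<lambda>i. c * x i + d * y i) (\<lambda>l. fps_const c * U l + fps_const d * W l) i = fps_const c * traj x U i + fps_const d * traj y W i"
proof -
  have "inp (\<lambda>i. c * x i + d * y i) (\<lambda>l. fps_const c * U l + fps_const d * W l) j
     = fps_const c * inp x U j + fps_const d * inp y W j" for j
    unfolding inp_def by (simp add: sum.distrib sum_distrib_left algebra_simps fps_const_add[symmetric] fps_const_mult[symmetric] del: fps_const_add fps_const_mult)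
  then show ?thesis
    unfolding traj_def st_def by (simp add: sum.distrib sum_distrib_left algebra_simps)
qed

definition l2W :: "(nat \<Rightarrow> real fps) set" where "l2W = {W. \<forall>l<m. l2f (W l)}"

definition nW :: "(nat \<Rightarrow> real fps) \<Rightarrow> real" where "nW W = (\<Sum>l<m. sq (W l))"
definition nx :: "(nat \<Rightarrow> real) \<Rightarrow> real" where "nx x = (\<Sum>i<K. (x i)\<^sup>2)"

lemma nx_nonneg: "0 \<le> nx x" unfolding nx_def by (intro sum_nonneg) auto

lemma nW_nonneg: "W \<in> l2W \<Longrightarrow> 0 \<le> nW W"
  unfolding nW_def l2W_def by (intro sum_nonneg sq_nonneg) auto

lemma l2_inp: "W \<in> l2W \<Longrightarrow> l2f (inp x W j)"
  unfolding inp_def l2W_def by (intro l2f_add l2f_const l2f_delay l2f_sum l2f_cmult) auto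

lemma l2_st: "W \<in> l2W \<Longrightarrow> l2f (st x W i)"
  unfolding st_def by (intro l2f_sum l2f_l1f_mult hinv l2_inp)

lemma l2_traj: "W \<in> l2W \<Longrightarrow> i < K + m \<Longrightarrow> l2f (traj x W i)"
  unfolding traj_def using l2_st by (auto simp: l2W_def)

text \<open>Finite gain from initial state and input is preserved by finite sums; applied once to
  the inputs and once to the columns of the inverse.\<close>

lemma sum_gain:
  fixes f :: "nat \<Rightarrow> (nat \<Rightarrow> real) \<Rightarrow> (nat \<Rightarrow> real fps) \<Rightarrow> real fps"
  assumes "\<And>i. i < k \<Longrightarrow> \<exists>C\<ge>0. \<forall>x. \<forall>W\<in>l2W. l2f (f i x W) \<and> sq (f i x W) \<le> C * (nx x + nW W)"
  shows "\<exists>C\<ge>0. \<forall>x. \<forall>W\<in>l2W. l2f (\<Sum>i<k. f i x W) \<and> sq (\<Sum>i<k. f i x W) \<le> C * (nx x + nW W)"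
  using assms
proof (induction k)
  case (Suc k)
  then obtain C where C: "C \<ge> 0" "\<And>x W. W \<in> l2W \<Longrightarrow> l2f (\<Sum>i<k. f i x W) \<and> sq (\<Sum>i<k. f i x W) \<le> C * (nx x + nW W)"
    by (metis less_SucI)
  obtain D where D: "D \<ge> 0" "\<And>x W. W \<in> l2W \<Longrightarrow> l2f (f k x W) \<and> sq (f k x W) \<le> D * (nx x + nW W)"
    using Suc.prems[of k] by auto
  have "l2f (\<Sum>i<Suc k. f i x W) \<and> sq (\<Sum>i<Suc k. f i x W) \<le> (2 * C + 2 * D) * (nx x + nW W)" if W: "W \<in> l2W" for x W
  proof
    show "l2f (\<Sum>i<Suc k. f i x W)" using C(2)[OF W] D(2)[OF W] by (auto intro: l2f_add)
    have "sq (\<Sum>i<Suc k. f i x W) \<le> 2 * sq (\<Sum>i<k. f i x W) + 2 * sq (f k x W)"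
      using C(2)[OF W] D(2)[OF W] sq_add_le by auto
    also have "\<dots> \<le> 2 * (C * (nx x + nW W)) + 2 * (D * (nx x + nW W))"
      using C(2)[OF W, of x] D(2)[OF W, of x] by linarith
    finally show "sq (\<Sum>i<Suc k. f i x W) \<le> (2 * C + 2 * D) * (nx x + nW W)" by (simp add: algebra_simps)
  qed
  then show ?case using C(1) D(1) by (intro exI[of _ "2 * C + 2 * D"]) auto
qed (auto intro!: exI[of _ 0])

lemma st_gain: "\<exists>C\<ge>0. \<forall>x. \<forall>W\<in>l2W. l2f (st x W i) \<and> sq (st x W i) \<le> C * (nx x + nW W)"
  unfolding st_def
proof (rule sum_gain)
  fix j assume j: "j < K"
  have "\<exists>C\<ge>0. \<forall>x. \<forall>W\<in>l2W. l2f (\<Sum>l<m. fps_const (B j l) * W l) \<and> sq (\<Sum>l<m. fps_const (B j l) * W l) \<le> C * (nx x + nW W)"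
  proof (rule sum_gain)
    fix l assume l: "l < m"
    have "sq (W l) \<le> nW W" if "W \<in> l2W" for W
      unfolding nW_def using that l by (intro member_le_sum) (auto simp: l2W_def intro: sq_nonneg)
    then show "\<exists>C\<ge>0. \<forall>x. \<forall>W\<in>l2W. l2f (fps_const (B j l) * W l) \<and> sq (fps_const (B j l) * W l) \<le> C * (nx x + nW W)"
      using l nx_nonneg by (intro exI[of _ "(B j l)\<^sup>2"])
        (auto simp: l2W_def l2f_cmult sq_cmult intro!: mult_left_mono add_increasing)
  qed
  then obtain C where C: "C \<ge> 0" "\<And>x W. W \<in> l2W \<Longrightarrow> l2f (\<Sum>l<m. fps_const (B j l) * W l) \<and> sq (\<Sum>l<m. fps_const (B j l) * W l) \<le> C * (nx x + nW W)"
    by auto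
  let ?h = "(\<Sum>k. \<bar>fps_nth (hinv i j) k\<bar>)\<^sup>2"
  have "sq (hinv i j * inp x W j) \<le> (?h * (2 + 2 * C)) * (nx x + nW W)" if W: "W \<in> l2W" for x W
  proof -
    have "(x j)\<^sup>2 \<le> nx x" unfolding nx_def using j by (auto intro!: member_le_sum[where f="\<lambda>i. (x i)\<^sup>2"])
    then have xj: "(x j)\<^sup>2 \<le> nx x + nW W" using nW_nonneg[OF W] by linarith
    have "sq (inp x W j) \<le> 2 * sq (fps_const (x j)) + 2 * sq (fps_X * (\<Sum>l<m. fps_const (B j l) * W l))"
      unfolding inp_def using C(2)[OF W] by (intro sq_add_le l2f_const l2f_delay) auto
    also have "\<dots> = 2 * (x j)\<^sup>2 + 2 * sq (\<Sum>l<m. fps_const (B j l) * W l)"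
      using C(2)[OF W] by (simp add: sq_const sq_delay)
    also have "\<dots> \<le> 2 * (nx x + nW W) + 2 * (C * (nx x + nW W))"
      using C(2)[OF W, of x, THEN conjunct2] xj by (intro add_mono mult_left_mono) auto
    finally have "?h * sq (inp x W j) \<le> ?h * (2 * (nx x + nW W) + 2 * (C * (nx x + nW W)))"
      by (intro mult_left_mono) auto
    moreover have "sq (hinv i j * inp x W j) \<le> ?h * sq (inp x W j)"
      by (rule sq_l1_mult[OF hinv(1) l2_inp[OF W]])
    ultimately show ?thesis by (simp add: algebra_simps)
  qed
  then show "\<exists>C\<ge>0. \<forall>x. \<forall>W\<in>l2W. l2f (hinv i j * inp x W j) \<and> sq (hinv i j * inp x W j) \<le> C * (nx x + nW W)"
    using C(1) by (intro exI[of _ "?h * (2 + 2 * C)"]) (auto intro!: l2f_l1f_mult hinv l2_inp)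
qed

lemma traj_gain:
  obtains C where "C \<ge> 0" "\<And>x W. W \<in> l2W \<Longrightarrow> (\<Sum>i<K + m. sq (traj x W i)) \<le> C * (nx x + nW W)"
proof -
  obtain c where c: "\<And>i. c i \<ge> 0" "\<And>i x W. W \<in> l2W \<Longrightarrow> sq (st x W i) \<le> c i * (nx x + nW W)"
    using st_gain by metis
  have "(\<Sum>i<K + m. sq (traj x W i)) \<le> ((\<Sum>i<K. c i) + 1) * (nx x + nW W)" if W: "W \<in> l2W" for x W
  proof -
    have "(\<Sum>i<K + m. sq (traj x W i)) = (\<Sum>i<K. sq (st x W i)) + nW W"
      unfolding sum_lessThan_add nW_def by (simp add: traj_def)
    also have "\<dots> \<le> (\<Sum>i<K. c i * (nx x + nW W)) + (nx x + nW W)"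
      using c(2)[OF W] nx_nonneg by (intro add_mono sum_mono) auto
    also have "\<dots> = ((\<Sum>i<K. c i) + 1) * (nx x + nW W)"
      by (simp only: sum_distrib_right[symmetric] distrib_right mult_1)
    finally show ?thesis .
  qed
  then show thesis using c(1) by (intro that[of "(\<Sum>i<K. c i) + 1"]) (auto intro!: add_nonneg_nonneg sum_nonneg)
qed

definition cost :: "(nat \<Rightarrow> nat \<Rightarrow> real) \<Rightarrow> (nat \<Rightarrow> real) \<Rightarrow> (nat \<Rightarrow> real fps) \<Rightarrow> real" where
  "cost N x W = (\<Sum>t. quad (K + m) N (\<lambda>i. fps_nth (traj x W i) t))"

lemma quad_summable:
  assumes "\<And>i. i < r \<Longrightarrow> l2f (Z i)" shows "summable (\<lambda>t. quad r N (\<lambda>i. fps_nth (Z i) t))"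
  using qM_summable[of r Z N] assms by (simp add: qM_def[abs_def] quad_def)

lemma sum_sq_suminf:
  assumes "\<And>i. i < r \<Longrightarrow> l2f (Z i)"
  shows "summable (\<lambda>t. \<Sum>i<r. (fps_nth (Z i) t)\<^sup>2)" "(\<Sum>t. \<Sum>i<r. (fps_nth (Z i) t)\<^sup>2) = (\<Sum>i<r. sq (Z i))"
proof -
  show "summable (\<lambda>t. \<Sum>i<r. (fps_nth (Z i) t)\<^sup>2)"
    using assms by (intro summable_sum) (auto simp: l2f_def)
  show "(\<Sum>t. \<Sum>i<r. (fps_nth (Z i) t)\<^sup>2) = (\<Sum>i<r. sq (Z i))"
    unfolding sq_def using assms by (intro suminf_sum) (auto simp: l2f_def)
qed

definition l2cons :: "(nat \<Rightarrow> real) \<Rightarrow> (nat \<Rightarrow> real fps) \<Rightarrow> nat \<Rightarrow> real fps" where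
  "l2cons w W l = fps_const (w l) + fps_X * W l"

text \<open>The dynamic programming step: prepending w to the input delays the rest of the
  trajectory by one and lets it start in the successor state.\<close>

lemma cost_step:
  assumes W: "W \<in> l2W"
  shows "l2cons w W \<in> l2W" "cost N x (l2cons w W) = quad (K + m) N (comb x w) + cost N (stp x w) W"
proof -
  show W': "l2cons w W \<in> l2W" using W unfolding l2W_def l2cons_def by (auto intro!: l2f_add l2f_delay)
  have w0: "fps_nth (l2cons w W l) 0 = w l" "fps_nth (l2cons w W l) (Suc t) = fps_nth (W l) t" for l t
    by (simp_all add: l2cons_def)
  have s: "fps_nth (st x (l2cons w W) i) (Suc t) = fps_nth (st (stp x w) W i) t" if "i < K" for i t
    using that
  proof (induction t arbitrary: i)
    case 0
    then show ?case by (simp add: st_Suc st_0 w0 stp_def)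
  next
    case (Suc t)
    have "fps_nth (st x (l2cons w W) i) (Suc (Suc t)) = stp (\<lambda>j. fps_nth (st x (l2cons w W) j) (Suc t)) (\<lambda>l. fps_nth (W l) t) i"
      by (subst st_Suc[OF Suc.prems]) (simp add: w0)
    also have "\<dots> = stp (\<lambda>j. fps_nth (st (stp x w) W j) t) (\<lambda>l. fps_nth (W l) t) i"
      unfolding stp_def by (intro arg_cong2[of _ _ _ _ plus] sum.cong refl) (simp add: Suc.IH stp_def[symmetric])
    finally show ?case by (simp add: st_Suc[OF Suc.prems])
  qed
  have q: "quad (K + m) N (\<lambda>i. fps_nth (traj x (l2cons w W) i) (Suc t)) = quad (K + m) N (\<lambda>i. fps_nth (traj (stp x w) W i) t)" for t
    unfolding quad_def by (intro sum.cong refl) (simp add: traj_def s w0)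
  have q0: "quad (K + m) N (\<lambda>i. fps_nth (traj x (l2cons w W) i) 0) = quad (K + m) N (comb x w)"
    unfolding quad_def by (intro sum.cong refl) (simp add: traj_def comb_def st_0 w0)
  have sm: "summable (\<lambda>t. quad (K + m) N (\<lambda>i. fps_nth (traj x (l2cons w W) i) t))"
    using l2_traj[OF W'] by (intro quad_summable)
  show "cost N x (l2cons w W) = quad (K + m) N (comb x w) + cost N (stp x w) W"
    unfolding cost_def using suminf_split_head[OF sm] by (simp add: q q0)
qed

text \<open>The trajectory is linear in initial state and input jointly, and the cost is quadratic
  in the trajectory.\<close>

lemma cost_parallelogram:
  assumes "U \<in> l2W" "W \<in> l2W"
  shows "cost N (\<lambda>i. x i + y i) (\<lambda>l. U l + W l) + cost N (\<lambda>i. x i - y i) (\<lambda>l. U l - W l) = 2 * cost N x U + 2 * cost N y W"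
proof -
  let ?q = "\<lambda>x W t. quad (K + m) N (\<lambda>i. fps_nth (traj x W i) t)"
  have p: "traj (\<lambda>i. x i + y i) (\<lambda>l. U l + W l) i = traj x U i + traj y W i"
    "traj (\<lambda>i. x i - y i) (\<lambda>l. U l - W l) i = traj x U i - traj y W i" for i
    using traj_lin[of 1 x 1 y U W i] traj_lin[of 1 x "-1" y U W i]
    by (simp_all add: fps_const_neg[symmetric] del: fps_const_neg)
  have "quad r N (\<lambda>i. u i + v i) + quad r N (\<lambda>i. u i - v i) = 2 * quad r N u + 2 * quad r N v" for r u v
    unfolding quad_def sum.distrib[symmetric] sum_distrib_left by (intro sum.cong refl) (simp add: algebra_simps)
  then have e: "?q (\<lambda>i. x i + y i) (\<lambda>l. U l + W l) t + ?q (\<lambda>i. x i - y i) (\<lambda>l. U l - W l) t = 2 * ?q x U t + 2 * ?q y W t" for t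
    by (simp add: p)
  have "(\<lambda>l. U l + W l) \<in> l2W" "(\<lambda>l. U l - W l) \<in> l2W" using assms by (auto simp: l2W_def l2f_add l2f_diff)
  then have "summable (?q (\<lambda>i. x i + y i) (\<lambda>l. U l + W l))" "summable (?q (\<lambda>i. x i - y i) (\<lambda>l. U l - W l))"
     "summable (?q x U)" "summable (?q y W)"
    using assms l2_traj by (auto intro!: quad_summable)
  then show ?thesis unfolding cost_def
    by (simp add: suminf_add e suminf_mult[symmetric] summable_mult)
qed

text \<open>P is the matrix of the value function, the supremum of the cost over square-summable
  inputs. The supremum is finite because the trajectory splits into a free and a forced part, and
  the negative cost of the forced part absorbs the cross term.\<close>

theorem kyp_lemma:
  fixes N :: "nat \<Rightarrow> nat \<Rightarrow> real" and \<epsilon> :: real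
  assumes \<epsilon>: "\<epsilon> > 0" and coer: "\<And>W. W \<in> l2W \<Longrightarrow> cost N (\<lambda>_. 0) W \<le> - \<epsilon> * nW W"
  obtains P where "\<And>i j. P i j = P j i"
    "\<And>x w. quad (K + m) N (comb x w) + quad K P (stp x w) \<le> quad K P x"
    "\<And>x W. W \<in> l2W \<Longrightarrow> cost N x W \<le> quad K P x"
proof -
  obtain C where C: "C \<ge> 0" "\<And>x W. W \<in> l2W \<Longrightarrow> (\<Sum>i<K + m. sq (traj x W i)) \<le> C * (nx x + nW W)"
    by (rule traj_gain, rule that)
  define cN where "cN = (\<Sum>i<K + m. \<Sum>j<K + m. \<bar>N i j\<bar>)"
  have cN: "cN \<ge> 0" unfolding cN_def by (intro sum_nonneg) auto
  have z0: "(\<lambda>_. 0) \<in> l2W" by (simp add: l2W_def)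
  have n0: "nW (\<lambda>_. 0) = 0" "nx (\<lambda>_. 0) = 0" by (simp_all add: nW_def nx_def)
  \<comment> \<open>Chosen so that the share \<open>cN * \<eta> * C\<close> of the input in the
    cross term is at most \<epsilon>; the added ones keep the denominator positive.\<close>
  define \<eta> where "\<eta> = \<epsilon> / ((cN + 1) * (C + 1))"
  have \<eta>: "\<eta> > 0" unfolding \<eta>_def using \<epsilon> cN C(1) by simp
  have \<eta>C: "cN * \<eta> * C \<le> \<epsilon>"
  proof -
    have "cN * C \<le> (cN + 1) * (C + 1)" using cN C(1) by (intro mult_mono) auto
    then have "\<epsilon> * (cN * C) \<le> \<epsilon> * ((cN + 1) * (C + 1))" using \<epsilon> by simp
    then show ?thesis unfolding \<eta>_def using cN C(1) by (simp add: divide_le_eq add_pos_nonneg mult_ac)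
  qed
  define c where "c = (cN + cN / \<eta>) * C"
  have c: "c \<ge> 0" unfolding c_def using cN C(1) \<eta> by simp
  have upper: "cost N x W \<le> c * nx x" if W: "W \<in> l2W" for x W
  proof -
    let ?x = "\<lambda>t i. fps_nth (traj x (\<lambda>_. 0) i) t" and ?w = "\<lambda>t i. fps_nth (traj (\<lambda>_. 0) W i) t"
    let ?G = "cN + cN / \<eta>"
    have dec: "traj x W i = traj x (\<lambda>_. 0) i + traj (\<lambda>_. 0) W i" for i
      using traj_lin[of 1 x 1 "\<lambda>_. 0" "\<lambda>_. 0" W i] by simp
    have le: "quad (K + m) N (\<lambda>i. fps_nth (traj x W i) t) \<le> quad (K + m) N (?w t) + ?G * (\<Sum>i<K + m. (?x t i)\<^sup>2) + cN * \<eta> * (\<Sum>i<K + m. (?w t i)\<^sup>2)" for t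
      using quad_bounds(2)[OF \<eta>, of "K + m" N "?x t" "?w t"] unfolding cN_def dec by simp
    have l2: "l2f (traj x W i)" "l2f (traj x (\<lambda>_. 0) i)" "l2f (traj (\<lambda>_. 0) W i)" if "i < K + m" for i
      using that W z0 by (auto intro: l2_traj)
    have s: "summable (\<lambda>t. quad (K + m) N (?w t))" "summable (\<lambda>t. \<Sum>i<K + m. (?x t i)\<^sup>2)" "summable (\<lambda>t. \<Sum>i<K + m. (?w t i)\<^sup>2)"
      using l2 by (auto intro!: quad_summable sum_sq_suminf)
    have "cost N x W \<le> (\<Sum>t. quad (K + m) N (?w t) + ?G * (\<Sum>i<K + m. (?x t i)\<^sup>2) + cN * \<eta> * (\<Sum>i<K + m. (?w t i)\<^sup>2))"
      unfolding cost_def using l2 s by (intro suminf_le le quad_summable summable_add summable_mult) auto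
    also have "\<dots> = cost N (\<lambda>_. 0) W + ?G * (\<Sum>i<K + m. sq (traj x (\<lambda>_. 0) i)) + cN * \<eta> * (\<Sum>i<K + m. sq (traj (\<lambda>_. 0) W i))"
      unfolding cost_def using s l2
      by (simp add: suminf_add[symmetric] summable_add summable_mult suminf_mult sum_sq_suminf)
    also have "\<dots> \<le> - \<epsilon> * nW W + ?G * (C * nx x) + cN * \<eta> * (C * nW W)"
      using coer[OF W] C(2)[OF z0, of x] C(2)[OF W, of "\<lambda>_. 0"] cN \<eta>
      by (intro add_mono mult_left_mono) (auto simp: n0)
    also have "\<dots> \<le> c * nx x"
    proof -
      have "cN * \<eta> * C * nW W \<le> \<epsilon> * nW W" using \<eta>C nW_nonneg[OF W] by (rule mult_right_mono)
      then show ?thesis by (simp add: c_def mult_ac)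
    qed
    finally show ?thesis .
  qed
  \<comment> \<open>The zero input bounds the value from below; together with \<open>upper\<close>
    this is the two-sided bound required for a quadratic form.\<close>
  have lower: "- (cN * C) * nx x \<le> cost N x (\<lambda>_. 0)" for x
  proof -
    let ?x = "\<lambda>t i. fps_nth (traj x (\<lambda>_. 0) i) t"
    have l2: "l2f (traj x (\<lambda>_. 0) i)" if "i < K + m" for i using that z0 by (rule l2_traj[rotated])
    have "- cN * (\<Sum>i<K + m. (?x t i)\<^sup>2) \<le> quad (K + m) N (?x t)" for t
      using quad_bounds(1)[OF \<eta>, where r="K + m" and N=N and x="?x t"] unfolding cN_def by (simp add: abs_le_iff)
    then have "(\<Sum>t. - cN * (\<Sum>i<K + m. (?x t i)\<^sup>2)) \<le> cost N x (\<lambda>_. 0)"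
      unfolding cost_def using l2 by (intro suminf_le summable_mult sum_sq_suminf quad_summable) auto
    also have "(\<Sum>t. - cN * (\<Sum>i<K + m. (?x t i)\<^sup>2)) = - cN * (\<Sum>i<K + m. sq (traj x (\<lambda>_. 0) i))"
      using sum_sq_suminf[where r="K + m" and Z="traj x (\<lambda>_. 0)"] l2 by (simp add: suminf_minus suminf_mult summable_mult)
    finally have "- cN * (\<Sum>i<K + m. sq (traj x (\<lambda>_. 0) i)) \<le> cost N x (\<lambda>_. 0)" .
    moreover have "cN * (\<Sum>i<K + m. sq (traj x (\<lambda>_. 0) i)) \<le> cN * (C * nx x)"
      using C(2)[OF z0, of x] cN by (intro mult_left_mono) (auto simp: n0)
    ultimately show ?thesis by (simp add: mult_ac)
  qed
  define V where "V x = (SUP W\<in>l2W. cost N x W)" for x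
  have bdd: "bdd_above (cost N x ` l2W)" for x using upper by (intro bdd_aboveI2[of _ _ "c * nx x"])
  have ne: "l2W \<noteq> {}" using z0 by auto
  have Vge: "cost N x W \<le> V x" if "W \<in> l2W" for x W
    unfolding V_def using bdd that by (intro cSUP_upper)
  have Vle: "V x \<le> b" if "\<And>W. W \<in> l2W \<Longrightarrow> cost N x W \<le> b" for x b
    unfolding V_def using ne that by (rule cSUP_least)
  have Vb: "\<bar>V x\<bar> \<le> (c + cN * C) * (\<Sum>i<K. (x i)\<^sup>2)" for x
  proof -
    have "V x \<le> c * nx x" using upper by (intro Vle)
    moreover have "- (cN * C) * nx x \<le> V x" using lower[of x] Vge[OF z0, of x] by linarith
    moreover have "0 \<le> c * nx x" "0 \<le> cN * C * nx x" using c cN C(1) nx_nonneg by auto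
    ultimately show ?thesis unfolding nx_def[symmetric] by (simp add: algebra_simps abs_le_iff)
  qed
  \<comment> \<open>Taking the suprema over U and W separately gives one half of the parallelogram
    law. The other half is this one at x + y and x - y, combined with V(2x) \<le> 4 V(x).\<close>
  have half: "2 * V x + 2 * V y \<le> V (\<lambda>i. x i + y i) + V (\<lambda>i. x i - y i)" for x y
  proof -
    have 1: "2 * cost N x U + 2 * cost N y W \<le> V (\<lambda>i. x i + y i) + V (\<lambda>i. x i - y i)" if "U \<in> l2W" "W \<in> l2W" for U W
    proof -
      have "(\<lambda>l. U l + W l) \<in> l2W" "(\<lambda>l. U l - W l) \<in> l2W" using that by (auto simp: l2W_def l2f_add l2f_diff)
      then show ?thesis unfolding cost_parallelogram[OF that, symmetric] by (intro add_mono Vge)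
    qed
    have "V x \<le> (V (\<lambda>i. x i + y i) + V (\<lambda>i. x i - y i) - 2 * cost N y W) / 2" if "W \<in> l2W" for W
      using 1[OF _ that] by (intro Vle) (simp add: field_simps)
    then have "V y \<le> (V (\<lambda>i. x i + y i) + V (\<lambda>i. x i - y i) - 2 * V x) / 2"
      by (intro Vle) (simp add: field_simps)
    then show ?thesis by (simp add: field_simps)
  qed
  have dbl: "V (\<lambda>i. 2 * x i) \<le> 4 * V x" for x
  proof (rule Vle)
    fix W assume W: "W \<in> l2W"
    define U where "U l = fps_const (1/2) * W l" for l
    have U: "U \<in> l2W" using W by (auto simp: U_def l2W_def l2f_cmult)
    have "(\<lambda>l. U l + U l) = W" by (auto simp: U_def fun_eq_iff fps_eq_iff)
    then have p: "cost N (\<lambda>i. x i + x i) W + cost N (\<lambda>_. 0) (\<lambda>_. 0) = 2 * cost N x U + 2 * cost N x U"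
      using cost_parallelogram[OF U U, where N=N and x=x and y=x] by (simp only: diff_self)
    have z: "cost N (\<lambda>_. 0) (\<lambda>_. 0) = 0"
      using traj_lin[of 0 "\<lambda>_. 0" 0 "\<lambda>_. 0" "\<lambda>_. 0" "\<lambda>_. 0"] by (simp add: cost_def quad_def)
    have e: "(\<lambda>i. x i + x i) = (\<lambda>i. 2 * x i)" by auto
    have "cost N (\<lambda>i. 2 * x i) W = 4 * cost N x U" using p z unfolding e by linarith
    then show "cost N (\<lambda>i. 2 * x i) W \<le> 4 * V x" using Vge[OF U, of x] by simp
  qed
  have par: "V (\<lambda>i. x i + y i) + V (\<lambda>i. x i - y i) = 2 * V x + 2 * V y" for x y
  proof (rule antisym)
    have "2 * V (\<lambda>i. x i + y i) + 2 * V (\<lambda>i. x i - y i) \<le> V (\<lambda>i. 2 * x i) + V (\<lambda>i. 2 * y i)"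
    proof -
      have e: "(\<lambda>i. x i + y i + (x i - y i)) = (\<lambda>i. 2 * x i)" "(\<lambda>i. x i + y i - (x i - y i)) = (\<lambda>i. 2 * y i)"
        by auto
      show ?thesis using half[of "\<lambda>i. x i + y i" "\<lambda>i. x i - y i"] unfolding e .
    qed
    then show "V (\<lambda>i. x i + y i) + V (\<lambda>i. x i - y i) \<le> 2 * V x + 2 * V y"
      using dbl[of x] dbl[of y] by linarith
  qed (rule half)
  have cc: "c + cN * C \<ge> 0" using c cN C(1) by simp
  obtain P where P: "\<And>i j. P i j = P j i" "\<And>x. V x = (\<Sum>i<K. \<Sum>j<K. P i j * x i * x j)"
    by (rule quadratic_of_parallelogram[OF par Vb cc], rule that)
  have VP: "V x = quad K P x" for x unfolding P(2) quad_def by (simp add: mult.assoc)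
  show thesis
  proof (rule that[of P])
    fix x w
    have "V (stp x w) \<le> V x - quad (K + m) N (comb x w)"
    proof (rule Vle)
      fix W assume W: "W \<in> l2W"
      show "cost N (stp x w) W \<le> V x - quad (K + m) N (comb x w)"
        using Vge[OF cost_step(1)[OF W], of x w] cost_step(2)[OF W, of N x w] by linarith
    qed
    then show "quad (K + m) N (comb x w) + quad K P (stp x w) \<le> quad K P x" by (simp add: VP)
  qed (use P Vge VP in auto)
qed

end

section \<open>Plant and filter in series, seen on the circle and in time\<close>

section \<open>The augmented system\<close>

lemma zts_const: "zts (fps_const c) (\<lambda>z. of_real c)"
  unfolding zts_def is_zt_def
proof
  have e: "zt_partial 1 (fps_nth (fps_const c)) (Suc N) z = of_real c" for N z
    unfolding zt_partial_def sum.lessThan_Suc_shift by simp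
  have "(\<lambda>N. circ (\<lambda>z. of_real c - zt_partial 1 (fps_nth (fps_const c)) (Suc N) z)) \<longlonglongrightarrow> 0"
    unfolding e by simp
  then show "(\<lambda>N. circ (\<lambda>z. of_real c - zt_partial 1 (fps_nth (fps_const c)) N z)) \<longlonglongrightarrow> 0"
    by (rule LIMSEQ_imp_Suc)
qed simp

context lti
begin

text \<open>The state equation on the circle. Multiplication by z removes the delay of
  \<open>st_eq\<close> and puts the factor z at the initial state; the exceptional null sets of the
  finitely many equations are united.\<close>

lemma st_zts:
  assumes W: "\<forall>l<m. zts (W l) (\<omega> l)" and X: "\<forall>i<K. zts (st x W i) (\<xi> i)"
  shows "AE \<theta> in lborel. \<theta> \<in> {0..2*pi} \<longrightarrow> (\<forall>i\<in>{..<K}. cis \<theta> * \<xi> i (cis \<theta>)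
    = cis \<theta> * of_real (x i) + (\<Sum>j<K. of_real (A i j) * \<xi> j (cis \<theta>)) + (\<Sum>l<m. of_real (B i l) * \<omega> l (cis \<theta>)))"
proof -
  have "AE \<theta> in lborel. \<forall>i\<in>{..<K}. \<theta> \<in> {0..2*pi} \<longrightarrow> \<xi> i (cis \<theta>)
     = of_real (x i) + ((\<Sum>j<K. of_real (A i j) * \<xi> j (cis \<theta>)) + (\<Sum>l<m. of_real (B i l) * \<omega> l (cis \<theta>))) / cis \<theta>"
  proof (rule AE_finite_allI)
    fix i assume i: "i \<in> {..<K}"
    then have "zts (st x W i) (\<lambda>z. of_real (x i) + ((\<Sum>j<K. of_real (A i j) * \<xi> j z) + (\<Sum>l<m. of_real (B i l) * \<omega> l z)) / z)"
      using W X by (subst st_eq) (auto intro!: zts_add zts_const zts_delay zts_sum zts_cmult)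
    from zts_unique[OF X[rule_format] this] i
    show "AE \<theta> in lborel. \<theta> \<in> {0..2*pi} \<longrightarrow> \<xi> i (cis \<theta>)
     = of_real (x i) + ((\<Sum>j<K. of_real (A i j) * \<xi> j (cis \<theta>)) + (\<Sum>l<m. of_real (B i l) * \<omega> l (cis \<theta>))) / cis \<theta>"
      by simp
  qed simp
  then show ?thesis
  proof eventually_elim
    case (elim \<theta>)
    show ?case
    proof (intro impI ballI)
      fix i assume "\<theta> \<in> {0..2*pi}" "i \<in> {..<K}"
      then have "\<xi> i (cis \<theta>) = of_real (x i) + ((\<Sum>j<K. of_real (A i j) * \<xi> j (cis \<theta>)) + (\<Sum>l<m. of_real (B i l) * \<omega> l (cis \<theta>))) / cis \<theta>"
        using elim by blast
      from arg_cong[OF this, of "\<lambda>x. cis \<theta> * x"]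
      show "cis \<theta> * \<xi> i (cis \<theta>) = cis \<theta> * of_real (x i) + (\<Sum>j<K. of_real (A i j) * \<xi> j (cis \<theta>)) + (\<Sum>l<m. of_real (B i l) * \<omega> l (cis \<theta>))"
        by (simp add: distrib_left)
    qed
  qed
qed

end

text \<open>Realizations enter through two properties: there is no eigenvalue of modulus at least
  \<rho>, and at the points \<rho> z every solution of the state equation has the output that the
  transfer function prescribes. This keeps matrices over the rational functions out of the
  argument.\<close>

locale aug = iqc \<rho> a b F d M \<Pi>m for \<rho> a b F d M \<Pi>m +
  fixes kG kP :: nat and AG BG CG DG AP BP CP DP :: "nat \<Rightarrow> nat \<Rightarrow> real"
    and Gr :: "nat \<Rightarrow> nat \<Rightarrow> complex \<Rightarrow> complex" and \<epsilon> :: real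
  assumes specG: "\<And>s v. cmod s \<ge> \<rho> \<Longrightarrow> (\<And>i. i < kG \<Longrightarrow> (\<Sum>j<kG. of_real (AG i j) * v j) = s * v i) \<Longrightarrow> (\<And>i. i < kG \<Longrightarrow> v i = 0)"
    and specP: "\<And>s v. cmod s \<ge> \<rho> \<Longrightarrow> (\<And>i. i < kP \<Longrightarrow> (\<Sum>j<kP. of_real (AP i j) * v j) = s * v i) \<Longrightarrow> (\<And>i. i < kP \<Longrightarrow> v i = 0)"
    and ssG: "\<And>z \<xi> \<upsilon> k. cmod z = 1 \<Longrightarrow>
       (\<And>i. i < kG \<Longrightarrow> of_real \<rho> * z * \<xi> i - (\<Sum>j<kG. of_real (AG i j) * \<xi> j) = (\<Sum>l<b. of_real (BG i l) * \<upsilon> l)) \<Longrightarrow>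
       k < a \<Longrightarrow> (\<Sum>j<kG. of_real (CG k j) * \<xi> j) + (\<Sum>l<b. of_real (DG k l) * \<upsilon> l) = (\<Sum>l<b. Gr k l z * \<upsilon> l)"
    and ssP: "\<And>z \<xi> \<upsilon> k. cmod z = 1 \<Longrightarrow>
       (\<And>i. i < kP \<Longrightarrow> of_real \<rho> * z * \<xi> i - (\<Sum>j<kP. of_real (AP i j) * \<xi> j) = (\<Sum>l<a + b. of_real (BP i l) * \<upsilon> l)) \<Longrightarrow>
       k < a + b \<Longrightarrow> (\<Sum>j<kP. of_real (CP k j) * \<xi> j) + (\<Sum>l<a + b. of_real (DP k l) * \<upsilon> l) = (\<Sum>l<a + b. Pf k l z * \<upsilon> l)"
    and \<epsilon>: "\<epsilon> > 0"
    and fdi: "\<And>z \<omega>. cmod z = 1 \<Longrightarrow>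
       Re (\<Sum>i<a + b. \<Sum>j<a + b. cnj (if i < a then (\<Sum>l<b. Gr i l z * \<omega> l) else \<omega> (i - a))
         * rf_eval (scale_mat \<rho> \<Pi>m $$ (i,j)) z * (if j < a then (\<Sum>l<b. Gr j l z * \<omega> l) else \<omega> (j - a)))
       \<le> - \<epsilon> * (\<Sum>l<b. (cmod (\<omega> l))\<^sup>2)"
begin

text \<open>Entries of the augmented matrices, unscaled; the systems below divide the state and
  input matrices by \<rho>.\<close>

definition Aa :: "nat \<Rightarrow> nat \<Rightarrow> real" where
  "Aa i j = (if i < kG then (if j < kG then AG i j else 0)
     else if j < kG then (\<Sum>s<a. BP (i - kG) s * CG s j) else AP (i - kG) (j - kG))"
definition Ba :: "nat \<Rightarrow> nat \<Rightarrow> real" where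
  "Ba i l = (if i < kG then BG i l else (\<Sum>s<a. BP (i - kG) s * DG s l) + BP (i - kG) (l + a))"
definition Ca :: "nat \<Rightarrow> nat \<Rightarrow> real" where
  "Ca k j = (if j < kG then (\<Sum>s<a. DP k s * CG s j) else CP k (j - kG))"
definition Da :: "nat \<Rightarrow> nat \<Rightarrow> real" where
  "Da k l = (\<Sum>s<a. DP k s * DG s l) + DP k (l + a)"

text \<open>A kernel vector of I - x A/\<rho> is an eigenvector of A for \<rho>/x, of modulus at
  least \<rho>. The value x = 0 is excluded because the matrix is then the identity.\<close>

lemma shift_singular:
  assumes x: "cmod x \<le> 1" and d: "det (pmat k (shiftmat (\<lambda>i j. A i j / \<rho>)) x) = 0"
  obtains s v where "cmod s \<ge> \<rho>" "\<And>i. i < k \<Longrightarrow> (\<Sum>j<k. of_real (A i j) * v j) = s * v i" "\<exists>i<k. v i \<noteq> 0"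
proof -
  let ?E = "pmat k (shiftmat (\<lambda>i j. A i j / \<rho>)) x"
  have E: "?E \<in> carrier_mat k k" by (simp add: pmat_def)
  obtain v where v: "v \<in> carrier_vec k" "v \<noteq> 0\<^sub>v k" "?E *\<^sub>v v = 0\<^sub>v k"
    using d det_0_iff_vec_prod_zero_field[OF E] by auto
  have m1: "cpoly (monom c (Suc 0)) x = x * of_real c" for c by (simp add: monom_Suc monom_0)
  have row: "v $ i = x * ((\<Sum>j<k. of_real (A i j) * v $ j) / of_real \<rho>)" if "i < k" for i
  proof -
    have "0 = (?E *\<^sub>v v) $ i" using v(3) that by simp
    also have "\<dots> = (\<Sum>j<k. ((if i = j then 1 else 0) - x * of_real (A i j / \<rho>)) * v $ j)"
      using that v(1) by (auto simp: pmat_def scalar_prod_def atLeast0LessThan shiftmat_def m1 intro!: sum.cong)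
    also have "\<dots> = (\<Sum>j<k. (if i = j then v $ j else 0) - x * (of_real (A i j) * v $ j / of_real \<rho>))"
      by (intro sum.cong refl) (simp add: left_diff_distrib)
    also have "\<dots> = v $ i - x * ((\<Sum>j<k. of_real (A i j) * v $ j) / of_real \<rho>)"
      using that by (simp add: sum_subtractf sum_distrib_left sum_divide_distrib)
    finally show ?thesis by simp
  qed
  have ex: "\<exists>i<k. v $ i \<noteq> 0" using v(1,2) by (metis carrier_vecD eq_vecI index_zero_vec)
  then have x0: "x \<noteq> 0" using row by force
  show thesis
  proof (rule that[of "of_real \<rho> / x" "\<lambda>i. v $ i"])
    show "cmod (of_real \<rho> / x) \<ge> \<rho>" using x x0 \<rho> by (simp add: norm_divide le_divide_eq mult_left_le)
    show "(\<Sum>j<k. of_real (A i j) * v $ j) = of_real \<rho> / x * v $ i" if "i < k" for i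
    proof -
      let ?S = "\<Sum>j<k. of_real (A i j) * v $ j"
      have "of_real \<rho> / x * v $ i = of_real \<rho> / x * (x * (?S / of_real \<rho>))"
        by (rule arg_cong[OF row[OF that]])
      also have "\<dots> = ?S" using x0 \<rho> by simp
      finally show ?thesis by simp
    qed
  qed (rule ex)
qed

text \<open>The filter alone and without inputs; it carries the free response to the filter's own
  initial state.\<close>

sublocale Q: lti kP 0 "\<lambda>i j. AP i j / \<rho>" "\<lambda>_ _. 0"
proof
  fix x :: complex assume x: "cmod x \<le> 1"
  show "det (pmat kP (shiftmat (\<lambda>i j. AP i j / \<rho>)) x) \<noteq> 0"
  proof
    assume d0: "det (pmat kP (shiftmat (\<lambda>i j. AP i j / \<rho>)) x) = 0"
    obtain s v where s: "cmod s \<ge> \<rho>" and v: "\<And>i. i < kP \<Longrightarrow> (\<Sum>j<kP. of_real (AP i j) * v j) = s * v i"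
      and nz: "\<exists>i<kP. v i \<noteq> 0"
      by (rule shift_singular[OF x d0], rule that)
    show False using specP[OF s v] nz by blast
  qed
qed

text \<open>By the block triangular form, an eigenvector vanishes first in the part of G and then in
  that of the filter.\<close>

sublocale L: lti "kG + kP" b "\<lambda>i j. Aa i j / \<rho>" "\<lambda>i j. Ba i j / \<rho>"
proof
  fix x :: complex assume x: "cmod x \<le> 1"
  show "det (pmat (kG + kP) (shiftmat (\<lambda>i j. Aa i j / \<rho>)) x) \<noteq> 0"
  proof
    assume d0: "det (pmat (kG + kP) (shiftmat (\<lambda>i j. Aa i j / \<rho>)) x) = 0"
    obtain s v where s: "cmod s \<ge> \<rho>" and v: "\<And>i. i < kG + kP \<Longrightarrow> (\<Sum>j<kG + kP. of_real (Aa i j) * v j) = s * v i"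
      and nz: "\<exists>i<kG + kP. v i \<noteq> 0"
      by (rule shift_singular[OF x d0], rule that)
    have "(\<Sum>j<kG. of_real (AG i j) * v j) = s * v i" if "i < kG" for i
      using v[of i] that by (simp add: sum_lessThan_add[of _ kG kP] Aa_def)
    then have 1: "v i = 0" if "i < kG" for i using specG[OF s, of v i] that by auto
    have "(\<Sum>j<kP. of_real (AP i j) * v (j + kG)) = s * v (i + kG)" if "i < kP" for i
      using v[of "i + kG"] that 1 by (simp add: sum_lessThan_add[of _ kG kP] Aa_def)
    then have 2: "v (i + kG) = 0" if "i < kP" for i using specP[OF s, of "\<lambda>i. v (i + kG)" i] that by auto
    obtain i where i: "i < kG + kP" "v i \<noteq> 0" using nz by auto
    show False
    proof (cases "i < kG")
      case False
      then have "i - kG < kP" "i - kG + kG = i" using i(1) by linarith+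
      then show False using 2[of "i - kG"] i(2) by simp
    qed (use 1[of i] i in simp)
  qed
qed

definition outY :: "(nat \<Rightarrow> real) \<Rightarrow> (nat \<Rightarrow> real fps) \<Rightarrow> nat \<Rightarrow> real fps" where
  "outY x W s = (\<Sum>j<kG. fps_const (CG s j) * L.st x W j) + (\<Sum>l<b. fps_const (DG s l) * W l)"
definition outU :: "(nat \<Rightarrow> real) \<Rightarrow> (nat \<Rightarrow> real fps) \<Rightarrow> nat \<Rightarrow> real fps" where
  "outU x W j = (if j < a then outY x W j else W (j - a))"
definition outP :: "(nat \<Rightarrow> real) \<Rightarrow> (nat \<Rightarrow> real fps) \<Rightarrow> nat \<Rightarrow> real fps" where
  "outP x W k = (\<Sum>j<kG + kP. fps_const (Ca k j) * L.st x W j) + (\<Sum>l<b. fps_const (Da k l) * W l)"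
text \<open>Only the filter's part of the initial state enters; that of G reaches the filter through
  the output y.\<close>

definition freeP :: "(nat \<Rightarrow> real) \<Rightarrow> nat \<Rightarrow> real fps" where
  "freeP x k = (\<Sum>j<kP. fps_const (CP k j) * Q.st (\<lambda>j. x (j + kG)) (\<lambda>_. 0) j)"

text \<open>Elimination of y from a row acting on (y, w) by the output equation of G; it matches the
  state rows and the output rows of the augmented system alike.\<close>

lemma interconnect:
  fixes c :: "nat \<Rightarrow> real" and \<xi> \<omega> :: "nat \<Rightarrow> complex"
  shows "(\<Sum>j<n. of_real (c j) * (if j < a then (\<Sum>i<kG. of_real (CG j i) * \<xi> i) + (\<Sum>l<b. of_real (DG j l) * \<omega> l) else \<omega> (j - a)))
    = (\<Sum>i<kG. of_real (\<Sum>s<a. c s * CG s i) * \<xi> i) + (\<Sum>l<b. of_real ((\<Sum>s<a. c s * DG s l) + c (l + a)) * \<omega> l)"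
proof -
  have "(\<Sum>s<a. of_real (c s) * (\<Sum>i<kG. of_real (CG s i) * \<xi> i)) = (\<Sum>i<kG. of_real (\<Sum>s<a. c s * CG s i) * \<xi> i)"
    by (simp add: sum_distrib_left sum_distrib_right mult.assoc) (rule sum.swap)
  moreover have "(\<Sum>s<a. of_real (c s) * (\<Sum>l<b. of_real (DG s l) * \<omega> l)) = (\<Sum>l<b. of_real (\<Sum>s<a. c s * DG s l) * \<omega> l)"
    by (simp add: sum_distrib_left sum_distrib_right mult.assoc) (rule sum.swap)
  ultimately show ?thesis
    by (simp add: sum_lessThan_add[of _ a b] distrib_left distrib_right sum.distrib)
qed

context
  fixes x :: "nat \<Rightarrow> real" and W :: "nat \<Rightarrow> real fps" and \<xi> \<omega> :: "nat \<Rightarrow> complex \<Rightarrow> complex"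
  assumes W: "W \<in> L.l2W" and \<omega>: "\<And>l. l < b \<Longrightarrow> zts (W l) (\<omega> l)"
    and \<xi>: "\<And>i. i < kG + kP \<Longrightarrow> zts (L.st x W i) (\<xi> i)"
begin

definition \<upsilon> :: "nat \<Rightarrow> complex \<Rightarrow> complex" where
  "\<upsilon> j z = (if j < a then (\<Sum>i<kG. of_real (CG j i) * \<xi> i z) + (\<Sum>l<b. of_real (DG j l) * \<omega> l z) else \<omega> (j - a) z)"

lemma l2_outU: "j < n \<Longrightarrow> l2f (outU x W j)"
  using W L.l2_st[OF W] unfolding outU_def outY_def
  by (auto intro!: l2f_add l2f_sum l2f_cmult simp: L.l2W_def)

lemma zts_outU: "j < n \<Longrightarrow> zts (outU x W j) (\<upsilon> j)"
proof -
  assume j: "j < n"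
  show ?thesis
  proof (cases "j < a")
    case True
    then have "\<upsilon> j = (\<lambda>z. (\<Sum>i<kG. of_real (CG j i) * \<xi> i z) + (\<Sum>l<b. of_real (DG j l) * \<omega> l z))"
      by (auto simp: \<upsilon>_def)
    then show ?thesis using True \<omega> \<xi> by (auto simp: outU_def outY_def intro!: zts_add zts_sum zts_cmult)
  next
    case False
    then have "\<upsilon> j = \<omega> (j - a)" by (auto simp: \<upsilon>_def)
    then show ?thesis using False j \<omega> by (auto simp: outU_def)
  qed
qed

text \<open>On the circle, the filter state minus its free part solves the filter's state equation
  with zero initial state and input (y, w), so the realization property gives the output; equality
  on the circle is then carried back to time.\<close>

lemma outP_decomp:
  assumes k: "k < n" shows "outP x W k = freeP x k + resp (outU x W) k"
proof -
  let ?x = "\<lambda>j. x (j + kG)"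
  have \<omega>': "\<forall>l<b. zts (W l) (\<omega> l)" and \<xi>': "\<forall>i<kG + kP. zts (L.st x W i) (\<xi> i)" using \<omega> \<xi> by auto
  have z0: "(\<lambda>_. 0) \<in> Q.l2W" by (simp add: Q.l2W_def)
  have "\<exists>f. zts (Q.st ?x (\<lambda>_. 0) i) f" for i using zts_exists[OF Q.l2_st[OF z0]] .
  then obtain \<zeta> where \<zeta>: "\<And>i. zts (Q.st ?x (\<lambda>_. 0) i) (\<zeta> i)" by metis
  then have \<zeta>': "\<forall>i<kP. zts (Q.st ?x (\<lambda>_. 0) i) (\<zeta> i)" by simp
  have nul: "\<forall>l<0. zts ((\<lambda>_. 0) l) ((\<lambda>_ _. 0) (l :: nat))" by simp
  have l2: "l2f (outP x W k)" "l2f (freeP x k)"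
    using W L.l2_st[OF W] Q.l2_st[OF z0] unfolding outP_def freeP_def
    by (auto intro!: l2f_add l2f_sum l2f_cmult simp: L.l2W_def)
  have zP: "zts (outP x W k) (\<lambda>z. (\<Sum>j<kG + kP. of_real (Ca k j) * \<xi> j z) + (\<Sum>l<b. of_real (Da k l) * \<omega> l z))"
    unfolding outP_def using \<omega> \<xi> by (intro zts_add zts_sum zts_cmult) auto
  have zF: "zts (freeP x k) (\<lambda>z. \<Sum>j<kP. of_real (CP k j) * \<zeta> j z)"
    unfolding freeP_def using \<zeta> by (intro zts_sum zts_cmult)
  have zR: "zts (resp (outU x W) k) (\<lambda>z. \<Sum>j<n. Pf k j z * \<upsilon> j z)"
    by (rule zts_resp) (auto intro: l2_outU zts_outU)
  note z = zts_diff[OF zts_diff[OF zP zF] zR]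
  have "outP x W k - freeP x k - resp (outU x W) k = 0"
  proof (rule zts_zero_imp[OF z])
    show "l2f (outP x W k - freeP x k - resp (outU x W) k)"
      using l2 by (intro l2f_diff l2_resp l2_outU)
    show "AE \<theta> in lborel. \<theta> \<in> {0..2*pi} \<longrightarrow> (\<Sum>j<kG + kP. of_real (Ca k j) * \<xi> j (cis \<theta>)) + (\<Sum>l<b. of_real (Da k l) * \<omega> l (cis \<theta>))
       - (\<Sum>j<kP. of_real (CP k j) * \<zeta> j (cis \<theta>)) - (\<Sum>j<n. Pf k j (cis \<theta>) * \<upsilon> j (cis \<theta>)) = 0"
      using L.st_zts[OF \<omega>' \<xi>'] Q.st_zts[OF nul \<zeta>']
    proof eventually_elim
      case (elim \<theta>)
      show ?case
      proof
        assume \<theta>: "\<theta> \<in> {0..2*pi}"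
        let ?z = "cis \<theta>"
        let ?\<xi> = "\<lambda>i. \<xi> (i + kG) ?z - \<zeta> i ?z"
        have "of_real \<rho> * ?z * ?\<xi> i - (\<Sum>j<kP. of_real (AP i j) * ?\<xi> j) = (\<Sum>l<n. of_real (BP i l) * \<upsilon> l ?z)"
          if i: "i < kP" for i
        proof -
          have 1: "?z * \<xi> (i + kG) ?z = ?z * of_real (x (i + kG)) + (\<Sum>j<kG + kP. of_real (Aa (i + kG) j / \<rho>) * \<xi> j ?z) + (\<Sum>l<b. of_real (Ba (i + kG) l / \<rho>) * \<omega> l ?z)"
            using elim(1) \<theta> i by auto
          have 2: "?z * \<zeta> i ?z = ?z * of_real (x (i + kG)) + (\<Sum>j<kP. of_real (AP i j / \<rho>) * \<zeta> j ?z)"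
            using elim(2) \<theta> i by auto
          have "of_real \<rho> * (?z * \<xi> (i + kG) ?z) = of_real \<rho> * ?z * of_real (x (i + kG)) + (\<Sum>j<kG + kP. of_real (Aa (i + kG) j) * \<xi> j ?z) + (\<Sum>l<b. of_real (Ba (i + kG) l) * \<omega> l ?z)"
            unfolding 1 using \<rho> by (simp add: distrib_left sum_distrib_left mult.assoc)
          moreover have "of_real \<rho> * (?z * \<zeta> i ?z) = of_real \<rho> * ?z * of_real (x (i + kG)) + (\<Sum>j<kP. of_real (AP i j) * \<zeta> j ?z)"
            unfolding 2 using \<rho> by (simp add: distrib_left sum_distrib_left mult.assoc)
          moreover have "(\<Sum>j<kG + kP. of_real (Aa (i + kG) j) * \<xi> j ?z) = (\<Sum>j<kG. of_real (\<Sum>s<a. BP i s * CG s j) * \<xi> j ?z) + (\<Sum>j<kP. of_real (AP i j) * \<xi> (j + kG) ?z)"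
            by (simp add: sum_lessThan_add[of _ kG kP] Aa_def)
          moreover have "(\<Sum>l<n. of_real (BP i l) * \<upsilon> l ?z) = (\<Sum>j<kG. of_real (\<Sum>s<a. BP i s * CG s j) * \<xi> j ?z) + (\<Sum>l<b. of_real (Ba (i + kG) l) * \<omega> l ?z)"
            unfolding \<upsilon>_def interconnect[where \<xi>="\<lambda>i. \<xi> i ?z" and \<omega>="\<lambda>l. \<omega> l ?z"] by (simp add: Ba_def)
          ultimately show ?thesis by (simp add: right_diff_distrib sum_subtractf mult.assoc)
        qed
        from ssP[OF norm_cis this k]
        have "(\<Sum>j<kP. of_real (CP k j) * ?\<xi> j) + (\<Sum>l<n. of_real (DP k l) * \<upsilon> l ?z) = (\<Sum>l<n. Pf k l ?z * \<upsilon> l ?z)" .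
        moreover have "(\<Sum>l<n. of_real (DP k l) * \<upsilon> l ?z) = (\<Sum>j<kG. of_real (Ca k j) * \<xi> j ?z) + (\<Sum>l<b. of_real (Da k l) * \<omega> l ?z)"
          unfolding \<upsilon>_def interconnect[where \<xi>="\<lambda>i. \<xi> i ?z" and \<omega>="\<lambda>l. \<omega> l ?z"] by (simp add: Ca_def Da_def)
        moreover have "(\<Sum>j<kG + kP. of_real (Ca k j) * \<xi> j ?z) = (\<Sum>j<kG. of_real (Ca k j) * \<xi> j ?z) + (\<Sum>j<kP. of_real (CP k j) * \<xi> (j + kG) ?z)"
          by (simp add: sum_lessThan_add[of _ kG kP] Ca_def)
        ultimately show "(\<Sum>j<kG + kP. of_real (Ca k j) * \<xi> j ?z) + (\<Sum>l<b. of_real (Da k l) * \<omega> l ?z)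
           - (\<Sum>j<kP. of_real (CP k j) * \<zeta> j ?z) - (\<Sum>j<n. Pf k j ?z * \<upsilon> j ?z) = 0"
          by (simp add: right_diff_distrib sum_subtractf algebra_simps)
      qed
    qed
  qed
  then show ?thesis by (simp add: algebra_simps)
qed

text \<open>From state zero the filter input is (G w, w) on the circle, which is where the frequency
  domain inequality applies.\<close>

lemma zero_state_energy:
  assumes x: "x = (\<lambda>_. 0)"
  shows "(\<Sum>t. qM n M (outP x W) t) \<le> - \<epsilon> * (\<Sum>l<b. sq (W l))"
proof -
  have \<omega>': "\<forall>l<b. zts (W l) (\<omega> l)" and \<xi>': "\<forall>i<kG + kP. zts (L.st x W i) (\<xi> i)" using \<omega> \<xi> by auto
  have "freeP x k = 0" for k
    unfolding freeP_def Q.st_def Q.inp_def by (simp add: x)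
  then have P: "outP x W k = resp (outU x W) k" if "k < n" for k using outP_decomp[OF that] by simp
  show ?thesis unfolding sq_def
  proof (rule energy_le[where f=\<upsilon> and w=\<omega>])
    show "l2f (outP x W k)" if "k < n" for k unfolding P[OF that] by (intro l2_resp l2_outU)
    show "zts (outP x W k) (\<lambda>z. \<Sum>j<n. Pf k j z * \<upsilon> j z)" if "k < n" for k
      unfolding P[OF that] by (intro zts_resp l2_outU zts_outU)
    show "AE \<theta> in lborel. \<theta> \<in> {0..2*pi} \<longrightarrow> Re (\<Sum>i<n. \<Sum>j<n. cnj (\<upsilon> i (cis \<theta>)) * S.r i j (cis \<theta>) * \<upsilon> j (cis \<theta>))
       \<le> - \<epsilon> * (\<Sum>l<b. (cmod (\<omega> l (cis \<theta>)))\<^sup>2)"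
      using L.st_zts[OF \<omega>' \<xi>']
    proof eventually_elim
      case (elim \<theta>)
      show ?case
      proof
        assume \<theta>: "\<theta> \<in> {0..2*pi}"
        let ?z = "cis \<theta>"
        have "of_real \<rho> * ?z * \<xi> i ?z - (\<Sum>j<kG. of_real (AG i j) * \<xi> j ?z) = (\<Sum>l<b. of_real (BG i l) * \<omega> l ?z)"
          if i: "i < kG" for i
        proof -
          have 1: "?z * \<xi> i ?z = (\<Sum>j<kG + kP. of_real (Aa i j / \<rho>) * \<xi> j ?z) + (\<Sum>l<b. of_real (Ba i l / \<rho>) * \<omega> l ?z)"
            using elim \<theta> i x by auto
          have "of_real \<rho> * (?z * \<xi> i ?z) = (\<Sum>j<kG + kP. of_real (Aa i j) * \<xi> j ?z) + (\<Sum>l<b. of_real (Ba i l) * \<omega> l ?z)"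
            unfolding 1 using \<rho> by (simp add: distrib_left sum_distrib_left)
          then show ?thesis using i by (simp add: sum_lessThan_add[of _ kG kP] Aa_def Ba_def mult.assoc)
        qed
        note g = ssG[OF norm_cis this]
        have "\<upsilon> j ?z = (if j < a then (\<Sum>l<b. Gr j l ?z * \<omega> l ?z) else \<omega> (j - a) ?z)" for j
          unfolding \<upsilon>_def using g by simp
        then show "Re (\<Sum>i<n. \<Sum>j<n. cnj (\<upsilon> i ?z) * S.r i j ?z * \<upsilon> j ?z) \<le> - \<epsilon> * (\<Sum>l<b. (cmod (\<omega> l ?z))\<^sup>2)"
          using fdi[OF norm_cis, where \<omega>="\<lambda>l. \<omega> l ?z"] by (simp only:)
      qed
    qed
    show "l2f (W i)" if "i < b" for i using W that by (simp add: L.l2W_def)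
  qed (rule \<omega>)
qed

end

end

section \<open>The LMI in index form, from the value function of the perturbed cost\<close>

context aug
begin

abbreviation K0 :: nat where "K0 \<equiv> kG + kP"

definition CD :: "nat \<Rightarrow> nat \<Rightarrow> real" where
  "CD k i = (if i < K0 then Ca k i else Da k (i - K0))"

text \<open>The form M of the output, pulled back along [C D] to state and input.\<close>

definition N0 :: "nat \<Rightarrow> nat \<Rightarrow> real" where
  "N0 i j = (\<Sum>k<n. \<Sum>l<n. M k l * (CD k i * CD l j))"

lemma quad_N0: "quad r N0 z = quad n M (\<lambda>k. \<Sum>i<r. CD k i * z i)"
proof -
  have "quad r N0 z = (\<Sum>i<r. \<Sum>j<r. \<Sum>k<n. \<Sum>l<n. M k l * ((CD k i * z i) * (CD l j * z j)))"
    unfolding quad_def N0_def sum_distrib_right by (intro sum.cong refl) (simp only: mult_ac)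
  also have "\<dots> = (\<Sum>i<r. \<Sum>k<n. \<Sum>l<n. \<Sum>j<r. M k l * ((CD k i * z i) * (CD l j * z j)))"
    by (rule sum.cong[OF refl], subst sum.swap, rule sum.cong[OF refl], rule sum.swap)
  also have "\<dots> = (\<Sum>k<n. \<Sum>l<n. \<Sum>i<r. \<Sum>j<r. M k l * ((CD k i * z i) * (CD l j * z j)))"
    by (subst sum.swap, rule sum.cong[OF refl], rule sum.swap)
  also have "\<dots> = quad n M (\<lambda>k. \<Sum>i<r. CD k i * z i)"
    unfolding quad_def by (simp only: sum_product) (simp only: sum_distrib_left)
  finally show ?thesis .
qed

lemma CD_sum: "(\<Sum>i<K0 + b. CD k i * z i) = (\<Sum>j<K0. Ca k j * z j) + (\<Sum>l<b. Da k l * z (l + K0))"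
  by (simp add: sum_lessThan_add[of _ K0 b] CD_def)

text \<open>The perturbation that makes the non-strict inequality of \<open>kyp_lemma\<close> strict
  for the original form.\<close>

definition Nd :: "real \<Rightarrow> nat \<Rightarrow> nat \<Rightarrow> real" where
  "Nd \<delta> i j = N0 i j + (if i = j then \<delta> else 0)"

lemma quad_Nd: "quad r (Nd \<delta>) z = quad r N0 z + \<delta> * (\<Sum>i<r. (z i)\<^sup>2)"
proof -
  have "quad r (Nd \<delta>) z = quad r N0 z + (\<Sum>i<r. \<Sum>j<r. if i = j then \<delta> * (z i)\<^sup>2 else 0)"
    unfolding quad_def Nd_def sum.distrib[symmetric]
    by (intro sum.cong refl) (simp add: distrib_right power2_eq_square)
  then show ?thesis by (simp add: sum_distrib_left)
qed

lemma cost_Nd: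
  assumes W: "W \<in> L.l2W"
  shows "L.cost (Nd \<delta>) x W = (\<Sum>t. qM n M (outP x W) t) + \<delta> * (\<Sum>i<K0 + b. sq (L.traj x W i))"
proof -
  have o: "(\<Sum>i<K0 + b. CD k i * fps_nth (L.traj x W i) t) = fps_nth (outP x W k) t" for k t
    unfolding CD_sum by (simp add: outP_def fps_sum_nth L.traj_def)
  have l2: "l2f (L.traj x W i)" if "i < K0 + b" for i by (rule L.l2_traj[OF W that])
  have l2P: "l2f (outP x W k)" for k
    using W L.l2_st[OF W] unfolding outP_def by (auto intro!: l2f_add l2f_sum l2f_cmult simp: L.l2W_def)
  have e: "quad (K0 + b) (Nd \<delta>) (\<lambda>i. fps_nth (L.traj x W i) t) = qM n M (outP x W) t + \<delta> * (\<Sum>i<K0 + b. (fps_nth (L.traj x W i) t)\<^sup>2)" for t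
    unfolding quad_Nd quad_N0 o by (simp add: qM_def quad_def)
  have s: "summable (qM n M (outP x W))" "summable (\<lambda>t. \<Sum>i<K0 + b. (fps_nth (L.traj x W i) t)\<^sup>2)"
    using l2 l2P by (auto intro!: qM_summable L.sum_sq_suminf)
  show ?thesis unfolding L.cost_def e
    using s l2 by (simp add: suminf_add[symmetric] summable_mult suminf_mult L.sum_sq_suminf)
qed

lemma zts_families:
  assumes W: "W \<in> L.l2W"
  obtains \<xi> \<omega> where "\<And>l. l < b \<Longrightarrow> zts (W l) (\<omega> l)" "\<And>i. i < K0 \<Longrightarrow> zts (L.st x W i) (\<xi> i)"
proof -
  have "\<forall>l. \<exists>f. l < b \<longrightarrow> zts (W l) f" using W zts_exists by (auto simp: L.l2W_def)
  then obtain \<omega> where "\<forall>l. l < b \<longrightarrow> zts (W l) (\<omega> l)" by metis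
  moreover have "\<forall>i. \<exists>f. zts (L.st x W i) f" using L.l2_st[OF W] zts_exists by blast
  then obtain \<xi> where "\<forall>i. zts (L.st x W i) (\<xi> i)" by metis
  ultimately show thesis by (intro that) auto
qed

text \<open>The input is chosen such that, together with a suitable output of \<open>G\<close>, it would cancel the
  free response of the filter; the mismatch only enters through the first block of the multiplier.\<close>

lemma nonneg_cost_input:
  obtains W where "W \<in> L.l2W" "0 \<le> (\<Sum>t. qM n M (outP x W) t)"
proof -
  have z0: "(\<lambda>_. 0) \<in> Q.l2W" by (simp add: Q.l2W_def)
  have fr: "l2f (freeP x k)" for k
    using Q.l2_st[OF z0] unfolding freeP_def by (auto intro!: l2f_sum l2f_cmult)
  obtain h where h: "\<And>i j. l1f (h i j)"
    "\<And>W k. k < n \<Longrightarrow> resp (\<lambda>j. \<Sum>l<n. h j l * W l) k = W k"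
    "\<And>U j. j < n \<Longrightarrow> (\<Sum>l<n. h j l * resp U l) = U j"
    by (rule inverse_filter, rule that)
  define V where "V j = (\<Sum>l<n. h j l * freeP x l)" for j
  have V2: "l2f (V j)" for j unfolding V_def by (intro l2f_sum l2f_l1f_mult h fr)
  have rV: "resp V k = freeP x k" if "k < n" for k using h(2)[OF that, of "freeP x"] by (simp add: V_def[abs_def])
  define W where "W l = - V (l + a)" for l
  have W: "W \<in> L.l2W" using V2 by (auto simp: L.l2W_def W_def l2f_uminus)
  obtain \<xi> \<omega> where zt: "\<And>l. l < b \<Longrightarrow> zts (W l) (\<omega> l)" "\<And>i. i < K0 \<Longrightarrow> zts (L.st x W i) (\<xi> i)"
    by (rule zts_families[OF W], rule that)
  \<comment> \<open>Since V filters to the free response, the whole output is the response to R. The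
    choice of W makes the second block of R zero.\<close>
  define R where "R j = outU x W j + V j" for j
  have oU: "l2f (outU x W j)" if "j < n" for j using l2_outU[OF W zt that] .
  have R2: "l2f (R j)" if "j < n" for j unfolding R_def using oU[OF that] V2 by (rule l2f_add)
  have R0: "R j = 0" if "a \<le> j" for j using that by (simp add: R_def outU_def W_def)
  have P: "outP x W k = resp R k" if "k < n" for k
    using outP_decomp[OF W zt that] rV[OF that]
    by (simp add: R_def resp_def distrib_left sum.distrib)
  have "\<exists>f. (j < n \<longrightarrow> zts (R j) f) \<and> (a \<le> j \<longrightarrow> f = (\<lambda>_. 0))" for j
  proof (cases "a \<le> j")
    case True
    then show ?thesis using R0 by (metis zts_0)
  next
    case False
    then show ?thesis using zts_exists[OF R2[of j]] by auto
  qed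
  then obtain f where f: "\<And>j. j < n \<Longrightarrow> zts (R j) (f j)" "\<And>j. a \<le> j \<Longrightarrow> f j = (\<lambda>_. 0)" by metis
  have "0 \<le> (\<Sum>t. qM n M (resp R) t)"
    by (rule energy_nonneg[where f=f]) (use f R2 in \<open>auto intro!: l2_resp zts_resp\<close>)
  also have "qM n M (resp R) = qM n M (outP x W)"
    by (rule ext) (simp add: qM_def P)
  finally show thesis using W by (intro that)
qed

text \<open>The inequality of \<open>kyp_lemma\<close> concerns the successor state divided by
  \<rho>; dividing P by \<rho>^2 turns it into the one for the unscaled matrices.\<close>

theorem index_LMI:
  obtains P :: "nat \<Rightarrow> nat \<Rightarrow> real" where "\<And>i j. P i j = P j i"
    "\<And>x. \<exists>i<K0. x i \<noteq> 0 \<Longrightarrow> 0 < quad K0 P x"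
    "\<And>x w. (\<exists>i<K0. x i \<noteq> 0) \<or> (\<exists>l<b. w l \<noteq> 0) \<Longrightarrow>
       - \<rho>\<^sup>2 * quad K0 P x + quad K0 P (\<lambda>i. (\<Sum>j<K0. Aa i j * x j) + (\<Sum>l<b. Ba i l * w l))
       + quad n M (\<lambda>k. (\<Sum>j<K0. Ca k j * x j) + (\<Sum>l<b. Da k l * w l)) < 0"
proof -
  obtain C where C: "C \<ge> 0" "\<And>x W. W \<in> L.l2W \<Longrightarrow> (\<Sum>i<K0 + b. sq (L.traj x W i)) \<le> C * (L.nx x + L.nW W)"
    by (rule L.traj_gain, rule that)
  \<comment> \<open>C bounds the gain from input to trajectory, so the perturbation uses at most
    half of the margin \<epsilon> and the cost stays coercive with the other half.\<close>
  define \<delta> where "\<delta> = \<epsilon> / (2 * (C + 1))"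
  have \<delta>: "\<delta> > 0" unfolding \<delta>_def using \<epsilon> C(1) by simp
  have \<delta>C: "\<delta> * C \<le> \<epsilon> / 2"
  proof -
    have "\<epsilon> * C \<le> \<epsilon> * (C + 1)" using \<epsilon> by simp
    then show ?thesis unfolding \<delta>_def using C(1) by (simp add: divide_le_eq field_simps)
  qed
  have e2: "\<epsilon> / 2 > 0" using \<epsilon> by simp
  have coer: "L.cost (Nd \<delta>) (\<lambda>_. 0) W \<le> - (\<epsilon> / 2) * L.nW W" if W: "W \<in> L.l2W" for W
  proof -
    obtain \<xi> \<omega> where zt: "\<And>l. l < b \<Longrightarrow> zts (W l) (\<omega> l)" "\<And>i. i < K0 \<Longrightarrow> zts (L.st (\<lambda>_. 0) W i) (\<xi> i)"
      by (rule zts_families[OF W], rule that)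
    have "(\<Sum>t. qM n M (outP (\<lambda>_. 0) W) t) \<le> - \<epsilon> * L.nW W"
      unfolding L.nW_def by (rule zero_state_energy[OF W zt refl])
    moreover have "\<delta> * (\<Sum>i<K0 + b. sq (L.traj (\<lambda>_. 0) W i)) \<le> \<delta> * (C * L.nW W)"
      using C(2)[OF W, of "\<lambda>_. 0"] \<delta> by (intro mult_left_mono) (auto simp: L.nx_def)
    moreover have "\<delta> * C * L.nW W \<le> \<epsilon> / 2 * L.nW W" using \<delta>C L.nW_nonneg[OF W] by (rule mult_right_mono)
    ultimately show ?thesis unfolding cost_Nd[OF W] by (simp add: mult.assoc)
  qed
  obtain P where P: "\<And>i j. P i j = P j i"
    "\<And>x w. quad (K0 + b) (Nd \<delta>) (L.comb x w) + quad K0 P (L.stp x w) \<le> quad K0 P x"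
    "\<And>x W. W \<in> L.l2W \<Longrightarrow> L.cost (Nd \<delta>) x W \<le> quad K0 P x"
    by (rule L.kyp_lemma[OF e2 coer], assumption, rule that)
  have sc: "quad k (\<lambda>i j. P i j / c) z = quad k P z / c" for k c z
    unfolding quad_def by (simp add: sum_divide_distrib)
  show thesis
  proof (rule that[of "\<lambda>i j. P i j / \<rho>\<^sup>2"])
    show "P i j / \<rho>\<^sup>2 = P j i / \<rho>\<^sup>2" for i j using P(1)[of i j] by simp
    show "0 < quad K0 (\<lambda>i j. P i j / \<rho>\<^sup>2) x" if x: "\<exists>i<K0. x i \<noteq> 0" for x
    proof -
      \<comment> \<open>With nonnegative output energy, the value is at least \<delta> times the
        squared norm of the trajectory, whose first term contains the nonzero initial state.\<close>
      obtain W where W: "W \<in> L.l2W" "0 \<le> (\<Sum>t. qM n M (outP x W) t)" by (rule nonneg_cost_input, rule that)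
      obtain i where i: "i < K0" "x i \<noteq> 0" using x by blast
      have l2: "l2f (L.traj x W j)" if "j < K0 + b" for j by (rule L.l2_traj[OF W(1) that])
      have "(x i)\<^sup>2 = (fps_nth (L.traj x W i) 0)\<^sup>2" using i by (simp add: L.traj_def L.st_0)
      also have "\<dots> \<le> sq (L.traj x W i)" unfolding sq_def
        using sum_le_suminf[of "\<lambda>t. (fps_nth (L.traj x W i) t)\<^sup>2" "{0}"] l2[of i] i by (simp add: l2f_def)
      also have "\<dots> \<le> (\<Sum>j<K0 + b. sq (L.traj x W j))"
        using i l2 by (intro member_le_sum) (auto intro: sq_nonneg)
      finally have "0 < (\<Sum>j<K0 + b. sq (L.traj x W j))" using i by (smt (verit) zero_less_power2)
      then have "0 < \<delta> * (\<Sum>j<K0 + b. sq (L.traj x W j))" using \<delta> by simp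
      then have "0 < quad K0 P x" using P(3)[OF W(1), of x] W(2) unfolding cost_Nd[OF W(1)] by linarith
      then show ?thesis unfolding sc using \<rho> by simp
    qed
    fix x w :: "nat \<Rightarrow> real" assume nz: "(\<exists>i<K0. x i \<noteq> 0) \<or> (\<exists>l<b. w l \<noteq> 0)"
    let ?y = "\<lambda>i. (\<Sum>j<K0. Aa i j * x j) + (\<Sum>l<b. Ba i l * w l)"
    have st: "L.stp x w = (\<lambda>i. ?y i / \<rho>)" by (auto simp: L.stp_def add_divide_distrib sum_divide_distrib)
    have q: "quad K0 P (L.stp x w) = quad K0 P ?y / \<rho>\<^sup>2"
      unfolding st quad_def by (simp add: sum_divide_distrib power2_eq_square)
    have N: "quad (K0 + b) N0 (L.comb x w) = quad n M (\<lambda>k. (\<Sum>j<K0. Ca k j * x j) + (\<Sum>l<b. Da k l * w l))"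
      unfolding quad_N0 CD_sum by (simp add: L.comb_def)
    have "0 < (\<Sum>i<K0 + b. (L.comb x w i)\<^sup>2)"
    proof -
      obtain i where i: "i < K0 + b" "L.comb x w i \<noteq> 0"
      proof -
        from nz show thesis
        proof
          assume "\<exists>i<K0. x i \<noteq> 0"
          then obtain i where "i < K0" "x i \<noteq> 0" by blast
          then show thesis using that[of i] by (simp add: L.comb_def)
        next
          assume "\<exists>l<b. w l \<noteq> 0"
          then obtain l where "l < b" "w l \<noteq> 0" by blast
          then show thesis using that[of "l + K0"] by (simp add: L.comb_def)
        qed
      qed
      then have "0 < (L.comb x w i)\<^sup>2" by simp
      also have "\<dots> \<le> (\<Sum>i<K0 + b. (L.comb x w i)\<^sup>2)"
        using i by (intro member_le_sum[where f="\<lambda>i. (L.comb x w i)\<^sup>2"]) auto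
      finally show ?thesis .
    qed
    then have "0 < \<delta> * (\<Sum>i<K0 + b. (L.comb x w i)\<^sup>2)" using \<delta> by simp
    then have "quad (K0 + b) N0 (L.comb x w) + quad K0 P ?y / \<rho>\<^sup>2 < quad K0 P x"
      using P(2)[of x w] unfolding quad_Nd q by linarith
    then show "- \<rho>\<^sup>2 * quad K0 (\<lambda>i j. P i j / \<rho>\<^sup>2) x + quad K0 (\<lambda>i j. P i j / \<rho>\<^sup>2) ?y
       + quad n M (\<lambda>k. (\<Sum>j<K0. Ca k j * x j) + (\<Sum>l<b. Da k l * w l)) < 0"
      unfolding sc N using \<rho> by simp
  qed
qed

end

section \<open>Translation between matrices and indexed sums\<close>

section \<open>Matrix forms\<close>

lemma mat_adjoint_carrier: "A \<in> carrier_mat n m \<Longrightarrow> mat_adjoint A \<in> carrier_mat m n"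
  by (auto simp: mat_adjoint_def)

lemma mat_adjoint_index:
  "i < dim_col A \<Longrightarrow> j < dim_row A \<Longrightarrow> mat_adjoint A $$ (i,j) = conjugate (A $$ (j,i))"
  by (simp add: mat_adjoint_def mat_of_rows_index)

lemma quad_form_real:
  fixes A :: "real mat"
  assumes "A \<in> carrier_mat n n" "v \<in> carrier_vec n"
  shows "quad_form A v = (\<Sum>i<n. \<Sum>j<n. A $$ (i,j) * (v $ i * v $ j))"
  unfolding quad_form_sum[OF assms] by (simp add: mult_ac)

lemma real_mat_adjoint: "mat_adjoint (A :: real mat) = transpose_mat A"
proof (rule eq_matI)
  fix i j assume "i < dim_row (transpose_mat A)" "j < dim_col (transpose_mat A)"
  then show "mat_adjoint A $$ (i, j) = transpose_mat A $$ (i, j)" by (simp add: mat_adjoint_index)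
qed (auto simp: mat_adjoint_def)

lemma append_cols_carrier:
  "A \<in> carrier_mat r c1 \<Longrightarrow> B \<in> carrier_mat r c2 \<Longrightarrow> A @\<^sub>c B \<in> carrier_mat r (c1 + c2)"
  by (auto simp: append_cols_def)

lemma append_cols_index:
  "A \<in> carrier_mat r c1 \<Longrightarrow> B \<in> carrier_mat r c2 \<Longrightarrow> i < r \<Longrightarrow> j < c1 + c2 \<Longrightarrow>
    (A @\<^sub>c B) $$ (i,j) = (if j < c1 then A $$ (i,j) else B $$ (i, j - c1))"
  by (auto simp: append_cols_def)

lemma append_rows_index:
  "A \<in> carrier_mat r1 c \<Longrightarrow> B \<in> carrier_mat r2 c \<Longrightarrow> i < r1 + r2 \<Longrightarrow> j < c \<Longrightarrow>
    (A @\<^sub>r B) $$ (i,j) = (if i < r1 then A $$ (i,j) else B $$ (i - r1, j))"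
  by (auto simp: append_rows_def)

lemma mult_vec_index:
  "A \<in> carrier_mat r c \<Longrightarrow> v \<in> carrier_vec c \<Longrightarrow> i < r \<Longrightarrow> (A *\<^sub>v v) $ i = (\<Sum>j<c. A $$ (i,j) * v $ j)"
  by (auto simp: scalar_prod_def atLeast0LessThan intro!: sum.cong)

lemma append_rows_mult_vec:
  assumes "A \<in> carrier_mat r1 c" "B \<in> carrier_mat r2 c" "v \<in> carrier_vec c"
  shows "(A @\<^sub>r B) *\<^sub>v v = (A *\<^sub>v v) @\<^sub>v (B *\<^sub>v v)"
proof (rule eq_vecI)
  fix i assume "i < dim_vec ((A *\<^sub>v v) @\<^sub>v (B *\<^sub>v v))"
  then have i: "i < r1 + r2" using assms by simp
  have "((A @\<^sub>r B) *\<^sub>v v) $ i = (\<Sum>j<c. (A @\<^sub>r B) $$ (i,j) * v $ j)"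
    using assms i by (intro mult_vec_index) auto
  also have "\<dots> = (if i < r1 then (A *\<^sub>v v) $ i else (B *\<^sub>v v) $ (i - r1))"
  proof (cases "i < r1")
    case True
    then show ?thesis using assms i by (subst mult_vec_index[OF assms(1,3)]) (simp_all add: append_rows_index)
  next
    case False
    then show ?thesis using assms i by (subst mult_vec_index[OF assms(2,3)]) (simp_all add: append_rows_index)
  qed
  finally show "((A @\<^sub>r B) *\<^sub>v v) $ i = ((A *\<^sub>v v) @\<^sub>v (B *\<^sub>v v)) $ i" using assms i by simp
qed (use assms in \<open>auto simp: append_rows_def\<close>)

lemma block_diag_quad:
  fixes A B :: "real mat"
  assumes "A \<in> carrier_mat k k" "B \<in> carrier_mat l l" "u \<in> carrier_vec k" "v \<in> carrier_vec l"
  shows "quad_form (four_block_mat A (0\<^sub>m k l) (0\<^sub>m l k) B) (u @\<^sub>v v) = quad_form A u + quad_form B v"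
proof -
  let ?F = "four_block_mat A (0\<^sub>m k l) (0\<^sub>m l k) B"
  have F: "?F \<in> carrier_mat (k + l) (k + l)" using assms by simp
  have "quad_form ?F (u @\<^sub>v v) = (\<Sum>i<k + l. \<Sum>j<k + l. ?F $$ (i,j) * ((u @\<^sub>v v) $ i * (u @\<^sub>v v) $ j))"
    by (rule quad_form_real[OF F]) (use assms in simp)
  also have "\<dots> = quad_form A u + quad_form B v"
    unfolding quad_form_real[OF assms(1,3)] quad_form_real[OF assms(2,4)]
    using assms by (simp add: sum_lessThan_add[of _ k l] carrier_vecD[OF assms(3)] carrier_vecD[OF assms(4)])
  finally show ?thesis .
qed

lemma quad_form_congruence:
  fixes D L :: "real mat"
  assumes D: "D \<in> carrier_mat r r" and L: "L \<in> carrier_mat r c" and v: "v \<in> carrier_vec c"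
  shows "quad_form (transpose_mat L * D * L) v = quad_form D (L *\<^sub>v v)"
proof -
  have Lt: "transpose_mat L \<in> carrier_mat c r" using L by simp
  have Lv: "L *\<^sub>v v \<in> carrier_vec r" and DLv: "D *\<^sub>v (L *\<^sub>v v) \<in> carrier_vec r" using L D v by auto
  have cr: "conjugate u = u" for u :: "real vec" by (rule eq_vecI) auto
  have "(transpose_mat L * D * L) *\<^sub>v v = transpose_mat L *\<^sub>v (D *\<^sub>v (L *\<^sub>v v))"
    using L D Lt v by (simp add: assoc_mult_mat_vec[of _ c r _ c] assoc_mult_mat_vec[of _ c r _ r])
  then have "quad_form (transpose_mat L * D * L) v = v \<bullet> (transpose_mat L *\<^sub>v (D *\<^sub>v (L *\<^sub>v v)))"
    by (simp add: quad_form_def cr)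
  also have "\<dots> = (transpose_mat L *\<^sub>v (D *\<^sub>v (L *\<^sub>v v))) \<bullet> v"
    using v Lt DLv by (intro comm_scalar_prod) auto
  also have "\<dots> = (D *\<^sub>v (L *\<^sub>v v)) \<bullet> (L *\<^sub>v v)" by (rule transpose_vec_mult_scalar[OF L v DLv])
  also have "\<dots> = (L *\<^sub>v v) \<bullet> (D *\<^sub>v (L *\<^sub>v v))" using Lv DLv by (rule comm_scalar_prod[rotated])
  finally show ?thesis by (simp add: quad_form_def cr)
qed

lemma spectrum_within_zero:
  assumes A: "A \<in> carrier_mat k k" and s: "spectrum_within \<rho> A" and l: "cmod l \<ge> \<rho>"
    and v: "\<And>i. i < k \<Longrightarrow> (\<Sum>j<k. of_real (A $$ (i,j)) * v j) = l * v i" and i: "i < k"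
  shows "v i = 0"
proof (rule ccontr)
  assume nz: "v i \<noteq> 0"
  let ?A = "map_mat complex_of_real A" and ?v = "vec k v"
  have "?A *\<^sub>v ?v = l \<cdot>\<^sub>v ?v"
  proof (rule eq_vecI)
    fix i assume "i < dim_vec (l \<cdot>\<^sub>v ?v)"
    then have i: "i < k" by simp
    have "(?A *\<^sub>v ?v) $ i = (\<Sum>j<k. ?A $$ (i,j) * ?v $ j)" using A i by (intro mult_vec_index) auto
    also have "\<dots> = l * v i" using A i v[OF i] by simp
    finally show "(?A *\<^sub>v ?v) $ i = (l \<cdot>\<^sub>v ?v) $ i" using i by simp
  qed (use A in auto)
  moreover have "?v \<noteq> 0\<^sub>v k" using nz i by (auto simp: vec_eq_iff)
  ultimately have "eigenvector ?A ?v l" using A by (simp add: eigenvector_def)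
  then have "l \<in> spectrum ?A" by (auto simp: spectrum_def eigenvalue_def)
  then show False using s l by (auto simp: spectrum_within_def)
qed

text \<open>The resolvent is the adjugate of zI - A over the characteristic polynomial and has no
  pole at s outside the spectrum; applied to the right-hand side of the state equation it returns
  the state.\<close>

lemma transfer_mat_eval:
  assumes A: "A \<in> carrier_mat k k" and B: "B \<in> carrier_mat k m" and C: "C \<in> carrier_mat p k" and D: "D \<in> carrier_mat p m"
    and sp: "spectrum_within \<rho> A" and s: "cmod s \<ge> \<rho>"
    and eq: "\<And>i. i < k \<Longrightarrow> s * \<xi> i - (\<Sum>j<k. of_real (A $$ (i,j)) * \<xi> j) = (\<Sum>l<m. of_real (B $$ (i,l)) * \<upsilon> l)"
    and q: "q < p"
  shows "(\<Sum>j<k. of_real (C $$ (q,j)) * \<xi> j) + (\<Sum>l<m. of_real (D $$ (q,l)) * \<upsilon> l)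
    = (\<Sum>l<m. rf_eval (transfer_mat A B C D $$ (q,l)) s * \<upsilon> l)"
proof -
  \<comment> \<open>The matrix zI - A over the polynomials, whose adjugate and determinant can be
    evaluated at s.\<close>
  define cm where "cm = mat k k (\<lambda>(i,j). (if i = j then [:0,1:] else 0) - [:A $$ (i,j):])"
  have cm: "cm \<in> carrier_mat k k" by (simp add: cm_def)
  define \<chi> where "\<chi> = det cm"
  define Nm where "Nm = adj_mat cm"
  note adj = adj_mat[OF cm, folded Nm_def \<chi>_def]
  interpret ev: comm_ring_hom "\<lambda>p. cpoly p s" by (rule cpoly_hom)
  have cms: "map_mat (\<lambda>p. cpoly p s) cm = mat k k (\<lambda>(i,j). (if i = j then s else 0) - of_real (A $$ (i,j)))"
    by (intro eq_matI) (auto simp: cm_def)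
  have \<chi>s: "cpoly \<chi> s \<noteq> 0"
  proof
    assume "cpoly \<chi> s = 0"
    then have "det (map_mat (\<lambda>p. cpoly p s) cm) = 0" by (simp add: \<chi>_def ev.hom_det)
    then obtain v where v: "v \<in> carrier_vec k" "v \<noteq> 0\<^sub>v k" "map_mat (\<lambda>p. cpoly p s) cm *\<^sub>v v = 0\<^sub>v k"
      using det_0_iff_vec_prod_zero_field[of "map_mat (\<lambda>p. cpoly p s) cm" k] cm by auto
    have "(\<Sum>j<k. of_real (A $$ (i,j)) * v $ j) = s * v $ i" if i: "i < k" for i
    proof -
      have "0 = (map_mat (\<lambda>p. cpoly p s) cm *\<^sub>v v) $ i" using v(3) i by simp
      also have "\<dots> = (\<Sum>j<k. (if i = j then s * v $ j else 0) - of_real (A $$ (i,j)) * v $ j)"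
        using cm v(1) i by (subst mult_vec_index[of _ k k]) (auto simp: cms left_diff_distrib intro!: sum.cong)
      also have "\<dots> = s * v $ i - (\<Sum>j<k. of_real (A $$ (i,j)) * v $ j)" using i by (simp add: sum_subtractf)
      finally show ?thesis by simp
    qed
    then have "v $ i = 0" if "i < k" for i using spectrum_within_zero[OF A sp s, of "\<lambda>i. v $ i" i] that by blast
    then show False using v(1,2) by (auto intro: eq_vecI)
  qed
  then have \<chi>0: "\<chi> \<noteq> 0" by auto
  interpret fr: comm_ring_hom "to_fract :: real poly \<Rightarrow> ratfun" by unfold_locales simp_all
  define E where "E = rf_z \<cdot>\<^sub>m 1\<^sub>m k - const_mat A"
  have E: "E \<in> carrier_mat k k" using A by (simp add: E_def const_mat_def minus_mat_def)
  have Ecm: "E = map_mat to_fract cm"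
    using A by (intro eq_matI) (auto simp: E_def cm_def const_mat_def rf_z_def rf_const_def)
  define I where "I = inverse (to_fract \<chi>) \<cdot>\<^sub>m map_mat to_fract Nm"
  have I: "I \<in> carrier_mat k k" using adj(1) by (simp add: I_def)
  have tN: "map_mat to_fract Nm \<in> carrier_mat k k" using adj(1) by simp
  have "map_mat to_fract cm * map_mat to_fract Nm = map_mat to_fract (\<chi> \<cdot>\<^sub>m 1\<^sub>m k)"
    unfolding adj(2)[symmetric] by (rule fr.mat_hom_mult[OF cm adj(1), symmetric])
  then have "E * I = inverse (to_fract \<chi>) \<cdot>\<^sub>m map_mat to_fract (\<chi> \<cdot>\<^sub>m 1\<^sub>m k)"
    unfolding I_def Ecm using cm tN by (simp add: mult_smult_distrib[of _ k k _ k])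
  also have "\<dots> = 1\<^sub>m k" using \<chi>0 by (intro eq_matI) auto
  finally have EI: "E * I = 1\<^sub>m k" .
  then have IE: "I * E = 1\<^sub>m k" by (rule mat_left_right_inverse_idom[OF E I])
  \<comment> \<open>\<open>mat_inverse\<close> yields an option: the explicit inverse excludes
    failure, and by uniqueness it is the value.\<close>
  have "the (mat_inverse E) = I"
  proof (cases "mat_inverse E")
    case None
    have "E \<in> Units (ring_mat TYPE(ratfun) k ())"
      unfolding Units_def ring_mat_def using E I EI IE by auto
    moreover have "E \<notin> Units (ring_mat TYPE(ratfun) k ())" by (rule mat_inverse(1)[OF E None])
    ultimately show ?thesis by simp
  next
    case (Some J)
    note J = mat_inverse(2)[OF E Some]
    have "J = (I * E) * J" unfolding IE using J left_mult_one_mat[of J k k] by simp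
    also have "\<dots> = I * (E * J)" using I E J by (intro assoc_mult_mat) auto
    also have "\<dots> = I" using J I by simp
    finally show ?thesis using Some by simp
  qed
  then have R: "transfer_mat A B C D = const_mat D + const_mat C * I * const_mat B"
    unfolding transfer_mat_def using A by (simp add: E_def)
  have cc: "const_mat B \<in> carrier_mat k m" "const_mat C \<in> carrier_mat p k" "const_mat D \<in> carrier_mat p m"
    using B C D by (auto simp: const_mat_def)
  define g where "g i j = cpoly (Nm $$ (i,j)) s / cpoly \<chi> s" for i j
  have Ie: "\<not> rf_pole (I $$ (i,j)) s" "rf_eval (I $$ (i,j)) s = g i j" if "i < k" "j < k" for i j
  proof -
    have "I $$ (i,j) = to_fract (Nm $$ (i,j)) / to_fract \<chi>" using adj(1) that by (simp add: I_def field_simps)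
    from rf_fraction[OF this \<chi>s] show "\<not> rf_pole (I $$ (i,j)) s" "rf_eval (I $$ (i,j)) s = g i j"
      by (simp_all add: g_def)
  qed
  have Re: "rf_eval (transfer_mat A B C D $$ (q,l)) s = of_real (D $$ (q,l)) + (\<Sum>j<k. (\<Sum>i<k. of_real (C $$ (q,i)) * g i j) * of_real (B $$ (j,l)))"
    if l: "l < m" for l
  proof -
    have CI: "\<not> rf_pole ((const_mat C * I) $$ (q,j)) s \<and> rf_eval ((const_mat C * I) $$ (q,j)) s = (\<Sum>i<k. of_real (C $$ (q,i)) * g i j)" if j: "j < k" for j
    proof -
      have t: "\<not> rf_pole (const_mat C $$ (q,i) * I $$ (i,j)) s \<and> rf_eval (const_mat C $$ (q,i) * I $$ (i,j)) s = of_real (C $$ (q,i)) * g i j" if "i < k" for i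
        using Ie[OF that j] C q that by (simp add: const_mat_def rf_mult)
      show ?thesis unfolding mat_mult_index[OF cc(2) I q j]
        using rf_sum[of "{..<k}" "\<lambda>i. const_mat C $$ (q,i) * I $$ (i,j)" s] t by simp
    qed
    have CI': "const_mat C * I \<in> carrier_mat p k" using cc I by simp
    have CIB: "\<not> rf_pole ((const_mat C * I * const_mat B) $$ (q,l)) s \<and> rf_eval ((const_mat C * I * const_mat B) $$ (q,l)) s = (\<Sum>j<k. (\<Sum>i<k. of_real (C $$ (q,i)) * g i j) * of_real (B $$ (j,l)))"
    proof -
      have t: "\<not> rf_pole ((const_mat C * I) $$ (q,j) * const_mat B $$ (j,l)) s \<and>
         rf_eval ((const_mat C * I) $$ (q,j) * const_mat B $$ (j,l)) s = (\<Sum>i<k. of_real (C $$ (q,i)) * g i j) * of_real (B $$ (j,l))" if "j < k" for j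
        using CI[OF that] B l that by (simp add: const_mat_def rf_mult)
      show ?thesis unfolding mat_mult_index[OF CI' cc(1) q l]
        using rf_sum[of "{..<k}" "\<lambda>j. (const_mat C * I) $$ (q,j) * const_mat B $$ (j,l)" s] t by simp
    qed
    have "transfer_mat A B C D $$ (q,l) = rf_const (D $$ (q,l)) + (const_mat C * I * const_mat B) $$ (q,l)"
      unfolding R using cc I D q l by (simp add: const_mat_def)
    then show ?thesis using CIB by (simp add: rf_add)
  qed
  have gx: "(\<Sum>j<k. g i j * (s * \<xi> j - (\<Sum>j'<k. of_real (A $$ (j,j')) * \<xi> j'))) = \<xi> i" if i: "i < k" for i
  proof -
    have "(\<Sum>j<k. cpoly (Nm $$ (i,j)) s * (s * \<xi> j - (\<Sum>j'<k. of_real (A $$ (j,j')) * \<xi> j')))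
      = (\<Sum>j<k. \<Sum>j'<k. cpoly (Nm $$ (i,j)) s * cpoly (cm $$ (j,j')) s * \<xi> j')"
    proof (intro sum.cong refl)
      fix j assume "j \<in> {..<k}"
      then have "(\<Sum>j'<k. cpoly (cm $$ (j,j')) s * \<xi> j') = (\<Sum>j'<k. (if j = j' then s * \<xi> j' else 0) - of_real (A $$ (j,j')) * \<xi> j')"
        by (intro sum.cong refl) (auto simp: cm_def left_diff_distrib)
      also have "\<dots> = s * \<xi> j - (\<Sum>j'<k. of_real (A $$ (j,j')) * \<xi> j')"
        using \<open>j \<in> {..<k}\<close> by (simp add: sum_subtractf)
      finally have e: "(\<Sum>j'<k. cpoly (cm $$ (j,j')) s * \<xi> j') = s * \<xi> j - (\<Sum>j'<k. of_real (A $$ (j,j')) * \<xi> j')" .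
      show "cpoly (Nm $$ (i,j)) s * (s * \<xi> j - (\<Sum>j'<k. of_real (A $$ (j,j')) * \<xi> j')) = (\<Sum>j'<k. cpoly (Nm $$ (i,j)) s * cpoly (cm $$ (j,j')) s * \<xi> j')"
        unfolding e[symmetric] by (simp add: sum_distrib_left mult.assoc)
    qed
    also have "\<dots> = (\<Sum>j'<k. (\<Sum>j<k. cpoly (Nm $$ (i,j)) s * cpoly (cm $$ (j,j')) s) * \<xi> j')"
      by (subst sum.swap) (simp add: sum_distrib_right)
    also have "\<dots> = (\<Sum>j'<k. cpoly ((Nm * cm) $$ (i,j')) s * \<xi> j')"
      using i by (intro sum.cong refl) (simp add: mat_mult_index[OF adj(1) cm])
    also have "\<dots> = (\<Sum>j'<k. if i = j' then cpoly \<chi> s * \<xi> j' else 0)"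
      unfolding adj(3) using i by (intro sum.cong refl) simp
    also have "\<dots> = cpoly \<chi> s * \<xi> i" using i by simp
    finally have "(\<Sum>j<k. cpoly (Nm $$ (i,j)) s * (s * \<xi> j - (\<Sum>j'<k. of_real (A $$ (j,j')) * \<xi> j'))) / cpoly \<chi> s = \<xi> i"
      using \<chi>s by simp
    then show ?thesis by (simp add: g_def sum_divide_distrib)
  qed
  have "(\<Sum>l<m. rf_eval (transfer_mat A B C D $$ (q,l)) s * \<upsilon> l)
    = (\<Sum>l<m. of_real (D $$ (q,l)) * \<upsilon> l) + (\<Sum>l<m. \<Sum>j<k. (\<Sum>i<k. of_real (C $$ (q,i)) * g i j) * (of_real (B $$ (j,l)) * \<upsilon> l))"
    by (simp add: Re distrib_right sum.distrib sum_distrib_right mult.assoc)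
  also have "(\<Sum>l<m. \<Sum>j<k. (\<Sum>i<k. of_real (C $$ (q,i)) * g i j) * (of_real (B $$ (j,l)) * \<upsilon> l))
    = (\<Sum>j<k. (\<Sum>i<k. of_real (C $$ (q,i)) * g i j) * (\<Sum>l<m. of_real (B $$ (j,l)) * \<upsilon> l))"
    by (subst sum.swap) (simp add: sum_distrib_left)
  also have "\<dots> = (\<Sum>j<k. (\<Sum>i<k. of_real (C $$ (q,i)) * g i j) * (s * \<xi> j - (\<Sum>j'<k. of_real (A $$ (j,j')) * \<xi> j')))"
    by (intro sum.cong refl) (simp add: eq)
  also have "\<dots> = (\<Sum>i<k. of_real (C $$ (q,i)) * (\<Sum>j<k. g i j * (s * \<xi> j - (\<Sum>j'<k. of_real (A $$ (j,j')) * \<xi> j'))))"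
    by (simp only: sum_distrib_left sum_distrib_right mult.assoc) (rule sum.swap)
  also have "\<dots> = (\<Sum>i<k. of_real (C $$ (q,i)) * \<xi> i)" by (intro sum.cong refl) (simp add: gx)
  finally show ?thesis by simp
qed

lemma append_cols_mult_vec_index:
  assumes "A \<in> carrier_mat r c1" "B \<in> carrier_mat r c2" "v \<in> carrier_vec (c1 + c2)" "i < r"
  shows "((A @\<^sub>c B) *\<^sub>v v) $ i = (\<Sum>j<c1. A $$ (i,j) * v $ j) + (\<Sum>l<c2. B $$ (i,l) * v $ (l + c1))"
  using assms mult_vec_index[OF append_cols_carrier[OF assms(1,2)] assms(3,4)]
  by (simp only: sum_lessThan_add) (simp add: append_cols_index)

lemma quad_form_mat: "v \<in> carrier_vec k \<Longrightarrow> quad_form (mat k k (\<lambda>(i,j). P i j)) v = quad k P (\<lambda>i. v $ i)" for P :: "nat \<Rightarrow> nat \<Rightarrow> real"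
  by (subst quad_form_real[of _ k]) (simp_all add: quad_def)

lemma transpose_block_diag:
  assumes "A \<in> carrier_mat k k" "B \<in> carrier_mat l l" "transpose_mat A = A" "transpose_mat B = B"
  shows "transpose_mat (four_block_mat A (0\<^sub>m k l) (0\<^sub>m l k) B) = four_block_mat A (0\<^sub>m k l) (0\<^sub>m l k) B"
  using assms by (subst transpose_four_block_mat[of _ k k _ l _ l]) auto

lemma transpose_uminus_mat: "transpose_mat (- A) = - transpose_mat A"
  by (rule eq_matI) auto

lemma quad_form_uminus:
  assumes A: "A \<in> carrier_mat n n" and v: "v \<in> carrier_vec n"
  shows "quad_form (- A) v = - quad_form A v"
proof -
  have A': "- A \<in> carrier_mat n n" using A by simp
  show ?thesis unfolding quad_form_sum[OF A v] quad_form_sum[OF A' v] using A by (simp add: sum_negf[symmetric])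
qed

lemma quad_form_minus:
  assumes A: "A \<in> carrier_mat n n" and B: "B \<in> carrier_mat n n" and v: "v \<in> carrier_vec n"
  shows "quad_form (A - B) v = quad_form A v - quad_form B v"
proof -
  have AB: "A - B \<in> carrier_mat n n" using A B by (simp add: minus_carrier_mat)
  show ?thesis unfolding quad_form_sum[OF A v] quad_form_sum[OF B v] quad_form_sum[OF AB v]
    using A B by (simp add: sum_subtractf[symmetric] algebra_simps)
qed

section \<open>The LMI and the frequency domain inequality as quadratic forms\<close>

text \<open>By congruence, the form of the LMI at (x, w) is that of the block-diagonal middle matrix
  at the stacked vector (x, Ax + Bw, Cx + Dw).\<close>

lemma lmi_neg_def:
  fixes P M :: "nat \<Rightarrow> nat \<Rightarrow> real"
  assumes A: "A \<in> carrier_mat k k" and B: "B \<in> carrier_mat k b" and C: "C \<in> carrier_mat n k" and D: "D \<in> carrier_mat n b"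
    and P: "\<And>i j. P i j = P j i" and M: "\<And>i j. i < n \<Longrightarrow> j < n \<Longrightarrow> M i j = M j i"
    and neg: "\<And>x w. (\<exists>i<k. x i \<noteq> 0) \<or> (\<exists>l<b. w l \<noteq> 0) \<Longrightarrow>
       - \<rho>\<^sup>2 * quad k P x + quad k P (\<lambda>i. (\<Sum>j<k. A $$ (i,j) * x j) + (\<Sum>l<b. B $$ (i,l) * w l))
       + quad n M (\<lambda>i. (\<Sum>j<k. C $$ (i,j) * x j) + (\<Sum>l<b. D $$ (i,l) * w l)) < 0"
  shows "neg_def (k + b) (lmi_mat \<rho> A B C D (mat k k (\<lambda>(i,j). P i j)) (mat n n (\<lambda>(i,j). M i j)))"
proof -
  let ?P = "mat k k (\<lambda>(i,j). P i j)" and ?M = "mat n n (\<lambda>(i,j). M i j)"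
  let ?L1 = "1\<^sub>m k @\<^sub>c 0\<^sub>m k b" and ?L2 = "A @\<^sub>c B" and ?L3 = "C @\<^sub>c D"
  let ?L = "?L1 @\<^sub>r ?L2 @\<^sub>r ?L3"
  let ?E = "four_block_mat ?P (0\<^sub>m k n) (0\<^sub>m n k) ?M"
  let ?D = "four_block_mat ((- (\<rho>\<^sup>2)) \<cdot>\<^sub>m ?P) (0\<^sub>m k (k + n)) (0\<^sub>m (k + n) k) ?E"
  let ?X = "transpose_mat ?L * ?D * ?L"
  have L: "?L1 \<in> carrier_mat k (k + b)" "?L2 \<in> carrier_mat k (k + b)" "?L3 \<in> carrier_mat n (k + b)"
    using A B C D by (auto intro: append_cols_carrier)
  then have L23: "?L2 @\<^sub>r ?L3 \<in> carrier_mat (k + n) (k + b)" and LL: "?L \<in> carrier_mat (k + (k + n)) (k + b)" by auto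
  \<comment> \<open>\<open>diag_block_mat\<close> ends its list with an empty block, which is
    removed here.\<close>
  have M1: "four_block_mat ?M (0\<^sub>m n 0) (0\<^sub>m 0 n) (0\<^sub>m 0 0) = ?M" by (rule eq_matI) auto
  have X: "lmi_mat \<rho> A B C D ?P ?M = ?X"
    unfolding lmi_mat_def Let_def using A B by (simp add: M1)
  have E: "?E \<in> carrier_mat (k + n) (k + n)" and Dc: "?D \<in> carrier_mat (k + (k + n)) (k + (k + n))" by auto
  have Xc: "?X \<in> carrier_mat (k + b) (k + b)" using LL Dc by (auto simp: mult_carrier_mat)
  have tP: "transpose_mat ?P = ?P" "transpose_mat ((- (\<rho>\<^sup>2)) \<cdot>\<^sub>m ?P) = (- (\<rho>\<^sup>2)) \<cdot>\<^sub>m ?P" and tM: "transpose_mat ?M = ?M"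
    using P M by (auto intro!: eq_matI)
  have tE: "transpose_mat ?E = ?E" by (rule transpose_block_diag[OF _ _ tP(1) tM]) auto
  have tD: "transpose_mat ?D = ?D" by (rule transpose_block_diag[OF _ E tP(2) tE]) auto
  have LtD: "transpose_mat ?L * ?D \<in> carrier_mat (k + b) (k + (k + n))" using LL Dc by (auto simp: mult_carrier_mat)
  have tX: "transpose_mat ?X = ?X"
  proof -
    have Lt: "transpose_mat ?L \<in> carrier_mat (k + b) (k + (k + n))" using LL by simp
    have "transpose_mat ?X = transpose_mat ?L * transpose_mat (transpose_mat ?L * ?D)"
      by (rule transpose_mult[OF LtD LL])
    also have "transpose_mat (transpose_mat ?L * ?D) = transpose_mat ?D * transpose_mat (transpose_mat ?L)"
      by (rule transpose_mult[OF Lt Dc])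
    also have "transpose_mat ?L * (transpose_mat ?D * transpose_mat (transpose_mat ?L)) = ?X"
      unfolding tD transpose_transpose by (rule assoc_mult_mat[OF Lt Dc LL, symmetric])
    finally show ?thesis .
  qed
  show ?thesis unfolding X neg_def_def pos_def_def
  proof (intro conjI ballI impI)
    show "- ?X \<in> carrier_mat (k + b) (k + b)" using Xc by simp
    show "mat_adjoint (- ?X) = - ?X" unfolding real_mat_adjoint transpose_uminus_mat tX ..
    fix v :: "real vec" assume v: "v \<in> carrier_vec (k + b)" and v0: "v \<noteq> 0\<^sub>v (k + b)"
    define x where "x i = v $ i" for i
    define w where "w l = v $ (l + k)" for l
    have nz: "(\<exists>i<k. x i \<noteq> 0) \<or> (\<exists>l<b. w l \<noteq> 0)"
    proof (rule ccontr)
      assume a: "\<not> ?thesis"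
      have "v $ i = 0" if "i < k + b" for i
      proof (cases "i < k")
        case False
        then have "i - k < b" "i - k + k = i" using that by auto
        then show ?thesis using a unfolding w_def by metis
      qed (use a in \<open>simp add: x_def\<close>)
      then show False using v v0 by (auto intro: eq_vecI)
    qed
    have c: "?L1 *\<^sub>v v \<in> carrier_vec k" "?L2 *\<^sub>v v \<in> carrier_vec k" "?L3 *\<^sub>v v \<in> carrier_vec n"
      by (rule mult_mat_vec_carrier[OF L(1) v] mult_mat_vec_carrier[OF L(2) v] mult_mat_vec_carrier[OF L(3) v])+
    have "quad_form ?X v = quad_form ?D (?L *\<^sub>v v)" by (rule quad_form_congruence[OF Dc LL v])
    also have "?L *\<^sub>v v = (?L1 *\<^sub>v v) @\<^sub>v ((?L2 *\<^sub>v v) @\<^sub>v (?L3 *\<^sub>v v))"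
      by (simp only: append_rows_mult_vec[OF L(1) L23 v] append_rows_mult_vec[OF L(2,3) v])
    also have "quad_form ?D \<dots> = quad_form ((- (\<rho>\<^sup>2)) \<cdot>\<^sub>m ?P) (?L1 *\<^sub>v v) + (quad_form ?P (?L2 *\<^sub>v v) + quad_form ?M (?L3 *\<^sub>v v))"
      using c by (subst block_diag_quad[of _ k _ "k + n"]) (simp_all add: block_diag_quad[of _ k _ n])
    also have "quad_form ((- (\<rho>\<^sup>2)) \<cdot>\<^sub>m ?P) (?L1 *\<^sub>v v) = - \<rho>\<^sup>2 * quad k P (\<lambda>i. (?L1 *\<^sub>v v) $ i)"
    proof -
      have "(- (\<rho>\<^sup>2)) \<cdot>\<^sub>m ?P = mat k k (\<lambda>(i,j). - (\<rho>\<^sup>2) * P i j)" by (rule eq_matI) auto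
      then show ?thesis using c(1) by (simp add: quad_form_mat quad_def sum_distrib_left mult.assoc sum_negf)
    qed
    also have "quad k P (\<lambda>i. (?L1 *\<^sub>v v) $ i) = quad k P x"
    proof -
      have "(?L1 *\<^sub>v v) $ i = x i" if "i < k" for i
      proof -
        have "(?L1 *\<^sub>v v) $ i = (\<Sum>j<k. 1\<^sub>m k $$ (i,j) * v $ j) + (\<Sum>l<b. 0\<^sub>m k b $$ (i,l) * v $ (l + k))"
          using that v by (intro append_cols_mult_vec_index) auto
        also have "\<dots> = (\<Sum>j<k. if i = j then v $ j else 0)"
        proof -
          have "(\<Sum>l<b. 0\<^sub>m k b $$ (i,l) * v $ (l + k)) = 0" using that by simp
          moreover have "(\<Sum>j<k. 1\<^sub>m k $$ (i,j) * v $ j) = (\<Sum>j<k. if i = j then v $ j else 0)"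
            using that by (intro sum.cong refl) auto
          ultimately show ?thesis by simp
        qed
        finally show ?thesis using that by (simp add: x_def)
      qed
      then show ?thesis by (simp add: quad_def)
    qed
    also have "quad_form ?P (?L2 *\<^sub>v v) = quad k P (\<lambda>i. (\<Sum>j<k. A $$ (i,j) * x j) + (\<Sum>l<b. B $$ (i,l) * w l))"
      unfolding quad_form_mat[OF c(2)] quad_def
      by (intro sum.cong refl) (simp add: append_cols_mult_vec_index[OF A B v] x_def w_def del: index_mult_mat_vec)
    also have "quad_form ?M (?L3 *\<^sub>v v) = quad n M (\<lambda>i. (\<Sum>j<k. C $$ (i,j) * x j) + (\<Sum>l<b. D $$ (i,l) * w l))"
      unfolding quad_form_mat[OF c(3)] quad_def
      by (intro sum.cong refl) (simp add: append_cols_mult_vec_index[OF C D v] x_def w_def del: index_mult_mat_vec)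
    finally have "quad_form ?X v < 0" using neg[OF nz] by simp
    moreover have "quad_form (- ?X) v = - quad_form ?X v" by (rule quad_form_uminus[OF Xc v])
    ultimately show "0 < quad_form (- ?X) v" by simp
  qed
qed

lemma adjoint_inner:
  fixes A :: "complex mat"
  assumes "A \<in> carrier_mat r c" "v \<in> carrier_vec c" "y \<in> carrier_vec r"
  shows "conjugate v \<bullet> (mat_adjoint A *\<^sub>v y) = conjugate (A *\<^sub>v v) \<bullet> y"
proof -
  have "conjugate v \<bullet> (mat_adjoint A *\<^sub>v y) = (\<Sum>j<c. \<Sum>i<r. cnj (v $ j) * (cnj (A $$ (i,j)) * y $ i))"
    using assms mat_adjoint_carrier[OF assms(1)]
    by (auto simp: scalar_prod_def atLeast0LessThan mat_adjoint_index sum_distrib_left intro!: sum.cong)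
  also have "\<dots> = (\<Sum>i<r. \<Sum>j<c. cnj (v $ j) * (cnj (A $$ (i,j)) * y $ i))" by (rule sum.swap)
  also have "\<dots> = (\<Sum>i<r. cnj (\<Sum>j<c. A $$ (i,j) * v $ j) * y $ i)"
    by (simp add: sum_distrib_right sum_distrib_left mult_ac)
  also have "\<dots> = conjugate (A *\<^sub>v v) \<bullet> y"
    using assms by (auto simp: scalar_prod_def atLeast0LessThan intro!: sum.cong)
  finally show ?thesis .
qed

lemma quad_form_complex_congruence:
  fixes D L :: "complex mat"
  assumes D: "D \<in> carrier_mat r r" and L: "L \<in> carrier_mat r c" and v: "v \<in> carrier_vec c"
  shows "quad_form (mat_adjoint L * D * L) v = quad_form D (L *\<^sub>v v)"
proof -
  have La: "mat_adjoint L \<in> carrier_mat c r" by (rule mat_adjoint_carrier[OF L])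
  have DLv: "D *\<^sub>v (L *\<^sub>v v) \<in> carrier_vec r" using L D v by auto
  have "(mat_adjoint L * D * L) *\<^sub>v v = mat_adjoint L *\<^sub>v (D *\<^sub>v (L *\<^sub>v v))"
    using L D La v by (simp add: assoc_mult_mat_vec[of _ c r _ c] assoc_mult_mat_vec[of _ c r _ r])
  then show ?thesis unfolding quad_form_def using adjoint_inner[OF L v DLv] by simp
qed

text \<open>The Loewner inequality is tested at one vector \<omega>, which the matrix (G; I) maps to
  (G \<omega>, \<omega>).\<close>

lemma FDI_index:
  assumes G: "G \<in> carrier_mat a b" and \<Pi>m: "\<Pi>m \<in> carrier_mat (a + b) (a + b)"
    and le: "let GI = eval_mat G s @\<^sub>r 1\<^sub>m b in loewner_le b (mat_adjoint GI * eval_mat \<Pi>m s * GI) (complex_of_real (- \<epsilon>) \<cdot>\<^sub>m 1\<^sub>m b)"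
  shows "Re (\<Sum>i<a + b. \<Sum>j<a + b. cnj (if i < a then (\<Sum>l<b. rf_eval (G $$ (i,l)) s * \<omega> l) else \<omega> (i - a))
         * rf_eval (\<Pi>m $$ (i,j)) s * (if j < a then (\<Sum>l<b. rf_eval (G $$ (j,l)) s * \<omega> l) else \<omega> (j - a)))
       \<le> - \<epsilon> * (\<Sum>l<b. (cmod (\<omega> l))\<^sup>2)"
proof -
  let ?GI = "eval_mat G s @\<^sub>r 1\<^sub>m b" and ?P = "eval_mat \<Pi>m s" and ?v = "vec b \<omega>"
  have e: "eval_mat G s \<in> carrier_mat a b" "?P \<in> carrier_mat (a + b) (a + b)"
    using G \<Pi>m by (auto simp: eval_mat_def)
  then have GI: "?GI \<in> carrier_mat (a + b) b" by auto
  let ?X = "mat_adjoint ?GI * ?P * ?GI"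
  have Xc: "?X \<in> carrier_mat b b"
    by (rule mult_carrier_mat[OF mult_carrier_mat[OF mat_adjoint_carrier[OF GI] e(2)] GI])
  have oc: "complex_of_real (- \<epsilon>) \<cdot>\<^sub>m 1\<^sub>m b \<in> carrier_mat b b" by simp
  have v: "?v \<in> carrier_vec b" by simp
  have "pos_semidef b (complex_of_real (- \<epsilon>) \<cdot>\<^sub>m 1\<^sub>m b - ?X)"
    using le by (simp add: loewner_le_def Let_def)
  then have 0: "0 \<le> quad_form (complex_of_real (- \<epsilon>) \<cdot>\<^sub>m 1\<^sub>m b - ?X) ?v" using v by (auto simp: pos_semidef_def)
  have "quad_form (complex_of_real (- \<epsilon>) \<cdot>\<^sub>m 1\<^sub>m b - ?X) ?v = quad_form (complex_of_real (- \<epsilon>) \<cdot>\<^sub>m 1\<^sub>m b) ?v - quad_form ?X ?v"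
    by (rule quad_form_minus[OF oc Xc v])
  also have "quad_form (complex_of_real (- \<epsilon>) \<cdot>\<^sub>m 1\<^sub>m b) ?v = of_real (- \<epsilon> * (\<Sum>l<b. (cmod (\<omega> l))\<^sup>2))"
  proof -
    have "quad_form (complex_of_real (- \<epsilon>) \<cdot>\<^sub>m 1\<^sub>m b) ?v = (\<Sum>i<b. \<Sum>j<b. if i = j then of_real (- \<epsilon>) * (cnj (\<omega> j) * \<omega> j) else 0)"
      unfolding quad_form_sum[OF oc v] by (intro sum.cong refl) auto
    also have "\<dots> = (\<Sum>i<b. of_real (- \<epsilon> * (cmod (\<omega> i))\<^sup>2))"
      by (intro sum.cong refl) (simp add: complex_norm_square mult.commute del: of_real_power)
    finally show ?thesis by (simp add: sum_distrib_left)
  qed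
  also have "quad_form ?X ?v = quad_form ?P (?GI *\<^sub>v ?v)" by (rule quad_form_complex_congruence[OF e(2) GI v])
  also have "\<dots> = (\<Sum>i<a + b. \<Sum>j<a + b. cnj (if i < a then (\<Sum>l<b. rf_eval (G $$ (i,l)) s * \<omega> l) else \<omega> (i - a))
         * rf_eval (\<Pi>m $$ (i,j)) s * (if j < a then (\<Sum>l<b. rf_eval (G $$ (j,l)) s * \<omega> l) else \<omega> (j - a)))"
  proof -
    have u: "(?GI *\<^sub>v ?v) $ i = (if i < a then (\<Sum>l<b. rf_eval (G $$ (i,l)) s * \<omega> l) else \<omega> (i - a))" if "i < a + b" for i
    proof -
      have "(?GI *\<^sub>v ?v) $ i = ((eval_mat G s *\<^sub>v ?v) @\<^sub>v ?v) $ i"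
        by (subst append_rows_mult_vec[OF e(1) one_carrier_mat v]) simp
      also have "\<dots> = (if i < a then (\<Sum>l<b. rf_eval (G $$ (i,l)) s * \<omega> l) else \<omega> (i - a))"
        using that G e(1) by (auto simp: eval_mat_def scalar_prod_def atLeast0LessThan)
      finally show ?thesis .
    qed
    have "?GI *\<^sub>v ?v \<in> carrier_vec (a + b)" using GI v by auto
    moreover have "?P $$ (i,j) = rf_eval (\<Pi>m $$ (i,j)) s" if "i < a + b" "j < a + b" for i j
      using that \<Pi>m by (simp add: eval_mat_def)
    ultimately show ?thesis
      by (subst quad_form_sum[OF e(2)]) (simp, intro sum.cong refl, simp add: u del: index_mult_mat_vec)
  qed
  finally show ?thesis using 0 by (simp add: less_eq_complex_def)
qed

text \<open>The factor depends on the multiplier and \<rho> only: F, d and M are fixed before any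
  operator or realization is considered, and the filter has as many outputs as inputs.\<close>

theorem theorem3:
  fixes \<rho> :: real and n\<^sub>y n\<^sub>w :: nat and G \<Pi>m :: "ratfun mat"
  assumes "0 < \<rho>" and "\<rho> \<le> 1"
    and "G \<in> proper_transfer n\<^sub>y n\<^sub>w" and "scale_mat \<rho> G \<in> RH_inf n\<^sub>y n\<^sub>w"
    and "\<Pi>m \<in> RL_inf (n\<^sub>y + n\<^sub>w) (n\<^sub>y + n\<^sub>w)" and "strict_PN n\<^sub>y n\<^sub>w (scale_mat \<rho> \<Pi>m)"
  shows "\<exists>(n\<^sub>p :: nat) (\<Psi> :: ratfun mat) (M :: real mat).
    \<Psi> \<in> RH_inf n\<^sub>p (n\<^sub>y + n\<^sub>w) \<and> transpose_mat M = M \<and>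
    rho_factorization \<rho> n\<^sub>p (n\<^sub>y + n\<^sub>w) \<Psi> M \<Pi>m \<and>
    (\<forall>\<Delta>. \<Delta> \<in> l2e n\<^sub>y \<rightarrow> l2e n\<^sub>w \<and> bounded_op \<rho> n\<^sub>y n\<^sub>w \<Delta> \<and> causal_op n\<^sub>y \<Delta> \<and>
         rho_IQC \<rho> n\<^sub>y n\<^sub>w \<Pi>m \<Delta> \<longrightarrow>
       rho_hard_IQC \<rho> n\<^sub>y \<Psi> M \<Delta>) \<and>
    ((\<exists>\<epsilon>>0. \<forall>z. cmod z = 1 \<longrightarrow>
        (let GI = eval_mat G (of_real \<rho> * z) @\<^sub>r 1\<^sub>m n\<^sub>w
         in loewner_le n\<^sub>w (mat_adjoint GI * eval_mat \<Pi>m (of_real \<rho> * z) * GI)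
              (complex_of_real (- \<epsilon>) \<cdot>\<^sub>m 1\<^sub>m n\<^sub>w))) \<longrightarrow>
     (\<forall>k\<^sub>G k\<^sub>\<Psi> A\<^sub>G B\<^sub>G C\<^sub>G D\<^sub>G A\<^sub>\<Psi> B\<^sub>\<Psi>\<^sub>y B\<^sub>\<Psi>\<^sub>w C\<^sub>\<Psi> D\<^sub>\<Psi>\<^sub>y D\<^sub>\<Psi>\<^sub>w.
        realization n\<^sub>y n\<^sub>w k\<^sub>G A\<^sub>G B\<^sub>G C\<^sub>G D\<^sub>G G \<and> spectrum_within \<rho> A\<^sub>G \<and>
        B\<^sub>\<Psi>\<^sub>y \<in> carrier_mat k\<^sub>\<Psi> n\<^sub>y \<and> B\<^sub>\<Psi>\<^sub>w \<in> carrier_mat k\<^sub>\<Psi> n\<^sub>w \<and>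
        D\<^sub>\<Psi>\<^sub>y \<in> carrier_mat n\<^sub>p n\<^sub>y \<and> D\<^sub>\<Psi>\<^sub>w \<in> carrier_mat n\<^sub>p n\<^sub>w \<and>
        realization n\<^sub>p (n\<^sub>y + n\<^sub>w) k\<^sub>\<Psi> A\<^sub>\<Psi> (B\<^sub>\<Psi>\<^sub>y @\<^sub>c B\<^sub>\<Psi>\<^sub>w) C\<^sub>\<Psi> (D\<^sub>\<Psi>\<^sub>y @\<^sub>c D\<^sub>\<Psi>\<^sub>w) \<Psi> \<and>
        spectrum_within \<rho> A\<^sub>\<Psi> \<longrightarrow>
        (\<exists>P. pos_def (k\<^sub>G + k\<^sub>\<Psi>) P \<and>
           neg_def (k\<^sub>G + k\<^sub>\<Psi> + n\<^sub>w)
             (lmi_mat \<rho> (aug_A A\<^sub>G C\<^sub>G A\<^sub>\<Psi> B\<^sub>\<Psi>\<^sub>y) (aug_B B\<^sub>G D\<^sub>G B\<^sub>\<Psi>\<^sub>y B\<^sub>\<Psi>\<^sub>w)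
                (aug_C C\<^sub>G C\<^sub>\<Psi> D\<^sub>\<Psi>\<^sub>y) (aug_D D\<^sub>G D\<^sub>\<Psi>\<^sub>y D\<^sub>\<Psi>\<^sub>w) P M))))"
proof -
  let ?n = "n\<^sub>y + n\<^sub>w"
  note rho = assms(1,2) and PN = assms(6)
  interpret S: strict_PN_at "n\<^sub>y" "n\<^sub>w" "scale_mat \<rho> \<Pi>m" by unfold_locales (rule PN)
  obtain F d M where M: "\<And>i j. i < ?n \<Longrightarrow> j < ?n \<Longrightarrow> M i j = M j i"
    and d: "\<And>x. cmod x \<le> 1 \<Longrightarrow> cpoly d x \<noteq> 0"
    and F: "\<And>x. cmod x \<le> 1 \<Longrightarrow> det (pmat ?n F x) \<noteq> 0"
    and r: "\<And>i j z. i < ?n \<Longrightarrow> j < ?n \<Longrightarrow> cmod z = 1 \<Longrightarrow>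
       S.r i j z = (\<Sum>k<?n. \<Sum>l<?n. cpoly (F k i) z / cpoly d z * of_real (M k l) * (cpoly (F l j) (1 / z) / cpoly d (1 / z)))"
    by (rule S.spectral_factors, rule that)
  interpret psi \<rho> ?n F d using rho d F by unfold_locales
  interpret iqc \<rho> "n\<^sub>y" "n\<^sub>w" F d M \<Pi>m
    using M PN r by unfold_locales (auto simp: Pf_def)
  let ?M = "mat ?n ?n (\<lambda>(i,j). M i j)"
  have fac: "rho_factorization \<rho> ?n ?n Psi ?M \<Pi>m"
    using fact PN by (intro rho_factorization) (auto simp: strict_PN_def)
  have Mt: "transpose_mat ?M = ?M" using M by (intro eq_matI) auto
  have LMI: "\<exists>P. pos_def (kG + kP) P \<and>
           neg_def (kG + kP + n\<^sub>w)
             (lmi_mat \<rho> (aug_A AG CG AP BPy) (aug_B BG DG BPy BPw) (aug_C CG CP DPy) (aug_D DG DPy DPw) P ?M)"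
    if \<epsilon>: "\<epsilon> > 0" and fdi: "\<And>z. cmod z = 1 \<Longrightarrow>
        (let GI = eval_mat G (of_real \<rho> * z) @\<^sub>r 1\<^sub>m n\<^sub>w
         in loewner_le n\<^sub>w (mat_adjoint GI * eval_mat \<Pi>m (of_real \<rho> * z) * GI)
              (complex_of_real (- \<epsilon>) \<cdot>\<^sub>m 1\<^sub>m n\<^sub>w))"
      and G: "realization n\<^sub>y n\<^sub>w kG AG BG CG DG G" "spectrum_within \<rho> AG"
      and BP: "BPy \<in> carrier_mat kP n\<^sub>y" "BPw \<in> carrier_mat kP n\<^sub>w"
      and DP: "DPy \<in> carrier_mat ?n n\<^sub>y" "DPw \<in> carrier_mat ?n n\<^sub>w"
      and Ps: "realization ?n ?n kP AP (BPy @\<^sub>c BPw) CP (DPy @\<^sub>c DPw) Psi" "spectrum_within \<rho> AP"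
    for \<epsilon> kG kP AG BG CG DG AP BPy BPw CP DPy DPw
  proof -
    have cG: "AG \<in> carrier_mat kG kG" "BG \<in> carrier_mat kG n\<^sub>w" "CG \<in> carrier_mat n\<^sub>y kG" "DG \<in> carrier_mat n\<^sub>y n\<^sub>w"
      "G = transfer_mat AG BG CG DG" using G(1) by (auto simp: realization_def)
    have cP: "AP \<in> carrier_mat kP kP" "BPy @\<^sub>c BPw \<in> carrier_mat kP ?n" "CP \<in> carrier_mat ?n kP" "DPy @\<^sub>c DPw \<in> carrier_mat ?n ?n"
      "Psi = transfer_mat AP (BPy @\<^sub>c BPw) CP (DPy @\<^sub>c DPw)" using Ps(1) by (auto simp: realization_def)
    have Gc: "G \<in> carrier_mat n\<^sub>y n\<^sub>w" using assms(3) by (simp add: proper_transfer_def)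
    have rz: "cmod (of_real \<rho> * z) \<ge> \<rho>" if "cmod z = 1" for z using that rho by (simp add: norm_mult)
    \<comment> \<open>The points \<rho> z have modulus \<rho>, hence lie outside both spectra; there
      the realizations provide what the locale asks for.\<close>
    interpret A: aug \<rho> "n\<^sub>y" "n\<^sub>w" F d M \<Pi>m kG kP "\<lambda>i j. AG $$ (i,j)" "\<lambda>i j. BG $$ (i,j)" "\<lambda>i j. CG $$ (i,j)" "\<lambda>i j. DG $$ (i,j)"
      "\<lambda>i j. AP $$ (i,j)" "\<lambda>i j. (BPy @\<^sub>c BPw) $$ (i,j)" "\<lambda>i j. CP $$ (i,j)" "\<lambda>i j. (DPy @\<^sub>c DPw) $$ (i,j)"
      "\<lambda>k l z. rf_eval (G $$ (k,l)) (of_real \<rho> * z)" \<epsilon>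
    proof unfold_locales
      show "v i = 0" if "cmod s \<ge> \<rho>" "\<And>i. i < kG \<Longrightarrow> (\<Sum>j<kG. of_real (AG $$ (i,j)) * v j) = s * v i" "i < kG" for s v i
        using spectrum_within_zero[OF cG(1) G(2) that] .
      show "v i = 0" if "cmod s \<ge> \<rho>" "\<And>i. i < kP \<Longrightarrow> (\<Sum>j<kP. of_real (AP $$ (i,j)) * v j) = s * v i" "i < kP" for s v i
        using spectrum_within_zero[OF cP(1) Ps(2) that] .
      show "(\<Sum>j<kG. of_real (CG $$ (k,j)) * \<xi> j) + (\<Sum>l<n\<^sub>w. of_real (DG $$ (k,l)) * \<upsilon> l)
          = (\<Sum>l<n\<^sub>w. rf_eval (G $$ (k,l)) (of_real \<rho> * z) * \<upsilon> l)"
        if z: "cmod z = 1" and e: "\<And>i. i < kG \<Longrightarrow> of_real \<rho> * z * \<xi> i - (\<Sum>j<kG. of_real (AG $$ (i,j)) * \<xi> j) = (\<Sum>l<n\<^sub>w. of_real (BG $$ (i,l)) * \<upsilon> l)"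
          and k: "k < n\<^sub>y" for z \<xi> \<upsilon> k
        unfolding cG(5) by (rule transfer_mat_eval[OF cG(1-4) G(2) rz[OF z] e k])
      show "(\<Sum>j<kP. of_real (CP $$ (k,j)) * \<xi> j) + (\<Sum>l<?n. of_real ((DPy @\<^sub>c DPw) $$ (k,l)) * \<upsilon> l)
          = (\<Sum>l<?n. Pf k l z * \<upsilon> l)"
        if z: "cmod z = 1" and e: "\<And>i. i < kP \<Longrightarrow> of_real \<rho> * z * \<xi> i - (\<Sum>j<kP. of_real (AP $$ (i,j)) * \<xi> j) = (\<Sum>l<?n. of_real ((BPy @\<^sub>c BPw) $$ (i,l)) * \<upsilon> l)"
          and k: "k < ?n" for z \<xi> \<upsilon> k
      proof -
        have "(\<Sum>l<?n. Pf k l z * \<upsilon> l) = (\<Sum>l<?n. rf_eval (Psi $$ (k,l)) (of_real \<rho> * z) * \<upsilon> l)"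
          by (intro sum.cong refl) (simp add: eval_circle(2)[OF k _ z])
        then show ?thesis using transfer_mat_eval[OF cP(1-4) Ps(2) rz[OF z] e k] unfolding cP(5)[symmetric] by simp
      qed
      show "\<epsilon> > 0" by (rule \<epsilon>)
      show "Re (\<Sum>i<?n. \<Sum>j<?n. cnj (if i < n\<^sub>y then (\<Sum>l<n\<^sub>w. rf_eval (G $$ (i,l)) (of_real \<rho> * z) * \<omega> l) else \<omega> (i - n\<^sub>y))
         * S.r i j z * (if j < n\<^sub>y then (\<Sum>l<n\<^sub>w. rf_eval (G $$ (j,l)) (of_real \<rho> * z) * \<omega> l) else \<omega> (j - n\<^sub>y)))
       \<le> - \<epsilon> * (\<Sum>l<n\<^sub>w. (cmod (\<omega> l))\<^sup>2)" if z: "cmod z = 1" for z \<omega>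
      proof -
        \<comment> \<open>The locale takes the values of the scaled multiplier on the circle, the
          hypothesis those of the multiplier itself at \<rho> z.\<close>
        have "(\<Sum>i<?n. \<Sum>j<?n. cnj (if i < n\<^sub>y then (\<Sum>l<n\<^sub>w. rf_eval (G $$ (i,l)) (of_real \<rho> * z) * \<omega> l) else \<omega> (i - n\<^sub>y))
            * S.r i j z * (if j < n\<^sub>y then (\<Sum>l<n\<^sub>w. rf_eval (G $$ (j,l)) (of_real \<rho> * z) * \<omega> l) else \<omega> (j - n\<^sub>y)))
          = (\<Sum>i<?n. \<Sum>j<?n. cnj (if i < n\<^sub>y then (\<Sum>l<n\<^sub>w. rf_eval (G $$ (i,l)) (of_real \<rho> * z) * \<omega> l) else \<omega> (i - n\<^sub>y))
            * rf_eval (\<Pi>m $$ (i,j)) (of_real \<rho> * z) * (if j < n\<^sub>y then (\<Sum>l<n\<^sub>w. rf_eval (G $$ (j,l)) (of_real \<rho> * z) * \<omega> l) else \<omega> (j - n\<^sub>y)))"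
          using z by (intro sum.cong refl) (simp only: lessThan_iff Pi_eval)
        then show ?thesis using FDI_index[OF Gc Pi_carrier fdi[OF z], of \<omega>] by simp
      qed
    qed
    let ?A = "aug_A AG CG AP BPy" and ?B = "aug_B BG DG BPy BPw" and ?C = "aug_C CG CP DPy" and ?D = "aug_D DG DPy DPw"
    have c: "?A \<in> carrier_mat (kG + kP) (kG + kP)" "?B \<in> carrier_mat (kG + kP) n\<^sub>w" "?C \<in> carrier_mat ?n (kG + kP)" "?D \<in> carrier_mat ?n n\<^sub>w"
      unfolding aug_A_def aug_B_def aug_C_def aug_D_def using cG cP(1,3) BP DP
      by (auto intro!: append_cols_carrier carrier_append_rows)
    have By: "(BPy @\<^sub>c BPw) $$ (i,s) = BPy $$ (i,s)" if "i < kP" "s < n\<^sub>y" for i s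
      using append_cols_index[OF BP] that by simp
    have Bw: "(BPy @\<^sub>c BPw) $$ (i,l + n\<^sub>y) = BPw $$ (i,l)" if "i < kP" "l < n\<^sub>w" for i l
      using append_cols_index[OF BP] that by simp
    have Dy: "(DPy @\<^sub>c DPw) $$ (i,s) = DPy $$ (i,s)" if "i < ?n" "s < n\<^sub>y" for i s
      using append_cols_index[OF DP] that by simp
    have Dw: "(DPy @\<^sub>c DPw) $$ (i,l + n\<^sub>y) = DPw $$ (i,l)" if "i < ?n" "l < n\<^sub>w" for i l
      using append_cols_index[OF DP] that by simp
    have A: "A.Aa i j = ?A $$ (i,j)" if "i < kG + kP" "j < kG + kP" for i j
      using that cG(1) cP(1) unfolding A.Aa_def aug_A_def
      by (auto simp: By mat_mult_index[OF BP(1) cG(3)] simp del: index_mult_mat)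
    have BD: "BPy * DG \<in> carrier_mat kP n\<^sub>w" "BPy * DG + BPw \<in> carrier_mat kP n\<^sub>w" using BP cG by auto
    have B: "A.Ba i l = ?B $$ (i,l)" if "i < kG + kP" "l < n\<^sub>w" for i l
    proof (cases "i < kG")
      case False
      then have "i - kG < kP" using that by simp
      then show ?thesis using that False BD BP(2)
        by (simp add: A.Ba_def aug_B_def append_rows_index[OF cG(2) BD(2)] By Bw mat_mult_index[OF BP(1) cG(4)] del: index_mult_mat)
    qed (use that in \<open>simp add: A.Ba_def aug_B_def append_rows_index[OF cG(2) BD(2)]\<close>)
    have DC: "DPy * CG \<in> carrier_mat ?n kG" using DP cG by auto
    have C: "A.Ca k j = ?C $$ (k,j)" if "k < ?n" "j < kG + kP" for k j
      using that by (simp add: A.Ca_def aug_C_def append_cols_index[OF DC cP(3)] Dy mat_mult_index[OF DP(1) cG(3)] del: index_mult_mat)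
    have D: "A.Da k l = ?D $$ (k,l)" if "k < ?n" "l < n\<^sub>w" for k l
      using that DP cG(4) by (simp add: A.Da_def aug_D_def Dy Dw mat_mult_index[OF DP(1) cG(4)] del: index_mult_mat(1))
    obtain P :: "nat \<Rightarrow> nat \<Rightarrow> real" where P: "\<And>i j. P i j = P j i"
      "\<And>x. \<exists>i<kG + kP. x i \<noteq> 0 \<Longrightarrow> 0 < quad (kG + kP) P x"
      "\<And>x w. (\<exists>i<kG + kP. x i \<noteq> 0) \<or> (\<exists>l<n\<^sub>w. w l \<noteq> 0) \<Longrightarrow>
         - \<rho>\<^sup>2 * quad (kG + kP) P x + quad (kG + kP) P (\<lambda>i. (\<Sum>j<kG + kP. A.Aa i j * x j) + (\<Sum>l<n\<^sub>w. A.Ba i l * w l))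
         + quad ?n M (\<lambda>k. (\<Sum>j<kG + kP. A.Ca k j * x j) + (\<Sum>l<n\<^sub>w. A.Da k l * w l)) < 0"
      by (rule A.index_LMI, rule that)
    let ?P = "mat (kG + kP) (kG + kP) (\<lambda>(i,j). P i j)"
    have "pos_def (kG + kP) ?P" unfolding pos_def_def
    proof (intro conjI ballI impI)
      show "mat_adjoint ?P = ?P" unfolding real_mat_adjoint using P(1) by (intro eq_matI) auto
      fix v :: "real vec" assume v: "v \<in> carrier_vec (kG + kP)" "v \<noteq> 0\<^sub>v (kG + kP)"
      then have "\<exists>i<kG + kP. v $ i \<noteq> 0" by (metis carrier_vecD eq_vecI index_zero_vec)
      then show "0 < quad_form ?P v" unfolding quad_form_mat[OF v(1)] by (rule P(2))
    qed simp
    moreover have "neg_def (kG + kP + n\<^sub>w) (lmi_mat \<rho> ?A ?B ?C ?D ?P ?M)"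
    proof (rule lmi_neg_def[OF c P(1)])
      fix x w :: "nat \<Rightarrow> real" assume nz: "(\<exists>i<kG + kP. x i \<noteq> 0) \<or> (\<exists>l<n\<^sub>w. w l \<noteq> 0)"
      have "quad (kG + kP) P (\<lambda>i. (\<Sum>j<kG + kP. A.Aa i j * x j) + (\<Sum>l<n\<^sub>w. A.Ba i l * w l))
          = quad (kG + kP) P (\<lambda>i. (\<Sum>j<kG + kP. ?A $$ (i,j) * x j) + (\<Sum>l<n\<^sub>w. ?B $$ (i,l) * w l))"
        unfolding quad_def by (intro sum.cong refl) (simp add: A B)
      moreover have "quad ?n M (\<lambda>k. (\<Sum>j<kG + kP. A.Ca k j * x j) + (\<Sum>l<n\<^sub>w. A.Da k l * w l))
          = quad ?n M (\<lambda>k. (\<Sum>j<kG + kP. ?C $$ (k,j) * x j) + (\<Sum>l<n\<^sub>w. ?D $$ (k,l) * w l))"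
        unfolding quad_def by (intro sum.cong refl) (simp add: C D)
      ultimately show "- \<rho>\<^sup>2 * quad (kG + kP) P x
          + quad (kG + kP) P (\<lambda>i. (\<Sum>j<kG + kP. ?A $$ (i,j) * x j) + (\<Sum>l<n\<^sub>w. ?B $$ (i,l) * w l))
          + quad ?n M (\<lambda>k. (\<Sum>j<kG + kP. ?C $$ (k,j) * x j) + (\<Sum>l<n\<^sub>w. ?D $$ (k,l) * w l)) < 0"
        using P(3)[OF nz] by simp
    qed (use M in auto)
    ultimately show ?thesis by blast
  qed
  show ?thesis
  proof (rule exI[of _ ?n], rule exI[of _ Psi], rule exI[of _ ?M], intro conjI impI allI)
    show "Psi \<in> RH_inf ?n ?n" by (rule RH)
    show "transpose_mat ?M = ?M" by (rule Mt)
    show "rho_factorization \<rho> ?n ?n Psi ?M \<Pi>m" by (rule fac)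
    show "rho_hard_IQC \<rho> n\<^sub>y Psi ?M \<Delta>"
      if "\<Delta> \<in> l2e n\<^sub>y \<rightarrow> l2e n\<^sub>w \<and> bounded_op \<rho> n\<^sub>y n\<^sub>w \<Delta> \<and> causal_op n\<^sub>y \<Delta> \<and> rho_IQC \<rho> n\<^sub>y n\<^sub>w \<Pi>m \<Delta>" for \<Delta>
      using that by (elim conjE) (rule hard_IQC)
  qed (elim exE conjE, rule LMI, assumption, blast, assumption+)
qed

end
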